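(* Let $\Bbbk$ be a commutative ring, $\mathcal{K}$ a $\Bbbk$-linear abelian category, $(\mathbb{X},\Gamma/{\sim})$ a triple whose set $\mathscr{P}$ of screens is nonempty, $C$ its path category, $\mathcal{C}$ its $\Bbbk$-linear path category, $\mathcal{I}$ a path based ideal of $\mathcal{C}$, and $\mathcal{A}=\mathcal{C}/\mathcal{I}$. Let $\mathscr{L}\subseteq\mathscr{P}$ be such that for any finite collection $\{\mathfrak{P}_i\}_{i=1}^n\subset\mathscr{L}$ there is a screen in $\mathscr{L}$ refining each $\mathfrak{P}_i$, and let $\mathfrak{P}\in\mathscr{L}$. Then any exact structure $\mathbb{E}$ on $\mathrm{Rep}^{\mathscr{L}}_{\mathcal{K}}(\mathcal{A})$, $\mathrm{rep}^{\mathscr{L}}_{\mathcal{K}}(\mathcal{A})$, $\mathrm{Rep}^{\mathscr{L}}_{\mathcal{K}}(C)$, or $\mathrm{rep}^{\mathscr{L}}_{\mathcal{K}}(C)$ restricts to an exact structure on $\mathrm{Rep}_{\mathcal{K}}(\overline{\mathcal{A}}^{\mathfrak{P}}[\Sigma_{\mathfrak{P}}^{-1}])$, $\mathrm{rep}^{\mathrm{pwf}}_{\mathcal{K}}(\overline{\mathcal{A}}^{\mathfrak{P}}[\Sigma_{\mathfrak{P}}^{-1}])$, $\mathrm{Rep}_{\mathcal{K}}(C[\Sigma_{\mathfrak{P}}^{-1}])$, or $\mathrm{rep}^{\mathrm{pwf}}_{\mathcal{K}}(C[\Sigma_{\mathfrak{P}}^{-1}])$, respectively.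
   Context: TRIPLES. A path in a nonempty set $\mathbb{X}$ is any function $\gamma:[0,1]\to\mathbb{X}$; $\mathrm{im}(\gamma)$ is its image. If $\gamma(1)=\gamma'(0)$, then $\gamma\cdot\gamma'$ is the path equal to $\gamma(2t)$ for $0\le t\le\frac12$ and to $\gamma'(2t-1)$ for $\frac12\le t\le1$. A triple $(\mathbb{X},\Gamma/{\sim})$ consists of a nonempty set $\mathbb{X}$, a set $\Gamma$ of paths in $\mathbb{X}$, and an equivalence relation $\sim$ on $\Gamma$ (equivalent paths have the same endpoints) such that: (a) $\gamma,\gamma'\in\Gamma$ with $\gamma(1)=\gamma'(0)$ implies $\gamma\cdot\gamma'\in\Gamma$; (b) if $\gamma\in\Gamma$ and $\phi:[0,1]\to[0,1]$ is weakly order preserving and sends intervals to intervals, then $\gamma\circ\phi\in\Gamma$; (c) all constant paths are in $\Gamma$; (d) a path equivalent to a constant path is constant; (e) if in (b) also $\phi(0)=0$, $\phi(1)=1$, then $\gamma\sim\gamma\circ\phi$; (f) if $\gamma,\gamma',\rho,\rho'\in\Gamma$ and $\rho\cdot\gamma\cdot\rho'$, $\rho\cdot\gamma'\cdot\rho'$ are defined and in $\Gamma$, then $\gamma\sim\gamma'$ if and only if $\rho\cdot\gamma\cdot\rho'\sim\rho\cdot\gamma'\cdot\rho'$. The class of $\gamma$ is $[\gamma]$. SCREENS. A screen of $(\mathbb{X},\Gamma/{\sim})$ is a partition $\mathfrak{P}$ of $\mathbb{X}$, whose elements are called pixels, such that: (S1) if $\gamma,\gamma'\in\Gamma$ have the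 same start and the same end and $\mathrm{im}(\gamma)\subset\mathsf{X}\in\mathfrak{P}$, then $\gamma\sim\gamma'$ if and only if $\mathrm{im}(\gamma')\subset\mathsf{X}$; (S2) any two points $x,y$ of a pixel $\mathsf{X}$ are joined by a finite walk $\gamma_0\cdot\gamma_1^{-1}\cdot\gamma_2\cdots\gamma_{2n-1}^{-1}\cdot\gamma_{2n}$ from $x$ to $y$ (where $\gamma^{-1}$ is $\gamma$ run backwards) with all $\gamma_i\in\Gamma$ and $\mathrm{im}(\gamma_i)\subset\mathsf{X}$; (S3) if $\rho,\gamma\in\Gamma$, $\rho(0)=\gamma(0)$ and $\mathrm{im}(\rho)$ lies in a pixel, then there are $\rho',\gamma'\in\Gamma$ with $\mathrm{im}(\rho')$ in a pixel and $\gamma\cdot\rho'\sim\rho\cdot\gamma'$; dually, if $\rho',\gamma'\in\Gamma$, $\rho'(1)=\gamma'(1)$ and $\mathrm{im}(\rho')$ lies in a pixel, then there are $\rho,\gamma\in\Gamma$ with $\mathrm{im}(\rho)$ in a pixel and $\gamma\cdot\rho'\sim\rho\cdot\gamma'$; (S4) for every $\gamma\in\Gamma$ there are a finite partition $\{I_i\}_{i=1}^n$ of $[0,1]$ into subintervals (listed in increasing order) and pixels $(\mathsf{X}_1,\dots,\mathsf{X}_n)$ with $\gamma(I_i)\subset\mathsf{X}_i$, where for $i\ne j$ the equality $\mathsf{X}_i=\mathsf{X}_j$ is allowed only if $|i-j|>1$; (S5) if $\gamma,\gamma'\in\Gamma$ have the same start and the same end and admit the same partition $\{I_i\}$ and the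 same list of pixels as in (S4), then $\gamma\sim\gamma'$. PATH CATEGORIES. $C$ has objects the points of $\mathbb{X}$, $\mathrm{Hom}_C(x,y)=\{[\gamma]\mid\gamma\in\Gamma,\gamma(0)=x,\gamma(1)=y\}$, composition $[\gamma']\circ[\gamma]=[\gamma\cdot\gamma']$. $\mathcal{C}$ has objects $\mathbb{X}\sqcup\{0\}$ with $0$ a zero object, $\mathrm{Hom}_{\mathcal{C}}(x,y)$ the free $\Bbbk$-module on $\mathrm{Hom}_C(x,y)$ for $x,y\in\mathbb{X}$, and bilinear composition. An ideal of $\mathcal{C}$ is path based if it is generated by finite sums $\sum_i\lambda_i[\gamma_i]$ with $\gamma_i\in\Gamma$, each $\lambda_i\in\Bbbk$ not a zero divisor (the zero ideal is allowed). PIXELATIONS. In $C$, $\Sigma_{\mathfrak{P}}$ is the class of $[\rho]$ with $\mathrm{im}(\rho)$ in a pixel. For the linear case: paths $\gamma,\gamma'\in\Gamma$ are $\mathfrak{P}$-equivalent if there are $\rho_1,\dots,\rho_4\in\Gamma$ with $\mathrm{im}(\rho_1)\cup\mathrm{im}(\rho_2)$ in one pixel, $\mathrm{im}(\rho_3)\cup\mathrm{im}(\rho_4)$ in one pixel, and $\rho_1\cdot\gamma\cdot\rho_3\sim\rho_2\cdot\gamma'\cdot\rho_4$; morphisms $\sum_{i=1}^m\lambda_i[\gamma_i]$, $\sum_{i=1}^m\lambda'_i[\gamma'_i]$ are $\mathfrak{P}$-equivalent if, up to permutation, $\lambda_i=\lambda'_i$ and $\gamma_i,\gamma'_i$ are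 $\mathfrak{P}$-equivalent for all $i$; $\overline{\mathcal{I}}^{\mathfrak{P}}$ is the ideal generated by all $f$ that are $\mathfrak{P}$-equivalent to some $g\in\mathcal{I}$; $\overline{\mathcal{A}}^{\mathfrak{P}}=\mathcal{C}/\overline{\mathcal{I}}^{\mathfrak{P}}$. A pixel is pre-dead if it contains $\mathrm{im}(\rho)$ for some $\rho\in\Gamma$ with $[\rho]=0$ in $\mathcal{A}$. In $\overline{\mathcal{A}}^{\mathfrak{P}}$, $\Sigma_{\mathfrak{P}}$ consists of the $[\rho]\ne0$ with $\mathrm{im}(\rho)$ in a pixel and of the zero morphisms $x\to y$ with $x,y$ in a common pre-dead pixel. Both classes admit a two-sided calculus of fractions, giving the localizations (pixelations) $C[\Sigma_{\mathfrak{P}}^{-1}]$ and $\overline{\mathcal{A}}^{\mathfrak{P}}[\Sigma_{\mathfrak{P}}^{-1}]$, with canonical functors $p:C\to C[\Sigma_{\mathfrak{P}}^{-1}]$ and $\pi:\mathcal{A}\to\overline{\mathcal{A}}^{\mathfrak{P}}\to\overline{\mathcal{A}}^{\mathfrak{P}}[\Sigma_{\mathfrak{P}}^{-1}]$. REPRESENTATIONS. $\mathrm{Rep}_{\mathcal{K}}(\mathcal{D})$ is the category of functors $\mathcal{D}\to\mathcal{K}$ ($\Bbbk$-linear and additive if $\mathcal{D}$ is $\Bbbk$-linear), and $\mathrm{rep}^{\mathrm{pwf}}_{\mathcal{K}}(\mathcal{D})$ the full subcategory of those taking values in finite-length objects. For $\mathcal{D}=C$ or $\mathcal{A}$, $\mathfrak{P}$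 pixelates $M$ if $M(\sigma)$ is an isomorphism for all $\sigma\in\Sigma_{\mathfrak{P}}$; explicitly for $\mathcal{A}$: $M([\rho])$ is an isomorphism whenever $\mathrm{im}(\rho)$ lies in a pixel and $[\rho]\ne0$ in $\overline{\mathcal{A}}^{\mathfrak{P}}$, and $M(0:x\to y)$ is an isomorphism for $x,y$ in a common pre-dead pixel. $\mathrm{Rep}^{\mathscr{L}}_{\mathcal{K}}(\mathcal{D})$ and $\mathrm{rep}^{\mathscr{L}}_{\mathcal{K}}(\mathcal{D})$ are the full subcategories of $\mathrm{Rep}_{\mathcal{K}}(\mathcal{D})$ and $\mathrm{rep}^{\mathrm{pwf}}_{\mathcal{K}}(\mathcal{D})$ of those $M$ pixelated by some screen in $\mathscr{L}$; these are abelian. Precomposition $p^*$ and $\pi^*$ embeds the representation categories of the pixelations with respect to $\mathfrak{P}\in\mathscr{L}$ exactly into these subcategories; "restricts" is meant along these embeddings. EXACT STRUCTURES. An exact structure on an abelian category $\mathcal{D}$ here means an additive subfunctor $\mathbb{E}\subset\mathrm{Ext}^1_{\mathcal{D}}:\mathcal{D}^{op}\times\mathcal{D}\to\mathrm{Ab}$, where $\mathrm{Ext}^1_{\mathcal{D}}(A,B)$ is the group of extensions $0\to B\to E\to A\to0$; restriction along an exact embedding means taking those extensions in the smaller category whose image lies in $\mathbb{E}$. *)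

theory Defs
  imports "HOL-Analysis.Analysis" "HOL-Algebra.Module"
begin

section \<open>Categories and functors\<close>

record ('o, 'm) precat =
  Obj :: "'o set"
  Arr :: "'m set"
  Dom :: "'m \<Rightarrow> 'o"
  Cod :: "'m \<Rightarrow> 'o"
  Idn :: "'o \<Rightarrow> 'm"
  Comp :: "'m \<Rightarrow> 'm \<Rightarrow> 'm"  (infixl \<open>\<cdot>\<index>\<close> 70)

definition Hom :: "('o, 'm, 'z) precat_scheme \<Rightarrow> 'o \<Rightarrow> 'o \<Rightarrow> 'm set" where
  "Hom C a b = {f \<in> Arr C. Dom C f = a \<and> Cod C f = b}"

locale category =
  fixes C :: "('o, 'm, 'z) precat_scheme"  (structure)
  assumes dom_obj: "f \<in> Arr C \<Longrightarrow> Dom C f \<in> Obj C"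
    and cod_obj: "f \<in> Arr C \<Longrightarrow> Cod C f \<in> Obj C"
    and idn_hom: "a \<in> Obj C \<Longrightarrow> Idn C a \<in> Hom C a a"
    and comp_hom: "\<lbrakk>f \<in> Hom C a b; g \<in> Hom C b c\<rbrakk> \<Longrightarrow> g \<cdot> f \<in> Hom C a c"
    and comp_idn_left: "f \<in> Hom C a b \<Longrightarrow> Idn C b \<cdot> f = f"
    and comp_idn_right: "f \<in> Hom C a b \<Longrightarrow> f \<cdot> Idn C a = f"
    and comp_assoc: "\<lbrakk>f \<in> Hom C a b; g \<in> Hom C b c; h \<in> Hom C c d\<rbrakk> \<Longrightarrow> h \<cdot> (g \<cdot> f) = (h \<cdot> g) \<cdot> f"

definition iso_arr :: "('o, 'm, 'z) precat_scheme \<Rightarrow> 'm \<Rightarrow> bool" where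
  "iso_arr C f \<longleftrightarrow> f \<in> Arr C \<and>
     (\<exists>g\<in>Hom C (Cod C f) (Dom C f). g \<cdot>\<^bsub>C\<^esub> f = Idn C (Dom C f) \<and> f \<cdot>\<^bsub>C\<^esub> g = Idn C (Cod C f))"

definition monic :: "('o, 'm, 'z) precat_scheme \<Rightarrow> 'm \<Rightarrow> bool" where
  "monic C f \<longleftrightarrow> f \<in> Arr C \<and>
     (\<forall>g\<in>Arr C. \<forall>h\<in>Arr C. Cod C g = Dom C f \<and> Cod C h = Dom C f \<and> Dom C g = Dom C h \<and>
        f \<cdot>\<^bsub>C\<^esub> g = f \<cdot>\<^bsub>C\<^esub> h \<longrightarrow> g = h)"

definition epic :: "('o, 'm, 'z) precat_scheme \<Rightarrow> 'm \<Rightarrow> bool" where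
  "epic C f \<longleftrightarrow> f \<in> Arr C \<and>
     (\<forall>g\<in>Arr C. \<forall>h\<in>Arr C. Dom C g = Cod C f \<and> Dom C h = Cod C f \<and> Cod C g = Cod C h \<and>
        g \<cdot>\<^bsub>C\<^esub> f = h \<cdot>\<^bsub>C\<^esub> f \<longrightarrow> g = h)"

definition zero_object :: "('o, 'm, 'z) precat_scheme \<Rightarrow> 'o \<Rightarrow> bool" where
  "zero_object C z \<longleftrightarrow> z \<in> Obj C \<and>
     (\<forall>a\<in>Obj C. (\<exists>!f. f \<in> Hom C a z) \<and> (\<exists>!f. f \<in> Hom C z a))"

text \<open>
  Object and arrow maps are extensional, so that functors (and, below, natural transformations)
  that agree on their domain are equal.
\<close>

record ('o, 'm, 'p, 'n) funct =
  FObj :: "'o \<Rightarrow> 'p"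
  FArr :: "'m \<Rightarrow> 'n"

definition is_functor ::
  "('o, 'm, 'z) precat_scheme \<Rightarrow> ('p, 'n, 'y) precat_scheme \<Rightarrow> ('o, 'm, 'p, 'n) funct \<Rightarrow> bool" where
  "is_functor C D F \<longleftrightarrow>
     FObj F \<in> Obj C \<rightarrow>\<^sub>E Obj D \<and> FArr F \<in> Arr C \<rightarrow>\<^sub>E Arr D \<and>
     (\<forall>f\<in>Arr C. FArr F f \<in> Hom D (FObj F (Dom C f)) (FObj F (Cod C f))) \<and>
     (\<forall>a\<in>Obj C. FArr F (Idn C a) = Idn D (FObj F a)) \<and>
     (\<forall>f\<in>Arr C. \<forall>g\<in>Arr C. Cod C f = Dom C g \<longrightarrow> FArr F (g \<cdot>\<^bsub>C\<^esub> f) = FArr F g \<cdot>\<^bsub>D\<^esub> FArr F f)"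

text \<open>\<open>funct_comp C G F\<close> is the composite of \<open>F\<close>, with domain \<open>C\<close>, followed by \<open>G\<close>.\<close>

definition funct_comp ::
  "('o, 'm, 'z) precat_scheme \<Rightarrow> ('p, 'n, 'q, 'l) funct \<Rightarrow> ('o, 'm, 'p, 'n) funct \<Rightarrow> ('o, 'm, 'q, 'l) funct" where
  "funct_comp C G F = \<lparr>FObj = (\<lambda>a\<in>Obj C. FObj G (FObj F a)), FArr = (\<lambda>f\<in>Arr C. FArr G (FArr F f))\<rparr>"


section \<open>Linear and abelian categories\<close>

record ('o, 'm, 'k) prelincat = "('o, 'm) precat" +
  Zro :: "'o \<Rightarrow> 'o \<Rightarrow> 'm"
  Add :: "'m \<Rightarrow> 'm \<Rightarrow> 'm"
  Scl :: "'k \<Rightarrow> 'm \<Rightarrow> 'm"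

definition Hom_module :: "('o, 'm, 'k) prelincat \<Rightarrow> 'o \<Rightarrow> 'o \<Rightarrow> ('k, 'm) module" where
  "Hom_module D a b = \<lparr>carrier = Hom D a b, mult = undefined, one = undefined,
     zero = Zro D a b, add = Add D, smult = Scl D\<rparr>"

locale preadditive_category = category D
  for D :: "('o, 'm, 'k) prelincat"  (structure) +
  assumes hom_abelian_group: "\<lbrakk>a \<in> Obj D; b \<in> Obj D\<rbrakk> \<Longrightarrow> abelian_group (Hom_module D a b)"
    and comp_add_left: "\<lbrakk>f \<in> Hom D a b; g \<in> Hom D b c; h \<in> Hom D b c\<rbrakk> \<Longrightarrow>
      Add D g h \<cdot> f = Add D (g \<cdot> f) (h \<cdot> f)"
    and comp_add_right: "\<lbrakk>f \<in> Hom D a b; g \<in> Hom D a b; h \<in> Hom D b c\<rbrakk> \<Longrightarrow>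
      h \<cdot> Add D f g = Add D (h \<cdot> f) (h \<cdot> g)"

locale linear_category = preadditive_category D
  for R :: "('k, 'r) ring_scheme" and D :: "('o, 'm, 'k) prelincat"  (structure) +
  assumes scalars: "cring R"
    and hom_module: "\<lbrakk>a \<in> Obj D; b \<in> Obj D\<rbrakk> \<Longrightarrow> module R (Hom_module D a b)"
    and comp_scl_left: "\<lbrakk>r \<in> carrier R; f \<in> Hom D a b; g \<in> Hom D b c\<rbrakk> \<Longrightarrow>
      Scl D r g \<cdot> f = Scl D r (g \<cdot> f)"
    and comp_scl_right: "\<lbrakk>r \<in> carrier R; f \<in> Hom D a b; g \<in> Hom D b c\<rbrakk> \<Longrightarrow>
      g \<cdot> Scl D r f = Scl D r (g \<cdot> f)"

definition is_linear_functor ::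
  "('k, 'r) ring_scheme \<Rightarrow> ('o, 'm, 'k) prelincat \<Rightarrow> ('p, 'n, 'k) prelincat \<Rightarrow> ('o, 'm, 'p, 'n) funct \<Rightarrow> bool" where
  "is_linear_functor R C D F \<longleftrightarrow> is_functor C D F \<and>
     (\<forall>f\<in>Arr C. \<forall>g\<in>Arr C. Dom C f = Dom C g \<and> Cod C f = Cod C g \<longrightarrow>
        FArr F (Add C f g) = Add D (FArr F f) (FArr F g)) \<and>
     (\<forall>r\<in>carrier R. \<forall>f\<in>Arr C. FArr F (Scl C r f) = Scl D r (FArr F f))"

definition is_kernel :: "('o, 'm, 'k) prelincat \<Rightarrow> 'm \<Rightarrow> 'm \<Rightarrow> bool" where
  "is_kernel D k f \<longleftrightarrow> k \<in> Arr D \<and> f \<in> Arr D \<and> Cod D k = Dom D f \<and>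
     f \<cdot>\<^bsub>D\<^esub> k = Zro D (Dom D k) (Cod D f) \<and>
     (\<forall>g\<in>Arr D. Cod D g = Dom D f \<and> f \<cdot>\<^bsub>D\<^esub> g = Zro D (Dom D g) (Cod D f) \<longrightarrow>
        (\<exists>!h. h \<in> Hom D (Dom D g) (Dom D k) \<and> k \<cdot>\<^bsub>D\<^esub> h = g))"

definition is_cokernel :: "('o, 'm, 'k) prelincat \<Rightarrow> 'm \<Rightarrow> 'm \<Rightarrow> bool" where
  "is_cokernel D c f \<longleftrightarrow> c \<in> Arr D \<and> f \<in> Arr D \<and> Dom D c = Cod D f \<and>
     c \<cdot>\<^bsub>D\<^esub> f = Zro D (Dom D f) (Cod D c) \<and>
     (\<forall>g\<in>Arr D. Dom D g = Cod D f \<and> g \<cdot>\<^bsub>D\<^esub> f = Zro D (Dom D f) (Cod D g) \<longrightarrow>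
        (\<exists>!h. h \<in> Hom D (Cod D c) (Cod D g) \<and> h \<cdot>\<^bsub>D\<^esub> c = g))"

text \<open>\<open>s\<close> is a biproduct of \<open>a\<close> and \<open>b\<close> with injections \<open>i\<close>, \<open>j\<close> and projections \<open>p\<close>, \<open>q\<close>.\<close>

definition is_biproduct ::
  "('o, 'm, 'k) prelincat \<Rightarrow> 'o \<Rightarrow> 'o \<Rightarrow> 'o \<Rightarrow> 'm \<Rightarrow> 'm \<Rightarrow> 'm \<Rightarrow> 'm \<Rightarrow> bool" where
  "is_biproduct D a b s i j p q \<longleftrightarrow> a \<in> Obj D \<and> b \<in> Obj D \<and> s \<in> Obj D \<and>
     i \<in> Hom D a s \<and> j \<in> Hom D b s \<and> p \<in> Hom D s a \<and> q \<in> Hom D s b \<and>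
     p \<cdot>\<^bsub>D\<^esub> i = Idn D a \<and> q \<cdot>\<^bsub>D\<^esub> j = Idn D b \<and> p \<cdot>\<^bsub>D\<^esub> j = Zro D b a \<and> q \<cdot>\<^bsub>D\<^esub> i = Zro D a b \<and>
     Add D (i \<cdot>\<^bsub>D\<^esub> p) (j \<cdot>\<^bsub>D\<^esub> q) = Idn D s"

locale abelian_category = preadditive_category D
  for D :: "('o, 'm, 'k) prelincat"  (structure) +
  assumes zero_ex: "\<exists>z. zero_object D z"
    and biproduct_ex: "\<lbrakk>a \<in> Obj D; b \<in> Obj D\<rbrakk> \<Longrightarrow> \<exists>s i j p q. is_biproduct D a b s i j p q"
    and kernel_ex: "f \<in> Arr D \<Longrightarrow> \<exists>k. is_kernel D k f"
    and cokernel_ex: "f \<in> Arr D \<Longrightarrow> \<exists>c. is_cokernel D c f"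
    and monic_is_kernel: "monic D f \<Longrightarrow> \<exists>g. is_kernel D f g"
    and epic_is_cokernel: "epic D f \<Longrightarrow> \<exists>g. is_cokernel D f g"

definition short_exact :: "('o, 'm, 'k) prelincat \<Rightarrow> 'm \<Rightarrow> 'm \<Rightarrow> bool" where
  "short_exact D i p \<longleftrightarrow> is_kernel D i p \<and> is_cokernel D p i"

definition simple_object :: "('o, 'm, 'k) prelincat \<Rightarrow> 'o \<Rightarrow> bool" where
  "simple_object D s \<longleftrightarrow> s \<in> Obj D \<and> \<not> zero_object D s \<and>
     (\<forall>m. monic D m \<and> Cod D m = s \<longrightarrow> zero_object D (Dom D m) \<or> iso_arr D m)"

text \<open>An object has finite length iff it is built from zero by finitely many extensions by simple objects,
  i.e. iff it has a composition series.\<close>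

inductive finite_length :: "('o, 'm, 'k) prelincat \<Rightarrow> 'o \<Rightarrow> bool" for D where
  zero: "zero_object D a \<Longrightarrow> finite_length D a"
| step: "\<lbrakk>short_exact D i p; finite_length D (Dom D i); simple_object D (Cod D p)\<rbrakk> \<Longrightarrow>
    finite_length D (Cod D i)"


section \<open>Extension groups and exact structures\<close>

text \<open>An extension \<open>0 \<rightarrow> B \<rightarrow> E \<rightarrow> A \<rightarrow> 0\<close> of \<open>A\<close> by \<open>B\<close> is the pair of its two nonzero arrows.\<close>

definition extensions :: "('o, 'm, 'k) prelincat \<Rightarrow> 'o \<Rightarrow> 'o \<Rightarrow> ('m \<times> 'm) set" where
  "extensions D A B = {(i, p). short_exact D i p \<and> Dom D i = B \<and> Cod D p = A}"

definition ext_rel :: "('o, 'm, 'k) prelincat \<Rightarrow> 'o \<Rightarrow> 'o \<Rightarrow> ('m \<times> 'm) rel" where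
  "ext_rel D A B = {((i, p), (i', p')). (i, p) \<in> extensions D A B \<and> (i', p') \<in> extensions D A B \<and>
     (\<exists>h\<in>Hom D (Cod D i) (Cod D i'). iso_arr D h \<and> h \<cdot>\<^bsub>D\<^esub> i = i' \<and> p' \<cdot>\<^bsub>D\<^esub> h = p)}"

text \<open>
  Contravariant and covariant action of an arrow \<open>f\<close> on classes of extensions. An extension
  \<open>(i', p')\<close> is a pullback of \<open>(i, p)\<close> along \<open>f\<close> into the right-hand end iff there is a morphism of
  extensions \<open>(1, h, f)\<close> from \<open>(i', p')\<close> to \<open>(i, p)\<close>, and a pushout along \<open>f\<close> out of the left-hand
  end iff there is one of the form \<open>(f, h, 1)\<close> in the other direction; see Mac Lane, Homology, III.1.
  Both actions take all such extensions, and so return a full equivalence class.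
\<close>

definition ext_pull :: "('o, 'm, 'k) prelincat \<Rightarrow> 'm \<Rightarrow> ('m \<times> 'm) set \<Rightarrow> ('m \<times> 'm) set" where
  "ext_pull D f \<xi> = {(i', p'). short_exact D i' p' \<and> Cod D p' = Dom D f \<and>
     (\<exists>(i, p)\<in>\<xi>. Dom D i' = Dom D i \<and> Cod D p = Cod D f \<and>
        (\<exists>h\<in>Hom D (Cod D i') (Cod D i). h \<cdot>\<^bsub>D\<^esub> i' = i \<and> p \<cdot>\<^bsub>D\<^esub> h = f \<cdot>\<^bsub>D\<^esub> p'))}"

definition ext_push :: "('o, 'm, 'k) prelincat \<Rightarrow> 'm \<Rightarrow> ('m \<times> 'm) set \<Rightarrow> ('m \<times> 'm) set" where
  "ext_push D f \<xi> = {(i', p'). short_exact D i' p' \<and> Dom D i' = Cod D f \<and>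
     (\<exists>(i, p)\<in>\<xi>. Dom D i = Dom D f \<and> Cod D p' = Cod D p \<and>
        (\<exists>h\<in>Hom D (Cod D i) (Cod D i'). h \<cdot>\<^bsub>D\<^esub> i = i' \<cdot>\<^bsub>D\<^esub> f \<and> p' \<cdot>\<^bsub>D\<^esub> h = p))}"

text \<open>
  The Baer sum of two extensions of \<open>A\<close> by \<open>B\<close>: form the direct sum
  \<open>0 \<rightarrow> B \<oplus> B \<rightarrow> E \<oplus> E' \<rightarrow> A \<oplus> A \<rightarrow> 0\<close>, pull back along the diagonal of \<open>A\<close> and push out along
  the codiagonal of \<open>B\<close>.
\<close>

definition baer_sum ::
  "('o, 'm, 'k) prelincat \<Rightarrow> 'o \<Rightarrow> 'o \<Rightarrow> ('m \<times> 'm) set \<Rightarrow> ('m \<times> 'm) set \<Rightarrow> ('m \<times> 'm) set" where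
  "baer_sum D A B \<xi> \<zeta> = {e. \<exists>i p i' p' BB b b' qb qb' EE e1 e2 qe qe' AA a a' qa qa'.
     (i, p) \<in> \<xi> \<and> (i', p') \<in> \<zeta> \<and>
     is_biproduct D B B BB b b' qb qb' \<and>
     is_biproduct D (Cod D i) (Cod D i') EE e1 e2 qe qe' \<and>
     is_biproduct D A A AA a a' qa qa' \<and>
     e \<in> ext_push D (Add D qb qb') (ext_pull D (Add D a a')
       {(Add D (e1 \<cdot>\<^bsub>D\<^esub> i \<cdot>\<^bsub>D\<^esub> qb) (e2 \<cdot>\<^bsub>D\<^esub> i' \<cdot>\<^bsub>D\<^esub> qb'),
         Add D (a \<cdot>\<^bsub>D\<^esub> p \<cdot>\<^bsub>D\<^esub> qe) (a' \<cdot>\<^bsub>D\<^esub> p' \<cdot>\<^bsub>D\<^esub> qe'))})}"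

definition split_extensions :: "('o, 'm, 'k) prelincat \<Rightarrow> 'o \<Rightarrow> 'o \<Rightarrow> ('m \<times> 'm) set" where
  "split_extensions D A B = {(i, p). \<exists>s j q. is_biproduct D B A s i j q p}"

definition Ext1 :: "('o, 'm, 'k) prelincat \<Rightarrow> 'o \<Rightarrow> 'o \<Rightarrow> ('m \<times> 'm) set monoid" where
  "Ext1 D A B = \<lparr>carrier = extensions D A B // ext_rel D A B,
     mult = baer_sum D A B, one = split_extensions D A B\<rparr>"

definition exact_structure ::
  "('o, 'm, 'k) prelincat \<Rightarrow> ('o \<Rightarrow> 'o \<Rightarrow> ('m \<times> 'm) set set) \<Rightarrow> bool" where
  "exact_structure D \<E> \<longleftrightarrow> abelian_category D \<and>
     (\<forall>A\<in>Obj D. \<forall>B\<in>Obj D. subgroup (\<E> A B) (Ext1 D A B)) \<and>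
     (\<forall>A\<in>Obj D. \<forall>A'\<in>Obj D. \<forall>B\<in>Obj D. \<forall>f\<in>Hom D A' A. \<forall>\<xi>\<in>\<E> A B. ext_pull D f \<xi> \<in> \<E> A' B) \<and>
     (\<forall>A\<in>Obj D. \<forall>B\<in>Obj D. \<forall>B'\<in>Obj D. \<forall>f\<in>Hom D B B'. \<forall>\<xi>\<in>\<E> A B. ext_push D f \<xi> \<in> \<E> A B')"

definition ext_image ::
  "('p, 'n, 'k) prelincat \<Rightarrow> ('o, 'm, 'p, 'n) funct \<Rightarrow> 'o \<Rightarrow> 'o \<Rightarrow> ('m \<times> 'm) set \<Rightarrow> ('n \<times> 'n) set" where
  "ext_image D \<Phi> A B \<xi> = (\<Union>(i, p)\<in>\<xi>. ext_rel D (FObj \<Phi> A) (FObj \<Phi> B) `` {(FArr \<Phi> i, FArr \<Phi> p)})"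

definition restrict_exact_structure ::
  "('o, 'm, 'k) prelincat \<Rightarrow> ('p, 'n, 'k) prelincat \<Rightarrow> ('o, 'm, 'p, 'n) funct \<Rightarrow>
   ('p \<Rightarrow> 'p \<Rightarrow> ('n \<times> 'n) set set) \<Rightarrow> 'o \<Rightarrow> 'o \<Rightarrow> ('m \<times> 'm) set set" where
  "restrict_exact_structure S D \<Phi> \<E> A B =
     {\<xi> \<in> carrier (Ext1 S A B). ext_image D \<Phi> A B \<xi> \<in> \<E> (FObj \<Phi> A) (FObj \<Phi> B)}"

definition exact_structures_restrict ::
  "('o, 'm, 'k) prelincat \<Rightarrow> ('p, 'n, 'k) prelincat \<Rightarrow> ('o, 'm, 'p, 'n) funct \<Rightarrow> bool" where
  "exact_structures_restrict S D \<Phi> \<longleftrightarrow>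
     (\<forall>\<E>. exact_structure D \<E> \<longrightarrow> exact_structure S (restrict_exact_structure S D \<Phi> \<E>))"


section \<open>Ideals, quotients and localizations\<close>

definition cat_ideal :: "('k, 'r) ring_scheme \<Rightarrow> ('o, 'm, 'k) prelincat \<Rightarrow> 'm set \<Rightarrow> bool" where
  "cat_ideal R D J \<longleftrightarrow> J \<subseteq> Arr D \<and>
     (\<forall>a\<in>Obj D. \<forall>b\<in>Obj D. Zro D a b \<in> J) \<and>
     (\<forall>f\<in>J. \<forall>g\<in>J. Dom D f = Dom D g \<and> Cod D f = Cod D g \<longrightarrow> Add D f g \<in> J) \<and>
     (\<forall>r\<in>carrier R. \<forall>f\<in>J. Scl D r f \<in> J) \<and>
     (\<forall>f\<in>J. \<forall>g\<in>Arr D. Dom D g = Cod D f \<longrightarrow> g \<cdot>\<^bsub>D\<^esub> f \<in> J) \<and>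
     (\<forall>f\<in>J. \<forall>g\<in>Arr D. Cod D g = Dom D f \<longrightarrow> f \<cdot>\<^bsub>D\<^esub> g \<in> J)"

definition ideal_gen :: "('k, 'r) ring_scheme \<Rightarrow> ('o, 'm, 'k) prelincat \<Rightarrow> 'm set \<Rightarrow> 'm set" where
  "ideal_gen R D S = \<Inter>{J. cat_ideal R D J \<and> S \<subseteq> J}"

definition coset :: "('o, 'm, 'k) prelincat \<Rightarrow> 'm set \<Rightarrow> 'm \<Rightarrow> 'm set" where
  "coset D J f = {Add D f h | h. h \<in> J \<inter> Hom D (Dom D f) (Cod D f)}"

definition quot_cat :: "('o, 'm, 'k) prelincat \<Rightarrow> 'm set \<Rightarrow> ('o, 'm set, 'k) prelincat" where
  "quot_cat D J = \<lparr>Obj = Obj D, Arr = coset D J ` Arr D,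
     Dom = (\<lambda>F. Dom D (SOME f. f \<in> F)), Cod = (\<lambda>F. Cod D (SOME f. f \<in> F)),
     Idn = (\<lambda>a. coset D J (Idn D a)),
     Comp = (\<lambda>G F. \<Union>g\<in>G. \<Union>f\<in>F. coset D J (g \<cdot>\<^bsub>D\<^esub> f)),
     Zro = (\<lambda>a b. coset D J (Zro D a b)),
     Add = (\<lambda>F G. \<Union>f\<in>F. \<Union>g\<in>G. coset D J (Add D f g)),
     Scl = (\<lambda>r F. \<Union>f\<in>F. coset D J (Scl D r f))\<rparr>"

text \<open>The canonical functor \<open>D/I \<rightarrow> D/J\<close> for ideals \<open>I \<subseteq> J\<close>.\<close>

definition quot_map :: "('o, 'm, 'k) prelincat \<Rightarrow> 'm set \<Rightarrow> 'm set \<Rightarrow> ('o, 'm set, 'o, 'm set) funct" where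
  "quot_map D I J = \<lparr>FObj = (\<lambda>a\<in>Obj D. a), FArr = (\<lambda>F\<in>Arr (quot_cat D I). \<Union>f\<in>F. coset D J f)\<rparr>"

text \<open>
  The localization \<open>C[S\<^sup>-\<^sup>1]\<close> is given by its usual presentation: arrows are formal composites of
  arrows of \<open>C\<close> and formal inverses of elements of \<open>S\<close>, modulo the congruence generated by the category
  axioms, the composition of \<open>C\<close> and the relations saying that \<open>LInv s\<close> is inverse to \<open>s\<close>. Theorem
  \<open>loc_universal\<close> below is its universal property; in particular it is canonically isomorphic to the
  category of fractions whenever \<open>S\<close> admits a calculus of fractions. A typing predicate singles out the
  composable terms, and an arrow of the localization is stored with its domain and codomain.
\<close>

datatype 'm loc_term = LArr 'm | LInv 'm | LComp "'m loc_term" "'m loc_term"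

inductive loc_typed :: "('o, 'm, 'z) precat_scheme \<Rightarrow> 'm set \<Rightarrow> 'm loc_term \<Rightarrow> 'o \<Rightarrow> 'o \<Rightarrow> bool"
  for C S where
  arr: "f \<in> Arr C \<Longrightarrow> loc_typed C S (LArr f) (Dom C f) (Cod C f)"
| inv: "s \<in> S \<Longrightarrow> s \<in> Arr C \<Longrightarrow> loc_typed C S (LInv s) (Cod C s) (Dom C s)"
| comp: "loc_typed C S t a b \<Longrightarrow> loc_typed C S u b c \<Longrightarrow> loc_typed C S (LComp u t) a c"

inductive loc_eq :: "('o, 'm, 'z) precat_scheme \<Rightarrow> 'm set \<Rightarrow> 'm loc_term \<Rightarrow> 'm loc_term \<Rightarrow> bool"
  for C S where
  refl: "loc_typed C S t a b \<Longrightarrow> loc_eq C S t t"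
| sym: "loc_eq C S t u \<Longrightarrow> loc_eq C S u t"
| trans: "loc_eq C S t u \<Longrightarrow> loc_eq C S u v \<Longrightarrow> loc_eq C S t v"
| cong: "\<lbrakk>loc_eq C S t t'; loc_eq C S u u'; loc_typed C S t a b; loc_typed C S u b c\<rbrakk> \<Longrightarrow>
    loc_eq C S (LComp u t) (LComp u' t')"
| assoc: "\<lbrakk>loc_typed C S t a b; loc_typed C S u b c; loc_typed C S v c d\<rbrakk> \<Longrightarrow>
    loc_eq C S (LComp v (LComp u t)) (LComp (LComp v u) t)"
| idn_left: "loc_typed C S t a b \<Longrightarrow> loc_eq C S (LComp (LArr (Idn C b)) t) t"
| idn_right: "loc_typed C S t a b \<Longrightarrow> loc_eq C S (LComp t (LArr (Idn C a))) t"
| arr_comp: "\<lbrakk>f \<in> Hom C a b; g \<in> Hom C b c\<rbrakk> \<Longrightarrow>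
    loc_eq C S (LArr (g \<cdot>\<^bsub>C\<^esub> f)) (LComp (LArr g) (LArr f))"
| inv_left: "\<lbrakk>s \<in> S; s \<in> Arr C\<rbrakk> \<Longrightarrow> loc_eq C S (LComp (LInv s) (LArr s)) (LArr (Idn C (Dom C s)))"
| inv_right: "\<lbrakk>s \<in> S; s \<in> Arr C\<rbrakk> \<Longrightarrow> loc_eq C S (LComp (LArr s) (LInv s)) (LArr (Idn C (Cod C s)))"

definition loc_cat ::
  "('o, 'm, 'z) precat_scheme \<Rightarrow> 'm set \<Rightarrow> ('o, 'o \<times> 'o \<times> 'm loc_term set) precat" where
  "loc_cat C S = \<lparr>Obj = Obj C,
     Arr = {(a, b, {u. loc_eq C S t u}) | a b t. loc_typed C S t a b},
     Dom = (\<lambda>(a, b, F). a), Cod = (\<lambda>(a, b, F). b),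
     Idn = (\<lambda>a. (a, a, {u. loc_eq C S (LArr (Idn C a)) u})),
     Comp = (\<lambda>(b', c, G) (a, b, F). (a, c, {v. \<exists>t\<in>F. \<exists>u\<in>G. loc_eq C S (LComp u t) v}))\<rparr>"

definition loc_functor ::
  "('o, 'm, 'z) precat_scheme \<Rightarrow> 'm set \<Rightarrow> ('o, 'm, 'o, 'o \<times> 'o \<times> 'm loc_term set) funct" where
  "loc_functor C S = \<lparr>FObj = (\<lambda>a\<in>Obj C. a),
     FArr = (\<lambda>f\<in>Arr C. (Dom C f, Cod C f, {u. loc_eq C S (LArr f) u}))\<rparr>"

lemma HomI: "f \<in> Arr C \<Longrightarrow> Dom C f = a \<Longrightarrow> Cod C f = b \<Longrightarrow> f \<in> Hom C a b"
  by (simp add: Hom_def)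

lemma HomD: "f \<in> Hom C a b \<Longrightarrow> f \<in> Arr C" "f \<in> Hom C a b \<Longrightarrow> Dom C f = a" "f \<in> Hom C a b \<Longrightarrow> Cod C f = b"
  by (simp_all add: Hom_def)

context
  fixes C :: "('o, 'm, 'z) precat_scheme" and S :: "'m set"
  assumes C: "category C"
begin

lemma loc_typed_obj: "loc_typed C S t a b \<Longrightarrow> a \<in> Obj C \<and> b \<in> Obj C"
  by (induction rule: loc_typed.induct) (use C in \<open>auto simp: category_def\<close>)

lemma loc_typed_unique: "loc_typed C S t a b \<Longrightarrow> loc_typed C S t a' b' \<Longrightarrow> a' = a \<and> b' = b"
proof (induction arbitrary: a' b' rule: loc_typed.induct)
  case (arr f) show ?case using arr(2) by (cases rule: loc_typed.cases) auto
next
  case (inv s) show ?case using inv(3) by (cases rule: loc_typed.cases) auto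
next
  case (comp t a b u c) from comp(5) obtain b'' where "loc_typed C S t a' b''" "loc_typed C S u b'' b'" by (cases rule: loc_typed.cases) auto
  then show ?case using comp.IH by blast
qed

lemma loc_typed_arr: "f \<in> Hom C a b \<Longrightarrow> loc_typed C S (LArr f) a b"
  using loc_typed.arr[of f C S] by (simp add: Hom_def)

lemma loc_typed_idn: "a \<in> Obj C \<Longrightarrow> loc_typed C S (LArr (Idn C a)) a a"
  using loc_typed_arr[OF category.idn_hom[OF C]] .

lemma loc_eq_typed: "loc_eq C S t u \<Longrightarrow> \<exists>a b. loc_typed C S t a b \<and> loc_typed C S u a b"
proof (induction rule: loc_eq.induct)
  case (trans t u v) then show ?case using loc_typed_unique by metis
next
  case (cong t t' u u' a b c) then show ?case using loc_typed_unique by (metis loc_typed.comp)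
next
  case (idn_left t a b) then show ?case by (meson loc_typed.comp loc_typed_idn loc_typed_obj)
next
  case (idn_right t a b) then show ?case by (meson loc_typed.comp loc_typed_idn loc_typed_obj)
next
  case (arr_comp f a b g c) then show ?case by (meson C category.comp_hom loc_typed.comp loc_typed_arr)
next
  case (inv_left s) then show ?case
    by (meson C category.dom_obj loc_typed.arr loc_typed.comp loc_typed.inv loc_typed_idn)
next
  case (inv_right s) then show ?case
    by (meson C category.cod_obj loc_typed.arr loc_typed.comp loc_typed.inv loc_typed_idn)
qed (blast intro: loc_typed.comp)+

lemma loc_eq_typed': "loc_eq C S t u \<Longrightarrow> loc_typed C S t a b \<longleftrightarrow> loc_typed C S u a b"
  using loc_eq_typed[of t u] loc_typed_unique by blast

abbreviation "lcls t \<equiv> {u. loc_eq C S t u}"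

lemma lcls_eq: "loc_typed C S t a b \<Longrightarrow> lcls t = lcls u \<longleftrightarrow> loc_eq C S t u"
  by (blast intro: loc_eq.refl loc_eq.sym loc_eq.trans)

lemma loc_Hom: "Hom (loc_cat C S) a b = {(a, b, lcls t) | t. loc_typed C S t a b}"
  by (auto simp: Hom_def loc_cat_def)

lemma loc_Comp:
  assumes "loc_typed C S t a b" "loc_typed C S u b c"
  shows "Comp (loc_cat C S) (b, c, lcls u) (a, b, lcls t) = (a, c, lcls (LComp u t))"
proof -
  have "loc_eq C S (LComp u t) v" if "loc_eq C S t t'" "loc_eq C S u u'" "loc_eq C S (LComp u' t') v" for t' u' v
    using that assms loc_eq.cong loc_eq.trans by metis
  moreover have "loc_eq C S t t" "loc_eq C S u u" using assms loc_eq.refl by metis+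
  ultimately show ?thesis by (auto simp: loc_cat_def)
qed

lemma loc_cat_category: "category (loc_cat C S)"
proof
  show "f \<in> Arr (loc_cat C S) \<Longrightarrow> Dom (loc_cat C S) f \<in> Obj (loc_cat C S)" for f
    by (auto simp: loc_cat_def dest: loc_typed_obj)
  show "f \<in> Arr (loc_cat C S) \<Longrightarrow> Cod (loc_cat C S) f \<in> Obj (loc_cat C S)" for f
    by (auto simp: loc_cat_def dest: loc_typed_obj)
  have Idn: "Idn (loc_cat C S) a = (a, a, lcls (LArr (Idn C a)))" for a by (simp add: loc_cat_def)
  have Obj: "Obj (loc_cat C S) = Obj C" by (simp add: loc_cat_def)
  show "a \<in> Obj (loc_cat C S) \<Longrightarrow> Idn (loc_cat C S) a \<in> Hom (loc_cat C S) a a" for a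
    using loc_typed_idn by (auto simp: loc_Hom Idn Obj)
  show "f \<in> Hom (loc_cat C S) a b \<Longrightarrow> g \<in> Hom (loc_cat C S) b c \<Longrightarrow> Comp (loc_cat C S) g f \<in> Hom (loc_cat C S) a c" for f g a b c
    by (auto simp: loc_Hom loc_Comp intro: loc_typed.comp)
  show "Comp (loc_cat C S) (Idn (loc_cat C S) b) f = f" if f: "f \<in> Hom (loc_cat C S) a b" for f a b
  proof -
    from f obtain t where t: "f = (a, b, lcls t)" "loc_typed C S t a b" by (auto simp: loc_Hom)
    have "loc_typed C S (LArr (Idn C b)) b b" using t loc_typed_obj loc_typed_idn by blast
    then show ?thesis using t loc_eq.idn_left[OF t(2)] lcls_eq[OF t(2)]
      by (metis (no_types, lifting) Idn loc_Comp loc_eq.sym)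
  qed
  show "Comp (loc_cat C S) f (Idn (loc_cat C S) a) = f" if f: "f \<in> Hom (loc_cat C S) a b" for f a b
  proof -
    from f obtain t where t: "f = (a, b, lcls t)" "loc_typed C S t a b" by (auto simp: loc_Hom)
    have "loc_typed C S (LArr (Idn C a)) a a" using t loc_typed_obj loc_typed_idn by blast
    then show ?thesis using t loc_eq.idn_right[OF t(2)] lcls_eq[OF t(2)]
      by (metis (no_types, lifting) Idn loc_Comp loc_eq.sym)
  qed
  show "Comp (loc_cat C S) h (Comp (loc_cat C S) g f) = Comp (loc_cat C S) (Comp (loc_cat C S) h g) f"
    if fgh: "f \<in> Hom (loc_cat C S) a b" "g \<in> Hom (loc_cat C S) b c" "h \<in> Hom (loc_cat C S) c d" for f g h a b c d
  proof -
    from fgh obtain t u v where t: "f = (a, b, lcls t)" "loc_typed C S t a b"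
      and u: "g = (b, c, lcls u)" "loc_typed C S u b c"
      and v: "h = (c, d, lcls v)" "loc_typed C S v c d" by (auto simp: loc_Hom)
    show ?thesis using loc_typed.comp[OF t(2) u(2)] loc_typed.comp[OF u(2) v(2)] t u v
      loc_eq.assoc[OF t(2) u(2) v(2)] lcls_eq[OF loc_typed.comp[OF loc_typed.comp[OF t(2) u(2)] v(2)]]
      by (simp add: loc_Comp)
  qed
qed

lemma loc_functor_is_functor: "is_functor C (loc_cat C S) (loc_functor C S)"
proof -
  have O: "FObj (loc_functor C S) \<in> Obj C \<rightarrow>\<^sub>E Obj (loc_cat C S)"
    by (auto simp: loc_functor_def loc_cat_def)
  have A: "FArr (loc_functor C S) \<in> Arr C \<rightarrow>\<^sub>E Arr (loc_cat C S)"
    by (auto simp: loc_functor_def loc_cat_def intro!: loc_typed.arr)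
  have H: "FArr (loc_functor C S) f \<in> Hom (loc_cat C S) (FObj (loc_functor C S) (Dom C f)) (FObj (loc_functor C S) (Cod C f))"
    if "f \<in> Arr C" for f
    using that C by (auto simp: loc_functor_def loc_Hom category_def intro!: exI loc_typed.arr)
  have I: "FArr (loc_functor C S) (Idn C a) = Idn (loc_cat C S) (FObj (loc_functor C S) a)" if "a \<in> Obj C" for a
    using that category.idn_hom[OF C that] by (simp add: loc_functor_def loc_cat_def Hom_def)
  have M: "FArr (loc_functor C S) (Comp C g f) = Comp (loc_cat C S) (FArr (loc_functor C S) g) (FArr (loc_functor C S) f)"
    if "f \<in> Arr C" "g \<in> Arr C" "Cod C f = Dom C g" for f g
  proof -
    have f: "f \<in> Hom C (Dom C f) (Dom C g)" and g: "g \<in> Hom C (Dom C g) (Cod C g)" using that by (auto simp: Hom_def)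
    have gf: "Comp C g f \<in> Hom C (Dom C f) (Cod C g)" using category.comp_hom[OF C f g] .
    note tf = loc_typed_arr[OF f] and tg = loc_typed_arr[OF g]
    show ?thesis using that HomD[OF gf] loc_Comp[OF tf tg] loc_eq.arr_comp[OF f g] lcls_eq[OF loc_typed_arr[OF gf]]
      by (simp add: loc_functor_def)
  qed
  show ?thesis unfolding is_functor_def using O A H I M by blast
qed

lemma loc_inverts:
  assumes "s \<in> S" "s \<in> Arr C"
  shows "iso_arr (loc_cat C S) (FArr (loc_functor C S) s)"
proof -
  have ts: "loc_typed C S (LArr s) (Dom C s) (Cod C s)" and ti: "loc_typed C S (LInv s) (Cod C s) (Dom C s)"
    using assms by (auto intro: loc_typed.intros)
  have "(Dom C s, Cod C s, lcls (LArr s)) \<in> Hom (loc_cat C S) (Dom C s) (Cod C s)"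
    "(Cod C s, Dom C s, lcls (LInv s)) \<in> Hom (loc_cat C S) (Cod C s) (Dom C s)"
    using ts ti by (auto simp: loc_Hom)
  then show ?thesis using loc_Comp[OF ts ti] loc_Comp[OF ti ts]  assms
      loc_eq.inv_left[OF assms] loc_eq.inv_right[OF assms]
      lcls_eq[OF loc_typed.comp[OF ts ti]] lcls_eq[OF loc_typed.comp[OF ti ts]]
    unfolding iso_arr_def
    by (intro conjI bexI[of _ "(Cod C s, Dom C s, lcls (LInv s))"])
       (auto simp: loc_functor_def HomD, auto simp: loc_cat_def)
qed

end

definition inv_arr :: "('o, 'm, 'z) precat_scheme \<Rightarrow> 'm \<Rightarrow> 'm" where
  "inv_arr C f = (SOME g. g \<in> Hom C (Cod C f) (Dom C f) \<and>
     g \<cdot>\<^bsub>C\<^esub> f = Idn C (Dom C f) \<and> f \<cdot>\<^bsub>C\<^esub> g = Idn C (Cod C f))"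

lemma inv_arr:
  assumes "iso_arr C f"
  shows "inv_arr C f \<in> Hom C (Cod C f) (Dom C f)" "inv_arr C f \<cdot>\<^bsub>C\<^esub> f = Idn C (Dom C f)"
    "f \<cdot>\<^bsub>C\<^esub> inv_arr C f = Idn C (Cod C f)"
proof -
  have "\<exists>g. g \<in> Hom C (Cod C f) (Dom C f) \<and>
     g \<cdot>\<^bsub>C\<^esub> f = Idn C (Dom C f) \<and> f \<cdot>\<^bsub>C\<^esub> g = Idn C (Cod C f)"
    using assms unfolding iso_arr_def by blast
  from someI_ex[OF this] show "inv_arr C f \<in> Hom C (Cod C f) (Dom C f)" "inv_arr C f \<cdot>\<^bsub>C\<^esub> f = Idn C (Dom C f)"
    "f \<cdot>\<^bsub>C\<^esub> inv_arr C f = Idn C (Cod C f)" unfolding inv_arr_def by blast+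
qed

lemma inv_arr_unique:
  assumes "category C" "f \<in> Hom C a b" "g \<in> Hom C b a" "g' \<in> Hom C b a"
    "g \<cdot>\<^bsub>C\<^esub> f = Idn C a" "f \<cdot>\<^bsub>C\<^esub> g' = Idn C b"
  shows "g = g'"
  using category.comp_assoc[OF assms(1) assms(4) assms(2) assms(3)] category.comp_idn_left[OF assms(1) assms(4)]
    category.comp_idn_right[OF assms(1) assms(3)] assms(5,6) by simp

fun loc_eval :: "('p, 'n, 'y) precat_scheme \<Rightarrow> ('o, 'm, 'p, 'n) funct \<Rightarrow> 'm loc_term \<Rightarrow> 'n" where
  "loc_eval D F (LArr f) = FArr F f"
| "loc_eval D F (LInv s) = inv_arr D (FArr F s)"
| "loc_eval D F (LComp u t) = loc_eval D F u \<cdot>\<^bsub>D\<^esub> loc_eval D F t"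

lemma is_functorD:
  assumes "is_functor C D F"
  shows "a \<in> Obj C \<Longrightarrow> FObj F a \<in> Obj D" "f \<in> Hom C a b \<Longrightarrow> FArr F f \<in> Hom D (FObj F a) (FObj F b)"
    "a \<in> Obj C \<Longrightarrow> FArr F (Idn C a) = Idn D (FObj F a)"
    "f \<in> Hom C a b \<Longrightarrow> g \<in> Hom C b c \<Longrightarrow> FArr F (g \<cdot>\<^bsub>C\<^esub> f) = FArr F g \<cdot>\<^bsub>D\<^esub> FArr F f"
  using assms by (auto simp: is_functor_def Hom_def)

theorem loc_universal:
  fixes C :: "('o, 'm, 'z) precat_scheme" and D :: "('p, 'n, 'y) precat_scheme"
  assumes C: "category C" and D: "category D" and F: "is_functor C D F"
    and S: "S \<subseteq> Arr C" and iso: "\<And>s. s \<in> S \<Longrightarrow> iso_arr D (FArr F s)"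
  shows "\<exists>!G. is_functor (loc_cat C S) D G \<and> funct_comp C G (loc_functor C S) = F"
proof -
  note FD = is_functorD[OF F]
  have evt: "loc_typed C S t a b \<Longrightarrow> loc_eval D F t \<in> Hom D (FObj F a) (FObj F b)" for t a b
  proof (induction rule: loc_typed.induct)
    case (arr f) then show ?case by (simp add: FD Hom_def[of C])
  next
    case (inv s)
    have "FArr F s \<in> Hom D (FObj F (Dom C s)) (FObj F (Cod C s))" using inv FD(2)[of s] by (simp add: Hom_def[of C])
    then show ?case using inv_arr(1)[OF iso[OF inv(1)]] by (simp add: HomD)
  next
    case (comp t a b u c) then show ?case using category.comp_hom[OF D] by fastforce
  qed
  have eve: "loc_eq C S t u \<Longrightarrow> loc_eval D F t = loc_eval D F u" for t u
  proof (induction rule: loc_eq.induct)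
    case (assoc t a b u c v d) then show ?case using category.comp_assoc[OF D evt evt evt] by simp
  next
    case (idn_left t a b)
    then show ?case using evt[OF idn_left] loc_typed_obj[OF C idn_left] category.comp_idn_left[OF D] by (simp add: FD(3))
  next
    case (idn_right t a b)
    then show ?case using evt[OF idn_right] loc_typed_obj[OF C idn_right] category.comp_idn_right[OF D] by (simp add: FD(3))
  next
    case (arr_comp f a b g c) then show ?case by (simp add: FD(4))
  next
    case (inv_left s)
    have "FArr F s \<in> Hom D (FObj F (Dom C s)) (FObj F (Cod C s))" using inv_left FD(2)[of s] by (simp add: Hom_def[of C])
    then show ?case using inv_arr(2)[OF iso[OF inv_left(1)]] category.dom_obj[OF C inv_left(2)] by (simp add: HomD FD(3))
  next
    case (inv_right s)
    have "FArr F s \<in> Hom D (FObj F (Dom C s)) (FObj F (Cod C s))" using inv_right FD(2)[of s] by (simp add: Hom_def[of C])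
    then show ?case using inv_arr(3)[OF iso[OF inv_right(1)]] category.cod_obj[OF C inv_right(2)] by (simp add: HomD FD(3))
  qed auto
  define G where "G = \<lparr>FObj = FObj F, FArr = (\<lambda>(a, b, X)\<in>Arr (loc_cat C S). loc_eval D F (SOME t. t \<in> X))\<rparr>"
  have arrL: "(a, b, {u. loc_eq C S t u}) \<in> Arr (loc_cat C S)" if "loc_typed C S t a b" for t a b
    using that by (auto simp: loc_cat_def)
  have Gc: "FArr G (a, b, {u. loc_eq C S t u}) = loc_eval D F t" if "loc_typed C S t a b" for t a b
  proof -
    have "loc_eq C S t (SOME u. loc_eq C S t u)" using loc_eq.refl[OF that] by (rule someI)
    then show ?thesis using arrL[OF that] eve by (simp add: G_def)
  qed
  have G1: "FObj G = FObj F" by (simp add: G_def)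
  note HL = loc_Hom[OF C] and CL = loc_Comp[OF C]
  have GH: "FArr G f \<in> Hom D (FObj G a) (FObj G b)" if "f \<in> Hom (loc_cat C S) a b" for f a b
    using that Gc evt by (auto simp: HL G1)
  have "is_functor (loc_cat C S) D G"
    unfolding is_functor_def
  proof (intro conjI ballI impI)
    show "FObj G \<in> Obj (loc_cat C S) \<rightarrow>\<^sub>E Obj D" using F by (simp add: is_functor_def G1 loc_cat_def)
    show "FArr G \<in> Arr (loc_cat C S) \<rightarrow>\<^sub>E Arr D"
      using GH by (force simp: PiE_def Hom_def G_def extensional_def)
    show "FArr G f \<in> Hom D (FObj G (Dom (loc_cat C S) f)) (FObj G (Cod (loc_cat C S) f))" if "f \<in> Arr (loc_cat C S)" for f
      using that GH by (simp add: Hom_def)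
    show "FArr G (Idn (loc_cat C S) a) = Idn D (FObj G a)" if "a \<in> Obj (loc_cat C S)" for a
    proof -
      have a: "a \<in> Obj C" using that by (simp add: loc_cat_def)
      show ?thesis using Gc[OF loc_typed_idn[OF C a]] FD(3)[OF a] by (simp add: G1 loc_cat_def)
    qed
    show "FArr G (Comp (loc_cat C S) g f) = FArr G g \<cdot>\<^bsub>D\<^esub> FArr G f"
      if fg: "f \<in> Arr (loc_cat C S)" "g \<in> Arr (loc_cat C S)" "Cod (loc_cat C S) f = Dom (loc_cat C S) g" for f g
    proof -
      obtain a b c t u where "f = (a, b, {v. loc_eq C S t v})" "loc_typed C S t a b"
        "g = (b, c, {v. loc_eq C S u v})" "loc_typed C S u b c"
        using fg by (auto simp: loc_cat_def)
      then show ?thesis by (simp add: CL Gc loc_typed.comp)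
    qed
  qed
  moreover have "funct_comp C G (loc_functor C S) = F"
  proof -
    have "(\<lambda>a\<in>Obj C. FObj F a) = FObj F" "(\<lambda>a\<in>Arr C. FArr F a) = FArr F"
      using F by (auto simp: is_functor_def PiE_def extensional_restrict)
    moreover have "(\<lambda>f\<in>Arr C. FArr G (FArr (loc_functor C S) f)) = (\<lambda>f\<in>Arr C. FArr F f)"
      using Gc[OF loc_typed.arr] by (auto simp: loc_functor_def)
    ultimately show ?thesis by (simp add: funct_comp_def G1 loc_functor_def cong: restrict_cong)
  qed
  moreover have "G' = G" if G': "is_functor (loc_cat C S) D G'" and e: "funct_comp C G' (loc_functor C S) = F" for G'
  proof -
    note GD = is_functorD[OF G']
    have O: "FObj G' a = FObj F a" if "a \<in> Obj C" for a
      using that e by (auto simp: funct_comp_def loc_functor_def)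
    have A: "FArr G' (Dom C f, Cod C f, {u. loc_eq C S (LArr f) u}) = FArr F f" if "f \<in> Arr C" for f
      using that e by (auto simp: funct_comp_def loc_functor_def)
    have T: "loc_typed C S t a b \<Longrightarrow> FArr G' (a, b, {u. loc_eq C S t u}) = loc_eval D F t" for t a b
    proof (induction rule: loc_typed.induct)
      case (arr f) then show ?case by (simp add: A)
    next
      case (inv s)
      let ?a = "Dom C s" and ?b = "Cod C s"
      let ?x = "(?a, ?b, {u. loc_eq C S (LArr s) u})" and ?y = "(?b, ?a, {u. loc_eq C S (LInv s) u})"
      have ob: "?a \<in> Obj C" "?b \<in> Obj C" using C inv by (auto simp: category_def)
      have ts: "loc_typed C S (LArr s) ?a ?b" and ti: "loc_typed C S (LInv s) ?b ?a"
        using inv by (auto intro: loc_typed.intros)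
      have x: "?x \<in> Hom (loc_cat C S) ?a ?b" and y: "?y \<in> Hom (loc_cat C S) ?b ?a" using ts ti by (auto simp: HL)
      have "Comp (loc_cat C S) ?x ?y = Idn (loc_cat C S) ?b"
        using CL[OF ti ts] lcls_eq[OF C loc_typed.comp[OF ti ts]] loc_eq.inv_right[OF inv] by (simp add: loc_cat_def)
      then have 1: "FArr G' ?x \<cdot>\<^bsub>D\<^esub> FArr G' ?y = Idn D (FObj G' ?b)"
        using GD(4)[OF y x] GD(3)[of ?b] ob by (simp add: loc_cat_def)
      have h: "FArr F s \<in> Hom D (FObj F ?a) (FObj F ?b)" using FD(2)[of s ?a ?b] inv by (simp add: Hom_def[of C])
      have "inv_arr D (FArr F s) = FArr G' ?y"
      proof (rule inv_arr_unique[OF D h])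
        show "inv_arr D (FArr F s) \<in> Hom D (FObj F ?b) (FObj F ?a)"
          "inv_arr D (FArr F s) \<cdot>\<^bsub>D\<^esub> FArr F s = Idn D (FObj F ?a)"
          using inv_arr[OF iso[OF inv(1)]] h by (simp_all add: HomD)
        show "FArr G' ?y \<in> Hom D (FObj F ?b) (FObj F ?a)" using GD(2)[OF y] O ob by simp
        show "FArr F s \<cdot>\<^bsub>D\<^esub> FArr G' ?y = Idn D (FObj F ?b)" using 1 A[OF inv(2)] O ob by simp
      qed
      then show ?case by simp
    next
      case (comp t a b u c)
      have "(a, b, {v. loc_eq C S t v}) \<in> Hom (loc_cat C S) a b" "(b, c, {v. loc_eq C S u v}) \<in> Hom (loc_cat C S) b c"
        using comp by (auto simp: HL)
      then show ?case using GD(4) CL[OF comp(1,2)] comp.IH by force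
    qed
    have "FObj G' = FObj G"
    proof (rule PiE_ext)
      show "FObj G' \<in> Obj C \<rightarrow>\<^sub>E Obj D" using G' by (simp add: is_functor_def loc_cat_def)
      show "FObj G \<in> Obj C \<rightarrow>\<^sub>E Obj D" using F by (simp add: is_functor_def G1)
    qed (simp add: O G1)
    moreover have "FArr G' = FArr G"
    proof (rule extensionalityI[of _ "Arr (loc_cat C S)"])
      show "FArr G' \<in> extensional (Arr (loc_cat C S))" using G' by (simp add: is_functor_def PiE_def)
      show "FArr G \<in> extensional (Arr (loc_cat C S))" by (simp add: G_def)
      show "FArr G' f = FArr G f" if "f \<in> Arr (loc_cat C S)" for f
        using that T Gc by (auto simp: loc_cat_def)
    qed
    ultimately show "G' = G" by simp
  qed
  ultimately show ?thesis by blast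
qed

text \<open>The linear localization is presented in the same way inside \<open>R\<close>-linear categories; its universal
  property among \<open>R\<close>-linear functors is \<open>lloc_universal\<close>.\<close>

datatype ('o, 'm, 'k) lloc_term = LLArr 'm | LLInv 'm
  | LLComp "('o, 'm, 'k) lloc_term" "('o, 'm, 'k) lloc_term"
  | LLZro 'o 'o
  | LLAdd "('o, 'm, 'k) lloc_term" "('o, 'm, 'k) lloc_term"
  | LLScl 'k "('o, 'm, 'k) lloc_term"

inductive lloc_typed ::
  "('k, 'r) ring_scheme \<Rightarrow> ('o, 'm, 'k) prelincat \<Rightarrow> 'm set \<Rightarrow> ('o, 'm, 'k) lloc_term \<Rightarrow> 'o \<Rightarrow> 'o \<Rightarrow> bool"
  for R D S where
  arr: "f \<in> Arr D \<Longrightarrow> lloc_typed R D S (LLArr f) (Dom D f) (Cod D f)"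
| inv: "s \<in> S \<Longrightarrow> s \<in> Arr D \<Longrightarrow> lloc_typed R D S (LLInv s) (Cod D s) (Dom D s)"
| comp: "lloc_typed R D S t a b \<Longrightarrow> lloc_typed R D S u b c \<Longrightarrow> lloc_typed R D S (LLComp u t) a c"
| zro: "a \<in> Obj D \<Longrightarrow> b \<in> Obj D \<Longrightarrow> lloc_typed R D S (LLZro a b) a b"
| add: "lloc_typed R D S t a b \<Longrightarrow> lloc_typed R D S u a b \<Longrightarrow> lloc_typed R D S (LLAdd t u) a b"
| scl: "r \<in> carrier R \<Longrightarrow> lloc_typed R D S t a b \<Longrightarrow> lloc_typed R D S (LLScl r t) a b"

inductive lloc_eq ::
  "('k, 'r) ring_scheme \<Rightarrow> ('o, 'm, 'k) prelincat \<Rightarrow> 'm set \<Rightarrow>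
   ('o, 'm, 'k) lloc_term \<Rightarrow> ('o, 'm, 'k) lloc_term \<Rightarrow> bool"
  for R D S where
  refl: "lloc_typed R D S t a b \<Longrightarrow> lloc_eq R D S t t"
| sym: "lloc_eq R D S t u \<Longrightarrow> lloc_eq R D S u t"
| trans: "lloc_eq R D S t u \<Longrightarrow> lloc_eq R D S u v \<Longrightarrow> lloc_eq R D S t v"
| cong_comp: "\<lbrakk>lloc_eq R D S t t'; lloc_eq R D S u u'; lloc_typed R D S t a b; lloc_typed R D S u b c\<rbrakk> \<Longrightarrow>
    lloc_eq R D S (LLComp u t) (LLComp u' t')"
| cong_add: "\<lbrakk>lloc_eq R D S t t'; lloc_eq R D S u u'; lloc_typed R D S t a b; lloc_typed R D S u a b\<rbrakk> \<Longrightarrow>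
    lloc_eq R D S (LLAdd t u) (LLAdd t' u')"
| cong_scl: "\<lbrakk>r \<in> carrier R; lloc_eq R D S t t'\<rbrakk> \<Longrightarrow> lloc_eq R D S (LLScl r t) (LLScl r t')"
| assoc: "\<lbrakk>lloc_typed R D S t a b; lloc_typed R D S u b c; lloc_typed R D S v c d\<rbrakk> \<Longrightarrow>
    lloc_eq R D S (LLComp v (LLComp u t)) (LLComp (LLComp v u) t)"
| idn_left: "lloc_typed R D S t a b \<Longrightarrow> lloc_eq R D S (LLComp (LLArr (Idn D b)) t) t"
| idn_right: "lloc_typed R D S t a b \<Longrightarrow> lloc_eq R D S (LLComp t (LLArr (Idn D a))) t"
| add_assoc: "\<lbrakk>lloc_typed R D S t a b; lloc_typed R D S u a b; lloc_typed R D S v a b\<rbrakk> \<Longrightarrow>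
    lloc_eq R D S (LLAdd (LLAdd t u) v) (LLAdd t (LLAdd u v))"
| add_comm: "\<lbrakk>lloc_typed R D S t a b; lloc_typed R D S u a b\<rbrakk> \<Longrightarrow>
    lloc_eq R D S (LLAdd t u) (LLAdd u t)"
| add_zro: "lloc_typed R D S t a b \<Longrightarrow> lloc_eq R D S (LLAdd (LLZro a b) t) t"
| add_neg: "lloc_typed R D S t a b \<Longrightarrow>
    lloc_eq R D S (LLAdd (LLScl (\<ominus>\<^bsub>R\<^esub> \<one>\<^bsub>R\<^esub>) t) t) (LLZro a b)"
| scl_add_left: "\<lbrakk>r \<in> carrier R; s \<in> carrier R; lloc_typed R D S t a b\<rbrakk> \<Longrightarrow>
    lloc_eq R D S (LLScl (r \<oplus>\<^bsub>R\<^esub> s) t) (LLAdd (LLScl r t) (LLScl s t))"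
| scl_add_right: "\<lbrakk>r \<in> carrier R; lloc_typed R D S t a b; lloc_typed R D S u a b\<rbrakk> \<Longrightarrow>
    lloc_eq R D S (LLScl r (LLAdd t u)) (LLAdd (LLScl r t) (LLScl r u))"
| scl_scl: "\<lbrakk>r \<in> carrier R; s \<in> carrier R; lloc_typed R D S t a b\<rbrakk> \<Longrightarrow>
    lloc_eq R D S (LLScl (r \<otimes>\<^bsub>R\<^esub> s) t) (LLScl r (LLScl s t))"
| scl_one: "lloc_typed R D S t a b \<Longrightarrow> lloc_eq R D S (LLScl \<one>\<^bsub>R\<^esub> t) t"
| comp_add_left: "\<lbrakk>lloc_typed R D S t a b; lloc_typed R D S u b c; lloc_typed R D S v b c\<rbrakk> \<Longrightarrow>
    lloc_eq R D S (LLComp (LLAdd u v) t) (LLAdd (LLComp u t) (LLComp v t))"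
| comp_add_right: "\<lbrakk>lloc_typed R D S t a b; lloc_typed R D S u a b; lloc_typed R D S v b c\<rbrakk> \<Longrightarrow>
    lloc_eq R D S (LLComp v (LLAdd t u)) (LLAdd (LLComp v t) (LLComp v u))"
| comp_scl_left: "\<lbrakk>r \<in> carrier R; lloc_typed R D S t a b; lloc_typed R D S u b c\<rbrakk> \<Longrightarrow>
    lloc_eq R D S (LLComp (LLScl r u) t) (LLScl r (LLComp u t))"
| comp_scl_right: "\<lbrakk>r \<in> carrier R; lloc_typed R D S t a b; lloc_typed R D S u b c\<rbrakk> \<Longrightarrow>
    lloc_eq R D S (LLComp u (LLScl r t)) (LLScl r (LLComp u t))"
| arr_comp: "\<lbrakk>f \<in> Hom D a b; g \<in> Hom D b c\<rbrakk> \<Longrightarrow>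
    lloc_eq R D S (LLArr (g \<cdot>\<^bsub>D\<^esub> f)) (LLComp (LLArr g) (LLArr f))"
| arr_add: "\<lbrakk>f \<in> Hom D a b; g \<in> Hom D a b\<rbrakk> \<Longrightarrow>
    lloc_eq R D S (LLArr (Add D f g)) (LLAdd (LLArr f) (LLArr g))"
| arr_scl: "\<lbrakk>r \<in> carrier R; f \<in> Arr D\<rbrakk> \<Longrightarrow>
    lloc_eq R D S (LLArr (Scl D r f)) (LLScl r (LLArr f))"
| inv_left: "\<lbrakk>s \<in> S; s \<in> Arr D\<rbrakk> \<Longrightarrow>
    lloc_eq R D S (LLComp (LLInv s) (LLArr s)) (LLArr (Idn D (Dom D s)))"
| inv_right: "\<lbrakk>s \<in> S; s \<in> Arr D\<rbrakk> \<Longrightarrow>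
    lloc_eq R D S (LLComp (LLArr s) (LLInv s)) (LLArr (Idn D (Cod D s)))"

definition lloc_cat ::
  "('k, 'r) ring_scheme \<Rightarrow> ('o, 'm, 'k) prelincat \<Rightarrow> 'm set \<Rightarrow>
   ('o, 'o \<times> 'o \<times> ('o, 'm, 'k) lloc_term set, 'k) prelincat" where
  "lloc_cat R D S = \<lparr>Obj = Obj D,
     Arr = {(a, b, {u. lloc_eq R D S t u}) | a b t. lloc_typed R D S t a b},
     Dom = (\<lambda>(a, b, F). a), Cod = (\<lambda>(a, b, F). b),
     Idn = (\<lambda>a. (a, a, {u. lloc_eq R D S (LLArr (Idn D a)) u})),
     Comp = (\<lambda>(b', c, G) (a, b, F). (a, c, {v. \<exists>t\<in>F. \<exists>u\<in>G. lloc_eq R D S (LLComp u t) v})),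
     Zro = (\<lambda>a b. (a, b, {u. lloc_eq R D S (LLZro a b) u})),
     Add = (\<lambda>(a, b, F) (a', b', G). (a, b, {v. \<exists>t\<in>F. \<exists>u\<in>G. lloc_eq R D S (LLAdd t u) v})),
     Scl = (\<lambda>r (a, b, F). (a, b, {v. \<exists>t\<in>F. lloc_eq R D S (LLScl r t) v}))\<rparr>"

definition lloc_functor ::
  "('k, 'r) ring_scheme \<Rightarrow> ('o, 'm, 'k) prelincat \<Rightarrow> 'm set \<Rightarrow>
   ('o, 'm, 'o, 'o \<times> 'o \<times> ('o, 'm, 'k) lloc_term set) funct" where
  "lloc_functor R D S = \<lparr>FObj = (\<lambda>a\<in>Obj D. a),
     FArr = (\<lambda>f\<in>Arr D. (Dom D f, Cod D f, {u. lloc_eq R D S (LLArr f) u}))\<rparr>"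

lemma Hom_module_simps [simp]:
  "carrier (Hom_module D a b) = Hom D a b" "zero (Hom_module D a b) = Zro D a b"
  "add (Hom_module D a b) = Add D" "smult (Hom_module D a b) = Scl D"
  by (simp_all add: Hom_module_def)

lemma (in preadditive_category) add_hom: "\<lbrakk>f \<in> Hom D a b; g \<in> Hom D a b\<rbrakk> \<Longrightarrow> Add D f g \<in> Hom D a b"
  using abelian_group.axioms(1)[OF hom_abelian_group[of a b]] abelian_monoid.a_closed[of "Hom_module D a b" f g]
    dom_obj[of f] cod_obj[of f] by (simp add: Hom_def)

lemma (in preadditive_category) zro_hom: "\<lbrakk>a \<in> Obj D; b \<in> Obj D\<rbrakk> \<Longrightarrow> Zro D a b \<in> Hom D a b"
  using abelian_group.axioms(1)[OF hom_abelian_group[of a b]] abelian_monoid.zero_closed[of "Hom_module D a b"]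
  by simp

lemma (in linear_category) scl_hom: "\<lbrakk>r \<in> carrier R; f \<in> Hom D a b\<rbrakk> \<Longrightarrow> Scl D r f \<in> Hom D a b"
  using hom_module[of a b] module.smult_closed[of R "Hom_module D a b" r f]
    dom_obj[of f] cod_obj[of f] by (simp add: Hom_def)

context
  fixes R :: "('k, 'r) ring_scheme" and D :: "('o, 'm, 'k) prelincat" and S :: "'m set"
  assumes D: "linear_category R D"
begin

interpretation D: linear_category R D by (fact D)
interpretation R: cring R by (fact D.scalars)

lemma lloc_typed_obj: "lloc_typed R D S t a b \<Longrightarrow> a \<in> Obj D \<and> b \<in> Obj D"
  by (induction rule: lloc_typed.induct) (auto simp: D.dom_obj D.cod_obj)

lemma lloc_typed_unique: "lloc_typed R D S t a b \<Longrightarrow> lloc_typed R D S t a' b' \<Longrightarrow> a' = a \<and> b' = b"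
proof (induction arbitrary: a' b' rule: lloc_typed.induct)
  case (arr f) show ?case using arr(2) by (cases rule: lloc_typed.cases) auto
next
  case (inv s) show ?case using inv(3) by (cases rule: lloc_typed.cases) auto
next
  case (comp t a b u c)
  from comp(5) obtain b'' where "lloc_typed R D S t a' b''" "lloc_typed R D S u b'' b'" by (cases rule: lloc_typed.cases) auto
  then show ?case using comp.IH by blast
next
  case (zro a b) show ?case using zro(3) by (cases rule: lloc_typed.cases) auto
next
  case (add t a b u)
  from add(5) have "lloc_typed R D S t a' b'" by (cases rule: lloc_typed.cases) auto
  then show ?case using add.IH by blast
next
  case (scl r t a b)
  from scl(4) have "lloc_typed R D S t a' b'" by (cases rule: lloc_typed.cases) auto
  then show ?case using scl.IH by blast
qed

lemma lloc_typed_arr: "f \<in> Hom D a b \<Longrightarrow> lloc_typed R D S (LLArr f) a b"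
  using lloc_typed.arr[of f D R S] by (simp add: Hom_def)

lemma lloc_typed_idn: "a \<in> Obj D \<Longrightarrow> lloc_typed R D S (LLArr (Idn D a)) a a"
  using lloc_typed_arr[OF D.idn_hom] .

lemma lloc_typed_zro: "lloc_typed R D S t a b \<Longrightarrow> lloc_typed R D S (LLZro a b) a b"
  using lloc_typed_obj[of t a b] lloc_typed.zro[of a D b R S] by simp

lemma lloc_eq_typed: "lloc_eq R D S t u \<Longrightarrow> \<exists>a b. lloc_typed R D S t a b \<and> lloc_typed R D S u a b"
proof (induction rule: lloc_eq.induct)
  case (trans t u v) then show ?case using lloc_typed_unique by metis
next
  case (cong_comp t t' u u' a b c)
  then have "lloc_typed R D S t' a b" "lloc_typed R D S u' b c" using lloc_typed_unique by blast+
  with cong_comp show ?case by (blast intro: lloc_typed.comp)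
next
  case (cong_add t t' u u' a b)
  then have "lloc_typed R D S t' a b" "lloc_typed R D S u' a b" using lloc_typed_unique by blast+
  with cong_add show ?case by (blast intro: lloc_typed.add)
next
  case (cong_scl r t t') then show ?case by (blast intro: lloc_typed.scl)
next
  case (idn_left t a b) then show ?case by (meson lloc_typed.comp lloc_typed_idn lloc_typed_obj)
next
  case (idn_right t a b) then show ?case by (meson lloc_typed.comp lloc_typed_idn lloc_typed_obj)
next
  case (add_zro t a b) then show ?case by (meson lloc_typed.add lloc_typed_zro)
next
  case (add_neg t a b) then show ?case
    by (meson lloc_typed.add lloc_typed.scl lloc_typed_zro R.a_inv_closed R.one_closed)
next
  case (scl_add_left r s t a b) then show ?case
    by (meson lloc_typed.add lloc_typed.scl R.a_closed)
next
  case (scl_scl r s t a b) then show ?case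
    by (meson lloc_typed.scl R.m_closed)
next
  case (scl_one t a b) then show ?case by (meson lloc_typed.scl R.one_closed)
next
  case (arr_comp f a b g c) then show ?case by (meson D.comp_hom lloc_typed.comp lloc_typed_arr)
next
  case (arr_add f a b g) then show ?case by (meson D.add_hom lloc_typed.add lloc_typed_arr)
next
  case (arr_scl r f)
  then have "f \<in> Hom D (Dom D f) (Cod D f)" by (simp add: Hom_def)
  with arr_scl show ?case by (meson D.scl_hom lloc_typed.scl lloc_typed_arr)
next
  case (inv_left s) then show ?case
    by (meson D.dom_obj lloc_typed.arr lloc_typed.comp lloc_typed.inv lloc_typed_idn)
next
  case (inv_right s) then show ?case
    by (meson D.cod_obj lloc_typed.arr lloc_typed.comp lloc_typed.inv lloc_typed_idn)
next
  case (refl t a b) then show ?case by blast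
next
  case (sym t u) then show ?case by blast
qed (intro exI conjI, (assumption | rule lloc_typed.comp lloc_typed.add lloc_typed.scl)+)+

abbreviation "llcls t \<equiv> {u. lloc_eq R D S t u}"

lemma llcls_eq: "lloc_typed R D S t a b \<Longrightarrow> llcls t = llcls u \<longleftrightarrow> lloc_eq R D S t u"
  by (blast intro: lloc_eq.refl lloc_eq.sym lloc_eq.trans)

lemma llcls_eqI: "lloc_eq R D S t u \<Longrightarrow> llcls t = llcls u"
  by (blast intro: lloc_eq.refl lloc_eq.sym lloc_eq.trans)

lemma lloc_Hom: "Hom (lloc_cat R D S) a b = {(a, b, llcls t) | t. lloc_typed R D S t a b}"
  by (auto simp: Hom_def lloc_cat_def)

lemma lloc_Comp:
  assumes "lloc_typed R D S t a b" "lloc_typed R D S u b c"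
  shows "Comp (lloc_cat R D S) (b, c, llcls u) (a, b, llcls t) = (a, c, llcls (LLComp u t))"
proof -
  have "lloc_eq R D S (LLComp u t) v" if "lloc_eq R D S t t'" "lloc_eq R D S u u'" "lloc_eq R D S (LLComp u' t') v" for t' u' v
    using lloc_eq.trans[OF lloc_eq.cong_comp[OF that(1,2) assms] that(3)] .
  moreover have "lloc_eq R D S t t" "lloc_eq R D S u u" using lloc_eq.refl[OF assms(1)] lloc_eq.refl[OF assms(2)] by simp_all
  ultimately show ?thesis by (auto simp: lloc_cat_def)
qed

lemma lloc_Add:
  assumes "lloc_typed R D S t a b" "lloc_typed R D S u a b"
  shows "Add (lloc_cat R D S) (a, b, llcls t) (a, b, llcls u) = (a, b, llcls (LLAdd t u))"
proof -
  have "lloc_eq R D S (LLAdd t u) v" if "lloc_eq R D S t t'" "lloc_eq R D S u u'" "lloc_eq R D S (LLAdd t' u') v" for t' u' v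
    using lloc_eq.trans[OF lloc_eq.cong_add[OF that(1,2) assms] that(3)] .
  moreover have "lloc_eq R D S t t" "lloc_eq R D S u u" using lloc_eq.refl[OF assms(1)] lloc_eq.refl[OF assms(2)] by simp_all
  ultimately show ?thesis by (auto simp: lloc_cat_def)
qed

lemma lloc_Scl:
  assumes "lloc_typed R D S t a b" "r \<in> carrier R"
  shows "Scl (lloc_cat R D S) r (a, b, llcls t) = (a, b, llcls (LLScl r t))"
proof -
  have "lloc_eq R D S (LLScl r t) v" if "lloc_eq R D S t t'" "lloc_eq R D S (LLScl r t') v" for t' v
    using lloc_eq.trans[OF lloc_eq.cong_scl[OF assms(2) that(1)] that(2)] .
  moreover have "lloc_eq R D S t t" using lloc_eq.refl[OF assms(1)] .
  ultimately show ?thesis by (auto simp: lloc_cat_def)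
qed

lemma lloc_Idn: "Idn (lloc_cat R D S) a = (a, a, llcls (LLArr (Idn D a)))"
  and lloc_Zro: "Zro (lloc_cat R D S) a b = (a, b, llcls (LLZro a b))"
  and lloc_Obj: "Obj (lloc_cat R D S) = Obj D"
  by (simp_all add: lloc_cat_def)

lemma lloc_homI: "lloc_typed R D S t a b \<Longrightarrow> (a, b, llcls t) \<in> Hom (lloc_cat R D S) a b"
  by (auto simp: lloc_Hom)

lemma lloc_homE:
  assumes "f \<in> Hom (lloc_cat R D S) a b"
  obtains t where "f = (a, b, llcls t)" "lloc_typed R D S t a b"
  using assms by (auto simp: lloc_Hom)

lemma lloc_cat_category: "category (lloc_cat R D S)"
proof
  show "f \<in> Arr (lloc_cat R D S) \<Longrightarrow> Dom (lloc_cat R D S) f \<in> Obj (lloc_cat R D S)" for f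
    by (auto simp: lloc_cat_def dest: lloc_typed_obj)
  show "f \<in> Arr (lloc_cat R D S) \<Longrightarrow> Cod (lloc_cat R D S) f \<in> Obj (lloc_cat R D S)" for f
    by (auto simp: lloc_cat_def dest: lloc_typed_obj)
  show "a \<in> Obj (lloc_cat R D S) \<Longrightarrow> Idn (lloc_cat R D S) a \<in> Hom (lloc_cat R D S) a a" for a
    using lloc_typed_idn by (auto simp: lloc_Hom lloc_Idn lloc_Obj)
  show "f \<in> Hom (lloc_cat R D S) a b \<Longrightarrow> g \<in> Hom (lloc_cat R D S) b c \<Longrightarrow>
      Comp (lloc_cat R D S) g f \<in> Hom (lloc_cat R D S) a c" for f g a b c
    by (auto simp: lloc_Hom lloc_Comp intro: lloc_typed.comp)
  show "Comp (lloc_cat R D S) (Idn (lloc_cat R D S) b) f = f" if f: "f \<in> Hom (lloc_cat R D S) a b" for f a b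
  proof -
    from f obtain t where t: "f = (a, b, llcls t)" "lloc_typed R D S t a b" by (rule lloc_homE)
    have "lloc_typed R D S (LLArr (Idn D b)) b b" using t lloc_typed_obj lloc_typed_idn by blast
    then show ?thesis using t llcls_eqI[OF lloc_eq.idn_left[OF t(2)]]
      by (simp add: lloc_Idn lloc_Comp)
  qed
  show "Comp (lloc_cat R D S) f (Idn (lloc_cat R D S) a) = f" if f: "f \<in> Hom (lloc_cat R D S) a b" for f a b
  proof -
    from f obtain t where t: "f = (a, b, llcls t)" "lloc_typed R D S t a b" by (rule lloc_homE)
    have "lloc_typed R D S (LLArr (Idn D a)) a a" using t lloc_typed_obj lloc_typed_idn by blast
    then show ?thesis using t llcls_eqI[OF lloc_eq.idn_right[OF t(2)]]
      by (simp add: lloc_Idn lloc_Comp)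
  qed
  show "Comp (lloc_cat R D S) h (Comp (lloc_cat R D S) g f) = Comp (lloc_cat R D S) (Comp (lloc_cat R D S) h g) f"
    if fgh: "f \<in> Hom (lloc_cat R D S) a b" "g \<in> Hom (lloc_cat R D S) b c" "h \<in> Hom (lloc_cat R D S) c d" for f g h a b c d
  proof -
    from fgh obtain t u v where t: "f = (a, b, llcls t)" "lloc_typed R D S t a b"
      and u: "g = (b, c, llcls u)" "lloc_typed R D S u b c"
      and v: "h = (c, d, llcls v)" "lloc_typed R D S v c d" by (auto elim!: lloc_homE)
    show ?thesis using lloc_typed.comp[OF t(2) u(2)] lloc_typed.comp[OF u(2) v(2)] t u v
      llcls_eqI[OF lloc_eq.assoc[OF t(2) u(2) v(2)]]
      by (simp add: lloc_Comp)
  qed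
qed

lemma lloc_hom_module:
  assumes ab: "a \<in> Obj D" "b \<in> Obj D"
  shows "abelian_group (Hom_module (lloc_cat R D S) a b)" "module R (Hom_module (lloc_cat R D S) a b)"
proof -
  let ?H = "Hom_module (lloc_cat R D S) a b"
  note I = lloc_typed.add lloc_typed.scl lloc_typed.zro[OF ab]
  show ag: "abelian_group ?H"
  proof (rule abelian_groupI)
    fix x y assume "x \<in> carrier ?H" "y \<in> carrier ?H"
    then obtain t u where t: "x = (a, b, llcls t)" "lloc_typed R D S t a b"
      and u: "y = (a, b, llcls u)" "lloc_typed R D S u a b" by (auto elim!: lloc_homE)
    show "x \<oplus>\<^bsub>?H\<^esub> y \<in> carrier ?H" using t u lloc_homI[OF I(1)[OF t(2) u(2)]] by (simp add: I lloc_Add)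
    show "x \<oplus>\<^bsub>?H\<^esub> y = y \<oplus>\<^bsub>?H\<^esub> x" using t u llcls_eqI[OF lloc_eq.add_comm[OF t(2) u(2)]] by (simp add: I lloc_Add)
    fix z assume "z \<in> carrier ?H"
    then obtain v where v: "z = (a, b, llcls v)" "lloc_typed R D S v a b" by (auto elim!: lloc_homE)
    show "x \<oplus>\<^bsub>?H\<^esub> y \<oplus>\<^bsub>?H\<^esub> z = x \<oplus>\<^bsub>?H\<^esub> (y \<oplus>\<^bsub>?H\<^esub> z)"
      using t u v llcls_eqI[OF lloc_eq.add_assoc[OF t(2) u(2) v(2)]] by (simp add: I lloc_Add)
  next
    show "\<zero>\<^bsub>?H\<^esub> \<in> carrier ?H" using lloc_homI[OF I(3)] by (simp add: I lloc_Zro)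
  next
    fix x assume "x \<in> carrier ?H"
    then obtain t where t: "x = (a, b, llcls t)" "lloc_typed R D S t a b" by (auto elim!: lloc_homE)
    show "\<zero>\<^bsub>?H\<^esub> \<oplus>\<^bsub>?H\<^esub> x = x" using t llcls_eqI[OF lloc_eq.add_zro[OF t(2)]]
      by (simp add: I lloc_Zro lloc_Add)
    have n: "lloc_typed R D S (LLScl (\<ominus>\<^bsub>R\<^esub> \<one>\<^bsub>R\<^esub>) t) a b" using t by (simp add: I)
    show "\<exists>y\<in>carrier ?H. y \<oplus>\<^bsub>?H\<^esub> x = \<zero>\<^bsub>?H\<^esub>"
    proof
      show "(a, b, llcls (LLScl (\<ominus>\<^bsub>R\<^esub> \<one>\<^bsub>R\<^esub>) t)) \<in> carrier ?H" using n by (auto simp: lloc_Hom)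
      show "(a, b, llcls (LLScl (\<ominus>\<^bsub>R\<^esub> \<one>\<^bsub>R\<^esub>) t)) \<oplus>\<^bsub>?H\<^esub> x = \<zero>\<^bsub>?H\<^esub>"
        using t n llcls_eqI[OF lloc_eq.add_neg[OF t(2)]] by (simp add: I lloc_Zro lloc_Add)
    qed
  qed
  show "module R ?H"
  proof (rule moduleI[OF R.is_cring ag])
    fix r x assume r: "r \<in> carrier R" and "x \<in> carrier ?H"
    then obtain t where t: "x = (a, b, llcls t)" "lloc_typed R D S t a b" by (auto elim!: lloc_homE)
    show "r \<odot>\<^bsub>?H\<^esub> x \<in> carrier ?H" using r t lloc_homI[OF I(2)[OF r t(2)]] by (simp add: I lloc_Scl)
    { fix s assume s: "s \<in> carrier R"
      show "(r \<oplus>\<^bsub>R\<^esub> s) \<odot>\<^bsub>?H\<^esub> x = r \<odot>\<^bsub>?H\<^esub> x \<oplus>\<^bsub>?H\<^esub> s \<odot>\<^bsub>?H\<^esub> x"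
        using r s t llcls_eqI[OF lloc_eq.scl_add_left[OF r s t(2)]] by (simp add: I lloc_Scl lloc_Add)
      show "(r \<otimes>\<^bsub>R\<^esub> s) \<odot>\<^bsub>?H\<^esub> x = r \<odot>\<^bsub>?H\<^esub> (s \<odot>\<^bsub>?H\<^esub> x)"
        using r s t llcls_eqI[OF lloc_eq.scl_scl[OF r s t(2)]] by (simp add: I lloc_Scl) }
    fix y assume "y \<in> carrier ?H"
    then obtain u where u: "y = (a, b, llcls u)" "lloc_typed R D S u a b" by (auto elim!: lloc_homE)
    show "r \<odot>\<^bsub>?H\<^esub> (x \<oplus>\<^bsub>?H\<^esub> y) = r \<odot>\<^bsub>?H\<^esub> x \<oplus>\<^bsub>?H\<^esub> r \<odot>\<^bsub>?H\<^esub> y"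
      using r t u llcls_eqI[OF lloc_eq.scl_add_right[OF r t(2) u(2)]] by (simp add: I lloc_Scl lloc_Add)
  next
    fix x assume "x \<in> carrier ?H"
    then obtain t where t: "x = (a, b, llcls t)" "lloc_typed R D S t a b" by (auto elim!: lloc_homE)
    show "\<one>\<^bsub>R\<^esub> \<odot>\<^bsub>?H\<^esub> x = x" using t llcls_eqI[OF lloc_eq.scl_one[OF t(2)]] by (simp add: I lloc_Scl)
  qed
qed

theorem lloc_cat_linear: "linear_category R (lloc_cat R D S)"
proof -
  interpret L: category "lloc_cat R D S" by (rule lloc_cat_category)
  note I = lloc_typed.add lloc_typed.scl lloc_typed.comp
  note sm = lloc_Add lloc_Scl lloc_Comp
  show ?thesis
  proof (intro linear_category.intro preadditive_category.intro preadditive_category_axioms.intro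
      linear_category_axioms.intro L.category_axioms)
    show "abelian_group (Hom_module (lloc_cat R D S) a b)" "module R (Hom_module (lloc_cat R D S) a b)"
      if "a \<in> Obj (lloc_cat R D S)" "b \<in> Obj (lloc_cat R D S)" for a b
      using lloc_hom_module that by (simp_all add: lloc_Obj)
    show "cring R" by (rule R.is_cring)
  next
    fix f g h a b c
    assume "f \<in> Hom (lloc_cat R D S) a b" "g \<in> Hom (lloc_cat R D S) b c" "h \<in> Hom (lloc_cat R D S) b c"
    then obtain t u v where t: "f = (a, b, llcls t)" "lloc_typed R D S t a b"
      and u: "g = (b, c, llcls u)" "lloc_typed R D S u b c"
      and v: "h = (b, c, llcls v)" "lloc_typed R D S v b c" by (auto elim!: lloc_homE)
    show "Comp (lloc_cat R D S) (Add (lloc_cat R D S) g h) f =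
        Add (lloc_cat R D S) (Comp (lloc_cat R D S) g f) (Comp (lloc_cat R D S) h f)"
      using t u v llcls_eqI[OF lloc_eq.comp_add_left[OF t(2) u(2) v(2)]]
        I(1)[OF u(2) v(2)] I(3)[OF t(2) u(2)] I(3)[OF t(2) v(2)] by (simp add: sm)
  next
    fix f g h a b c
    assume "f \<in> Hom (lloc_cat R D S) a b" "g \<in> Hom (lloc_cat R D S) a b" "h \<in> Hom (lloc_cat R D S) b c"
    then obtain t u v where t: "f = (a, b, llcls t)" "lloc_typed R D S t a b"
      and u: "g = (a, b, llcls u)" "lloc_typed R D S u a b"
      and v: "h = (b, c, llcls v)" "lloc_typed R D S v b c" by (auto elim!: lloc_homE)
    show "Comp (lloc_cat R D S) h (Add (lloc_cat R D S) f g) =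
        Add (lloc_cat R D S) (Comp (lloc_cat R D S) h f) (Comp (lloc_cat R D S) h g)"
      using t u v llcls_eqI[OF lloc_eq.comp_add_right[OF t(2) u(2) v(2)]]
        I(1)[OF t(2) u(2)] I(3)[OF t(2) v(2)] I(3)[OF u(2) v(2)] by (simp add: sm)
  next
    fix r f g a b c
    assume r: "r \<in> carrier R" and "f \<in> Hom (lloc_cat R D S) a b" "g \<in> Hom (lloc_cat R D S) b c"
    then obtain t u where t: "f = (a, b, llcls t)" "lloc_typed R D S t a b"
      and u: "g = (b, c, llcls u)" "lloc_typed R D S u b c" by (auto elim!: lloc_homE)
    show "Comp (lloc_cat R D S) (Scl (lloc_cat R D S) r g) f = Scl (lloc_cat R D S) r (Comp (lloc_cat R D S) g f)"
      using t u r llcls_eqI[OF lloc_eq.comp_scl_left[OF r t(2) u(2)]] I(2)[OF r u(2)] I(3)[OF t(2) u(2)] by (simp add: sm)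
    show "Comp (lloc_cat R D S) g (Scl (lloc_cat R D S) r f) = Scl (lloc_cat R D S) r (Comp (lloc_cat R D S) g f)"
      using t u r llcls_eqI[OF lloc_eq.comp_scl_right[OF r t(2) u(2)]] I(2)[OF r t(2)] I(3)[OF t(2) u(2)] by (simp add: sm)
  qed
qed

theorem lloc_functor_linear: "is_linear_functor R D (lloc_cat R D S) (lloc_functor R D S)"
proof -
  let ?Q = "lloc_functor R D S" and ?L = "lloc_cat R D S"
  have A: "FArr ?Q f = (Dom D f, Cod D f, llcls (LLArr f))" if "f \<in> Arr D" for f
    using that by (simp add: lloc_functor_def)
  have H: "FArr ?Q f \<in> Hom ?L (FObj ?Q (Dom D f)) (FObj ?Q (Cod D f))" if "f \<in> Arr D" for f
    using that D.dom_obj D.cod_obj by (auto simp: lloc_functor_def lloc_Hom intro!: lloc_typed.arr)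
  have M: "FArr ?Q (Comp D g f) = Comp ?L (FArr ?Q g) (FArr ?Q f)"
    if "f \<in> Arr D" "g \<in> Arr D" "Cod D f = Dom D g" for f g
  proof -
    have f: "f \<in> Hom D (Dom D f) (Dom D g)" and g: "g \<in> Hom D (Dom D g) (Cod D g)" using that by (auto simp: Hom_def)
    show ?thesis using that HomD[OF D.comp_hom[OF f g]] lloc_Comp[OF lloc_typed_arr[OF f] lloc_typed_arr[OF g]]
      llcls_eqI[OF lloc_eq.arr_comp[OF f g]] by (simp add: A)
  qed
  have P: "FArr ?Q (Add D f g) = Add ?L (FArr ?Q f) (FArr ?Q g)"
    if "f \<in> Arr D" "g \<in> Arr D" "Dom D f = Dom D g" "Cod D f = Cod D g" for f g
  proof -
    have f: "f \<in> Hom D (Dom D f) (Cod D f)" and g: "g \<in> Hom D (Dom D f) (Cod D f)" using that by (auto simp: Hom_def)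
    show ?thesis using that HomD[OF D.add_hom[OF f g]] lloc_Add[OF lloc_typed_arr[OF f] lloc_typed_arr[OF g]]
      llcls_eqI[OF lloc_eq.arr_add[OF f g]] by (simp add: A)
  qed
  have Sc: "FArr ?Q (Scl D r f) = Scl ?L r (FArr ?Q f)" if "r \<in> carrier R" "f \<in> Arr D" for r f
  proof -
    have f: "f \<in> Hom D (Dom D f) (Cod D f)" using that by (auto simp: Hom_def)
    show ?thesis using that HomD[OF D.scl_hom[OF that(1) f]] lloc_Scl[OF lloc_typed_arr[OF f] that(1)]
      llcls_eqI[OF lloc_eq.arr_scl[OF that]] by (simp add: A)
  qed
  have O: "FObj ?Q \<in> Obj D \<rightarrow>\<^sub>E Obj ?L" by (auto simp: lloc_functor_def lloc_Obj)
  have E: "FArr ?Q \<in> Arr D \<rightarrow>\<^sub>E Arr ?L"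
    by (auto simp: lloc_functor_def lloc_cat_def intro!: lloc_typed.arr)
  have Id: "FArr ?Q (Idn D a) = Idn ?L (FObj ?Q a)" if "a \<in> Obj D" for a
    using that HomD[OF D.idn_hom[OF that]] by (simp add: A lloc_Idn) (simp add: lloc_functor_def)
  show ?thesis unfolding is_linear_functor_def is_functor_def
    using O E H Id M P Sc by blast
qed

theorem lloc_inverts:
  assumes "s \<in> S" "s \<in> Arr D"
  shows "iso_arr (lloc_cat R D S) (FArr (lloc_functor R D S) s)"
proof -
  have ts: "lloc_typed R D S (LLArr s) (Dom D s) (Cod D s)" and ti: "lloc_typed R D S (LLInv s) (Cod D s) (Dom D s)"
    using assms by (auto intro: lloc_typed.intros)
  have "(Dom D s, Cod D s, llcls (LLArr s)) \<in> Hom (lloc_cat R D S) (Dom D s) (Cod D s)"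
    "(Cod D s, Dom D s, llcls (LLInv s)) \<in> Hom (lloc_cat R D S) (Cod D s) (Dom D s)"
    using ts ti by (auto simp: lloc_Hom)
  then show ?thesis using lloc_Comp[OF ts ti] lloc_Comp[OF ti ts]  assms
      llcls_eqI[OF lloc_eq.inv_left[OF assms]] llcls_eqI[OF lloc_eq.inv_right[OF assms]]
    unfolding iso_arr_def
    by (intro conjI bexI[of _ "(Cod D s, Dom D s, llcls (LLInv s))"])
       (auto simp: lloc_functor_def HomD, auto simp: lloc_cat_def)
qed

end

fun lloc_eval :: "('p, 'n, 'k) prelincat \<Rightarrow> ('o, 'm, 'p, 'n) funct \<Rightarrow> ('o, 'm, 'k) lloc_term \<Rightarrow> 'n" where
  "lloc_eval K F (LLArr f) = FArr F f"
| "lloc_eval K F (LLInv s) = inv_arr K (FArr F s)"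
| "lloc_eval K F (LLComp u t) = lloc_eval K F u \<cdot>\<^bsub>K\<^esub> lloc_eval K F t"
| "lloc_eval K F (LLZro a b) = Zro K (FObj F a) (FObj F b)"
| "lloc_eval K F (LLAdd t u) = Add K (lloc_eval K F t) (lloc_eval K F u)"
| "lloc_eval K F (LLScl r t) = Scl K r (lloc_eval K F t)"

theorem lloc_universal:
  fixes R :: "('k, 'r) ring_scheme" and D :: "('o, 'm, 'k) prelincat" and K :: "('p, 'n, 'k) prelincat"
  assumes D: "linear_category R D" and K: "linear_category R K" and lin: "is_linear_functor R D K F"
    and iso: "\<And>s. s \<in> S \<Longrightarrow> iso_arr K (FArr F s)"
  shows "\<exists>!G. is_linear_functor R (lloc_cat R D S) K G \<and> funct_comp D G (lloc_functor R D S) = F"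
proof -
  interpret D: linear_category R D by (fact D)
  interpret K: linear_category R K by (fact K)
  interpret R: cring R by (fact D.scalars)
  have F: "is_functor D K F" using lin by (simp add: is_linear_functor_def)
  note FD = is_functorD[OF F]
  have FA: "FArr F (Add D f g) = Add K (FArr F f) (FArr F g)" if "f \<in> Hom D a b" "g \<in> Hom D a b" for f g a b
    using that lin by (auto simp: is_linear_functor_def Hom_def)
  have FS: "FArr F (Scl D r f) = Scl K r (FArr F f)" if "r \<in> carrier R" "f \<in> Arr D" for r f
    using that lin by (auto simp: is_linear_functor_def)
  have Fs: "FArr F s \<in> Hom K (FObj F (Dom D s)) (FObj F (Cod D s))" if "s \<in> Arr D" for s
    using that FD(2)[of s] by (simp add: Hom_def[of D])
  have evt: "lloc_typed R D S t a b \<Longrightarrow> lloc_eval K F t \<in> Hom K (FObj F a) (FObj F b)" for t a b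
  proof (induction rule: lloc_typed.induct)
    case (arr f) then show ?case by (simp add: Fs)
  next
    case (inv s) then show ?case using inv_arr(1)[OF iso[OF inv(1)]] Fs[OF inv(2)] by (simp add: HomD)
  next
    case (comp t a b u c) then show ?case using K.comp_hom by simp
  next
    case (zro a b) then show ?case using K.zro_hom FD(1) by simp
  next
    case (add t a b u) then show ?case using K.add_hom by simp
  next
    case (scl r t a b) then show ?case using K.scl_hom by simp
  qed
  have mod: "module R (Hom_module K (FObj F a) (FObj F b))" if "lloc_typed R D S t a b" for t a b
    using lloc_typed_obj[OF D that] FD(1) K.hom_module by blast
  have eve: "lloc_eq R D S t u \<Longrightarrow> lloc_eval K F t = lloc_eval K F u" for t u
  proof (induction rule: lloc_eq.induct)
    case (assoc t a b u c v d) then show ?case using K.comp_assoc[OF evt evt evt] by simp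
  next
    case (idn_left t a b)
    then show ?case using evt[OF idn_left] lloc_typed_obj[OF D idn_left] K.comp_idn_left by (simp add: FD(3))
  next
    case (idn_right t a b)
    then show ?case using evt[OF idn_right] lloc_typed_obj[OF D idn_right] K.comp_idn_right by (simp add: FD(3))
  next
    case (add_assoc t a b u v)
    interpret M: module R "Hom_module K (FObj F a) (FObj F b)" using mod add_assoc by blast
    show ?case using M.M.a_assoc add_assoc[THEN evt] by simp
  next
    case (add_comm t a b u)
    interpret M: module R "Hom_module K (FObj F a) (FObj F b)" using mod add_comm by blast
    show ?case using M.M.a_comm add_comm[THEN evt] by simp
  next
    case (add_zro t a b)
    interpret M: module R "Hom_module K (FObj F a) (FObj F b)" using mod add_zro by blast
    show ?case using M.M.l_zero add_zro[THEN evt] by simp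
  next
    case (add_neg t a b)
    interpret M: module R "Hom_module K (FObj F a) (FObj F b)" using mod add_neg by blast
    note t = add_neg[THEN evt]
    have "Add K (Scl K (\<ominus>\<^bsub>R\<^esub> \<one>\<^bsub>R\<^esub>) (lloc_eval K F t)) (Scl K \<one>\<^bsub>R\<^esub> (lloc_eval K F t)) = Scl K \<zero>\<^bsub>R\<^esub> (lloc_eval K F t)"
      using M.smult_l_distr[of "\<ominus>\<^bsub>R\<^esub> \<one>\<^bsub>R\<^esub>" "\<one>\<^bsub>R\<^esub>" "lloc_eval K F t"] t by (simp add: R.l_neg)
    then show ?case using M.smult_one[of "lloc_eval K F t"] M.smult_l_null[of "lloc_eval K F t"] t by simp
  next
    case (scl_add_left r s t a b)
    interpret M: module R "Hom_module K (FObj F a) (FObj F b)" using mod scl_add_left by blast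
    show ?case using M.smult_l_distr[OF scl_add_left(1,2)] scl_add_left(3)[THEN evt] by simp
  next
    case (scl_add_right r t a b u)
    interpret M: module R "Hom_module K (FObj F a) (FObj F b)" using mod scl_add_right by blast
    show ?case using M.smult_r_distr[OF scl_add_right(1)] scl_add_right(2,3)[THEN evt] by simp
  next
    case (scl_scl r s t a b)
    interpret M: module R "Hom_module K (FObj F a) (FObj F b)" using mod scl_scl by blast
    show ?case using M.smult_assoc1[OF scl_scl(1,2)] scl_scl(3)[THEN evt] by simp
  next
    case (scl_one t a b)
    interpret M: module R "Hom_module K (FObj F a) (FObj F b)" using mod scl_one by blast
    show ?case using M.smult_one scl_one[THEN evt] by simp
  next
    case (comp_add_left t a b u c v) then show ?case using K.comp_add_left[OF evt evt evt] by simp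
  next
    case (comp_add_right t a b u v c) then show ?case using K.comp_add_right[OF evt evt evt] by simp
  next
    case (comp_scl_left r t a b u c) then show ?case using K.comp_scl_left[OF _ evt evt] by simp
  next
    case (comp_scl_right r t a b u c) then show ?case using K.comp_scl_right[OF _ evt evt] by simp
  next
    case (arr_comp f a b g c) then show ?case by (simp add: FD(4))
  next
    case (arr_add f a b g) then show ?case by (simp add: FA)
  next
    case (arr_scl r f) then show ?case by (simp add: FS)
  next
    case (inv_left s)
    then show ?case using inv_arr(2)[OF iso[OF inv_left(1)]] D.dom_obj[OF inv_left(2)] Fs[OF inv_left(2)] by (simp add: HomD FD(3))
  next
    case (inv_right s)
    then show ?case using inv_arr(3)[OF iso[OF inv_right(1)]] D.cod_obj[OF inv_right(2)] Fs[OF inv_right(2)] by (simp add: HomD FD(3))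
  qed auto
  let ?L = "lloc_cat R D S" and ?Q = "lloc_functor R D S"
  let ?c = "\<lambda>t. {u. lloc_eq R D S t u}"
  define G where "G = \<lparr>FObj = FObj F, FArr = (\<lambda>(a, b, X)\<in>Arr ?L. lloc_eval K F (SOME t. t \<in> X))\<rparr>"
  have arrL: "(a, b, ?c t) \<in> Arr ?L" if "lloc_typed R D S t a b" for t a b
    using that by (auto simp: lloc_cat_def)
  have Gc: "FArr G (a, b, ?c t) = lloc_eval K F t" if "lloc_typed R D S t a b" for t a b
  proof -
    have "lloc_eq R D S t (SOME u. lloc_eq R D S t u)" using lloc_eq.refl[OF that] by (rule someI)
    then show ?thesis using arrL[OF that] eve by (simp add: G_def)
  qed
  have G1: "FObj G = FObj F" by (simp add: G_def)
  note HL = lloc_Hom[OF D] and CL = lloc_Comp[OF D] and AL = lloc_Add[OF D] and SL = lloc_Scl[OF D]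
  note Lsimps = lloc_Idn[OF D] lloc_Zro[OF D] lloc_Obj[OF D]
  have GH: "FArr G f \<in> Hom K (FObj G a) (FObj G b)" if "f \<in> Hom ?L a b" for f a b
    using that Gc evt by (auto simp: HL G1)
  have arrE: "\<exists>t. f = (Dom ?L f, Cod ?L f, ?c t) \<and> lloc_typed R D S t (Dom ?L f) (Cod ?L f)" if "f \<in> Arr ?L" for f
    using that by (auto simp: lloc_cat_def)
  have "is_linear_functor R ?L K G"
    unfolding is_linear_functor_def is_functor_def
  proof (intro conjI ballI impI)
    show "FObj G \<in> Obj ?L \<rightarrow>\<^sub>E Obj K" using F by (simp add: is_functor_def G1 Lsimps)
    show "FArr G \<in> Arr ?L \<rightarrow>\<^sub>E Arr K"
      using GH by (force simp: PiE_def Hom_def G_def extensional_def)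
    show "FArr G f \<in> Hom K (FObj G (Dom ?L f)) (FObj G (Cod ?L f))" if "f \<in> Arr ?L" for f
      using that GH by (simp add: Hom_def)
    show "FArr G (Idn ?L a) = Idn K (FObj G a)" if "a \<in> Obj ?L" for a
    proof -
      have a: "a \<in> Obj D" using that by (simp add: Lsimps)
      show ?thesis using Gc[OF lloc_typed_idn[OF D a]] FD(3)[OF a] by (simp add: G1 Lsimps)
    qed
    show "FArr G (Comp ?L g f) = FArr G g \<cdot>\<^bsub>K\<^esub> FArr G f"
      if fg: "f \<in> Arr ?L" "g \<in> Arr ?L" "Cod ?L f = Dom ?L g" for f g
    proof -
      obtain a b c t u where "f = (a, b, ?c t)" "lloc_typed R D S t a b"
        "g = (b, c, ?c u)" "lloc_typed R D S u b c"
        using arrE[OF fg(1)] arrE[OF fg(2)] fg(3) by metis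
      then show ?thesis by (simp add: CL Gc lloc_typed.comp)
    qed
    show "FArr G (Add ?L f g) = Add K (FArr G f) (FArr G g)"
      if fg: "f \<in> Arr ?L" "g \<in> Arr ?L" "Dom ?L f = Dom ?L g \<and> Cod ?L f = Cod ?L g" for f g
    proof -
      obtain a b t u where "f = (a, b, ?c t)" "lloc_typed R D S t a b"
        "g = (a, b, ?c u)" "lloc_typed R D S u a b"
        using arrE[OF fg(1)] arrE[OF fg(2)] fg(3) by metis
      then show ?thesis by (simp add: AL Gc lloc_typed.add)
    qed
    show "FArr G (Scl ?L r f) = Scl K r (FArr G f)" if rf: "r \<in> carrier R" "f \<in> Arr ?L" for r f
    proof -
      obtain a b t where "f = (a, b, ?c t)" "lloc_typed R D S t a b" using arrE[OF rf(2)] by metis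
      then show ?thesis using rf by (simp add: SL Gc lloc_typed.scl)
    qed
  qed
  moreover have "funct_comp D G ?Q = F"
  proof -
    have "(\<lambda>a\<in>Obj D. FObj F a) = FObj F" "(\<lambda>a\<in>Arr D. FArr F a) = FArr F"
      using F by (auto simp: is_functor_def PiE_def extensional_restrict)
    moreover have "(\<lambda>f\<in>Arr D. FArr G (FArr ?Q f)) = (\<lambda>f\<in>Arr D. FArr F f)"
      using Gc[OF lloc_typed.arr] by (auto simp: lloc_functor_def)
    ultimately show ?thesis by (simp add: funct_comp_def G1 lloc_functor_def cong: restrict_cong)
  qed
  moreover have "G' = G" if G': "is_linear_functor R ?L K G'" and e: "funct_comp D G' ?Q = F" for G'
  proof -
    have G'F: "is_functor ?L K G'" using G' by (simp add: is_linear_functor_def)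
    note GD = is_functorD[OF G'F]
    have GA: "FArr G' (Add ?L f g) = Add K (FArr G' f) (FArr G' g)" if "f \<in> Hom ?L a b" "g \<in> Hom ?L a b" for f g a b
      using that G' by (auto simp: is_linear_functor_def Hom_def)
    have GS: "FArr G' (Scl ?L r f) = Scl K r (FArr G' f)" if "r \<in> carrier R" "f \<in> Hom ?L a b" for r f a b
      using that G' by (auto simp: is_linear_functor_def Hom_def)
    have O: "FObj G' a = FObj F a" if "a \<in> Obj D" for a
      using that e by (auto simp: funct_comp_def lloc_functor_def)
    have A: "FArr G' (Dom D f, Cod D f, ?c (LLArr f)) = FArr F f" if "f \<in> Arr D" for f
      using that e by (auto simp: funct_comp_def lloc_functor_def)
    have h: "(a, b, ?c t) \<in> Hom ?L a b" if "lloc_typed R D S t a b" for t a b using that by (auto simp: HL)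
    have T: "lloc_typed R D S t a b \<Longrightarrow> FArr G' (a, b, ?c t) = lloc_eval K F t" for t a b
    proof (induction rule: lloc_typed.induct)
      case (arr f) then show ?case by (simp add: A)
    next
      case (inv s)
      let ?a = "Dom D s" and ?b = "Cod D s"
      let ?x = "(?a, ?b, ?c (LLArr s))" and ?y = "(?b, ?a, ?c (LLInv s))"
      have ob: "?a \<in> Obj D" "?b \<in> Obj D" using D.dom_obj D.cod_obj inv by auto
      have ts: "lloc_typed R D S (LLArr s) ?a ?b" and ti: "lloc_typed R D S (LLInv s) ?b ?a"
        using inv by (auto intro: lloc_typed.intros)
      have "Comp ?L ?x ?y = Idn ?L ?b"
        using CL[OF ti ts] llcls_eqI[OF D lloc_eq.inv_right[OF inv]] by (simp add: Lsimps)
      then have 1: "FArr G' ?x \<cdot>\<^bsub>K\<^esub> FArr G' ?y = Idn K (FObj G' ?b)"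
        using GD(4)[OF h[OF ti] h[OF ts]] GD(3)[of ?b] ob by (simp add: Lsimps)
      have "inv_arr K (FArr F s) = FArr G' ?y"
      proof (rule inv_arr_unique[OF K.category_axioms Fs[OF inv(2)]])
        show "inv_arr K (FArr F s) \<in> Hom K (FObj F ?b) (FObj F ?a)"
          "inv_arr K (FArr F s) \<cdot>\<^bsub>K\<^esub> FArr F s = Idn K (FObj F ?a)"
          using inv_arr[OF iso[OF inv(1)]] Fs[OF inv(2)] by (simp_all add: HomD)
        show "FArr G' ?y \<in> Hom K (FObj F ?b) (FObj F ?a)" using GD(2)[OF h[OF ti]] O ob by simp
        show "FArr F s \<cdot>\<^bsub>K\<^esub> FArr G' ?y = Idn K (FObj F ?b)" using 1 A[OF inv(2)] O ob by simp
      qed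
      then show ?case by simp
    next
      case (comp t a b u c)
      then show ?case using GD(4)[OF h h] CL[OF comp(1,2)] by force
    next
      case (zro a b)
      interpret M: module R "Hom_module K (FObj F a) (FObj F b)"
        using zro FD(1) K.hom_module by blast
      interpret L: module R "Hom_module ?L a b" using lloc_hom_module(2)[OF D zro] .
      have z: "Zro ?L a b \<in> Hom ?L a b" using L.M.zero_closed by simp
      have "Scl ?L \<zero>\<^bsub>R\<^esub> (Zro ?L a b) = Zro ?L a b" using L.smult_l_null[of "Zro ?L a b"] z by simp
      then have "FArr G' (Zro ?L a b) = Scl K \<zero>\<^bsub>R\<^esub> (FArr G' (Zro ?L a b))" using GS[OF R.zero_closed z] by simp
      also have "\<dots> = Zro K (FObj F a) (FObj F b)"
        using M.smult_l_null[of "FArr G' (Zro ?L a b)"] GD(2)[OF z] O zro by simp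
      finally show ?case by (simp add: Lsimps)
    next
      case (add t a b u) then show ?case using GA[OF h h] AL[OF add(1,2)] by force
    next
      case (scl r t a b) then show ?case using GS[OF _ h] SL[OF scl(2,1)] by force
    qed
    have "FObj G' = FObj G"
    proof (rule PiE_ext)
      show "FObj G' \<in> Obj D \<rightarrow>\<^sub>E Obj K" using G'F by (simp add: is_functor_def Lsimps)
      show "FObj G \<in> Obj D \<rightarrow>\<^sub>E Obj K" using F by (simp add: is_functor_def G1)
    qed (simp add: O G1)
    moreover have "FArr G' = FArr G"
    proof (rule extensionalityI[of _ "Arr ?L"])
      show "FArr G' \<in> extensional (Arr ?L)" using G'F by (simp add: is_functor_def PiE_def)
      show "FArr G \<in> extensional (Arr ?L)" by (simp add: G_def)
      show "FArr G' f = FArr G f" if "f \<in> Arr ?L" for f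
        using arrE[OF that] T Gc by metis
    qed
    ultimately show "G' = G" by simp
  qed
  ultimately show ?thesis by blast
qed

section \<open>Functor categories\<close>

definition nat_trans ::
  "('o, 'm, 'z) precat_scheme \<Rightarrow> ('p, 'n, 'k) prelincat \<Rightarrow> ('o, 'm, 'p, 'n) funct \<Rightarrow>
   ('o, 'm, 'p, 'n) funct \<Rightarrow> ('o \<Rightarrow> 'n) \<Rightarrow> bool" where
  "nat_trans C K F G \<eta> \<longleftrightarrow> \<eta> \<in> extensional (Obj C) \<and>
     (\<forall>a\<in>Obj C. \<eta> a \<in> Hom K (FObj F a) (FObj G a)) \<and>
     (\<forall>f\<in>Arr C. \<eta> (Cod C f) \<cdot>\<^bsub>K\<^esub> FArr F f = FArr G f \<cdot>\<^bsub>K\<^esub> \<eta> (Dom C f))"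

type_synonym ('o, 'm, 'p, 'n) nat_arr =
  "('o, 'm, 'p, 'n) funct \<times> ('o, 'm, 'p, 'n) funct \<times> ('o \<Rightarrow> 'n)"

text \<open>\<open>functor_cat C K \<F>\<close> is the full subcategory on \<open>\<F>\<close> of the category of functors \<open>C \<rightarrow> K\<close>.\<close>

definition functor_cat ::
  "('o, 'm, 'z) precat_scheme \<Rightarrow> ('p, 'n, 'k) prelincat \<Rightarrow> ('o, 'm, 'p, 'n) funct set \<Rightarrow>
   (('o, 'm, 'p, 'n) funct, ('o, 'm, 'p, 'n) nat_arr, 'k) prelincat" where
  "functor_cat C K \<F> = \<lparr>Obj = \<F>,
     Arr = {(F, G, \<eta>). F \<in> \<F> \<and> G \<in> \<F> \<and> nat_trans C K F G \<eta>},
     Dom = (\<lambda>(F, G, \<eta>). F), Cod = (\<lambda>(F, G, \<eta>). G),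
     Idn = (\<lambda>F. (F, F, \<lambda>a\<in>Obj C. Idn K (FObj F a))),
     Comp = (\<lambda>(G', H, \<theta>) (F, G, \<eta>). (F, H, \<lambda>a\<in>Obj C. \<theta> a \<cdot>\<^bsub>K\<^esub> \<eta> a)),
     Zro = (\<lambda>F G. (F, G, \<lambda>a\<in>Obj C. Zro K (FObj F a) (FObj G a))),
     Add = (\<lambda>(F, G, \<eta>) (F', G', \<theta>). (F, G, \<lambda>a\<in>Obj C. Add K (\<eta> a) (\<theta> a))),
     Scl = (\<lambda>r (F, G, \<eta>). (F, G, \<lambda>a\<in>Obj C. Scl K r (\<eta> a)))\<rparr>"

text \<open>Precomposition with \<open>Q : C \<rightarrow> D\<close>, on a category \<open>\<R>\<close> of functors out of \<open>D\<close>.\<close>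

definition precomposition ::
  "(('p, 'n, 'q, 'l) funct, ('p, 'n, 'q, 'l) nat_arr, 'k) prelincat \<Rightarrow> ('o, 'm, 'z) precat_scheme \<Rightarrow>
   ('o, 'm, 'p, 'n) funct \<Rightarrow>
   (('p, 'n, 'q, 'l) funct, ('p, 'n, 'q, 'l) nat_arr, ('o, 'm, 'q, 'l) funct, ('o, 'm, 'q, 'l) nat_arr) funct" where
  "precomposition \<R> C Q = \<lparr>FObj = (\<lambda>F\<in>Obj \<R>. funct_comp C F Q),
     FArr = (\<lambda>\<alpha>\<in>Arr \<R>. case \<alpha> of (F, G, \<eta>) \<Rightarrow>
       (funct_comp C F Q, funct_comp C G Q, \<lambda>a\<in>Obj C. \<eta> (FObj Q a)))\<rparr>"


section \<open>Paths and triples\<close>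

text \<open>Paths are arbitrary functions on the unit interval, extended by \<open>undefined\<close>.\<close>

type_synonym 'x path = "real \<Rightarrow> 'x"

record 'x path_triple =
  Pts :: "'x set"
  Paths :: "'x path set"
  Peq :: "'x path rel"

definition const_path :: "'x \<Rightarrow> 'x path" where
  "const_path x = (\<lambda>t\<in>{0..1}. x)"

definition conc :: "'x path \<Rightarrow> 'x path \<Rightarrow> 'x path"  (infixl \<open>\<frown>\<close> 75) where
  "\<gamma> \<frown> \<gamma>' = (\<lambda>t\<in>{0..1}. if t \<le> 1/2 then \<gamma> (2 * t) else \<gamma>' (2 * t - 1))"

definition im :: "'x path \<Rightarrow> 'x set" where
  "im \<gamma> = \<gamma> ` {0..1}"

definition reparam :: "(real \<Rightarrow> real) \<Rightarrow> bool" where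
  "reparam \<phi> \<longleftrightarrow> \<phi> ` {0..1} \<subseteq> {0..1} \<and> mono_on {0..1} \<phi> \<and>
     (\<forall>J\<subseteq>{0..1}. is_interval J \<longrightarrow> is_interval (\<phi> ` J))"

definition is_triple :: "'x path_triple \<Rightarrow> bool" where
  "is_triple T \<longleftrightarrow> Pts T \<noteq> {} \<and> Paths T \<subseteq> {0..1} \<rightarrow>\<^sub>E Pts T \<and> equiv (Paths T) (Peq T) \<and>
     (\<forall>(\<gamma>, \<gamma>')\<in>Peq T. \<gamma> 0 = \<gamma>' 0 \<and> \<gamma> 1 = \<gamma>' 1) \<and>
     (\<forall>\<gamma>\<in>Paths T. \<forall>\<gamma>'\<in>Paths T. \<gamma> 1 = \<gamma>' 0 \<longrightarrow> \<gamma> \<frown> \<gamma>' \<in> Paths T) \<and>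
     (\<forall>\<gamma>\<in>Paths T. \<forall>\<phi>. reparam \<phi> \<longrightarrow> restrict (\<gamma> \<circ> \<phi>) {0..1} \<in> Paths T) \<and>
     (\<forall>x\<in>Pts T. const_path x \<in> Paths T) \<and>
     (\<forall>\<gamma>. \<forall>x\<in>Pts T. (\<gamma>, const_path x) \<in> Peq T \<longrightarrow> (\<exists>y\<in>Pts T. \<gamma> = const_path y)) \<and>
     (\<forall>\<gamma>\<in>Paths T. \<forall>\<phi>. reparam \<phi> \<and> \<phi> 0 = 0 \<and> \<phi> 1 = 1 \<longrightarrow> (\<gamma>, restrict (\<gamma> \<circ> \<phi>) {0..1}) \<in> Peq T) \<and>
     (\<forall>\<gamma>\<in>Paths T. \<forall>\<gamma>'\<in>Paths T. \<forall>\<rho>\<in>Paths T. \<forall>\<rho>'\<in>Paths T.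
        \<rho> 1 = \<gamma> 0 \<and> \<gamma> 1 = \<rho>' 0 \<and> \<rho> 1 = \<gamma>' 0 \<and> \<gamma>' 1 = \<rho>' 0 \<and>
        \<rho> \<frown> \<gamma> \<frown> \<rho>' \<in> Paths T \<and> \<rho> \<frown> \<gamma>' \<frown> \<rho>' \<in> Paths T \<longrightarrow>
        ((\<gamma>, \<gamma>') \<in> Peq T \<longleftrightarrow> (\<rho> \<frown> \<gamma> \<frown> \<rho>', \<rho> \<frown> \<gamma>' \<frown> \<rho>') \<in> Peq T))"

abbreviation path_class :: "'x path_triple \<Rightarrow> 'x path \<Rightarrow> 'x path set" where
  "path_class T \<gamma> \<equiv> Peq T `` {\<gamma>}"


section \<open>Screens\<close>

definition in_pixel :: "'x set set \<Rightarrow> 'x set \<Rightarrow> bool" where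
  "in_pixel P A \<longleftrightarrow> (\<exists>X\<in>P. A \<subseteq> X)"

definition interval_partition :: "real set list \<Rightarrow> bool" where
  "interval_partition Is \<longleftrightarrow> \<Union>(set Is) = {0..1} \<and> (\<forall>J\<in>set Is. is_interval J \<and> J \<noteq> {}) \<and>
     (\<forall>i j. i < j \<and> j < length Is \<longrightarrow> (\<forall>s\<in>Is ! i. \<forall>t\<in>Is ! j. s < t))"

definition admits :: "'x set set \<Rightarrow> 'x path \<Rightarrow> real set list \<Rightarrow> 'x set list \<Rightarrow> bool" where
  "admits P \<gamma> Is Xs \<longleftrightarrow> interval_partition Is \<and> length Xs = length Is \<and> set Xs \<subseteq> P \<and>
     (\<forall>i<length Is. \<gamma> ` (Is ! i) \<subseteq> Xs ! i) \<and>
     (\<forall>i<length Xs. \<forall>j<length Xs. i \<noteq> j \<and> Xs ! i = Xs ! j \<longrightarrow> \<bar>int i - int j\<bar> > 1)"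

text \<open>The walk \<open>\<gamma>\<^sub>0 \<cdot> \<gamma>\<^sub>1\<^sup>-\<^sup>1 \<cdots> \<gamma>\<^sub>2\<^sub>n\<^sub>-\<^sub>1\<^sup>-\<^sup>1 \<cdot> \<gamma>\<^sub>2\<^sub>n\<close> from \<open>x\<close> to \<open>y\<close> inside \<open>X\<close>.\<close>

definition walk_in :: "'x path_triple \<Rightarrow> 'x set \<Rightarrow> 'x \<Rightarrow> 'x \<Rightarrow> bool" where
  "walk_in T X x y \<longleftrightarrow> (\<exists>n (\<gamma> :: nat \<Rightarrow> 'x path). (\<forall>i\<le>2 * n. \<gamma> i \<in> Paths T \<and> im (\<gamma> i) \<subseteq> X) \<and>
     \<gamma> 0 0 = x \<and> \<gamma> (2 * n) 1 = y \<and>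
     (\<forall>i<n. \<gamma> (2 * i) 1 = \<gamma> (2 * i + 1) 1 \<and> \<gamma> (2 * i + 1) 0 = \<gamma> (2 * i + 2) 0))"

definition is_screen :: "'x path_triple \<Rightarrow> 'x set set \<Rightarrow> bool" where
  "is_screen T P \<longleftrightarrow> partition_on (Pts T) P \<and>
     (\<forall>\<gamma>\<in>Paths T. \<forall>\<gamma>'\<in>Paths T. \<forall>X\<in>P. \<gamma> 0 = \<gamma>' 0 \<and> \<gamma> 1 = \<gamma>' 1 \<and> im \<gamma> \<subseteq> X \<longrightarrow>
        ((\<gamma>, \<gamma>') \<in> Peq T \<longleftrightarrow> im \<gamma>' \<subseteq> X)) \<and>
     (\<forall>X\<in>P. \<forall>x\<in>X. \<forall>y\<in>X. walk_in T X x y) \<and>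
     (\<forall>\<rho>\<in>Paths T. \<forall>\<gamma>\<in>Paths T. \<rho> 0 = \<gamma> 0 \<and> in_pixel P (im \<rho>) \<longrightarrow>
        (\<exists>\<rho>'\<in>Paths T. \<exists>\<gamma>'\<in>Paths T. in_pixel P (im \<rho>') \<and> \<gamma> 1 = \<rho>' 0 \<and> \<rho> 1 = \<gamma>' 0 \<and>
           (\<gamma> \<frown> \<rho>', \<rho> \<frown> \<gamma>') \<in> Peq T)) \<and>
     (\<forall>\<rho>'\<in>Paths T. \<forall>\<gamma>'\<in>Paths T. \<rho>' 1 = \<gamma>' 1 \<and> in_pixel P (im \<rho>') \<longrightarrow>
        (\<exists>\<rho>\<in>Paths T. \<exists>\<gamma>\<in>Paths T. in_pixel P (im \<rho>) \<and> \<gamma> 1 = \<rho>' 0 \<and> \<rho> 1 = \<gamma>' 0 \<and>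
           (\<gamma> \<frown> \<rho>', \<rho> \<frown> \<gamma>') \<in> Peq T)) \<and>
     (\<forall>\<gamma>\<in>Paths T. \<exists>Is Xs. admits P \<gamma> Is Xs) \<and>
     (\<forall>\<gamma>\<in>Paths T. \<forall>\<gamma>'\<in>Paths T. \<gamma> 0 = \<gamma>' 0 \<and> \<gamma> 1 = \<gamma>' 1 \<and>
        (\<exists>Is Xs. admits P \<gamma> Is Xs \<and> admits P \<gamma>' Is Xs) \<longrightarrow> (\<gamma>, \<gamma>') \<in> Peq T)"

definition screens :: "'x path_triple \<Rightarrow> 'x set set set" where
  "screens T = {P. is_screen T P}"


section \<open>Path categories\<close>

definition path_cat :: "'x path_triple \<Rightarrow> ('x, 'x path set) precat" where
  "path_cat T = \<lparr>Obj = Pts T, Arr = path_class T ` Paths T,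
     Dom = (\<lambda>c. (SOME \<gamma>. \<gamma> \<in> c) 0), Cod = (\<lambda>c. (SOME \<gamma>. \<gamma> \<in> c) 1),
     Idn = (\<lambda>x. path_class T (const_path x)),
     Comp = (\<lambda>d c. \<Union>\<gamma>\<in>c. \<Union>\<gamma>'\<in>d. path_class T (\<gamma> \<frown> \<gamma>'))\<rparr>"

text \<open>
  In the linear path category, \<open>Some x\<close> is the point \<open>x\<close> and \<open>None\<close> the adjoined zero object. A morphism
  is stored with its domain, its codomain and its finitely supported family of coefficients, which
  vanishes unless both ends are points.
\<close>

type_synonym ('x, 'k) lin_path = "'x option \<times> 'x option \<times> ('x path set \<Rightarrow> 'k)"

definition lin_path_cat ::
  "('k, 'r) ring_scheme \<Rightarrow> 'x path_triple \<Rightarrow> ('x option, ('x, 'k) lin_path, 'k) prelincat" where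
  "lin_path_cat R T = \<lparr>Obj = insert None (Some ` Pts T),
     Arr = {(a, b, f). a \<in> insert None (Some ` Pts T) \<and> b \<in> insert None (Some ` Pts T) \<and>
       range f \<subseteq> carrier R \<and> finite {c. f c \<noteq> \<zero>\<^bsub>R\<^esub>} \<and>
       (\<forall>c. f c \<noteq> \<zero>\<^bsub>R\<^esub> \<longrightarrow> (\<exists>x y. a = Some x \<and> b = Some y \<and> c \<in> Hom (path_cat T) x y))},
     Dom = (\<lambda>(a, b, f). a), Cod = (\<lambda>(a, b, f). b),
     Idn = (\<lambda>a. (a, a, \<lambda>c. if \<exists>x. a = Some x \<and> c = Idn (path_cat T) x then \<one>\<^bsub>R\<^esub> else \<zero>\<^bsub>R\<^esub>)),
     Comp = (\<lambda>(b', d, g) (a, b, f). (a, d, \<lambda>c. finsum R (\<lambda>(v, u). g v \<otimes>\<^bsub>R\<^esub> f u)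
       {(v, u). g v \<noteq> \<zero>\<^bsub>R\<^esub> \<and> f u \<noteq> \<zero>\<^bsub>R\<^esub> \<and> v \<cdot>\<^bsub>path_cat T\<^esub> u = c})),
     Zro = (\<lambda>a b. (a, b, \<lambda>c. \<zero>\<^bsub>R\<^esub>)),
     Add = (\<lambda>(a, b, f) (a', b', g). (a, b, \<lambda>c. f c \<oplus>\<^bsub>R\<^esub> g c)),
     Scl = (\<lambda>r (a, b, f). (a, b, \<lambda>c. r \<otimes>\<^bsub>R\<^esub> f c))\<rparr>"

text \<open>The list \<open>[(\<lambda>\<^sub>1, \<gamma>\<^sub>1), \<dots>]\<close> stands for the morphism \<open>\<Sum>\<^sub>i \<lambda>\<^sub>i [\<gamma>\<^sub>i]\<close> from \<open>x\<close> to \<open>y\<close>.\<close>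

definition valid_terms ::
  "('k, 'r) ring_scheme \<Rightarrow> 'x path_triple \<Rightarrow> 'x \<Rightarrow> 'x \<Rightarrow> ('k \<times> 'x path) list \<Rightarrow> bool" where
  "valid_terms R T x y ts \<longleftrightarrow> x \<in> Pts T \<and> y \<in> Pts T \<and>
     (\<forall>(l, \<gamma>)\<in>set ts. l \<in> carrier R \<and> \<gamma> \<in> Paths T \<and> \<gamma> 0 = x \<and> \<gamma> 1 = y)"

definition path_sum ::
  "('k, 'r) ring_scheme \<Rightarrow> 'x path_triple \<Rightarrow> 'x \<Rightarrow> 'x \<Rightarrow> ('k \<times> 'x path) list \<Rightarrow> ('x, 'k) lin_path" where
  "path_sum R T x y ts = (Some x, Some y, \<lambda>c. \<Oplus>\<^bsub>R\<^esub>i\<in>{i. i < length ts \<and> path_class T (snd (ts ! i)) = c}. fst (ts ! i))"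

definition lin_class :: "('k, 'r) ring_scheme \<Rightarrow> 'x path_triple \<Rightarrow> 'x path \<Rightarrow> ('x, 'k) lin_path" where
  "lin_class R T \<gamma> = path_sum R T (\<gamma> 0) (\<gamma> 1) [(\<one>\<^bsub>R\<^esub>, \<gamma>)]"

definition non_zero_divisor :: "('k, 'r) ring_scheme \<Rightarrow> 'k \<Rightarrow> bool" where
  "non_zero_divisor R l \<longleftrightarrow> l \<in> carrier R \<and> (\<forall>m\<in>carrier R. l \<otimes>\<^bsub>R\<^esub> m = \<zero>\<^bsub>R\<^esub> \<longrightarrow> m = \<zero>\<^bsub>R\<^esub>)"

definition path_based :: "('k, 'r) ring_scheme \<Rightarrow> 'x path_triple \<Rightarrow> ('x, 'k) lin_path set \<Rightarrow> bool" where
  "path_based R T I \<longleftrightarrow> (\<exists>S. I = ideal_gen R (lin_path_cat R T) S \<and>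
     S \<subseteq> {path_sum R T x y ts | x y ts. valid_terms R T x y ts \<and> (\<forall>(l, \<gamma>)\<in>set ts. non_zero_divisor R l)})"


section \<open>Pixelations\<close>

definition sigma :: "'x path_triple \<Rightarrow> 'x set set \<Rightarrow> 'x path set set" where
  "sigma T P = {path_class T \<rho> | \<rho>. \<rho> \<in> Paths T \<and> in_pixel P (im \<rho>)}"

abbreviation pixelation where
  "pixelation T P \<equiv> loc_cat (path_cat T) (sigma T P)"

abbreviation pixelation_functor where
  "pixelation_functor T P \<equiv> loc_functor (path_cat T) (sigma T P)"

definition pix_equiv :: "'x path_triple \<Rightarrow> 'x set set \<Rightarrow> 'x path \<Rightarrow> 'x path \<Rightarrow> bool" where
  "pix_equiv T P \<gamma> \<gamma>' \<longleftrightarrow> \<gamma> \<in> Paths T \<and> \<gamma>' \<in> Paths T \<and>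
     (\<exists>\<rho>\<^sub>1\<in>Paths T. \<exists>\<rho>\<^sub>2\<in>Paths T. \<exists>\<rho>\<^sub>3\<in>Paths T. \<exists>\<rho>\<^sub>4\<in>Paths T.
        in_pixel P (im \<rho>\<^sub>1 \<union> im \<rho>\<^sub>2) \<and> in_pixel P (im \<rho>\<^sub>3 \<union> im \<rho>\<^sub>4) \<and>
        \<rho>\<^sub>1 1 = \<gamma> 0 \<and> \<gamma> 1 = \<rho>\<^sub>3 0 \<and> \<rho>\<^sub>2 1 = \<gamma>' 0 \<and> \<gamma>' 1 = \<rho>\<^sub>4 0 \<and>
        (\<rho>\<^sub>1 \<frown> \<gamma> \<frown> \<rho>\<^sub>3, \<rho>\<^sub>2 \<frown> \<gamma>' \<frown> \<rho>\<^sub>4) \<in> Peq T)"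

text \<open>The expressions of the two morphisms as sums may be chosen freely, so the permutation of the
  summands is absorbed into this choice.\<close>

definition pix_equiv_lin ::
  "('k, 'r) ring_scheme \<Rightarrow> 'x path_triple \<Rightarrow> 'x set set \<Rightarrow> ('x, 'k) lin_path \<Rightarrow> ('x, 'k) lin_path \<Rightarrow> bool" where
  "pix_equiv_lin R T P f g \<longleftrightarrow> (\<exists>x y ts x' y' us.
     valid_terms R T x y ts \<and> f = path_sum R T x y ts \<and>
     valid_terms R T x' y' us \<and> g = path_sum R T x' y' us \<and>
     list_all2 (\<lambda>(l, \<gamma>) (l', \<gamma>'). l = l' \<and> pix_equiv T P \<gamma> \<gamma>') ts us)"

definition ideal_closure ::
  "('k, 'r) ring_scheme \<Rightarrow> 'x path_triple \<Rightarrow> ('x, 'k) lin_path set \<Rightarrow> 'x set set \<Rightarrow> ('x, 'k) lin_path set" where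
  "ideal_closure R T I P = ideal_gen R (lin_path_cat R T) {f. \<exists>g\<in>I. pix_equiv_lin R T P f g}"

abbreviation A_cat where
  "A_cat R T I \<equiv> quot_cat (lin_path_cat R T) I"

abbreviation A_bar where
  "A_bar R T I P \<equiv> quot_cat (lin_path_cat R T) (ideal_closure R T I P)"

text \<open>The class of \<open>[\<gamma>]\<close> in the quotient of the linear path category by \<open>J\<close>.\<close>

definition quot_class ::
  "('k, 'r) ring_scheme \<Rightarrow> 'x path_triple \<Rightarrow> ('x, 'k) lin_path set \<Rightarrow> 'x path \<Rightarrow> ('x, 'k) lin_path set" where
  "quot_class R T J \<gamma> = coset (lin_path_cat R T) J (lin_class R T \<gamma>)"

definition vanishes ::
  "('k, 'r) ring_scheme \<Rightarrow> 'x path_triple \<Rightarrow> ('x, 'k) lin_path set \<Rightarrow> 'x path \<Rightarrow> bool" where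
  "vanishes R T J \<gamma> \<longleftrightarrow> quot_class R T J \<gamma> = Zro (quot_cat (lin_path_cat R T) J) (Some (\<gamma> 0)) (Some (\<gamma> 1))"

definition pre_dead ::
  "('k, 'r) ring_scheme \<Rightarrow> 'x path_triple \<Rightarrow> ('x, 'k) lin_path set \<Rightarrow> 'x set \<Rightarrow> bool" where
  "pre_dead R T I X \<longleftrightarrow> (\<exists>\<rho>\<in>Paths T. im \<rho> \<subseteq> X \<and> vanishes R T I \<rho>)"

definition sigma_lin ::
  "('k, 'r) ring_scheme \<Rightarrow> 'x path_triple \<Rightarrow> ('x, 'k) lin_path set \<Rightarrow> 'x set set \<Rightarrow> ('x, 'k) lin_path set set" where
  "sigma_lin R T I P =
     {quot_class R T (ideal_closure R T I P) \<rho> | \<rho>. \<rho> \<in> Paths T \<and> in_pixel P (im \<rho>) \<and>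
        \<not> vanishes R T (ideal_closure R T I P) \<rho>} \<union>
     {Zro (A_bar R T I P) (Some x) (Some y) | x y. \<exists>X\<in>P. pre_dead R T I X \<and> x \<in> X \<and> y \<in> X}"

abbreviation pixelation_lin where
  "pixelation_lin R T I P \<equiv> lloc_cat R (A_bar R T I P) (sigma_lin R T I P)"

definition pixelation_lin_functor where
  "pixelation_lin_functor R T I P = funct_comp (A_cat R T I)
     (lloc_functor R (A_bar R T I P) (sigma_lin R T I P))
     (quot_map (lin_path_cat R T) I (ideal_closure R T I P))"


section \<open>Categories of representations\<close>

definition Rep where
  "Rep C K = functor_cat C K {M. is_functor C K M}"

definition rep_pwf where
  "rep_pwf C K = functor_cat C K {M. is_functor C K M \<and> (\<forall>x\<in>Obj C. finite_length K (FObj M x))}"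

definition Rep_lin where
  "Rep_lin R D K = functor_cat D K {M. is_linear_functor R D K M}"

definition rep_lin_pwf where
  "rep_lin_pwf R D K = functor_cat D K
     {M. is_linear_functor R D K M \<and> (\<forall>x\<in>Obj D. finite_length K (FObj M x))}"

definition pixelates where
  "pixelates T K P M \<longleftrightarrow> (\<forall>\<sigma>\<in>sigma T P. iso_arr K (FArr M \<sigma>))"

definition pixelates_lin where
  "pixelates_lin R T I K P M \<longleftrightarrow>
     (\<forall>\<rho>\<in>Paths T. in_pixel P (im \<rho>) \<and> \<not> vanishes R T (ideal_closure R T I P) \<rho> \<longrightarrow>
        iso_arr K (FArr M (quot_class R T I \<rho>))) \<and>
     (\<forall>X\<in>P. pre_dead R T I X \<longrightarrow>
        (\<forall>x\<in>X. \<forall>y\<in>X. iso_arr K (FArr M (Zro (A_cat R T I) (Some x) (Some y)))))"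

definition Rep_scr where
  "Rep_scr T K L = functor_cat (path_cat T) K
     {M. M \<in> Obj (Rep (path_cat T) K) \<and> (\<exists>P\<in>L. pixelates T K P M)}"

definition rep_scr where
  "rep_scr T K L = functor_cat (path_cat T) K
     {M. M \<in> Obj (rep_pwf (path_cat T) K) \<and> (\<exists>P\<in>L. pixelates T K P M)}"

definition Rep_lin_scr where
  "Rep_lin_scr R T I K L = functor_cat (A_cat R T I) K
     {M. M \<in> Obj (Rep_lin R (A_cat R T I) K) \<and> (\<exists>P\<in>L. pixelates_lin R T I K P M)}"

definition rep_lin_scr where
  "rep_lin_scr R T I K L = functor_cat (A_cat R T I) K
     {M. M \<in> Obj (rep_lin_pwf R (A_cat R T I) K) \<and> (\<exists>P\<in>L. pixelates_lin R T I K P M)}"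


end

theory Submission
  imports Defs
begin

text \<open>
  In an abelian category \<open>Ext(A, -)\<close> preserves biproducts, so it takes values in groups whose law, the Baer
  sum, is induced by the addition of arrows. Hence an additive functor that preserves short exact sequences
  induces homomorphisms of extension groups compatible with pullbacks and pushouts, and the preimage of an
  additive subfunctor of \<open>Ext\<close> is again one. Representations of a pixelation form an abelian category with
  pointwise kernels and cokernels. Precomposition with the localization functor sends them to representations
  pixelated by \<open>P\<close>, and it is exact because exactness is pointwise on both sides. That the target category is
  abelian is part of the definition of an exact structure on it.
\<close>

section \<open>Arrows in preadditive categories\<close>

text \<open>Extensions are pairs of arrows, and pullback, pushout and Baer sum of classes are
  defined by quantifying over all choices. The obstacle is to compute with them without fixing
  choices. The device is the relation \<open>ext_mor\<close>: existence of a morphism of extensions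
  with prescribed outer arrows. It factors through pullbacks and pushouts, so each operation on
  classes becomes a statement about this relation, and a functor preserving short exact sequences
  preserves the relation. Most facts on cokernels, epics and pushouts are those on kernels, monics
  and pullbacks in the opposite category. The rest of the work is on the source side. Finite-length
  functors form an abelian category because finite length passes to subobjects, quotients and direct
  sums; linear functors do because linearity can be tested after a monic or before an epic. The
  linear pixelation localizes a quotient of the linear path category, whose linearity rests on
  associativity of concatenation up to reparametrization and on a convolution product of finitely
  supported coefficients.\<close>

lemma (in category) comp_simps [simp]:
  assumes "f \<in> Arr C" "g \<in> Arr C" "Cod C f = Dom C g"
  shows "g \<cdot> f \<in> Arr C" "Dom C (g \<cdot> f) = Dom C f" "Cod C (g \<cdot> f) = Cod C g"
  using comp_hom[of f "Dom C f" "Dom C g" g "Cod C g"] assms by (auto simp: Hom_def)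

lemma (in category) comp_assoc_right [simp]:
  assumes "f \<in> Arr C" "g \<in> Arr C" "h \<in> Arr C" "Cod C f = Dom C g" "Cod C g = Dom C h"
  shows "(h \<cdot> g) \<cdot> f = h \<cdot> (g \<cdot> f)"
  using comp_assoc[of f "Dom C f" "Dom C g" g "Dom C h" h "Cod C h"] assms by (auto simp: Hom_def)

lemma (in category) idn_simps [simp]:
  assumes "a \<in> Obj C"
  shows "Idn C a \<in> Arr C" "Dom C (Idn C a) = a" "Cod C (Idn C a) = a"
  using idn_hom[OF assms] by (auto simp: Hom_def)

lemma (in category) idn_comp [simp]:
  "f \<in> Arr C \<Longrightarrow> Cod C f = b \<Longrightarrow> Idn C b \<cdot> f = f"
  "f \<in> Arr C \<Longrightarrow> Dom C f = a \<Longrightarrow> f \<cdot> Idn C a = f"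
  using comp_idn_left[of f "Dom C f" b] comp_idn_right[of f a "Cod C f"] by (auto simp: Hom_def)

text \<open>Composites are kept in right-nested form, which hides a known equation for
  \<open>g \<cdot> f\<close> as soon as a further arrow stands on the right. This is the equation in
  the form that still applies there. Typing is stated by \<open>Dom\<close> and \<open>Cod\<close>
  equations instead of \<open>Hom\<close>, so that the simplifier can discharge it.\<close>

lemma (in category) comp_reassoc:
  assumes "g \<cdot> f = k" "f \<in> Arr C" "g \<in> Arr C" "Cod C f = Dom C g" "x \<in> Arr C" "Cod C x = Dom C f"
  shows "g \<cdot> (f \<cdot> x) = k \<cdot> x"
  using comp_assoc_right[of x f g] assms by simp

context preadditive_category
begin

definition neg :: "'m \<Rightarrow> 'm" where
  "neg f = \<ominus>\<^bsub>Hom_module D (Dom D f) (Cod D f)\<^esub> f"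

lemma homI: "f \<in> Arr D \<Longrightarrow> f \<in> Hom D (Dom D f) (Cod D f)"
  by (simp add: Hom_def)

lemma hom_group: "f \<in> Arr D \<Longrightarrow> abelian_group (Hom_module D (Dom D f) (Cod D f))"
  using hom_abelian_group dom_obj cod_obj by blast

lemma add_simps [simp]:
  assumes "f \<in> Arr D" "g \<in> Arr D" "Dom D f = Dom D g" "Cod D f = Cod D g"
  shows "Add D f g \<in> Arr D" "Dom D (Add D f g) = Dom D g" "Cod D (Add D f g) = Cod D g"
  using add_hom[of f "Dom D f" "Cod D f" g] assms by (auto simp: Hom_def)

lemma zro_simps [simp]:
  assumes "a \<in> Obj D" "b \<in> Obj D"
  shows "Zro D a b \<in> Arr D" "Dom D (Zro D a b) = a" "Cod D (Zro D a b) = b"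
  using zro_hom[OF assms] by (auto simp: Hom_def)

lemma neg_simps [simp]:
  assumes "f \<in> Arr D"
  shows "neg f \<in> Arr D" "Dom D (neg f) = Dom D f" "Cod D (neg f) = Cod D f"
  using abelian_group.a_inv_closed[OF hom_group[OF assms]] homI[OF assms]
  by (auto simp: Hom_def neg_def)

lemma add_assoc:
  assumes "f \<in> Arr D" "g \<in> Arr D" "h \<in> Arr D"
    "Dom D f = Dom D g" "Cod D f = Cod D g" "Dom D g = Dom D h" "Cod D g = Cod D h"
  shows "Add D (Add D f g) h = Add D f (Add D g h)"
proof -
  interpret abelian_group "Hom_module D (Dom D h) (Cod D h)" using hom_group assms by simp
  show ?thesis using a_assoc[of f g h] assms by (auto simp: Hom_def)
qed

lemma add_comm:
  assumes "f \<in> Arr D" "g \<in> Arr D" "Dom D f = Dom D g" "Cod D f = Cod D g"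
  shows "Add D f g = Add D g f"
proof -
  interpret abelian_group "Hom_module D (Dom D g) (Cod D g)" using hom_group assms by simp
  show ?thesis using a_comm[of f g] assms by (auto simp: Hom_def)
qed

lemma add_zro [simp]:
  assumes "f \<in> Arr D" "Dom D f = a" "Cod D f = b"
  shows "Add D f (Zro D a b) = f" "Add D (Zro D a b) f = f"
proof -
  interpret abelian_group "Hom_module D a b" using hom_group assms by blast
  show "Add D f (Zro D a b) = f" "Add D (Zro D a b) f = f"
    using l_zero[of f] r_zero[of f] assms by (auto simp: Hom_def)
qed

lemma add_neg [simp]:
  assumes "f \<in> Arr D"
  shows "Add D f (neg f) = Zro D (Dom D f) (Cod D f)" "Add D (neg f) f = Zro D (Dom D f) (Cod D f)"
proof -
  interpret abelian_group "Hom_module D (Dom D f) (Cod D f)" using hom_group assms by simp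
  show "Add D f (neg f) = Zro D (Dom D f) (Cod D f)" "Add D (neg f) f = Zro D (Dom D f) (Cod D f)"
    using l_neg[of f] r_neg[of f] homI[OF assms] by (auto simp: neg_def)
qed

lemma add_cancel_left:
  assumes "f \<in> Arr D" "g \<in> Arr D" "h \<in> Arr D"
    "Dom D f = Dom D g" "Cod D f = Cod D g" "Dom D g = Dom D h" "Cod D g = Cod D h"
    and e: "Add D f g = Add D f h"
  shows "g = h"
proof -
  have "Add D (neg f) (Add D f g) = Add D (neg f) (Add D f h)" using e by simp
  then show ?thesis using assms(1-7) by (simp add: add_assoc[symmetric])
qed

lemma comp_add [simp]:
  "\<lbrakk>f \<in> Arr D; g \<in> Arr D; h \<in> Arr D; Cod D f = Dom D g; Dom D g = Dom D h; Cod D g = Cod D h\<rbrakk> \<Longrightarrow>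
    Add D g h \<cdot> f = Add D (g \<cdot> f) (h \<cdot> f)"
  "\<lbrakk>f \<in> Arr D; g \<in> Arr D; h \<in> Arr D; Dom D f = Dom D g; Cod D f = Cod D g; Dom D h = Cod D f\<rbrakk> \<Longrightarrow>
    h \<cdot> Add D f g = Add D (h \<cdot> f) (h \<cdot> g)"
  using comp_add_left[of f "Dom D f" "Cod D f" g "Cod D g" h] comp_add_right[of f "Dom D f" "Cod D f" g h "Cod D h"]
  by (auto simp: Hom_def)

text \<open>In a group only the neutral element is idempotent. The bilinearity axioms do not mention
  \<open>Zro\<close>; a composite with a zero arrow is recognized as zero because it equals its own
  double.\<close>

lemma add_idem_zro:
  assumes "f \<in> Arr D" "Add D f f = f"
  shows "f = Zro D (Dom D f) (Cod D f)"
  by (rule add_cancel_left[of f]) (use assms dom_obj cod_obj in auto)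

lemma comp_zro_right [simp]:
  assumes "f \<in> Arr D" "Dom D f = b" "a \<in> Obj D"
  shows "f \<cdot> Zro D a b = Zro D a (Cod D f)"
proof -
  have ob: "b \<in> Obj D" "Cod D f \<in> Obj D" using assms dom_obj cod_obj by auto
  have "Add D (Zro D a b) (Zro D a b) = Zro D a b" using assms ob by simp
  then have "Add D (f \<cdot> Zro D a b) (f \<cdot> Zro D a b) = f \<cdot> Zro D a b"
    using comp_add(2)[of "Zro D a b" "Zro D a b" f] assms ob by simp
  from add_idem_zro[OF _ this] show ?thesis using assms ob by simp
qed

lemma comp_zro_left [simp]:
  assumes "f \<in> Arr D" "Cod D f = a" "b \<in> Obj D"
  shows "Zro D a b \<cdot> f = Zro D (Dom D f) b"
proof -
  have ob: "a \<in> Obj D" "Dom D f \<in> Obj D" using assms dom_obj cod_obj by auto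
  have "Add D (Zro D a b) (Zro D a b) = Zro D a b" using assms ob by simp
  then have "Add D (Zro D a b \<cdot> f) (Zro D a b \<cdot> f) = Zro D a b \<cdot> f"
    using comp_add(1)[of f "Zro D a b" "Zro D a b"] assms ob by simp
  from add_idem_zro[OF _ this] show ?thesis using assms ob by simp
qed

lemma neg_unique:
  assumes "f \<in> Arr D" "g \<in> Arr D" "Dom D f = Dom D g" "Cod D f = Cod D g"
    and "Add D f g = Zro D (Dom D f) (Cod D f)"
  shows "g = neg f"
  by (rule add_cancel_left[of f]) (use assms in auto)

lemma comp_neg [simp]:
  "f \<in> Arr D \<Longrightarrow> g \<in> Arr D \<Longrightarrow> Cod D f = Dom D g \<Longrightarrow> g \<cdot> neg f = neg (g \<cdot> f)"
  "f \<in> Arr D \<Longrightarrow> g \<in> Arr D \<Longrightarrow> Cod D f = Dom D g \<Longrightarrow> neg g \<cdot> f = neg (g \<cdot> f)"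
   apply (rule neg_unique; simp add: comp_add(2)[symmetric] dom_obj cod_obj del: comp_add)
  apply (rule neg_unique; simp add: comp_add(1)[symmetric] dom_obj cod_obj del: comp_add)
  done

lemma eq_if_sub_zro:
  assumes "f \<in> Arr D" "g \<in> Arr D" "Dom D f = Dom D g" "Cod D f = Cod D g"
    and "Add D f (neg g) = Zro D (Dom D f) (Cod D f)"
  shows "f = g"
proof -
  have "Add D (neg g) f = Add D (neg g) g" using assms by (simp add: add_comm[of "neg g" f])
  then show ?thesis using add_cancel_left[of "neg g" f g] assms by simp
qed

text \<open>Serves for sums of cosets, where representatives \<open>f + h\<close> and
  \<open>g + h'\<close> are regrouped into \<open>f + g\<close> plus an element of the
  ideal.\<close>

lemma add_interchange:
  assumes "f \<in> Arr D" "g \<in> Arr D" "h \<in> Arr D" "k \<in> Arr D"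
    "Dom D f = a" "Cod D f = b" "Dom D g = a" "Cod D g = b" "Dom D h = a" "Cod D h = b" "Dom D k = a" "Cod D k = b"
  shows "Add D (Add D f g) (Add D h k) = Add D (Add D f h) (Add D g k)"
proof -
  have "Add D g (Add D h k) = Add D h (Add D g k)"
    using assms add_assoc[of g h k, symmetric] add_assoc[of h g k] add_comm[of g h] by simp
  then show ?thesis using assms by (simp add: add_assoc)
qed

text \<open>Cancellation needs testing against zero only, since
  \<open>f \<cdot> g = f \<cdot> h\<close> makes \<open>f\<close> kill the difference of
  \<open>g\<close> and \<open>h\<close>.\<close>

lemma monicI:
  assumes "f \<in> Arr D"
    and z: "\<And>g. g \<in> Arr D \<Longrightarrow> Cod D g = Dom D f \<Longrightarrow> f \<cdot> g = Zro D (Dom D g) (Cod D f) \<Longrightarrow> g = Zro D (Dom D g) (Dom D f)"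
  shows "monic D f"
  unfolding monic_def
proof (intro conjI ballI impI)
  fix g h assume gh: "g \<in> Arr D" "h \<in> Arr D"
    and e: "Cod D g = Dom D f \<and> Cod D h = Dom D f \<and> Dom D g = Dom D h \<and> f \<cdot> g = f \<cdot> h"
  have "Add D g (neg h) = Zro D (Dom D (Add D g (neg h))) (Dom D f)"
    by (rule z) (use gh e assms(1) in \<open>simp_all\<close>)
  then show "g = h" using eq_if_sub_zro gh e by simp
qed (fact assms)

lemma monic_zro:
  assumes "monic D f" "g \<in> Arr D" "Cod D g = Dom D f" "f \<cdot> g = Zro D (Dom D g) (Cod D f)"
  shows "g = Zro D (Dom D g) (Dom D f)"
proof -
  have f: "f \<in> Arr D" using assms(1) by (simp add: monic_def)
  show ?thesis using assms f dom_obj cod_obj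
    unfolding monic_def by (metis comp_zro_right zro_simps)
qed

lemma epicI:
  assumes "f \<in> Arr D"
    and z: "\<And>g. g \<in> Arr D \<Longrightarrow> Dom D g = Cod D f \<Longrightarrow> g \<cdot> f = Zro D (Dom D f) (Cod D g) \<Longrightarrow> g = Zro D (Cod D f) (Cod D g)"
  shows "epic D f"
  unfolding epic_def
proof (intro conjI ballI impI)
  fix g h assume gh: "g \<in> Arr D" "h \<in> Arr D"
    and e: "Dom D g = Cod D f \<and> Dom D h = Cod D f \<and> Cod D g = Cod D h \<and> g \<cdot> f = h \<cdot> f"
  have "Add D g (neg h) = Zro D (Cod D f) (Cod D (Add D g (neg h)))"
    by (rule z) (use gh e assms(1) in \<open>simp_all\<close>)
  then show "g = h" using eq_if_sub_zro gh e by simp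
qed (fact assms)

lemma epic_zro:
  assumes "epic D f" "g \<in> Arr D" "Dom D g = Cod D f" "g \<cdot> f = Zro D (Dom D f) (Cod D g)"
  shows "g = Zro D (Cod D f) (Cod D g)"
proof -
  have f: "f \<in> Arr D" using assms(1) by (simp add: epic_def)
  show ?thesis using assms f dom_obj cod_obj
    unfolding epic_def by (metis comp_zro_left zro_simps)
qed

lemma monic_cancel:
  "monic D f \<Longrightarrow> g \<in> Arr D \<Longrightarrow> h \<in> Arr D \<Longrightarrow> Cod D g = Dom D f \<Longrightarrow> Cod D h = Dom D f \<Longrightarrow>
    Dom D g = Dom D h \<Longrightarrow> f \<cdot> g = f \<cdot> h \<Longrightarrow> g = h"
  by (simp add: monic_def)

lemma epic_cancel:
  "epic D f \<Longrightarrow> g \<in> Arr D \<Longrightarrow> h \<in> Arr D \<Longrightarrow> Dom D g = Cod D f \<Longrightarrow> Dom D h = Cod D f \<Longrightarrow>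
    Cod D g = Cod D h \<Longrightarrow> g \<cdot> f = h \<cdot> f \<Longrightarrow> g = h"
  by (simp add: epic_def)

end

section \<open>Opposite categories\<close>

text \<open>Two opposites are needed, because a functor category is dualized on both sides: its
  index category carries no linear structure, whereas its target does.\<close>

definition op_cat :: "('o, 'm, 'z) precat_scheme \<Rightarrow> ('o, 'm) precat" where
  "op_cat C = \<lparr>Obj = Obj C, Arr = Arr C, Dom = Cod C, Cod = Dom C, Idn = Idn C, Comp = (\<lambda>g f. f \<cdot>\<^bsub>C\<^esub> g)\<rparr>"

definition op_lin :: "('o, 'm, 'k) prelincat \<Rightarrow> ('o, 'm, 'k) prelincat" where
  "op_lin D = \<lparr>Obj = Obj D, Arr = Arr D, Dom = Cod D, Cod = Dom D, Idn = Idn D, Comp = (\<lambda>g f. f \<cdot>\<^bsub>D\<^esub> g),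
     Zro = (\<lambda>a b. Zro D b a), Add = Add D, Scl = Scl D\<rparr>"

lemma op_cat_simps [simp]:
  "Obj (op_cat C) = Obj C" "Arr (op_cat C) = Arr C" "Dom (op_cat C) = Cod C" "Cod (op_cat C) = Dom C"
  "Idn (op_cat C) = Idn C" "Comp (op_cat C) g f = f \<cdot>\<^bsub>C\<^esub> g" "Hom (op_cat C) a b = Hom C b a"
  by (auto simp: op_cat_def Hom_def)

lemma op_lin_simps [simp]:
  "Obj (op_lin D) = Obj D" "Arr (op_lin D) = Arr D" "Dom (op_lin D) = Cod D" "Cod (op_lin D) = Dom D"
  "Idn (op_lin D) = Idn D" "Comp (op_lin D) g f = f \<cdot>\<^bsub>D\<^esub> g" "Hom (op_lin D) a b = Hom D b a"
  "Zro (op_lin D) a b = Zro D b a" "Add (op_lin D) = Add D" "Scl (op_lin D) = Scl D"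
  by (auto simp: op_lin_def Hom_def)

lemma category_op_cat: "category C \<Longrightarrow> category (op_cat C)"
  unfolding category_def by simp metis

lemma category_op_lin: "category D \<Longrightarrow> category (op_lin D)"
  unfolding category_def by simp metis

text \<open>As simplification rules these equivalences turn an instance of a theorem at
  \<open>op_lin D\<close> into the dual theorem about \<open>D\<close>, so that one half of a dual
  pair suffices.\<close>

lemma iso_arr_op_lin [simp]: "iso_arr (op_lin D) f \<longleftrightarrow> iso_arr D f"
  by (auto simp: iso_arr_def)

lemma monic_op_lin [simp]: "monic (op_lin D) f \<longleftrightarrow> epic D f"
  by (auto simp: monic_def epic_def)

lemma epic_op_lin [simp]: "epic (op_lin D) f \<longleftrightarrow> monic D f"
  by (auto simp: monic_def epic_def)

lemma is_kernel_op_lin [simp]: "is_kernel (op_lin D) k f \<longleftrightarrow> is_cokernel D k f"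
  by (auto simp: is_kernel_def is_cokernel_def)

lemma is_cokernel_op_lin [simp]: "is_cokernel (op_lin D) k f \<longleftrightarrow> is_kernel D k f"
  by (auto simp: is_kernel_def is_cokernel_def)

lemma short_exact_op_lin [simp]: "short_exact (op_lin D) p i \<longleftrightarrow> short_exact D i p"
  by (auto simp: short_exact_def)

lemma zero_object_op_lin [simp]: "zero_object (op_lin D) z \<longleftrightarrow> zero_object D z"
  by (auto simp: zero_object_def)

lemma is_biproduct_op_lin [simp]: "is_biproduct (op_lin D) a b s p q i j \<longleftrightarrow> is_biproduct D a b s i j p q"
  by (auto simp: is_biproduct_def)

lemma preadditive_op_lin:
  assumes "preadditive_category D"
  shows "preadditive_category (op_lin D)"
proof -
  interpret preadditive_category D by fact
  interpret op: category "op_lin D" by (rule category_op_lin) (rule category_axioms)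
  have "Hom_module (op_lin D) a b = Hom_module D b a" for a b by (simp add: Hom_module_def)
  then show ?thesis
    by (intro preadditive_category.intro preadditive_category_axioms.intro op.category_axioms)
      (simp_all add: hom_abelian_group comp_add_left comp_add_right)
qed

lemma abelian_op_lin:
  assumes "abelian_category D"
  shows "abelian_category (op_lin D)"
proof -
  interpret abelian_category D by fact
  interpret op: preadditive_category "op_lin D" by (rule preadditive_op_lin) (rule preadditive_category_axioms)
  show ?thesis
    by unfold_locales (simp_all add: zero_ex biproduct_ex kernel_ex cokernel_ex monic_is_kernel epic_is_cokernel, metis biproduct_ex)
qed

section \<open>Kernels, cokernels and biproducts\<close>

context category
begin

lemma HomE: "f \<in> Hom C a b \<Longrightarrow> f \<in> Arr C \<and> Dom C f = a \<and> Cod C f = b"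
  by (simp add: Hom_def)

lemma iso_arrI:
  assumes "f \<in> Arr C" "g \<in> Arr C" "Dom C g = Cod C f" "Cod C g = Dom C f"
    "g \<cdot> f = Idn C (Dom C f)" "f \<cdot> g = Idn C (Cod C f)"
  shows "iso_arr C f"
  using assms by (auto simp: iso_arr_def Hom_def)

lemma iso_arrE:
  assumes "iso_arr C f"
  obtains g where "f \<in> Arr C" "g \<in> Arr C" "Dom C g = Cod C f" "Cod C g = Dom C f"
    "g \<cdot> f = Idn C (Dom C f)" "f \<cdot> g = Idn C (Cod C f)"
  using assms by (auto simp: iso_arr_def Hom_def)

lemma iso_arr_comp:
  assumes "iso_arr C f" "iso_arr C g" "Cod C f = Dom C g"
  shows "iso_arr C (g \<cdot> f)"
proof -
  obtain f' where f: "f \<in> Arr C" "f' \<in> Arr C" "Dom C f' = Cod C f" "Cod C f' = Dom C f"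
    "f' \<cdot> f = Idn C (Dom C f)" "f \<cdot> f' = Idn C (Cod C f)" using assms(1) by (rule iso_arrE)
  obtain g' where g: "g \<in> Arr C" "g' \<in> Arr C" "Dom C g' = Cod C g" "Cod C g' = Dom C g"
    "g' \<cdot> g = Idn C (Dom C g)" "g \<cdot> g' = Idn C (Cod C g)" using assms(2) by (rule iso_arrE)
  show ?thesis
    by (rule iso_arrI[of _ "f' \<cdot> g'"])
       (use f g assms(3) comp_reassoc[OF f(6)] comp_reassoc[OF g(5)] in \<open>simp_all\<close>)
qed

end

context preadditive_category
begin

lemma is_kernelD:
  assumes "is_kernel D k f"
  shows "k \<in> Arr D" "f \<in> Arr D" "Cod D k = Dom D f" "f \<cdot> k = Zro D (Dom D k) (Cod D f)"
  using assms by (auto simp: is_kernel_def)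

lemma is_kernel_lift:
  assumes "is_kernel D k f" "g \<in> Arr D" "Cod D g = Dom D f" "f \<cdot> g = Zro D (Dom D g) (Cod D f)"
  obtains h where "h \<in> Arr D" "Dom D h = Dom D g" "Cod D h = Dom D k" "k \<cdot> h = g"
  using assms unfolding is_kernel_def Hom_def by blast

text \<open>An arrow \<open>g\<close> with \<open>k \<cdot> g = 0\<close> and the zero arrow are
  both lifts of the zero arrow along \<open>k\<close>, so the uniqueness clause of the kernel
  identifies them.\<close>

lemma is_kernel_monic:
  assumes "is_kernel D k f"
  shows "monic D k"
proof (rule monicI)
  note k = is_kernelD[OF assms]
  show "k \<in> Arr D" by fact
  fix g assume g: "g \<in> Arr D" "Cod D g = Dom D k" "k \<cdot> g = Zro D (Dom D g) (Cod D k)"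
  note ob = dom_obj[OF g(1)] dom_obj[OF k(1)] dom_obj[OF k(2)] cod_obj[OF k(2)]
  let ?z = "Zro D (Dom D g) (Cod D k)"
  have z: "?z \<in> Arr D" "Cod D ?z = Dom D f" "Dom D ?z = Dom D g" "f \<cdot> ?z = Zro D (Dom D g) (Cod D f)"
    using k ob by simp_all
  have "\<forall>g\<in>Arr D. Cod D g = Dom D f \<and> f \<cdot> g = Zro D (Dom D g) (Cod D f) \<longrightarrow>
        (\<exists>!h. h \<in> Hom D (Dom D g) (Dom D k) \<and> k \<cdot> h = g)"
    using assms by (simp add: is_kernel_def)
  from this[rule_format, OF z(1), unfolded z(3)] have "\<exists>!h. h \<in> Hom D (Dom D g) (Dom D k) \<and> k \<cdot> h = ?z"
    using z by blast
  moreover have "Zro D (Dom D g) (Dom D k) \<in> Hom D (Dom D g) (Dom D k)" "k \<cdot> Zro D (Dom D g) (Dom D k) = ?z"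
    "g \<in> Hom D (Dom D g) (Dom D k)"
    using g k ob by (simp_all add: Hom_def)
  ultimately show "g = Zro D (Dom D g) (Dom D k)"
    using g(3) by blast
qed

lemma is_kernelI:
  assumes "monic D k" "f \<in> Arr D" "Cod D k = Dom D f" "f \<cdot> k = Zro D (Dom D k) (Cod D f)"
    and "\<And>g. g \<in> Arr D \<Longrightarrow> Cod D g = Dom D f \<Longrightarrow> f \<cdot> g = Zro D (Dom D g) (Cod D f) \<Longrightarrow>
      \<exists>h\<in>Hom D (Dom D g) (Dom D k). k \<cdot> h = g"
  shows "is_kernel D k f"
  unfolding is_kernel_def
proof (intro conjI ballI impI)
  show k: "k \<in> Arr D" using assms(1) by (simp add: monic_def)
  fix g assume g: "g \<in> Arr D" "Cod D g = Dom D f \<and> f \<cdot> g = Zro D (Dom D g) (Cod D f)"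
  with assms(5)[OF g(1)] obtain h where h: "h \<in> Hom D (Dom D g) (Dom D k)" "k \<cdot> h = g" by blast
  show "\<exists>!h. h \<in> Hom D (Dom D g) (Dom D k) \<and> k \<cdot> h = g"
  proof (rule ex1I)
    show "h \<in> Hom D (Dom D g) (Dom D k) \<and> k \<cdot> h = g" using h by simp
    fix h' assume "h' \<in> Hom D (Dom D g) (Dom D k) \<and> k \<cdot> h' = g"
    then show "h' = h" using monic_cancel[OF assms(1), of h' h] h by (simp add: Hom_def)
  qed
qed (use assms in simp_all)

lemma is_cokernelD:
  assumes "is_cokernel D c f"
  shows "c \<in> Arr D" "f \<in> Arr D" "Dom D c = Cod D f" "c \<cdot> f = Zro D (Dom D f) (Cod D c)"
  using assms by (auto simp: is_cokernel_def)

lemma is_cokernel_lift: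
  assumes "is_cokernel D c f" "g \<in> Arr D" "Dom D g = Cod D f" "g \<cdot> f = Zro D (Dom D f) (Cod D g)"
  obtains h where "h \<in> Arr D" "Dom D h = Cod D c" "Cod D h = Cod D g" "h \<cdot> c = g"
  using assms unfolding is_cokernel_def Hom_def by blast

lemma is_cokernel_epic: "is_cokernel D c f \<Longrightarrow> epic D c"
  using preadditive_category.is_kernel_monic[OF preadditive_op_lin[OF preadditive_category_axioms], of c f] by simp

lemma kernel_iso_comp:
  assumes k: "is_kernel D k f" and h: "iso_arr D h" "Cod D h = Dom D k"
  shows "is_kernel D (k \<cdot> h) f"
proof -
  obtain h' where h': "h \<in> Arr D" "h' \<in> Arr D" "Dom D h' = Cod D h" "Cod D h' = Dom D h"
    "h' \<cdot> h = Idn D (Dom D h)" "h \<cdot> h' = Idn D (Cod D h)" using h(1) by (rule iso_arrE)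
  note kD = is_kernelD[OF k]
  note ob = dom_obj[OF h'(1)] cod_obj[OF kD(2)]
  show ?thesis
  proof (rule is_kernelI)
    show "monic D (k \<cdot> h)"
    proof (rule monicI)
      fix g assume g: "g \<in> Arr D" "Cod D g = Dom D (k \<cdot> h)" "k \<cdot> h \<cdot> g = Zro D (Dom D g) (Cod D (k \<cdot> h))"
      have "h \<cdot> g = Zro D (Dom D g) (Dom D k)"
        using monic_zro[OF is_kernel_monic[OF k], of "h \<cdot> g"] g h h' kD by simp
      then have "h' \<cdot> (h \<cdot> g) = Zro D (Dom D g) (Dom D h)"
        using g h h' kD ob dom_obj[OF g(1)] by simp
      then show "g = Zro D (Dom D g) (Dom D (k \<cdot> h))"
        using g h h' kD comp_reassoc[OF h'(5)] by simp
    qed (use h h' kD in simp)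
    fix g assume g: "g \<in> Arr D" "Cod D g = Dom D f" "f \<cdot> g = Zro D (Dom D g) (Cod D f)"
    obtain u where u: "u \<in> Arr D" "Dom D u = Dom D g" "Cod D u = Dom D k" "k \<cdot> u = g"
      using is_kernel_lift[OF k g] .
    show "\<exists>u\<in>Hom D (Dom D g) (Dom D (k \<cdot> h)). k \<cdot> h \<cdot> u = g"
      by (rule bexI[of _ "h' \<cdot> u"]) (use u h h' kD comp_reassoc[OF h'(6)] in \<open>simp_all add: Hom_def\<close>)
  qed (use kD h h' ob comp_reassoc[OF kD(4)] in simp_all)
qed

lemma kernel_unique:
  assumes k: "is_kernel D k f" and k': "is_kernel D k' f"
  obtains h where "iso_arr D h" "Dom D h = Dom D k'" "Cod D h = Dom D k" "k \<cdot> h = k'"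
proof -
  note kD = is_kernelD[OF k] and kD' = is_kernelD[OF k']
  obtain h where h: "h \<in> Arr D" "Dom D h = Dom D k'" "Cod D h = Dom D k" "k \<cdot> h = k'"
    using is_kernel_lift[OF k kD'(1,3,4)] .
  obtain h' where h': "h' \<in> Arr D" "Dom D h' = Dom D k" "Cod D h' = Dom D k'" "k' \<cdot> h' = k"
    using is_kernel_lift[OF k' kD(1,3,4)] .
  have "h \<cdot> h' = Idn D (Dom D k)"
    by (rule monic_cancel[OF is_kernel_monic[OF k]])
       (use h h' kD kD' dom_obj[OF kD(1)] comp_reassoc[OF h(4)] in simp_all)
  moreover have "h' \<cdot> h = Idn D (Dom D k')"
    by (rule monic_cancel[OF is_kernel_monic[OF k']])
       (use h h' kD kD' dom_obj[OF kD'(1)] comp_reassoc[OF h'(4)] in simp_all)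
  ultimately show ?thesis using that[of h] iso_arrI[of h h'] h h' by simp
qed

text \<open>Facts 1 to 15 are typing and are cited separately from the equations, which could
  otherwise rewrite composites too early. The last four facts repeat the equations with a further
  arrow on the right, as they occur in right-nested composites.\<close>

lemma is_biproductD:
  assumes "is_biproduct D a b s i j p q"
  shows "a \<in> Obj D" "b \<in> Obj D" "s \<in> Obj D"
    "i \<in> Arr D" "Dom D i = a" "Cod D i = s" "j \<in> Arr D" "Dom D j = b" "Cod D j = s"
    "p \<in> Arr D" "Dom D p = s" "Cod D p = a" "q \<in> Arr D" "Dom D q = s" "Cod D q = b"
    "p \<cdot> i = Idn D a" "q \<cdot> j = Idn D b" "p \<cdot> j = Zro D b a" "q \<cdot> i = Zro D a b"
    "Add D (i \<cdot> p) (j \<cdot> q) = Idn D s"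
    "\<And>x. x \<in> Arr D \<Longrightarrow> Cod D x = a \<Longrightarrow> p \<cdot> (i \<cdot> x) = x"
    "\<And>x. x \<in> Arr D \<Longrightarrow> Cod D x = b \<Longrightarrow> q \<cdot> (j \<cdot> x) = x"
    "\<And>x. x \<in> Arr D \<Longrightarrow> Cod D x = b \<Longrightarrow> p \<cdot> (j \<cdot> x) = Zro D (Dom D x) a"
    "\<And>x. x \<in> Arr D \<Longrightarrow> Cod D x = a \<Longrightarrow> q \<cdot> (i \<cdot> x) = Zro D (Dom D x) b"
proof -
  show t: "a \<in> Obj D" "b \<in> Obj D" "s \<in> Obj D"
    "i \<in> Arr D" "Dom D i = a" "Cod D i = s" "j \<in> Arr D" "Dom D j = b" "Cod D j = s"
    "p \<in> Arr D" "Dom D p = s" "Cod D p = a" "q \<in> Arr D" "Dom D q = s" "Cod D q = b"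
    "p \<cdot> i = Idn D a" "q \<cdot> j = Idn D b" "p \<cdot> j = Zro D b a" "q \<cdot> i = Zro D a b"
    "Add D (i \<cdot> p) (j \<cdot> q) = Idn D s"
    using assms by (auto simp: is_biproduct_def Hom_def)
  show "x \<in> Arr D \<Longrightarrow> Cod D x = a \<Longrightarrow> p \<cdot> (i \<cdot> x) = x"
    "x \<in> Arr D \<Longrightarrow> Cod D x = b \<Longrightarrow> q \<cdot> (j \<cdot> x) = x"
    "x \<in> Arr D \<Longrightarrow> Cod D x = b \<Longrightarrow> p \<cdot> (j \<cdot> x) = Zro D (Dom D x) a"
    "x \<in> Arr D \<Longrightarrow> Cod D x = a \<Longrightarrow> q \<cdot> (i \<cdot> x) = Zro D (Dom D x) b" for x
    using t comp_reassoc[OF t(16)] comp_reassoc[OF t(17)] comp_reassoc[OF t(18)] comp_reassoc[OF t(19)] by simp_all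
qed

lemma biproduct_decomp:
  assumes "is_biproduct D a b s i j p q" "x \<in> Arr D" "Cod D x = s"
  shows "x = Add D (i \<cdot> (p \<cdot> x)) (j \<cdot> (q \<cdot> x))"
proof -
  note bD = is_biproductD[OF assms(1)]
  have "x = Add D (i \<cdot> p) (j \<cdot> q) \<cdot> x" using bD assms by simp
  also have "\<dots> = Add D (i \<cdot> (p \<cdot> x)) (j \<cdot> (q \<cdot> x))"
    by (subst comp_add) (use bD(1-15) assms in simp_all)
  finally show ?thesis .
qed

lemma biproduct_eqI:
  assumes b: "is_biproduct D a b s i j p q" and x: "x \<in> Arr D" "Cod D x = s" and y: "y \<in> Arr D" "Cod D y = s"
    and "p \<cdot> x = p \<cdot> y" "q \<cdot> x = q \<cdot> y"
  shows "x = y"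
  using biproduct_decomp[OF b x] biproduct_decomp[OF b y] assms(6,7) by simp

end

context abelian_category
begin

text \<open>If \<open>m\<close> is a kernel of \<open>g\<close>, then \<open>g\<close> kills
  \<open>m\<close> and factors through the cokernel \<open>c\<close>. Whatever \<open>c\<close>
  kills is therefore killed by \<open>g\<close> and lifts along \<open>m\<close>.\<close>

lemma monic_is_kernel_of_cokernel:
  assumes m: "monic D m" and c: "is_cokernel D c m"
  shows "is_kernel D m c"
proof -
  obtain g where g: "is_kernel D m g" using monic_is_kernel[OF m] by blast
  note gD = is_kernelD[OF g] and cD = is_cokernelD[OF c]
  obtain t where t: "t \<in> Arr D" "Dom D t = Cod D c" "Cod D t = Cod D g" "t \<cdot> c = g"
    using is_cokernel_lift[OF c gD(2)] gD by auto
  show ?thesis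
  proof (rule is_kernelI[OF m])
    fix x assume x: "x \<in> Arr D" "Cod D x = Dom D c" "c \<cdot> x = Zro D (Dom D x) (Cod D c)"
    have "g \<cdot> x = t \<cdot> (c \<cdot> x)" by (rule comp_reassoc[OF t(4), symmetric]) (use t gD cD x in simp_all)
    also have "\<dots> = Zro D (Dom D x) (Cod D g)" using t x cD dom_obj by simp
    finally obtain h where "h \<in> Arr D" "Dom D h = Dom D x" "Cod D h = Dom D m" "m \<cdot> h = x"
      using is_kernel_lift[OF g, of x] x gD cD by auto
    then show "\<exists>h\<in>Hom D (Dom D x) (Dom D m). m \<cdot> h = x" by (auto simp: Hom_def)
  qed (use cD in auto)
qed

lemma epic_is_cokernel_of_kernel: "epic D e \<Longrightarrow> is_kernel D k e \<Longrightarrow> is_cokernel D e k"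
  using abelian_category.monic_is_kernel_of_cokernel[OF abelian_op_lin[OF abelian_category_axioms], of e k] by simp

lemma short_exactI: "is_kernel D i p \<Longrightarrow> epic D p \<Longrightarrow> short_exact D i p"
  by (simp add: short_exact_def epic_is_cokernel_of_kernel)

lemma short_exactI': "is_cokernel D p i \<Longrightarrow> monic D i \<Longrightarrow> short_exact D i p"
  by (simp add: short_exact_def monic_is_kernel_of_cokernel)

lemma short_exactD:
  assumes "short_exact D i p"
  shows "i \<in> Arr D" "p \<in> Arr D" "Cod D i = Dom D p" "p \<cdot> i = Zro D (Dom D i) (Cod D p)"
    "monic D i" "epic D p" "is_kernel D i p" "is_cokernel D p i"
  using assms is_kernelD[of i p] is_kernel_monic is_cokernel_epic unfolding short_exact_def by auto

text \<open>As a kernel of some \<open>g\<close>, an epic \<open>f\<close> forces \<open>g\<close>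
  to be zero. The identity then lifts along \<open>f\<close> to a right inverse, and monicness makes
  that inverse two-sided.\<close>

lemma monic_epic_iso:
  assumes m: "monic D f" and e: "epic D f"
  shows "iso_arr D f"
proof -
  have f: "f \<in> Arr D" using m by (simp add: monic_def)
  note ob = dom_obj[OF f] cod_obj[OF f]
  obtain g where g: "is_kernel D f g" using monic_is_kernel[OF m] by blast
  note gD = is_kernelD[OF g]
  have "g = Zro D (Cod D f) (Cod D g)"
    by (rule epic_zro[OF e]) (use gD in simp_all)
  then have "g \<cdot> Idn D (Cod D f) = Zro D (Cod D f) (Cod D g)" using gD by simp
  then obtain h where h: "h \<in> Arr D" "Dom D h = Cod D f" "Cod D h = Dom D f" "f \<cdot> h = Idn D (Cod D f)"
    using is_kernel_lift[OF g, of "Idn D (Cod D f)"] ob gD by auto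
  have "h \<cdot> f = Idn D (Dom D f)"
    by (rule monic_cancel[OF m]) (use h f ob comp_reassoc[OF h(4)] in simp_all)
  then show ?thesis using iso_arrI[of f h] h f by simp
qed

end

section \<open>Morphisms of extensions\<close>

text \<open>The common form of equivalence, pullback and pushout, which are the cases with
  identities at both ends, at the left end and at the right end. The middle arrow is quantified
  away, since operations on classes only see the outer ones.\<close>

definition ext_mor :: "('o, 'm, 'k) prelincat \<Rightarrow> 'm \<times> 'm \<Rightarrow> 'm \<times> 'm \<Rightarrow> 'm \<Rightarrow> 'm \<Rightarrow> bool" where
  "ext_mor D e e' f g \<longleftrightarrow> (\<exists>h\<in>Hom D (Cod D (fst e)) (Cod D (fst e')).
     h \<cdot>\<^bsub>D\<^esub> fst e = fst e' \<cdot>\<^bsub>D\<^esub> f \<and> snd e' \<cdot>\<^bsub>D\<^esub> h = g \<cdot>\<^bsub>D\<^esub> snd e)"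

abbreviation ext_class :: "('o, 'm, 'k) prelincat \<Rightarrow> 'o \<Rightarrow> 'o \<Rightarrow> 'm \<times> 'm \<Rightarrow> ('m \<times> 'm) set" where
  "ext_class D A B e \<equiv> ext_rel D A B `` {e}"

lemma extensions_op_lin: "(p, i) \<in> extensions (op_lin D) B A \<longleftrightarrow> (i, p) \<in> extensions D A B"
  by (auto simp: extensions_def)

text \<open>The middle object is read off as the codomain of the first arrow. After dualization the
  first arrow is the old second one, so the two readings must be known to agree.\<close>

lemma ext_mor_op_lin:
  assumes "Cod D (fst e) = Dom D (snd e)" "Cod D (fst e') = Dom D (snd e')"
  shows "ext_mor (op_lin D) (prod.swap e') (prod.swap e) g f \<longleftrightarrow> ext_mor D e e' f g"
  using assms by (auto simp: ext_mor_def)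

lemma (in preadditive_category) neg_zro [simp]:
  "a \<in> Obj D \<Longrightarrow> b \<in> Obj D \<Longrightarrow> neg (Zro D a b) = Zro D a b"
  using neg_unique[of "Zro D a b" "Zro D a b"] by simp

context preadditive_category
begin

lemma monic_zeroI:
  "monic D f \<Longrightarrow> g \<in> Arr D \<Longrightarrow> Cod D g = Dom D f \<Longrightarrow> Dom D f = b \<Longrightarrow> Dom D g = a \<Longrightarrow>
    f \<cdot> g = Zro D a (Cod D f) \<Longrightarrow> g = Zro D a b"
  using monic_zro[of f g] by simp

lemma epic_zeroI:
  "epic D f \<Longrightarrow> g \<in> Arr D \<Longrightarrow> Dom D g = Cod D f \<Longrightarrow> Cod D f = a \<Longrightarrow> Cod D g = b \<Longrightarrow>
    g \<cdot> f = Zro D (Dom D f) b \<Longrightarrow> g = Zro D a b"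
  using epic_zro[of f g] by simp

end

context abelian_category
begin

lemma extensionsD:
  assumes "(i, p) \<in> extensions D A B"
  shows "short_exact D i p" "i \<in> Arr D" "p \<in> Arr D" "Dom D i = B" "Cod D i = Dom D p" "Cod D p = A"
    "A \<in> Obj D" "B \<in> Obj D" "Dom D p \<in> Obj D" "p \<cdot> i = Zro D B A"
  using assms short_exactD[of i p] dom_obj[of i] cod_obj[of p] dom_obj[of p] by (auto simp: extensions_def)

lemma ext_morE:
  assumes "ext_mor D (i, p) (i', p') f g"
  obtains h where "h \<in> Arr D" "Dom D h = Cod D i" "Cod D h = Cod D i'" "h \<cdot> i = i' \<cdot> f" "p' \<cdot> h = g \<cdot> p"
  using assms by (auto simp: ext_mor_def Hom_def)

lemma ext_morI:
  "h \<in> Arr D \<Longrightarrow> Dom D h = Cod D i \<Longrightarrow> Cod D h = Cod D i' \<Longrightarrow> h \<cdot> i = i' \<cdot> f \<Longrightarrow> p' \<cdot> h = g \<cdot> p \<Longrightarrow>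
    ext_mor D (i, p) (i', p') f g"
  by (auto simp: ext_mor_def Hom_def)

lemma ext_mor_comp:
  assumes e: "e \<in> extensions D A B" "e' \<in> extensions D A' B'" "e'' \<in> extensions D A'' B''"
    and f: "f \<in> Hom D B B'" "f' \<in> Hom D B' B''" and g: "g \<in> Hom D A A'" "g' \<in> Hom D A' A''"
    and m: "ext_mor D e e' f g" "ext_mor D e' e'' f' g'"
  shows "ext_mor D e e'' (f' \<cdot> f) (g' \<cdot> g)"
proof -
  obtain i p i' p' i'' p'' where ep: "e = (i, p)" "e' = (i', p')" "e'' = (i'', p'')"
    by (metis surj_pair)
  note eD = extensionsD[OF e(1)[unfolded ep]] extensionsD[OF e(2)[unfolded ep]] extensionsD[OF e(3)[unfolded ep]]
  obtain h where h: "h \<in> Arr D" "Dom D h = Cod D i" "Cod D h = Cod D i'" "h \<cdot> i = i' \<cdot> f" "p' \<cdot> h = g \<cdot> p"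
    using m(1)[unfolded ep] by (rule ext_morE)
  obtain h' where h': "h' \<in> Arr D" "Dom D h' = Cod D i'" "Cod D h' = Cod D i''" "h' \<cdot> i' = i'' \<cdot> f'" "p'' \<cdot> h' = g' \<cdot> p'"
    using m(2)[unfolded ep] by (rule ext_morE)
  note s = f[THEN HomE] g[THEN HomE]
  show ?thesis unfolding ep
    by (rule ext_morI[of "h' \<cdot> h"])
       (use h h' eD s comp_reassoc[OF h'(4)] comp_reassoc[OF h'(5)] in simp_all)
qed

lemma ext_mor_refl: "e \<in> extensions D A B \<Longrightarrow> ext_mor D e e (Idn D B) (Idn D A)"
proof -
  obtain i p where e: "e = (i, p)" by (cases e)
  assume "e \<in> extensions D A B"
  note eD = extensionsD[OF this[unfolded e]]
  show ?thesis unfolding e by (rule ext_morI[of "Idn D (Cod D i)"]) (use eD in simp_all)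
qed

lemma extensions_obj: "e \<in> extensions D A B \<Longrightarrow> A \<in> Obj D \<and> B \<in> Obj D"
  by (cases e) (auto dest: extensionsD)

text \<open>By the short five lemma, invertibility of the middle arrow is automatic.\<close>

lemma ext_rel_iff:
  "(e, e') \<in> ext_rel D A B \<longleftrightarrow> e \<in> extensions D A B \<and> e' \<in> extensions D A B \<and> ext_mor D e e' (Idn D B) (Idn D A)"
proof -
  obtain i p i' p' where ep: "e = (i, p)" "e' = (i', p')" by (metis surj_pair)
  show ?thesis
  proof
    assume "(e, e') \<in> ext_rel D A B"
    then have e: "e \<in> extensions D A B" "e' \<in> extensions D A B"
      and h: "\<exists>h\<in>Hom D (Cod D i) (Cod D i'). h \<cdot> i = i' \<and> p' \<cdot> h = p"
      by (auto simp: ext_rel_def ep)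
    note eD = extensionsD[OF e(1)[unfolded ep]] extensionsD[OF e(2)[unfolded ep]]
    show "e \<in> extensions D A B \<and> e' \<in> extensions D A B \<and> ext_mor D e e' (Idn D B) (Idn D A)"
      using e h eD by (auto simp: ext_mor_def ep)
  next
    assume r: "e \<in> extensions D A B \<and> e' \<in> extensions D A B \<and> ext_mor D e e' (Idn D B) (Idn D A)"
    then have e: "(i, p) \<in> extensions D A B" "(i', p') \<in> extensions D A B" by (simp_all add: ep)
    note eD = extensionsD[OF e(1)] extensionsD[OF e(2)]
    note S = short_exactD[OF eD(1)] and S' = short_exactD[OF eD(11)]
    from r obtain h where h: "h \<in> Arr D" "Dom D h = Cod D i" "Cod D h = Cod D i'" "h \<cdot> i = i'" "p' \<cdot> h = p"
      unfolding ep using eD by (auto elim!: ext_morE)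
    note hr = comp_reassoc[OF h(4)] comp_reassoc[OF h(5)]
    \<comment> \<open>What \<open>h\<close> kills is killed by \<open>p\<close>, hence of the form
      \<open>i \<cdot> u\<close>; then \<open>i' \<cdot> u\<close> vanishes and so does
      \<open>u\<close>. Epicness below is the dual chase.\<close>
    have "monic D h"
    proof (rule monicI[OF h(1)])
      fix g assume g: "g \<in> Arr D" "Cod D g = Dom D h" "h \<cdot> g = Zro D (Dom D g) (Cod D h)"
      note og = dom_obj[OF g(1)]
      have "p \<cdot> g = p' \<cdot> (h \<cdot> g)" by (rule hr(2)[symmetric]) (use g h eD in simp_all)
      then have "p \<cdot> g = Zro D (Dom D g) A" using g h eD og by simp
      then obtain u where u: "u \<in> Arr D" "Dom D u = Dom D g" "Cod D u = B" "i \<cdot> u = g"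
        using is_kernel_lift[OF S(7), of g] g h eD by auto
      have "i' \<cdot> u = h \<cdot> (i \<cdot> u)" by (rule hr(1)[symmetric]) (use u h eD in simp_all)
      then have iu: "i' \<cdot> u = Zro D (Dom D g) (Cod D i')" using u g h by simp
      have "u = Zro D (Dom D g) B" by (rule monic_zeroI[OF S'(5)]) (use u iu eD in simp_all)
      then have "i \<cdot> u = Zro D (Dom D g) (Dom D h)" using h eD og by simp
      then show "g = Zro D (Dom D g) (Dom D h)" using u(4) by simp
    qed
    moreover have "epic D h"
    proof (rule epicI[OF h(1)])
      fix g assume g: "g \<in> Arr D" "Dom D g = Cod D h" "g \<cdot> h = Zro D (Dom D h) (Cod D g)"
      note og = cod_obj[OF g(1)]
      have "(g \<cdot> h) \<cdot> i = g \<cdot> i'" using comp_assoc_right[of i h g] g h eD by simp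
      then have "g \<cdot> i' = Zro D B (Cod D g)" using g h eD og by simp
      then obtain u where u: "u \<in> Arr D" "Dom D u = A" "Cod D u = Cod D g" "u \<cdot> p' = g"
        using is_cokernel_lift[OF S'(8), of g] g h eD by auto
      have "g \<cdot> h = u \<cdot> p" using comp_assoc_right[of h p' u] u h eD by simp
      then have up: "u \<cdot> p = Zro D (Dom D p) (Cod D g)" using g h eD by simp
      have "u = Zro D A (Cod D g)" by (rule epic_zeroI[OF S(6)]) (use u up eD in simp_all)
      then have "u \<cdot> p' = Zro D (Cod D h) (Cod D g)" using h eD og by simp
      then show "g = Zro D (Cod D h) (Cod D g)" using u(4) by simp
    qed
    ultimately have "iso_arr D h" by (rule monic_epic_iso)
    then show "(e, e') \<in> ext_rel D A B" using e h by (auto simp: ext_rel_def ep Hom_def)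
  qed
qed

lemma ext_rel_equiv: "equiv (extensions D A B) (ext_rel D A B)"
proof (rule equivI)
  show "ext_rel D A B \<subseteq> extensions D A B \<times> extensions D A B" by (auto simp: ext_rel_def)
  show "refl_on (extensions D A B) (ext_rel D A B)"
    by (rule refl_onI) (auto simp: ext_rel_iff ext_mor_refl)
  show "sym (ext_rel D A B)"
  proof (rule symI)
    fix e e' assume r: "(e, e') \<in> ext_rel D A B"
    obtain i p i' p' where ep: "e = (i, p)" "e' = (i', p')" by (metis surj_pair)
    from r have e: "(i, p) \<in> extensions D A B" "(i', p') \<in> extensions D A B" by (auto simp: ext_rel_def ep)
    note eD = extensionsD[OF e(1)] extensionsD[OF e(2)]
    from r obtain h where h: "iso_arr D h" "h \<in> Hom D (Cod D i) (Cod D i')" "h \<cdot> i = i'" "p' \<cdot> h = p"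
      by (auto simp: ext_rel_def ep)
    obtain g where g: "h \<in> Arr D" "g \<in> Arr D" "Dom D g = Cod D h" "Cod D g = Dom D h"
      "g \<cdot> h = Idn D (Dom D h)" "h \<cdot> g = Idn D (Cod D h)" using h(1) by (rule iso_arrE)
    have "g \<cdot> i' = i" "p \<cdot> g = p'"
      using h(2-4) g eD comp_reassoc[OF g(5), of i] comp_assoc_right[of g h p'] by (auto simp: Hom_def)
    then have "ext_mor D e' e (Idn D B) (Idn D A)"
      unfolding ep using g h(2) eD by (intro ext_morI[of g]) (auto simp: Hom_def)
    then show "(e', e) \<in> ext_rel D A B" using e by (simp add: ext_rel_iff ep)
  qed
  show "trans (ext_rel D A B)"
  proof (rule transI)
    fix e e' e'' assume r: "(e, e') \<in> ext_rel D A B" "(e', e'') \<in> ext_rel D A B"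
    then have e: "e \<in> extensions D A B" "e' \<in> extensions D A B" "e'' \<in> extensions D A B" by (auto simp: ext_rel_def)
    have ob: "A \<in> Obj D" "B \<in> Obj D" using extensions_obj[OF e(1)] by simp_all
    show "(e, e'') \<in> ext_rel D A B"
      using ext_mor_comp[OF e idn_hom[OF ob(2)] idn_hom[OF ob(2)] idn_hom[OF ob(1)] idn_hom[OF ob(1)]] r e ob
      by (simp add: ext_rel_iff)
  qed
qed

text \<open>The pullback object is the kernel of the difference of \<open>p\<close> and
  \<open>f\<close> on the biproduct of \<open>Cod D i\<close> and \<open>A'\<close>, and its
  universal property is that of the kernel read through the two projections. Abelianness enters for
  the epicness of the new projection \<open>p'\<close>.\<close>

lemma pullback_extension:
  assumes e: "(i, p) \<in> extensions D A B" and f: "f \<in> Arr D" "Dom D f = A'" "Cod D f = A"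
  obtains i' p' h where "(i', p') \<in> extensions D A' B"
    "h \<in> Arr D" "Dom D h = Cod D i'" "Cod D h = Cod D i" "h \<cdot> i' = i" "p \<cdot> h = f \<cdot> p'"
    "\<And>u v. u \<in> Arr D \<Longrightarrow> v \<in> Arr D \<Longrightarrow> Dom D u = Dom D v \<Longrightarrow> Cod D u = Cod D i \<Longrightarrow> Cod D v = A' \<Longrightarrow>
       p \<cdot> u = f \<cdot> v \<Longrightarrow> \<exists>!w. w \<in> Hom D (Dom D u) (Cod D i') \<and> h \<cdot> w = u \<and> p' \<cdot> w = v"
proof -
  note eD = extensionsD[OF e]
  note S = short_exactD[OF eD(1)]
  let ?E = "Cod D i"
  have A': "A' \<in> Obj D" using f dom_obj by blast
  obtain s j j' q q' where b: "is_biproduct D ?E A' s j j' q q'" using biproduct_ex[of ?E A'] A' eD by metis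
  note bD = is_biproductD[OF b]
  define d where "d = Add D (p \<cdot> q) (neg (f \<cdot> q'))"
  have d: "d \<in> Arr D" "Dom D d = s" "Cod D d = A" using f eD bD(1-15) by (simp_all add: d_def)
  have dx: "d \<cdot> x = Add D (p \<cdot> (q \<cdot> x)) (neg (f \<cdot> (q' \<cdot> x)))" if "x \<in> Arr D" "Cod D x = s" for x
    unfolding d_def by (subst comp_add) (use that f eD bD(1-15) in simp_all)
  have dx0: "d \<cdot> x = Zro D (Dom D x) A \<longleftrightarrow> p \<cdot> (q \<cdot> x) = f \<cdot> (q' \<cdot> x)" if "x \<in> Arr D" "Cod D x = s" for x
  proof
    assume z: "d \<cdot> x = Zro D (Dom D x) A"
    show "p \<cdot> (q \<cdot> x) = f \<cdot> (q' \<cdot> x)"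
      by (rule eq_if_sub_zro) (use z that f eD bD(1-15) dx[OF that] in simp_all)
  next
    assume "p \<cdot> (q \<cdot> x) = f \<cdot> (q' \<cdot> x)"
    then show "d \<cdot> x = Zro D (Dom D x) A" using that f eD bD(1-15) dx[OF that] by simp
  qed
  have dj: "d \<cdot> j = p" using dx[of j] f eD bD by simp
  \<comment> \<open>Restricted along the injection \<open>j\<close>, the arrow \<open>d\<close> is
    the epic \<open>p\<close>.\<close>
  have d_epic: "epic D d"
  proof (rule epicI[OF d(1)])
    fix g assume g: "g \<in> Arr D" "Dom D g = Cod D d" "g \<cdot> d = Zro D (Dom D d) (Cod D g)"
    have "g \<cdot> p = (g \<cdot> d) \<cdot> j" using comp_assoc_right[of j d g] dj g(1,2) d bD(1-15) by simp
    also have "\<dots> = Zro D ?E (Cod D g)" unfolding g(3) using g d bD(1-15) cod_obj[OF g(1)] by simp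
    finally have gp: "g \<cdot> p = Zro D ?E (Cod D g)" .
    show "g = Zro D (Cod D d) (Cod D g)" by (rule epic_zeroI[OF S(6)]) (use gp g(1,2) d eD in simp_all)
  qed
  obtain k where k: "is_kernel D k d" using kernel_ex d by blast
  note kD = is_kernelD[OF k]
  let ?X = "Dom D k"
  have X: "?X \<in> Obj D" using kD dom_obj by blast
  define h where "h = q \<cdot> k"
  define p' where "p' = q' \<cdot> k"
  have h: "h \<in> Arr D" "Dom D h = ?X" "Cod D h = ?E" and p': "p' \<in> Arr D" "Dom D p' = ?X" "Cod D p' = A'"
    using kD d bD(1-15) by (simp_all add: h_def p'_def)
  have sq: "p \<cdot> h = f \<cdot> p'" using dx0[of k] kD d bD by (simp add: h_def p'_def)
  have univ: "\<exists>!w. w \<in> Hom D (Dom D u) ?X \<and> h \<cdot> w = u \<and> p' \<cdot> w = v"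
    if uv: "u \<in> Arr D" "v \<in> Arr D" "Dom D u = Dom D v" "Cod D u = ?E" "Cod D v = A'" "p \<cdot> u = f \<cdot> v" for u v
  proof -
    define t where "t = Add D (j \<cdot> u) (j' \<cdot> v)"
    have t: "t \<in> Arr D" "Dom D t = Dom D u" "Cod D t = s" using uv bD(1-15) by (simp_all add: t_def)
    have qt: "q \<cdot> t = u" "q' \<cdot> t = v" using uv bD by (simp_all add: t_def dom_obj)
    have "d \<cdot> t = Zro D (Dom D t) A" using dx0[of t] t qt uv by simp
    then obtain w where w: "w \<in> Arr D" "Dom D w = Dom D t" "Cod D w = ?X" "k \<cdot> w = t"
      using is_kernel_lift[OF k, of t] t d by auto
    have hw: "h \<cdot> w = u" "p' \<cdot> w = v" using w qt kD d bD(1-15) by (simp_all add: h_def p'_def)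
    have uniq: "w' = w" if w': "w' \<in> Hom D (Dom D u) ?X" "h \<cdot> w' = u" "p' \<cdot> w' = v" for w'
    proof (rule monic_cancel[OF is_kernel_monic[OF k]])
      show "k \<cdot> w' = k \<cdot> w"
        by (rule biproduct_eqI[OF b]) (use w w' t qt kD d bD(1-15) HomE[OF w'(1)] in \<open>simp_all add: h_def p'_def\<close>)
    qed (use w t HomE[OF w'(1)] in simp_all)
    have "w \<in> Hom D (Dom D u) ?X" using w t by (simp add: Hom_def)
    with hw uniq show ?thesis by blast
  qed
  \<comment> \<open>The new inclusion \<open>i'\<close> is the arrow into the pullback with
    components \<open>i\<close> and zero.\<close>
  have "p \<cdot> i = f \<cdot> Zro D B A'" using f eD A' by simp
  then have "\<exists>!w. w \<in> Hom D B ?X \<and> h \<cdot> w = i \<and> p' \<cdot> w = Zro D B A'"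
    using univ[of i "Zro D B A'"] eD A' by simp
  then obtain i' where i': "i' \<in> Hom D B ?X" "h \<cdot> i' = i" "p' \<cdot> i' = Zro D B A'"
    by blast
  note i'h = HomE[OF i'(1)]
  have i'm: "monic D i'"
  proof (rule monicI)
    fix g assume g: "g \<in> Arr D" "Cod D g = Dom D i'" "i' \<cdot> g = Zro D (Dom D g) (Cod D i')"
    have "i \<cdot> g = h \<cdot> (i' \<cdot> g)" by (rule comp_reassoc[OF i'(2), symmetric]) (use g h i'h in simp_all)
    then have "i \<cdot> g = Zro D (Dom D g) (Cod D i)" using g h i'h dom_obj[OF g(1)] by simp
    then have ig: "i \<cdot> g = Zro D (Dom D g) (Cod D i)" .
    show "g = Zro D (Dom D g) (Dom D i')" by (rule monic_zeroI[OF S(5)]) (use ig g(1,2) eD i'h in simp_all)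
  qed (use i'h in simp)
  have ker: "is_kernel D i' p'"
  proof (rule is_kernelI[OF i'm])
    fix g assume g: "g \<in> Arr D" "Cod D g = Dom D p'" "p' \<cdot> g = Zro D (Dom D g) (Cod D p')"
    note og = dom_obj[OF g(1)]
    have "p \<cdot> (h \<cdot> g) = f \<cdot> (p' \<cdot> g)" using comp_reassoc[OF sq, of g] g h p' f eD by simp
    then have hg: "p \<cdot> (h \<cdot> g) = f \<cdot> Zro D (Dom D g) A'" using g p' by simp
    then have "p \<cdot> (h \<cdot> g) = Zro D (Dom D g) A" using f og by simp
    then obtain u where u: "u \<in> Arr D" "Dom D u = Dom D g" "Cod D u = B" "i \<cdot> u = h \<cdot> g"
      using is_kernel_lift[OF S(7), of "h \<cdot> g"] g h p' eD by auto
    have U: "\<exists>!w. w \<in> Hom D (Dom D g) ?X \<and> h \<cdot> w = h \<cdot> g \<and> p' \<cdot> w = Zro D (Dom D g) A'"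
      using univ[of "h \<cdot> g" "Zro D (Dom D g) A'"] hg g h p' og A' by simp
    have "i' \<cdot> u = g"
    proof (rule ex1E[OF U])
      fix w assume w: "\<forall>y. y \<in> Hom D (Dom D g) ?X \<and> h \<cdot> y = h \<cdot> g \<and> p' \<cdot> y = Zro D (Dom D g) A' \<longrightarrow> y = w"
      have "i' \<cdot> u = w"
        by (rule w[rule_format]) (use u g h p' i'h eD og A' comp_reassoc[OF i'(2)] comp_reassoc[OF i'(3)] in \<open>simp add: Hom_def\<close>)
      moreover have "g = w" by (rule w[rule_format]) (use g p' in \<open>simp add: Hom_def\<close>)
      ultimately show ?thesis by simp
    qed
    then show "\<exists>u\<in>Hom D (Dom D g) (Dom D i'). i' \<cdot> u = g" using u i'h by (auto simp: Hom_def)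
  qed (use i' i'h p' in simp_all)
  \<comment> \<open>Being epic, \<open>d\<close> is the cokernel of \<open>k\<close>. If
    \<open>g\<close> kills \<open>p'\<close>, then \<open>g \<cdot> q'\<close> kills
    \<open>k\<close> and equals some \<open>t \<cdot> d\<close>. Restricting along \<open>j\<close>
    gives \<open>t \<cdot> p = 0\<close>, so \<open>t\<close> is zero, and restricting along
    \<open>j'\<close> then shows that \<open>g\<close> is zero.\<close>
  have "epic D p'"
  proof (rule epicI[OF p'(1)])
    fix g assume g: "g \<in> Arr D" "Dom D g = Cod D p'" "g \<cdot> p' = Zro D (Dom D p') (Cod D g)"
    note og = cod_obj[OF g(1)]
    have "is_cokernel D d k" by (rule epic_is_cokernel_of_kernel[OF d_epic k])
    then obtain t where t: "t \<in> Arr D" "Dom D t = A" "Cod D t = Cod D g" "t \<cdot> d = g \<cdot> q'"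
      by (rule is_cokernel_lift[of d k "g \<cdot> q'"]) (use g p' kD d bD(1-15) in \<open>simp_all add: p'_def\<close>)
    have "t \<cdot> p = (t \<cdot> d) \<cdot> j" using comp_assoc_right[of j d t] dj t(1-3) d bD(1-15) by simp
    also have "\<dots> = Zro D ?E (Cod D g)" unfolding t(4) using g p' bD og by simp
    finally have tp: "t \<cdot> p = Zro D ?E (Cod D g)" .
    have "t = Zro D A (Cod D g)" by (rule epic_zeroI[OF S(6)]) (use tp t(1-3) eD in simp_all)
    then have "t \<cdot> d = Zro D s (Cod D g)" using d og by simp
    then have "g \<cdot> q' = Zro D s (Cod D g)" using t(4) by simp
    then have "(g \<cdot> q') \<cdot> j' = Zro D A' (Cod D g)" using bD(1-15) og by simp
    moreover have "(g \<cdot> q') \<cdot> j' = g" using g(1,2) p' bD(1-17) by simp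
    ultimately show "g = Zro D (Cod D p') (Cod D g)" using p' by simp
  qed
  then have "(i', p') \<in> extensions D A' B"
    using short_exactI[OF ker] i'h p' by (simp add: extensions_def)
  moreover have "Dom D h = Cod D i'" using h i'h by simp
  moreover have "\<exists>!w. w \<in> Hom D (Dom D u) (Cod D i') \<and> h \<cdot> w = u \<and> p' \<cdot> w = v"
    if "u \<in> Arr D" "v \<in> Arr D" "Dom D u = Dom D v" "Cod D u = Cod D i" "Cod D v = A'" "p \<cdot> u = f \<cdot> v" for u v
    unfolding conjunct2[OF conjunct2[OF i'h]] by (rule univ[OF that])
  ultimately show thesis
    by (rule that[OF _ h(1) _ h(3) i'(2) sq])
qed

lemma ext_pull_exists:
  assumes e: "e \<in> extensions D A B" and f: "f \<in> Hom D A' A"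
  obtains e' where "e' \<in> extensions D A' B" "ext_mor D e' e (Idn D B) f"
proof -
  obtain i p where ip: "e = (i, p)" by (cases e)
  note eD = extensionsD[OF e[unfolded ip]] and fh = HomE[OF f]
  show thesis
  proof (rule pullback_extension[OF e[unfolded ip], of f A'])
    fix i' p' h assume a: "(i', p') \<in> extensions D A' B"
      "h \<in> Arr D" "Dom D h = Cod D i'" "Cod D h = Cod D i" "h \<cdot> i' = i" "p \<cdot> h = f \<cdot> p'"
    show thesis
    proof (rule that[OF a(1)])
      show "ext_mor D (i', p') e (Idn D B) f" unfolding ip by (rule ext_morI[of h]) (use a eD in simp_all)
    qed
  qed (use fh in simp_all)
qed

text \<open>The universal property belongs to one constructed pullback \<open>(i0, p0)\<close>. It
  passes to every extension \<open>e'\<close> that maps to \<open>e\<close> over \<open>f\<close>,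
  because such an \<open>e'\<close> is equivalent to the constructed one.\<close>

lemma ext_pull_factor:
  assumes e: "e \<in> extensions D A B" "e' \<in> extensions D A' B" "x \<in> extensions D A'' C" and f: "f \<in> Hom D A' A"
    and g: "g \<in> Hom D A'' A'" and c: "c \<in> Hom D C B"
    and m: "ext_mor D e' e (Idn D B) f" "ext_mor D x e c (f \<cdot> g)"
  shows "ext_mor D x e' c g"
proof -
  obtain i p i' p' j r where ep: "e = (i, p)" "e' = (i', p')" "x = (j, r)" by (metis surj_pair)
  note eD = extensionsD[OF e(1)[unfolded ep]] extensionsD[OF e(2)[unfolded ep]] extensionsD[OF e(3)[unfolded ep]]
  note s = HomE[OF f] HomE[OF g] HomE[OF c]
  obtain i0 p0 h0 where e0: "(i0, p0) \<in> extensions D A' B"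
    "h0 \<in> Arr D" "Dom D h0 = Cod D i0" "Cod D h0 = Cod D i" "h0 \<cdot> i0 = i" "p \<cdot> h0 = f \<cdot> p0"
    and univ: "\<And>u v. u \<in> Arr D \<Longrightarrow> v \<in> Arr D \<Longrightarrow> Dom D u = Dom D v \<Longrightarrow> Cod D u = Cod D i \<Longrightarrow> Cod D v = A' \<Longrightarrow>
       p \<cdot> u = f \<cdot> v \<Longrightarrow> \<exists>!w. w \<in> Hom D (Dom D u) (Cod D i0) \<and> h0 \<cdot> w = u \<and> p0 \<cdot> w = v"
    by (rule pullback_extension[OF e(1)[unfolded ep], of f A']) (use s in simp_all)
  note e0D = extensionsD[OF e0(1)]
  have key: "ext_mor D y (i0, p0) d g'" if y: "y \<in> extensions D A0 C'" and g': "g' \<in> Hom D A0 A'" and d: "d \<in> Hom D C' B"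
    and my: "ext_mor D y e d (f \<cdot> g')" for y d g' A0 C'
  proof -
    obtain k t where yp: "y = (k, t)" by (cases y)
    note yD = extensionsD[OF y[unfolded yp]] and s' = s HomE[OF g'] HomE[OF d]
    obtain h where h: "h \<in> Arr D" "Dom D h = Cod D k" "Cod D h = Cod D i" "h \<cdot> k = i \<cdot> d" "p \<cdot> h = (f \<cdot> g') \<cdot> t"
      using my[unfolded yp ep] by (rule ext_morE)
    have "p \<cdot> h = f \<cdot> (g' \<cdot> t)" using h yD s' by simp
    then have "\<exists>!w. w \<in> Hom D (Cod D k) (Cod D i0) \<and> h0 \<cdot> w = h \<and> p0 \<cdot> w = g' \<cdot> t"
      using univ[of h "g' \<cdot> t"] h yD s' by simp
    then obtain w where w: "w \<in> Hom D (Cod D k) (Cod D i0)" "h0 \<cdot> w = h" "p0 \<cdot> w = g' \<cdot> t"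
      by blast
    note wh = HomE[OF w(1)]
    have "p \<cdot> (i \<cdot> d) = f \<cdot> Zro D C' A'"
      using comp_reassoc[OF eD(10)] eD yD s' by simp
    then have U: "\<exists>!x. x \<in> Hom D C' (Cod D i0) \<and> h0 \<cdot> x = i \<cdot> d \<and> p0 \<cdot> x = Zro D C' A'"
      using univ[of "i \<cdot> d" "Zro D C' A'"] eD yD s' by simp
    \<comment> \<open>Both arrows into the pullback have the components \<open>i \<cdot> d\<close>
      and zero, so uniqueness identifies them.\<close>
    have "w \<cdot> k = i0 \<cdot> d"
    proof (rule ex1E[OF U])
      fix z assume z: "\<forall>y. y \<in> Hom D C' (Cod D i0) \<and> h0 \<cdot> y = i \<cdot> d \<and> p0 \<cdot> y = Zro D C' A' \<longrightarrow> y = z"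
      have "w \<cdot> k = z"
        by (rule z[rule_format]) (use wh yD e0 e0D h s' comp_reassoc[OF w(2)] comp_reassoc[OF w(3)] in \<open>simp add: Hom_def\<close>)
      moreover have "i0 \<cdot> d = z"
        by (rule z[rule_format]) (use yD e0 e0D eD s' comp_reassoc[OF e0(5)] comp_reassoc[OF e0D(10)] in \<open>simp add: Hom_def\<close>)
      ultimately show ?thesis by simp
    qed
    then show ?thesis unfolding yp using wh w yD s' by (intro ext_morI[of w]) auto
  qed
  have ob: "A' \<in> Obj D" "B \<in> Obj D" using eD by auto
  \<comment> \<open>Taken with identities, \<open>key\<close> says that \<open>e'\<close> is
    equivalent to the constructed pullback. The equivalence is reversed and composed with the
    factorization of \<open>x\<close>.\<close>
  have "ext_mor D e' e (Idn D B) (f \<cdot> Idn D A')" using m(1) s by simp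
  then have "(e', (i0, p0)) \<in> ext_rel D A' B"
    using key[OF e(2) idn_hom[OF ob(1)] idn_hom[OF ob(2)]] e(2) e0(1) by (simp add: ext_rel_iff)
  then have m': "ext_mor D (i0, p0) e' (Idn D B) (Idn D A')"
    using equivE[OF ext_rel_equiv[of A' B]] by (metis ext_rel_iff symD)
  have "ext_mor D x (i0, p0) c g" by (rule key[OF e(3) g c m(2)])
  from ext_mor_comp[OF e(3) e0(1) e(2) c idn_hom[OF ob(2)] g idn_hom[OF ob(1)] this m']
  show ?thesis using s by simp
qed

lemma ext_push_exists:
  assumes e: "e \<in> extensions D A B" and f: "f \<in> Hom D B B'"
  obtains e' where "e' \<in> extensions D A B'" "ext_mor D e e' f (Idn D A)"
proof -
  obtain i p where ip: "e = (i, p)" by (cases e)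
  \<comment> \<open>In the opposite category \<open>(p, i)\<close> is an extension of
    \<open>B\<close> by \<open>A\<close> and \<open>f\<close> runs from \<open>B'\<close> to
    \<open>B\<close>; its pullback there is the pushout here.\<close>
  obtain e' where e': "e' \<in> extensions (op_lin D) B' A" "ext_mor (op_lin D) e' (p, i) (Idn (op_lin D) A) f"
    using abelian_category.ext_pull_exists[OF abelian_op_lin[OF abelian_category_axioms], of "(p, i)" B A f B'] e f
    by (auto simp: ip extensions_op_lin)
  have x: "prod.swap e' \<in> extensions D A B'" using e' by (cases e') (auto simp: extensions_op_lin)
  have "Cod D (fst e) = Dom D (snd e)" "Cod D (fst (prod.swap e')) = Dom D (snd (prod.swap e'))"
    using extensionsD(5) x e by (metis prod.collapse)+
  from ext_mor_op_lin[OF this] show thesis using that[OF x] e'(2) by (simp add: ip)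
qed

lemma ext_push_factor:
  assumes e: "e \<in> extensions D A B" "e' \<in> extensions D A B'" "x \<in> extensions D C B''" and f: "f \<in> Hom D B B'"
    and g: "g \<in> Hom D B' B''" and c: "c \<in> Hom D A C"
    and m: "ext_mor D e e' f (Idn D A)" "ext_mor D e x (g \<cdot> f) c"
  shows "ext_mor D e' x g c"
proof -
  have t: "Cod D (fst e) = Dom D (snd e)" "Cod D (fst e') = Dom D (snd e')" "Cod D (fst x) = Dom D (snd x)"
    using extensionsD(5) e by (metis prod.collapse)+
  have s: "prod.swap e \<in> extensions (op_lin D) B A" "prod.swap e' \<in> extensions (op_lin D) B' A"
    "prod.swap x \<in> extensions (op_lin D) B'' C"
    using e by (cases e; cases e'; cases x; simp add: extensions_op_lin)+
  have "ext_mor (op_lin D) (prod.swap x) (prod.swap e') c g"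
    by (rule abelian_category.ext_pull_factor[OF abelian_op_lin[OF abelian_category_axioms] s])
       (use f g c m t in \<open>simp_all add: ext_mor_op_lin\<close>)
  then show ?thesis using ext_mor_op_lin[of D e' x, OF t(2,3)] by simp
qed

end

section \<open>The group of extensions\<close>

context abelian_category
begin

section \<open>Equivalence classes of extensions under pullback and pushout\<close>

lemma ext_class_iff:
  "e \<in> extensions D A B \<Longrightarrow> e' \<in> ext_class D A B e \<longleftrightarrow> e' \<in> extensions D A B \<and> ext_mor D e e' (Idn D B) (Idn D A)"
  by (simp add: ext_rel_iff)

lemma ext_class_eq_iff:
  "e \<in> extensions D A B \<Longrightarrow> e' \<in> extensions D A B \<Longrightarrow>
    ext_class D A B e = ext_class D A B e' \<longleftrightarrow> ext_mor D e e' (Idn D B) (Idn D A)"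
  using eq_equiv_class_iff[OF ext_rel_equiv[of A B], of e e'] by (simp add: ext_rel_iff)

lemma ext_mor_push_comp:
  assumes e: "e \<in> extensions D A B" "e' \<in> extensions D A B'" "e'' \<in> extensions D A B''"
    and f: "f \<in> Hom D B B'" "f' \<in> Hom D B' B''"
    and m: "ext_mor D e e' f (Idn D A)" "ext_mor D e' e'' f' (Idn D A)"
  shows "ext_mor D e e'' (f' \<cdot> f) (Idn D A)"
proof -
  have A: "A \<in> Obj D" using extensions_obj[OF e(1)] by simp
  show ?thesis using ext_mor_comp[OF e f idn_hom[OF A] idn_hom[OF A] m] A by simp
qed

lemma ext_mor_pull_comp:
  assumes e: "e \<in> extensions D A B" "e' \<in> extensions D A' B" "e'' \<in> extensions D A'' B"
    and g: "g \<in> Hom D A A'" "g' \<in> Hom D A' A''"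
    and m: "ext_mor D e e' (Idn D B) g" "ext_mor D e' e'' (Idn D B) g'"
  shows "ext_mor D e e'' (Idn D B) (g' \<cdot> g)"
proof -
  have B: "B \<in> Obj D" using extensions_obj[OF e(1)] by simp
  show ?thesis using ext_mor_comp[OF e idn_hom[OF B] idn_hom[OF B] g m] B by simp
qed

text \<open>Composition of morphisms gives one direction and factorization through the pushout the
  other. Hence the extensions reached from \<open>e\<close> along \<open>f\<close> make up exactly
  one class, which is what lets \<open>ext_push\<close> collect all of them.\<close>

lemma ext_mor_push_class:
  assumes e: "e \<in> extensions D A B" "e' \<in> extensions D A B'" and f: "f \<in> Hom D B B'"
    and m: "ext_mor D e e' f (Idn D A)"
  shows "e'' \<in> ext_class D A B' e' \<longleftrightarrow> e'' \<in> extensions D A B' \<and> ext_mor D e e'' f (Idn D A)"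
proof -
  have ob: "A \<in> Obj D" "B' \<in> Obj D" using extensions_obj[OF e(2)] by simp_all
  have f1: "Idn D B' \<cdot> f = f" using HomE[OF f] by simp
  have "ext_mor D e' e'' (Idn D B') (Idn D A) \<longleftrightarrow> ext_mor D e e'' f (Idn D A)" if x: "e'' \<in> extensions D A B'"
    using ext_mor_push_comp[OF e x f idn_hom[OF ob(2)] m]
      ext_push_factor[OF e x f idn_hom[OF ob(2)] idn_hom[OF ob(1)] m] f1 by auto
  then show ?thesis unfolding ext_class_iff[OF e(2)] by blast
qed

lemma ext_mor_pull_class:
  assumes e: "e \<in> extensions D A B" "e' \<in> extensions D A' B" and f: "f \<in> Hom D A' A"
    and m: "ext_mor D e' e (Idn D B) f"
  shows "e'' \<in> ext_class D A' B e' \<longleftrightarrow> e'' \<in> extensions D A' B \<and> ext_mor D e'' e (Idn D B) f"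
proof -
  have ob: "A' \<in> Obj D" "B \<in> Obj D" using extensions_obj[OF e(2)] by simp_all
  have f1: "f \<cdot> Idn D A' = f" using HomE[OF f] by simp
  have "ext_mor D e'' e' (Idn D B) (Idn D A') \<longleftrightarrow> ext_mor D e'' e (Idn D B) f" if x: "e'' \<in> extensions D A' B"
    using ext_mor_pull_comp[OF x e(2,1) idn_hom[OF ob(1)] f _ m]
      ext_pull_factor[OF e x f idn_hom[OF ob(1)] idn_hom[OF ob(2)] m] f1 by auto
  \<comment> \<open>Factorization through a pullback produces a morphism into \<open>e'\<close>,
    while a class is described by morphisms out of its representative; symmetry of
    \<open>ext_rel\<close> reconciles the two.\<close>
  moreover have "e'' \<in> ext_class D A' B e' \<longleftrightarrow> e'' \<in> extensions D A' B \<and> ext_mor D e'' e' (Idn D B) (Idn D A')"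
    using symD[of "ext_rel D A' B"] equivE[OF ext_rel_equiv[of A' B]] ext_rel_iff[of _ _ A' B] e(2)
    by (metis Image_singleton_iff)
  ultimately show ?thesis by blast
qed

lemma ext_push_iff:
  assumes "\<xi> \<subseteq> extensions D A B" "f \<in> Hom D B B'" "\<xi> \<noteq> {}"
  shows "e' \<in> ext_push D f \<xi> \<longleftrightarrow> e' \<in> extensions D A B' \<and> (\<exists>e\<in>\<xi>. ext_mor D e e' f (Idn D A))"
proof -
  obtain i' p' where e': "e' = (i', p')" by (cases e')
  have "(\<exists>(i, p)\<in>\<xi>. Dom D i = Dom D f \<and> Cod D p' = Cod D p \<and>
        (\<exists>h\<in>Hom D (Cod D i) (Cod D i'). h \<cdot> i = i' \<cdot> f \<and> p' \<cdot> h = p)) \<longleftrightarrow>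
      Cod D p' = A \<and> (\<exists>e\<in>\<xi>. ext_mor D e e' f (Idn D A))" (is "?L \<longleftrightarrow> ?R")
  proof
    assume ?L
    then obtain i p h where ip: "(i, p) \<in> \<xi>" "Dom D i = Dom D f" "Cod D p' = Cod D p"
      "h \<in> Hom D (Cod D i) (Cod D i')" "h \<cdot> i = i' \<cdot> f" "p' \<cdot> h = p" by blast
    note eD = extensionsD[OF subsetD[OF assms(1) ip(1)]]
    have "ext_mor D (i, p) e' f (Idn D A)" using ip eD by (auto simp: ext_mor_def e')
    then show ?R using ip eD by auto
  next
    assume ?R
    then obtain i p where ip: "(i, p) \<in> \<xi>" "Cod D p' = A" "ext_mor D (i, p) e' f (Idn D A)" by auto
    note eD = extensionsD[OF subsetD[OF assms(1) ip(1)]]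
    show ?L using ip eD HomE[OF assms(2)] by (intro bexI[of _ "(i, p)"]) (auto simp: ext_mor_def e')
  qed
  then show ?thesis using HomE[OF assms(2)] by (auto simp: e' ext_push_def extensions_def)
qed

lemma ext_pull_iff:
  assumes "\<xi> \<subseteq> extensions D A B" "f \<in> Hom D A' A" "\<xi> \<noteq> {}"
  shows "e' \<in> ext_pull D f \<xi> \<longleftrightarrow> e' \<in> extensions D A' B \<and> (\<exists>e\<in>\<xi>. ext_mor D e' e (Idn D B) f)"
proof -
  obtain i' p' where e': "e' = (i', p')" by (cases e')
  have "(\<exists>(i, p)\<in>\<xi>. Dom D i' = Dom D i \<and> Cod D p = Cod D f \<and>
        (\<exists>h\<in>Hom D (Cod D i') (Cod D i). h \<cdot> i' = i \<and> p \<cdot> h = f \<cdot> p')) \<longleftrightarrow>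
      Dom D i' = B \<and> (\<exists>e\<in>\<xi>. ext_mor D e' e (Idn D B) f)" (is "?L \<longleftrightarrow> ?R")
  proof
    assume ?L
    then obtain i p h where ip: "(i, p) \<in> \<xi>" "Dom D i' = Dom D i" "Cod D p = Cod D f"
      "h \<in> Hom D (Cod D i') (Cod D i)" "h \<cdot> i' = i" "p \<cdot> h = f \<cdot> p'" by blast
    note eD = extensionsD[OF subsetD[OF assms(1) ip(1)]]
    have "ext_mor D e' (i, p) (Idn D B) f" using ip eD by (auto simp: ext_mor_def e')
    then show ?R using ip eD by auto
  next
    assume ?R
    then obtain i p where ip: "(i, p) \<in> \<xi>" "Dom D i' = B" "ext_mor D e' (i, p) (Idn D B) f" by auto
    note eD = extensionsD[OF subsetD[OF assms(1) ip(1)]]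
    show ?L using ip eD HomE[OF assms(2)] by (intro bexI[of _ "(i, p)"]) (auto simp: ext_mor_def e')
  qed
  then show ?thesis using HomE[OF assms(2)] by (auto simp: e' ext_pull_def extensions_def)
qed

lemma ext_class_self: "e \<in> extensions D A B \<Longrightarrow> e \<in> ext_class D A B e"
  by (simp add: ext_rel_iff ext_mor_refl)

lemma ext_class_sub: "ext_class D A B e \<subseteq> extensions D A B"
  by (auto simp: ext_rel_def)

text \<open>A morphism out of another representative becomes one out of \<open>e\<close> after
  composition with the equivalence. So the action on a class can be computed from one pushout of one
  representative.\<close>

lemma ext_push_class:
  assumes e: "e \<in> extensions D A B" "e' \<in> extensions D A B'" and f: "f \<in> Hom D B B'"
    and m: "ext_mor D e e' f (Idn D A)"
  shows "ext_push D f (ext_class D A B e) = ext_class D A B' e'"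
proof (rule Set.set_eqI)
  fix x
  have ob: "B \<in> Obj D" using extensions_obj[OF e(1)] by simp
  have f1: "f \<cdot> Idn D B = f" using HomE[OF f] by simp
  have "ext_mor D e x f (Idn D A)" if x: "x \<in> extensions D A B'" and y: "y \<in> ext_class D A B e" "ext_mor D y x f (Idn D A)" for y
    using ext_mor_push_comp[OF e(1) _ x idn_hom[OF ob] f _ y(2)] y(1)[unfolded ext_class_iff[OF e(1)]] f1 by simp
  then show "x \<in> ext_push D f (ext_class D A B e) \<longleftrightarrow> x \<in> ext_class D A B' e'"
    unfolding ext_mor_push_class[OF e f m]
    using ext_push_iff[OF ext_class_sub f, of A e x] ext_class_self[OF e(1)] by blast
qed

lemma ext_pull_class:
  assumes e: "e \<in> extensions D A B" "e' \<in> extensions D A' B" and f: "f \<in> Hom D A' A"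
    and m: "ext_mor D e' e (Idn D B) f"
  shows "ext_pull D f (ext_class D A B e) = ext_class D A' B e'"
proof (rule Set.set_eqI)
  fix x
  have ob: "A \<in> Obj D" using extensions_obj[OF e(1)] by simp
  have f1: "Idn D A \<cdot> f = f" using HomE[OF f] by simp
  have "ext_mor D x e (Idn D B) f" if x: "x \<in> extensions D A' B" and y: "y \<in> ext_class D A B e" "ext_mor D x y (Idn D B) f" for y
  proof -
    have y': "y \<in> extensions D A B" "ext_mor D y e (Idn D B) (Idn D A)"
      using y(1) e(1) symD[of "ext_rel D A B"] equivE[OF ext_rel_equiv[of A B]] ext_rel_iff[of _ _ A B]
      by (metis Image_singleton_iff)+
    show ?thesis using ext_mor_pull_comp[OF x y'(1) e(1) f idn_hom[OF ob] y(2) y'(2)] f1 by simp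
  qed
  then show "x \<in> ext_pull D f (ext_class D A B e) \<longleftrightarrow> x \<in> ext_class D A' B e'"
    unfolding ext_mor_pull_class[OF e f m]
    using ext_pull_iff[OF ext_class_sub f, of B e x] ext_class_self[OF e(1)] by blast
qed

section \<open>Direct sums of extensions and the Baer sum\<close>

lemma biproduct_kernel:
  assumes k: "is_kernel D i p" "is_kernel D i' p'"
    and b: "is_biproduct D (Dom D i) (Dom D i') BB b b' qb qb'"
      "is_biproduct D (Cod D i) (Cod D i') EE e1 e2 qe qe'"
      "is_biproduct D (Cod D p) (Cod D p') AA a a' qa qa'"
  shows "is_kernel D (Add D (e1 \<cdot> (i \<cdot> qb)) (e2 \<cdot> (i' \<cdot> qb'))) (Add D (a \<cdot> (p \<cdot> qe)) (a' \<cdot> (p' \<cdot> qe')))"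
    (is "is_kernel D ?I ?P")
proof -
  note kD = is_kernelD[OF k(1)] is_kernelD[OF k(2)]
  note bD = is_biproductD[OF b(1)] is_biproductD[OF b(2)] is_biproductD[OF b(3)]
  note bt = is_biproductD(1-15)[OF b(1)] is_biproductD(1-15)[OF b(2)] is_biproductD(1-15)[OF b(3)]
  have I: "?I \<in> Arr D" "Dom D ?I = BB" "Cod D ?I = EE" using kD bt by simp_all
  have P: "?P \<in> Arr D" "Dom D ?P = EE" "Cod D ?P = AA" using kD bt by simp_all
  \<comment> \<open>Under the projections both sums are diagonal: \<open>Ix\<close> and
    \<open>Px\<close> split each claim about \<open>?I\<close> and \<open>?P\<close> into the same
    claim about the two given kernels.\<close>
  have Ix: "qe \<cdot> (?I \<cdot> x) = i \<cdot> (qb \<cdot> x)" "qe' \<cdot> (?I \<cdot> x) = i' \<cdot> (qb' \<cdot> x)" if "x \<in> Arr D" "Cod D x = BB" for x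
    using that kD bt is_biproductD(21-)[OF b(2)] dom_obj[OF that(1)] by simp_all
  have Px: "qa \<cdot> (?P \<cdot> x) = p \<cdot> (qe \<cdot> x)" "qa' \<cdot> (?P \<cdot> x) = p' \<cdot> (qe' \<cdot> x)" if "x \<in> Arr D" "Cod D x = EE" for x
    using that kD bt is_biproductD(21-)[OF b(3)] dom_obj[OF that(1)] by simp_all
  have PI: "?P \<cdot> ?I = Zro D BB AA"
  proof (rule biproduct_eqI[OF b(3)])
    have qI: "qe \<cdot> ?I = i \<cdot> qb" "qe' \<cdot> ?I = i' \<cdot> qb'" using kD bt is_biproductD(21-)[OF b(2)] by simp_all
    show "qa \<cdot> (?P \<cdot> ?I) = qa \<cdot> Zro D BB AA" "qa' \<cdot> (?P \<cdot> ?I) = qa' \<cdot> Zro D BB AA"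
      unfolding Px[OF I(1,3)] qI using kD bt comp_reassoc[OF kD(4)] comp_reassoc[OF kD(8)] by simp_all
    have t: "Cod D ?I = Dom D ?P" unfolding I(3) P(2) ..
    show "?P \<cdot> ?I \<in> Arr D" "Cod D (?P \<cdot> ?I) = AA"
      using comp_simps(1,3)[OF I(1) P(1) t] P(3) by simp_all
  qed (use bt in simp_all)
  show ?thesis
  proof (rule is_kernelI)
    show "monic D ?I"
    proof (rule monicI[OF I(1)])
      fix g assume g: "g \<in> Arr D" "Cod D g = Dom D ?I" "?I \<cdot> g = Zro D (Dom D g) (Cod D ?I)"
      have g2: "Cod D g = BB" using g(2) unfolding I(2) .
      have g3: "?I \<cdot> g = Zro D (Dom D g) EE" using g(3) unfolding I(3) .
      note og = dom_obj[OF g(1)]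
      have "i \<cdot> (qb \<cdot> g) = Zro D (Dom D g) (Cod D i)" "i' \<cdot> (qb' \<cdot> g) = Zro D (Dom D g) (Cod D i')"
        unfolding Ix[OF g(1) g2, symmetric] g3 using og bt by simp_all
      note iz = this
      have q: "qb \<cdot> g = Zro D (Dom D g) (Dom D i)"
        by (rule monic_zeroI[OF is_kernel_monic[OF k(1)]]) (use iz(1) g(1) g2 bt in simp_all)
      have q': "qb' \<cdot> g = Zro D (Dom D g) (Dom D i')"
        by (rule monic_zeroI[OF is_kernel_monic[OF k(2)]]) (use iz(2) g(1) g2 bt in simp_all)
      have "g = Zro D (Dom D g) BB"
        by (rule biproduct_eqI[OF b(1)]) (use g(1) g2 q q' og bt in simp_all)
      then show "g = Zro D (Dom D g) (Dom D ?I)" unfolding I(2) .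
    qed
    fix g assume g: "g \<in> Arr D" "Cod D g = Dom D ?P" "?P \<cdot> g = Zro D (Dom D g) (Cod D ?P)"
    have g2: "Cod D g = EE" using g(2) unfolding P(2) .
    have g3: "?P \<cdot> g = Zro D (Dom D g) AA" using g(3) unfolding P(3) .
    note og = dom_obj[OF g(1)]
    have pz: "p \<cdot> (qe \<cdot> g) = Zro D (Dom D g) (Cod D p)" "p' \<cdot> (qe' \<cdot> g) = Zro D (Dom D g) (Cod D p')"
      unfolding Px[OF g(1) g2, symmetric] g3 using og bt by simp_all
    obtain u where u: "u \<in> Arr D" "Dom D u = Dom D g" "Cod D u = Dom D i" "i \<cdot> u = qe \<cdot> g"
      using is_kernel_lift[OF k(1), of "qe \<cdot> g"] g(1) g2 kD bt pz by auto
    obtain u' where u': "u' \<in> Arr D" "Dom D u' = Dom D g" "Cod D u' = Dom D i'" "i' \<cdot> u' = qe' \<cdot> g"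
      using is_kernel_lift[OF k(2), of "qe' \<cdot> g"] g(1) g2 kD bt pz by auto
    let ?u = "Add D (b \<cdot> u) (b' \<cdot> u')"
    have U: "?u \<in> Arr D" "Dom D ?u = Dom D g" "Cod D ?u = BB" using u u' bt by simp_all
    have qu: "qb \<cdot> ?u = u" "qb' \<cdot> ?u = u'" using u u' bt is_biproductD(21-)[OF b(1)] og by simp_all
    have "?I \<cdot> ?u = g"
    proof (rule biproduct_eqI[OF b(2)])
      show "qe \<cdot> (?I \<cdot> ?u) = qe \<cdot> g" "qe' \<cdot> (?I \<cdot> ?u) = qe' \<cdot> g"
        unfolding Ix[OF U(1,3)] qu u u' by simp_all
      have t: "Cod D ?u = Dom D ?I" unfolding U(3) I(2) ..
      show "?I \<cdot> ?u \<in> Arr D" "Cod D (?I \<cdot> ?u) = EE"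
        using comp_simps(1,3)[OF U(1) I(1) t] I(3) by simp_all
    qed (use g(1) g2 in simp_all)
    then show "\<exists>h\<in>Hom D (Dom D g) (Dom D ?I). ?I \<cdot> h = g" using U I(2) by (auto simp: Hom_def intro!: bexI[of _ ?u])
  qed (use I P PI in simp_all)
qed

lemma biproduct_extension:
  assumes e: "(i, p) \<in> extensions D A B" "(i', p') \<in> extensions D A' B'"
    and b: "is_biproduct D B B' BB b b' qb qb'"
      "is_biproduct D (Cod D i) (Cod D i') EE e1 e2 qe qe'"
      "is_biproduct D A A' AA a a' qa qa'"
  shows "(Add D (e1 \<cdot> i \<cdot> qb) (e2 \<cdot> i' \<cdot> qb'), Add D (a \<cdot> p \<cdot> qe) (a' \<cdot> p' \<cdot> qe')) \<in> extensions D AA BB"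
proof -
  note eD = extensionsD[OF e(1)] extensionsD[OF e(2)]
  note S = short_exactD[OF eD(1)] short_exactD[OF eD(11)]
  note bt = is_biproductD(1-15)[OF b(1)] is_biproductD(1-15)[OF b(2)] is_biproductD(1-15)[OF b(3)]
  let ?I = "Add D (e1 \<cdot> (i \<cdot> qb)) (e2 \<cdot> (i' \<cdot> qb'))" and ?P = "Add D (a \<cdot> (p \<cdot> qe)) (a' \<cdot> (p' \<cdot> qe'))"
  have k: "is_kernel D ?I ?P"
    by (rule biproduct_kernel[OF S(7,15)]) (use b eD in simp_all)
  \<comment> \<open>Dualization exchanges injections with projections and the sums \<open>?I\<close>
    and \<open>?P\<close> with each other, so the statement on kernels also yields the
    cokernel.\<close>
  have "is_cokernel D ?P ?I"
    using abelian_category.biproduct_kernel[OF abelian_op_lin[OF abelian_category_axioms],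
        of p i p' i' AA qa qa' a a' EE qe qe' e1 e2 BB qb qb' b b'] S b eD bt by simp
  with k have "short_exact D ?I ?P" by (simp add: short_exact_def)
  then have "(?I, ?P) \<in> extensions D AA BB" using eD bt by (simp add: extensions_def)
  then show ?thesis using eD bt by simp
qed

text \<open>A middle arrow into the direct sum is determined by its two projections, and the
  diagonal \<open>Add D a a'\<close> becomes the identity under either projection of
  \<open>AA\<close>. So pulling the direct sum back along the diagonal represents pairs of
  extensions of the same object \<open>A\<close>.\<close>

lemma ext_mor_biproduct_iff:
  assumes e: "(i, p) \<in> extensions D A B" "(i', p') \<in> extensions D A B'" "x \<in> extensions D A BB"
    and b: "is_biproduct D B B' BB b b' qb qb'"
      "is_biproduct D (Cod D i) (Cod D i') EE e1 e2 qe qe'"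
      "is_biproduct D A A AA a a' qa qa'"
  shows "ext_mor D x (Add D (e1 \<cdot> i \<cdot> qb) (e2 \<cdot> i' \<cdot> qb'), Add D (a \<cdot> p \<cdot> qe) (a' \<cdot> p' \<cdot> qe')) (Idn D BB) (Add D a a') \<longleftrightarrow>
    ext_mor D x (i, p) qb (Idn D A) \<and> ext_mor D x (i', p') qb' (Idn D A)"
proof -
  obtain j r where x: "x = (j, r)" by (cases x)
  note eD = extensionsD[OF e(1)] extensionsD[OF e(2)] extensionsD[OF e(3)[unfolded x]]
  note bt = is_biproductD(1-15)[OF b(1)] is_biproductD(1-15)[OF b(2)] is_biproductD(1-15)[OF b(3)]
  note be = is_biproductD(16-)[OF b(1)] is_biproductD(16-)[OF b(2)] is_biproductD(16-)[OF b(3)]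
  let ?I = "Add D (e1 \<cdot> (i \<cdot> qb)) (e2 \<cdot> (i' \<cdot> qb'))" and ?P = "Add D (a \<cdot> (p \<cdot> qe)) (a' \<cdot> (p' \<cdot> qe'))"
  have IP: "?I = Add D (e1 \<cdot> i \<cdot> qb) (e2 \<cdot> i' \<cdot> qb')" "?P = Add D (a \<cdot> p \<cdot> qe) (a' \<cdot> p' \<cdot> qe')"
    using eD bt by simp_all
  have I: "?I \<in> Arr D" "Dom D ?I = BB" "Cod D ?I = EE" using eD bt by simp_all
  have P: "?P \<in> Arr D" "Dom D ?P = EE" "Cod D ?P = AA" using eD bt by simp_all
  have qI: "qe \<cdot> ?I = i \<cdot> qb" "qe' \<cdot> ?I = i' \<cdot> qb'" using eD bt be by simp_all
  have qP: "qa \<cdot> (?P \<cdot> h) = p \<cdot> (qe \<cdot> h)" "qa' \<cdot> (?P \<cdot> h) = p' \<cdot> (qe' \<cdot> h)"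
    if "h \<in> Arr D" "Cod D h = EE" for h using that eD bt be dom_obj[OF that(1)] by simp_all
  have qd: "qa \<cdot> (Add D a a' \<cdot> r) = r" "qa' \<cdot> (Add D a a' \<cdot> r) = r" using eD bt be by simp_all
  have Ar: "Add D a a' \<cdot> r \<in> Arr D" "Cod D (Add D a a' \<cdot> r) = AA" using eD bt by simp_all
  show ?thesis unfolding IP[symmetric] x
  proof
    assume "ext_mor D (j, r) (?I, ?P) (Idn D BB) (Add D a a')"
    then obtain h where h: "h \<in> Arr D" "Dom D h = Cod D j" "Cod D h = EE" "h \<cdot> j = ?I" "?P \<cdot> h = Add D a a' \<cdot> r"
      using I by (auto elim!: ext_morE)
    have "qe \<cdot> h \<cdot> j = i \<cdot> qb" "qe' \<cdot> h \<cdot> j = i' \<cdot> qb'" using h(1-4) qI bt eD by simp_all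
    moreover have "p \<cdot> (qe \<cdot> h) = r" "p' \<cdot> (qe' \<cdot> h) = r" using qP[OF h(1,3)] h(5) qd by simp_all
    ultimately show "ext_mor D (j, r) (i, p) qb (Idn D A) \<and> ext_mor D (j, r) (i', p') qb' (Idn D A)"
      using h(1-3) bt eD by (intro conjI ext_morI[of "qe \<cdot> h"] ext_morI[of "qe' \<cdot> h"]) simp_all
  next
    assume m: "ext_mor D (j, r) (i, p) qb (Idn D A) \<and> ext_mor D (j, r) (i', p') qb' (Idn D A)"
    obtain h where h: "h \<in> Arr D" "Dom D h = Cod D j" "Cod D h = Cod D i" "h \<cdot> j = i \<cdot> qb" "p \<cdot> h = Idn D A \<cdot> r"
      using conjunct1[OF m] by (rule ext_morE)
    obtain h' where h': "h' \<in> Arr D" "Dom D h' = Cod D j" "Cod D h' = Cod D i'" "h' \<cdot> j = i' \<cdot> qb'" "p' \<cdot> h' = Idn D A \<cdot> r"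
      using conjunct2[OF m] by (rule ext_morE)
    let ?h = "Add D (e1 \<cdot> h) (e2 \<cdot> h')"
    have H: "?h \<in> Arr D" "Dom D ?h = Cod D j" "Cod D ?h = EE" using h h' bt eD by simp_all
    have qh: "qe \<cdot> ?h = h" "qe' \<cdot> ?h = h'" using h(1-3) h'(1-3) bt be eD by simp_all
    have "?P \<cdot> ?h = Add D a a' \<cdot> r"
    proof (rule biproduct_eqI[OF b(3)])
      show "qa \<cdot> (?P \<cdot> ?h) = qa \<cdot> (Add D a a' \<cdot> r)" "qa' \<cdot> (?P \<cdot> ?h) = qa' \<cdot> (Add D a a' \<cdot> r)"
        unfolding qP[OF H(1,3)] qh qd using h h' eD by simp_all
      have t: "Cod D ?h = Dom D ?P" unfolding H(3) P(2) ..
      show "?P \<cdot> ?h \<in> Arr D" "Cod D (?P \<cdot> ?h) = AA"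
        using comp_simps(1,3)[OF H(1) P(1) t] P(3) by simp_all
    qed (use Ar in simp_all)
    moreover have "?h \<cdot> j = ?I" using h(1-4) h'(1-4) bt eD by simp
    moreover have "?I \<cdot> Idn D BB = ?I" using I by (intro idn_comp)
    ultimately show "ext_mor D (j, r) (?I, ?P) (Idn D BB) (Add D a a')"
      using H I by (intro ext_morI[of ?h]) simp_all
  qed
qed

lemma ext_rel_sym: "(e, e') \<in> ext_rel D A B \<Longrightarrow> (e', e) \<in> ext_rel D A B"
  using ext_rel_equiv[of A B] by (meson equivE symE)

text \<open>Pulling the direct sum back along the diagonal amounts to giving a common source
  \<open>x\<close> over \<open>B \<oplus> B\<close> that maps to both summands along the
  projections. In this form the auxiliary sums of the middle terms and of two copies of
  \<open>A\<close> have disappeared, and the Baer sum is the pushout of \<open>x\<close> along the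
  codiagonal.\<close>

lemma baer_sum_iff:
  assumes e: "e \<in> extensions D A B" "e' \<in> extensions D A B"
  shows "z \<in> baer_sum D A B (ext_class D A B e) (ext_class D A B e') \<longleftrightarrow>
    (\<exists>BB b b' qb qb' x. is_biproduct D B B BB b b' qb qb' \<and> x \<in> extensions D A BB \<and>
       ext_mor D x e qb (Idn D A) \<and> ext_mor D x e' qb' (Idn D A) \<and>
       z \<in> extensions D A B \<and> ext_mor D x z (Add D qb qb') (Idn D A))" (is "?L \<longleftrightarrow> ?R")
proof -
  have step: "z \<in> ext_push D (Add D qb qb') (ext_pull D (Add D a a')
       {(Add D (e1 \<cdot> i \<cdot> qb) (e2 \<cdot> i' \<cdot> qb'), Add D (a \<cdot> p \<cdot> qe) (a' \<cdot> p' \<cdot> qe'))}) \<longleftrightarrow>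
     (\<exists>x. x \<in> extensions D A BB \<and> ext_mor D x (i, p) qb (Idn D A) \<and> ext_mor D x (i', p') qb' (Idn D A) \<and>
       z \<in> extensions D A B \<and> ext_mor D x z (Add D qb qb') (Idn D A))"
    if ip: "(i, p) \<in> extensions D A B" "(i', p') \<in> extensions D A B"
      and b: "is_biproduct D B B BB b b' qb qb'" "is_biproduct D (Cod D i) (Cod D i') EE e1 e2 qe qe'"
        "is_biproduct D A A AA a a' qa qa'"
    for i p i' p' BB b b' qb qb' EE e1 e2 qe qe' AA a a' qa qa'
  proof -
    let ?s = "(Add D (e1 \<cdot> i \<cdot> qb) (e2 \<cdot> i' \<cdot> qb'), Add D (a \<cdot> p \<cdot> qe) (a' \<cdot> p' \<cdot> qe'))"
    note s = biproduct_extension[OF ip b]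
    have d: "Add D a a' \<in> Hom D A AA" "Add D qb qb' \<in> Hom D BB B"
      using is_biproductD(1-15)[OF b(1)] is_biproductD(1-15)[OF b(3)] by (simp_all add: Hom_def)
    have pull: "x \<in> ext_pull D (Add D a a') {?s} \<longleftrightarrow>
      x \<in> extensions D A BB \<and> ext_mor D x (i, p) qb (Idn D A) \<and> ext_mor D x (i', p') qb' (Idn D A)" for x
      using ext_pull_iff[OF _ d(1), of "{?s}" BB x] s ext_mor_biproduct_iff[OF ip _ b] by blast
    have ne: "ext_pull D (Add D a a') {?s} \<noteq> {}"
    proof (rule ext_pull_exists[OF s d(1)])
      fix x assume "x \<in> extensions D A BB" "ext_mor D x ?s (Idn D BB) (Add D a a')"
      then have "x \<in> ext_pull D (Add D a a') {?s}"
        using ext_pull_iff[OF _ d(1), of "{?s}" BB x] s by blast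
      then show ?thesis by blast
    qed
    have "ext_pull D (Add D a a') {?s} \<subseteq> extensions D A BB" using pull by blast
    from ext_push_iff[OF this d(2) ne, of z] show ?thesis unfolding Bex_def pull by blast
  qed
  \<comment> \<open>The definition lets the two representatives vary over their classes; a morphism
    to one member of a class yields a morphism to every other member.\<close>
  have tr: "ext_mor D x e' qb (Idn D A)"
    if "x \<in> extensions D A BB" "qb \<in> Hom D BB B" "e1 \<in> ext_class D A B e'" "ext_mor D x e1 qb (Idn D A)" "e' \<in> extensions D A B"
    for x qb e1 e' BB
  proof -
    have e1: "e1 \<in> extensions D A B" "e' \<in> ext_class D A B e1"
      using that(3) ext_rel_sym[of e' e1 A B] ext_rel_iff[of e' e1 A B] by simp_all
    show ?thesis using ext_mor_push_class[OF that(1) e1(1) that(2,4)] e1(2) by blast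
  qed
  show ?thesis
  proof
    assume ?L
    then obtain i p i' p' BB b b' qb qb' EE e1 e2 qe qe' AA a a' qa qa' where
      c: "(i, p) \<in> ext_class D A B e" "(i', p') \<in> ext_class D A B e'"
      and b: "is_biproduct D B B BB b b' qb qb'" "is_biproduct D (Cod D i) (Cod D i') EE e1 e2 qe qe'"
        "is_biproduct D A A AA a a' qa qa'"
      and z: "z \<in> ext_push D (Add D qb qb') (ext_pull D (Add D a a')
       {(Add D (e1 \<cdot> i \<cdot> qb) (e2 \<cdot> i' \<cdot> qb'), Add D (a \<cdot> p \<cdot> qe) (a' \<cdot> p' \<cdot> qe'))})"
      unfolding baer_sum_def by blast
    have ip: "(i, p) \<in> extensions D A B" "(i', p') \<in> extensions D A B" using c ext_class_sub by blast+
    obtain x where x: "x \<in> extensions D A BB" "ext_mor D x (i, p) qb (Idn D A)" "ext_mor D x (i', p') qb' (Idn D A)"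
       "z \<in> extensions D A B" "ext_mor D x z (Add D qb qb') (Idn D A)"
      using step[OF ip b] z by blast
    have q: "qb \<in> Hom D BB B" "qb' \<in> Hom D BB B" using is_biproductD[OF b(1)] by (simp_all add: Hom_def)
    show ?R using b(1) x tr[OF x(1) q(1) c(1) x(2) e(1)] tr[OF x(1) q(2) c(2) x(3) e(2)] by blast
  next
    assume ?R
    then obtain BB b b' qb qb' x where b: "is_biproduct D B B BB b b' qb qb'" and x: "x \<in> extensions D A BB"
       "ext_mor D x e qb (Idn D A)" "ext_mor D x e' qb' (Idn D A)"
       "z \<in> extensions D A B" "ext_mor D x z (Add D qb qb') (Idn D A)" by blast
    obtain i p i' p' where ip: "e = (i, p)" "e' = (i', p')" by (metis surj_pair)
    have "Cod D i \<in> Obj D" "Cod D i' \<in> Obj D" "A \<in> Obj D"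
      using extensionsD[OF e(1)[unfolded ip]] extensionsD[OF e(2)[unfolded ip]] by simp_all
    then obtain EE e1 e2 qe qe' AA a a' qa qa' where b': "is_biproduct D (Cod D i) (Cod D i') EE e1 e2 qe qe'"
        "is_biproduct D A A AA a a' qa qa'" using biproduct_ex by metis
    have "z \<in> ext_push D (Add D qb qb') (ext_pull D (Add D a a')
       {(Add D (e1 \<cdot> i \<cdot> qb) (e2 \<cdot> i' \<cdot> qb'), Add D (a \<cdot> p \<cdot> qe) (a' \<cdot> p' \<cdot> qe'))})"
      using step[OF e[unfolded ip] b b'] x[unfolded ip] by blast
    then show ?L unfolding baer_sum_def
      using ext_class_self[OF e(1)] ext_class_self[OF e(2)] b b' ip by blast
  qed
qed

text \<open>Surjectivity of \<open>Ext(A, B \<oplus> B') \<rightarrow> Ext(A, B) \<times> Ext(A,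
  B')\<close>: the direct sum of the two extensions is pulled back along the diagonal of
  \<open>A\<close>.\<close>

lemma ext_pair_exists:
  assumes e: "e \<in> extensions D A B" "e' \<in> extensions D A B'"
    and b: "is_biproduct D B B' BB b b' qb qb'"
  obtains x where "x \<in> extensions D A BB" "ext_mor D x e qb (Idn D A)" "ext_mor D x e' qb' (Idn D A)"
proof -
  obtain i p i' p' where ip: "e = (i, p)" "e' = (i', p')" by (metis surj_pair)
  have "Cod D i \<in> Obj D" "Cod D i' \<in> Obj D" "A \<in> Obj D"
    using extensionsD[OF e(1)[unfolded ip]] extensionsD[OF e(2)[unfolded ip]] by simp_all
  then obtain EE e1 e2 qe qe' AA a a' qa qa' where b': "is_biproduct D (Cod D i) (Cod D i') EE e1 e2 qe qe'"
      "is_biproduct D A A AA a a' qa qa'" using biproduct_ex by metis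
  have "Add D a a' \<in> Hom D A AA" using is_biproductD(1-15)[OF b'(2)] by (simp add: Hom_def)
  from ext_pull_exists[OF biproduct_extension[OF e[unfolded ip] b b'] this] obtain x where
    "x \<in> extensions D A BB" "ext_mor D x (Add D (e1 \<cdot> i \<cdot> qb) (e2 \<cdot> i' \<cdot> qb'), Add D (a \<cdot> p \<cdot> qe) (a' \<cdot> p' \<cdot> qe')) (Idn D BB) (Add D a a')"
    by blast
  then show thesis using that ext_mor_biproduct_iff[OF e[unfolded ip] _ b b'] ip by blast
qed

text \<open>Injectivity of the same map: \<open>x\<close> and \<open>y\<close> are both pullbacks of
  one direct sum along the diagonal, and pullbacks form a single class.\<close>

lemma ext_pair_unique:
  assumes e: "e \<in> extensions D A B" "e' \<in> extensions D A B'"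
    and b: "is_biproduct D B B' BB b b' qb qb'"
    and x: "x \<in> extensions D A BB" "ext_mor D x e qb (Idn D A)" "ext_mor D x e' qb' (Idn D A)"
    and y: "y \<in> extensions D A BB" "ext_mor D y e qb (Idn D A)" "ext_mor D y e' qb' (Idn D A)"
  shows "ext_mor D x y (Idn D BB) (Idn D A)"
proof -
  obtain i p i' p' where ip: "e = (i, p)" "e' = (i', p')" by (metis surj_pair)
  have "Cod D i \<in> Obj D" "Cod D i' \<in> Obj D" and A: "A \<in> Obj D"
    using extensionsD[OF e(1)[unfolded ip]] extensionsD[OF e(2)[unfolded ip]] by simp_all
  then obtain EE e1 e2 qe qe' AA a a' qa qa' where b': "is_biproduct D (Cod D i) (Cod D i') EE e1 e2 qe qe'"
      "is_biproduct D A A AA a a' qa qa'" using biproduct_ex by metis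
  let ?s = "(Add D (e1 \<cdot> i \<cdot> qb) (e2 \<cdot> i' \<cdot> qb'), Add D (a \<cdot> p \<cdot> qe) (a' \<cdot> p' \<cdot> qe'))"
  have d: "Add D a a' \<in> Hom D A AA" using is_biproductD(1-15)[OF b'(2)] by (simp add: Hom_def)
  have "ext_mor D x ?s (Idn D BB) (Add D a a')" "ext_mor D y ?s (Idn D BB) (Add D a a')"
    using ext_mor_biproduct_iff[OF e[unfolded ip] _ b b'] x y ip by blast+
  then have "y \<in> ext_class D A BB x"
    using ext_mor_pull_class[OF biproduct_extension[OF e[unfolded ip] b b'] x(1) d, of y] y(1) by blast
  then show ?thesis by (simp add: ext_rel_iff)
qed

text \<open>\<open>Ext(A, -)\<close> preserves biproducts, so the Baer sum is induced by the addition of arrows out of a common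
  extension; this is the source of all the group axioms.\<close>

lemma baer_sum_push:
  assumes y: "y \<in> extensions D A P" and uv: "u \<in> Hom D P B" "v \<in> Hom D P B"
    and e: "e \<in> extensions D A B" "e' \<in> extensions D A B" "z \<in> extensions D A B"
    and m: "ext_mor D y e u (Idn D A)" "ext_mor D y e' v (Idn D A)" "ext_mor D y z (Add D u v) (Idn D A)"
  shows "baer_sum D A B (ext_class D A B e) (ext_class D A B e') = ext_class D A B z"
proof -
  have ob: "A \<in> Obj D" "B \<in> Obj D" "P \<in> Obj D" using extensions_obj[OF e(1)] extensions_obj[OF y] by simp_all
  note uvh = HomE[OF uv(1)] HomE[OF uv(2)]
  have uvH: "Add D u v \<in> Hom D P B" using uvh by (simp add: Hom_def)
  \<comment> \<open>For any biproduct of \<open>B\<close> with itself, \<open>w\<close> is the arrow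
    with components \<open>u\<close> and \<open>v\<close>. Pushing \<open>y\<close> out along
    \<open>w\<close> gives the common source, and the codiagonal after \<open>w\<close> is
    \<open>u + v\<close>.\<close>
  have factor: "\<exists>x w. x \<in> extensions D A BB \<and> w \<in> Hom D P BB \<and> ext_mor D y x w (Idn D A) \<and>
      ext_mor D x e qb (Idn D A) \<and> ext_mor D x e' qb' (Idn D A) \<and> Add D qb qb' \<cdot> w = Add D u v"
    if b: "is_biproduct D B B BB b b' qb qb'" for BB b b' qb qb'
  proof -
    note bt = is_biproductD(1-15)[OF b] and be = is_biproductD(16-)[OF b]
    let ?w = "Add D (b \<cdot> u) (b' \<cdot> v)"
    have w: "?w \<in> Hom D P BB" using uvh bt by (simp add: Hom_def)
    have q: "qb \<in> Hom D BB B" "qb' \<in> Hom D BB B" using bt by (simp_all add: Hom_def)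
    have qw: "qb \<cdot> ?w = u" "qb' \<cdot> ?w = v" using uvh bt be ob by simp_all
    obtain x where x: "x \<in> extensions D A BB" "ext_mor D y x ?w (Idn D A)" using ext_push_exists[OF y w] .
    have "ext_mor D x e qb (Idn D A)"
      by (rule ext_push_factor[OF y x(1) e(1) w q(1) idn_hom[OF ob(1)] x(2)]) (unfold qw, fact m)
    moreover have "ext_mor D x e' qb' (Idn D A)"
      by (rule ext_push_factor[OF y x(1) e(2) w q(2) idn_hom[OF ob(1)] x(2)]) (unfold qw, fact m)
    moreover have "Add D qb qb' \<cdot> ?w = Add D (qb \<cdot> ?w) (qb' \<cdot> ?w)"
      by (rule comp_add(1)) (use HomE[OF w] bt in simp_all)
    ultimately show ?thesis using x w qw by metis
  qed
  show ?thesis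
  proof (rule Set.set_eqI)
    fix t
    show "t \<in> baer_sum D A B (ext_class D A B e) (ext_class D A B e') \<longleftrightarrow> t \<in> ext_class D A B z"
      unfolding baer_sum_iff[OF e(1,2)] ext_mor_push_class[OF y e(3) uvH m(3)]
    proof
      assume "\<exists>BB b b' qb qb' x. is_biproduct D B B BB b b' qb qb' \<and> x \<in> extensions D A BB \<and>
       ext_mor D x e qb (Idn D A) \<and> ext_mor D x e' qb' (Idn D A) \<and>
       t \<in> extensions D A B \<and> ext_mor D x t (Add D qb qb') (Idn D A)"
      then obtain BB b b' qb qb' x where b: "is_biproduct D B B BB b b' qb qb'" and x: "x \<in> extensions D A BB"
        "ext_mor D x e qb (Idn D A)" "ext_mor D x e' qb' (Idn D A)"
        and t: "t \<in> extensions D A B" "ext_mor D x t (Add D qb qb') (Idn D A)" by blast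
      note bt = is_biproductD(1-15)[OF b]
      have q: "Add D qb qb' \<in> Hom D BB B" using bt by (simp add: Hom_def)
      have q1: "Add D qb qb' \<cdot> Idn D BB = Add D qb qb'" using HomE[OF q] by simp
      obtain x' w where x': "x' \<in> extensions D A BB" "w \<in> Hom D P BB" "ext_mor D y x' w (Idn D A)"
        "ext_mor D x' e qb (Idn D A)" "ext_mor D x' e' qb' (Idn D A)" "Add D qb qb' \<cdot> w = Add D u v"
        using factor[OF b] by blast
      \<comment> \<open>The source \<open>x\<close> comes from the definition of the sum and
        \<open>x'\<close> from \<open>y\<close>. They agree by uniqueness over the biproduct, so the
        sum \<open>t\<close> is reached from \<open>y\<close> along \<open>u + v\<close>.\<close>
      have "ext_mor D x' x (Idn D BB) (Idn D A)"
        by (rule ext_pair_unique[OF e(1,2) b x'(1,4,5) x])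
      from ext_mor_push_comp[OF x'(1) x(1) t(1) idn_hom[OF bt(3)] q this t(2)]
      have "ext_mor D x' t (Add D qb qb') (Idn D A)" unfolding q1 .
      from ext_mor_push_comp[OF y x'(1) t(1) x'(2) q x'(3) this]
      show "t \<in> extensions D A B \<and> ext_mor D y t (Add D u v) (Idn D A)" using t(1) x'(6) by simp
    next
      assume t: "t \<in> extensions D A B \<and> ext_mor D y t (Add D u v) (Idn D A)"
      obtain BB b b' qb qb' where b: "is_biproduct D B B BB b b' qb qb'" using biproduct_ex[OF ob(2,2)] by blast
      note bt = is_biproductD(1-15)[OF b]
      have q: "Add D qb qb' \<in> Hom D BB B" using bt by (simp add: Hom_def)
      obtain x w where x: "x \<in> extensions D A BB" "w \<in> Hom D P BB" "ext_mor D y x w (Idn D A)"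
        "ext_mor D x e qb (Idn D A)" "ext_mor D x e' qb' (Idn D A)" "Add D qb qb' \<cdot> w = Add D u v"
        using factor[OF b] by blast
      have "ext_mor D x t (Add D qb qb') (Idn D A)"
        by (rule ext_push_factor[OF y x(1) _ x(2) q idn_hom[OF ob(1)] x(3)]) (use t x(6) in simp_all)
      then show "\<exists>BB b b' qb qb' x. is_biproduct D B B BB b b' qb qb' \<and> x \<in> extensions D A BB \<and>
       ext_mor D x e qb (Idn D A) \<and> ext_mor D x e' qb' (Idn D A) \<and>
       t \<in> extensions D A B \<and> ext_mor D x t (Add D qb qb') (Idn D A)"
        using b x t by blast
    qed
  qed
qed

section \<open>Split extensions and the group laws\<close>

lemma biproduct_kernel_cokernel:
  assumes b: "is_biproduct D B A s i j q p"
  shows "short_exact D i p"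
proof -
  note bt = is_biproductD(1-15)[OF b] and be = is_biproductD(16-)[OF b]
  have ex: "epic D p"
  proof (rule epicI)
    fix g assume g: "g \<in> Arr D" "Dom D g = Cod D p" "g \<cdot> p = Zro D (Dom D p) (Cod D g)"
    have "g = (g \<cdot> p) \<cdot> j" using g(1,2) bt be by simp
    also have "\<dots> = Zro D A (Cod D g)" unfolding g(3) using bt cod_obj[OF g(1)] by simp
    finally show "g = Zro D (Cod D p) (Cod D g)" using bt by simp
  qed (use bt in simp)
  have "is_kernel D i p"
  proof (rule is_kernelI)
    show "monic D i"
    proof (rule monicI)
      fix g assume g: "g \<in> Arr D" "Cod D g = Dom D i" "i \<cdot> g = Zro D (Dom D g) (Cod D i)"
      have "g = q \<cdot> (i \<cdot> g)" using g(1,2) bt be by simp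
      also have "\<dots> = Zro D (Dom D g) B" unfolding g(3) using bt dom_obj[OF g(1)] by simp
      finally show "g = Zro D (Dom D g) (Dom D i)" using bt by simp
    qed (use bt in simp)
    fix g assume g: "g \<in> Arr D" "Cod D g = Dom D p" "p \<cdot> g = Zro D (Dom D g) (Cod D p)"
    have gs: "Cod D g = s" using g bt by simp
    have "g = Add D (i \<cdot> (q \<cdot> g)) (j \<cdot> (p \<cdot> g))" by (rule biproduct_decomp[OF b g(1) gs])
    also have "\<dots> = i \<cdot> (q \<cdot> g)" unfolding g(3) using g(1) gs bt dom_obj[OF g(1)] by simp
    finally show "\<exists>h\<in>Hom D (Dom D g) (Dom D i). i \<cdot> h = g"
      using g(1) gs bt by (intro bexI[of _ "q \<cdot> g"]) (simp_all add: Hom_def)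
  qed (use bt be in simp_all)
  then show ?thesis using ex by (rule short_exactI)
qed

lemma split_extension:
  assumes b: "is_biproduct D B A s i j q p"
  shows "(i, p) \<in> extensions D A B"
  using biproduct_kernel_cokernel[OF b] is_biproductD[OF b] by (simp add: extensions_def)

text \<open>The middle arrow is \<open>j \<cdot> r\<close>: it vanishes on the subobject because
  \<open>r\<close> does, and \<open>p\<close> is a retraction of \<open>j\<close>. Pushing out along
  zero thus always lands in the split class, which makes that class neutral.\<close>

lemma zero_push_split:
  assumes b: "is_biproduct D B A s i j q p" and y: "y \<in> extensions D A P"
  shows "ext_mor D y (i, p) (Zro D P B) (Idn D A)"
proof -
  obtain k r where kr: "y = (k, r)" by (cases y)
  note eD = extensionsD[OF y[unfolded kr]] and bt = is_biproductD(1-15)[OF b] and be = is_biproductD(16-)[OF b]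
  show ?thesis unfolding kr by (rule ext_morI[of "j \<cdot> r"]) (use eD bt be in simp_all)
qed

text \<open>The pushouts of a fixed extension along zero form one class, and every split extension
  is among them. Conversely a section and a retraction can be transported along an isomorphism of
  middle terms.\<close>

lemma split_extensions_class:
  assumes b: "is_biproduct D B A s i j q p"
  shows "split_extensions D A B = ext_class D A B (i, p)"
proof (rule Set.set_eqI)
  fix e :: "'m \<times> 'm"
  obtain i' p' where e: "e = (i', p')" by (cases e)
  note bt = is_biproductD(1-15)[OF b] and be = is_biproductD(16-)[OF b]
  note x = split_extension[OF b]
  have zz: "Zro D B B \<in> Hom D B B" using bt by (simp add: Hom_def)
  show "e \<in> split_extensions D A B \<longleftrightarrow> e \<in> ext_class D A B (i, p)"
  proof
    assume "e \<in> split_extensions D A B"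
    then obtain s' j' q' where b': "is_biproduct D B A s' i' j' q' p'" by (auto simp: split_extensions_def e)
    show "e \<in> ext_class D A B (i, p)"
      unfolding ext_mor_push_class[OF x x zz zero_push_split[OF b x]] e
      using split_extension[OF b'] zero_push_split[OF b' x] by blast
  next
    assume "e \<in> ext_class D A B (i, p)"
    then have e': "(i', p') \<in> extensions D A B"
      and "\<exists>h\<in>Hom D (Cod D i) (Cod D i'). iso_arr D h \<and> h \<cdot> i = i' \<and> p' \<cdot> h = p"
      by (auto simp: ext_rel_def e)
    then obtain h where h: "iso_arr D h" "Dom D h = s" "Cod D h = Cod D i'" "h \<cdot> i = i'" "p' \<cdot> h = p"
      using bt by (auto simp: Hom_def)
    note eD = extensionsD[OF e']
    obtain g where g: "h \<in> Arr D" "g \<in> Arr D" "Dom D g = Cod D h" "Cod D g = Dom D h"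
      "g \<cdot> h = Idn D (Dom D h)" "h \<cdot> g = Idn D (Cod D h)" using h(1) by (rule iso_arrE)
    have gi: "g \<cdot> i' = i" using comp_reassoc[OF g(5), of i] h g(1-4) bt by simp
    have pg: "p \<cdot> g = p'" using comp_assoc_right[of g h p'] h g eD bt by simp
    have "Add D (i' \<cdot> (q \<cdot> g)) ((h \<cdot> j) \<cdot> p') = h \<cdot> (Add D (i \<cdot> q) (j \<cdot> p) \<cdot> g)"
      using h(4)[symmetric] pg[symmetric] h(2,3) g(1-4) bt eD by simp
    also have "\<dots> = Idn D (Cod D i')" unfolding be(5) using g h(2,3) bt by simp
    finally have "is_biproduct D B A (Cod D i') i' (h \<cdot> j) (q \<cdot> g) p'"
      unfolding is_biproduct_def Hom_def
      using g h eD bt be gi comp_reassoc[OF g(5)] comp_reassoc[OF h(5)] comp_assoc_right[of i' g q]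
      by simp
    then show "e \<in> split_extensions D A B" by (auto simp: split_extensions_def e)
  qed
qed

lemma Ext1_carrierE:
  assumes "\<xi> \<in> carrier (Ext1 D A B)"
  obtains e where "e \<in> extensions D A B" "\<xi> = ext_class D A B e"
  using assms by (auto simp: Ext1_def quotient_def)

lemma Ext1_carrierI: "e \<in> extensions D A B \<Longrightarrow> ext_class D A B e \<in> carrier (Ext1 D A B)"
  by (auto simp: Ext1_def quotient_def)

text \<open>By \<open>baer_sum_push\<close> each law is an identity between arrows out of one common
  source: a sum of three components for associativity, \<open>0 + 1 = 1\<close> for the neutral
  element and \<open>-1 + 1 = 0\<close> for inverses.\<close>

theorem Ext1_group:
  assumes ob: "A \<in> Obj D" "B \<in> Obj D"
  shows "group (Ext1 D A B)"
proof -
  obtain s i j q p where split: "is_biproduct D B A s i j q p" using biproduct_ex[OF ob(2,1)] by blast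
  note x0 = split_extension[OF split]
  have one: "\<one>\<^bsub>Ext1 D A B\<^esub> = ext_class D A B (i, p)"
    using split_extensions_class[OF split] by (simp add: Ext1_def)
  have mult: "\<xi> \<otimes>\<^bsub>Ext1 D A B\<^esub> \<zeta> = baer_sum D A B \<xi> \<zeta>" for \<xi> \<zeta> by (simp add: Ext1_def)
  obtain BB b b' qb qb' where bp: "is_biproduct D B B BB b b' qb qb'" using biproduct_ex[OF ob(2,2)] by blast
  have q: "qb \<in> Hom D BB B" "qb' \<in> Hom D BB B" "Add D qb qb' \<in> Hom D BB B" and BB: "BB \<in> Obj D"
    using is_biproductD(1-15)[OF bp] by (simp_all add: Hom_def)
  show ?thesis
  proof (rule groupI, unfold one mult)
    fix \<xi> \<zeta> assume c: "\<xi> \<in> carrier (Ext1 D A B)" "\<zeta> \<in> carrier (Ext1 D A B)"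
    obtain e where e: "e \<in> extensions D A B" "\<xi> = ext_class D A B e" using c(1) by (rule Ext1_carrierE)
    obtain e' where e': "e' \<in> extensions D A B" "\<zeta> = ext_class D A B e'" using c(2) by (rule Ext1_carrierE)
    obtain x where x: "x \<in> extensions D A BB" "ext_mor D x e qb (Idn D A)" "ext_mor D x e' qb' (Idn D A)"
      using ext_pair_exists[OF e(1) e'(1) bp] .
    obtain z where z: "z \<in> extensions D A B" "ext_mor D x z (Add D qb qb') (Idn D A)"
      using ext_push_exists[OF x(1) q(3)] .
    have sum: "baer_sum D A B \<xi> \<zeta> = ext_class D A B z"
      unfolding e e' by (rule baer_sum_push[OF x(1) q(1,2) e(1) e'(1) z(1) x(2,3) z(2)])
    then show "baer_sum D A B \<xi> \<zeta> \<in> carrier (Ext1 D A B)" using z Ext1_carrierI by simp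
    fix \<eta> assume c': "\<eta> \<in> carrier (Ext1 D A B)"
    obtain e'' where e'': "e'' \<in> extensions D A B" "\<eta> = ext_class D A B e''" using c' by (rule Ext1_carrierE)
    \<comment> \<open>The source for associativity lies over
      \<open>(B \<oplus> B) \<oplus> B\<close>; its components are \<open>qb \<cdot> r\<close>,
      \<open>qb' \<cdot> r\<close> and \<open>r'\<close>.\<close>
    obtain P c c' r r' where bp': "is_biproduct D BB B P c c' r r'" using biproduct_ex[OF BB ob(2)] by blast
    have r: "r \<in> Hom D P BB" "r' \<in> Hom D P B" using is_biproductD(1-15)[OF bp'] by (simp_all add: Hom_def)
    obtain y where y: "y \<in> extensions D A P" "ext_mor D y x r (Idn D A)" "ext_mor D y e'' r' (Idn D A)"
      using ext_pair_exists[OF x(1) e''(1) bp'] .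
    let ?u = "qb \<cdot> r" and ?v = "qb' \<cdot> r"
    note h = HomE[OF q(1)] HomE[OF q(2)] HomE[OF r(1)] HomE[OF r(2)]
    have uv: "?u \<in> Hom D P B" "?v \<in> Hom D P B" "Add D ?u ?v \<in> Hom D P B" "Add D ?v r' \<in> Hom D P B"
      "Add D ?u (Add D ?v r') \<in> Hom D P B" using h by (simp_all add: Hom_def)
    have ye: "ext_mor D y e ?u (Idn D A)" "ext_mor D y e' ?v (Idn D A)"
      using ext_mor_push_comp[OF y(1) x(1) _ r(1) _ y(2)] e e' q x by simp_all
    have "ext_mor D y z (Add D qb qb' \<cdot> r) (Idn D A)"
      using ext_mor_push_comp[OF y(1) x(1) z(1) r(1) q(3) y(2) z(2)] .
    then have yz: "ext_mor D y z (Add D ?u ?v) (Idn D A)" using h by simp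
    obtain z' where z': "z' \<in> extensions D A B" "ext_mor D y z' (Add D ?v r') (Idn D A)"
      using ext_push_exists[OF y(1) uv(4)] .
    obtain t where t: "t \<in> extensions D A B" "ext_mor D y t (Add D ?u (Add D ?v r')) (Idn D A)"
      using ext_push_exists[OF y(1) uv(5)] .
    have as: "Add D (Add D ?u ?v) r' = Add D ?u (Add D ?v r')" using h by (simp add: add_assoc)
    have "baer_sum D A B (baer_sum D A B \<xi> \<zeta>) \<eta> = ext_class D A B t"
      unfolding sum e'' by (rule baer_sum_push[OF y(1) uv(3) r(2) z(1) e''(1) t(1) yz y(3)]) (unfold as, fact t)
    moreover have "baer_sum D A B \<zeta> \<eta> = ext_class D A B z'"
      unfolding e' e'' by (rule baer_sum_push[OF y(1) uv(2) r(2) e'(1) e''(1) z'(1) ye(2) y(3) z'(2)])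
    moreover have "baer_sum D A B \<xi> (ext_class D A B z') = ext_class D A B t"
      unfolding e by (rule baer_sum_push[OF y(1) uv(1,4) e(1) z'(1) t(1) ye(1) z'(2) t(2)])
    ultimately show "baer_sum D A B (baer_sum D A B \<xi> \<zeta>) \<eta> = baer_sum D A B \<xi> (baer_sum D A B \<zeta> \<eta>)" by simp
  next
    show "ext_class D A B (i, p) \<in> carrier (Ext1 D A B)" using x0 by (rule Ext1_carrierI)
  next
    fix \<xi> assume c: "\<xi> \<in> carrier (Ext1 D A B)"
    obtain e where e: "e \<in> extensions D A B" "\<xi> = ext_class D A B e" using c(1) by (rule Ext1_carrierE)
    have h: "Zro D B B \<in> Hom D B B" "Idn D B \<in> Hom D B B" "neg (Idn D B) \<in> Hom D B B"
      using ob by (simp_all add: Hom_def)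
    have a: "Add D (Zro D B B) (Idn D B) = Idn D B" "Add D (neg (Idn D B)) (Idn D B) = Zro D B B"
      using ob by simp_all
    \<comment> \<open>For the remaining laws \<open>e\<close> itself is the common source: it maps
      to itself along the identity, to the split extension along zero and to the inverse along minus
      the identity.\<close>
    note e1 = ext_mor_refl[OF e(1)] and e0 = zero_push_split[OF split e(1)]
    show "baer_sum D A B (ext_class D A B (i, p)) \<xi> = \<xi>"
      unfolding e(2) by (rule baer_sum_push[OF e(1) h(1,2) x0 e(1) e(1) e0 e1]) (unfold a, fact e1)
    obtain e' where e': "e' \<in> extensions D A B" "ext_mor D e e' (neg (Idn D B)) (Idn D A)"
      using ext_push_exists[OF e(1) h(3)] .
    have "baer_sum D A B (ext_class D A B e') \<xi> = ext_class D A B (i, p)"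
      unfolding e(2) by (rule baer_sum_push[OF e(1) h(3,2) e'(1) e(1) x0 e'(2) e1]) (unfold a, fact e0)
    then show "\<exists>\<zeta>\<in>carrier (Ext1 D A B). baer_sum D A B \<zeta> \<xi> = ext_class D A B (i, p)"
      using Ext1_carrierI[OF e'(1)] by blast
  qed
qed

end

section \<open>Restriction along exact functors\<close>

lemma (in group_hom) subgroup_preimage:
  assumes "subgroup K H"
  shows "subgroup {x \<in> carrier G. h x \<in> K} G"
proof -
  interpret K: subgroup K H by fact
  show ?thesis by (rule G.subgroupI) auto
qed

text \<open>The functor carries \<open>ext_mor\<close> to \<open>ext_mor\<close>, and pullback,
  pushout and Baer sum have all been described through that relation. The induced map on classes
  therefore commutes with each of them, and the restricted structure is a preimage under it.\<close>

theorem exact_functor_restricts: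
  fixes S :: "('o, 'm, 'k) prelincat" and D :: "('p, 'n, 'k) prelincat"
  assumes S: "abelian_category S" and F: "is_functor S D \<Phi>"
    and add: "\<And>f g. f \<in> Arr S \<Longrightarrow> g \<in> Arr S \<Longrightarrow> Dom S f = Dom S g \<Longrightarrow> Cod S f = Cod S g \<Longrightarrow>
      FArr \<Phi> (Add S f g) = Add D (FArr \<Phi> f) (FArr \<Phi> g)"
    and exact: "\<And>i p. short_exact S i p \<Longrightarrow> short_exact D (FArr \<Phi> i) (FArr \<Phi> p)"
  shows "exact_structures_restrict S D \<Phi>"
  unfolding exact_structures_restrict_def
proof (intro allI impI)
  fix \<E> assume E: "exact_structure D \<E>"
  interpret S: abelian_category S by fact
  interpret D: abelian_category D using E by (simp add: exact_structure_def)
  note FD = is_functorD[OF F]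
  have FA: "FArr \<Phi> f \<in> Arr D" "Dom D (FArr \<Phi> f) = FObj \<Phi> (Dom S f)" "Cod D (FArr \<Phi> f) = FObj \<Phi> (Cod S f)"
    if "f \<in> Arr S" for f
    using FD(2)[OF S.homI[OF that]] by (simp_all add: Hom_def)
  have FC: "FArr \<Phi> (g \<cdot>\<^bsub>S\<^esub> f) = FArr \<Phi> g \<cdot>\<^bsub>D\<^esub> FArr \<Phi> f" if "f \<in> Arr S" "g \<in> Arr S" "Cod S f = Dom S g" for f g
    using FD(4)[of f "Dom S f" "Dom S g" g "Cod S g"] that by (simp add: Hom_def)
  define m where "m = map_prod (FArr \<Phi>) (FArr \<Phi>)"
  have ext: "m e \<in> extensions D (FObj \<Phi> A) (FObj \<Phi> B)" if "e \<in> extensions S A B" for e A B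
  proof -
    obtain i p where e: "e = (i, p)" by (cases e)
    note eD = S.extensionsD[OF that[unfolded e]]
    show ?thesis using exact[OF eD(1)] eD by (simp add: m_def e extensions_def FA)
  qed
  have mor: "ext_mor D (m e) (m e') (FArr \<Phi> f) (FArr \<Phi> g)"
    if e: "e \<in> extensions S A B" "e' \<in> extensions S A' B'" and fg: "f \<in> Hom S B B'" "g \<in> Hom S A A'"
      and r: "ext_mor S e e' f g" for e e' f g A B A' B'
  proof -
    obtain i p i' p' where ip: "e = (i, p)" "e' = (i', p')" by (metis surj_pair)
    note eD = S.extensionsD[OF e(1)[unfolded ip]] S.extensionsD[OF e(2)[unfolded ip]]
    note fgh = S.HomE[OF fg(1)] S.HomE[OF fg(2)]
    obtain h where h: "h \<in> Arr S" "Dom S h = Cod S i" "Cod S h = Cod S i'" "h \<cdot>\<^bsub>S\<^esub> i = i' \<cdot>\<^bsub>S\<^esub> f" "p' \<cdot>\<^bsub>S\<^esub> h = g \<cdot>\<^bsub>S\<^esub> p"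
      using r[unfolded ip] by (rule S.ext_morE)
    have "FArr \<Phi> h \<cdot>\<^bsub>D\<^esub> FArr \<Phi> i = FArr \<Phi> i' \<cdot>\<^bsub>D\<^esub> FArr \<Phi> f"
      using FC[of i h] FC[of f i'] h eD fgh by simp
    moreover have "FArr \<Phi> p' \<cdot>\<^bsub>D\<^esub> FArr \<Phi> h = FArr \<Phi> g \<cdot>\<^bsub>D\<^esub> FArr \<Phi> p"
      using FC[of h p'] FC[of p g] h eD fgh by simp
    ultimately show ?thesis unfolding ip m_def map_prod_simp
      by (intro D.ext_morI[of "FArr \<Phi> h"]) (use h eD in \<open>simp_all add: FA\<close>)
  qed
  have idn: "FArr \<Phi> (Idn S a) = Idn D (FObj \<Phi> a)" if "a \<in> Obj S" for a using FD(3) that .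
  have img: "ext_image D \<Phi> A B (ext_class S A B e) = ext_class D (FObj \<Phi> A) (FObj \<Phi> B) (m e)"
    if e: "e \<in> extensions S A B" for e A B
  proof -
    have ob: "A \<in> Obj S" "B \<in> Obj S" using S.extensions_obj[OF e] by simp_all
    \<comment> \<open>\<open>ext_image\<close> is a union over all representatives of a class; since
      equivalent extensions have equivalent images, each contributes the same class.\<close>
    have "ext_class D (FObj \<Phi> A) (FObj \<Phi> B) (m e') = ext_class D (FObj \<Phi> A) (FObj \<Phi> B) (m e)"
      if "e' \<in> ext_class S A B e" for e'
    proof -
      have e': "e' \<in> extensions S A B" "ext_mor S e e' (Idn S B) (Idn S A)"
        using that S.ext_rel_iff[of e e' A B] by simp_all
      have "ext_mor D (m e) (m e') (Idn D (FObj \<Phi> B)) (Idn D (FObj \<Phi> A))"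
        using mor[OF e e'(1) S.idn_hom[OF ob(2)] S.idn_hom[OF ob(1)] e'(2)] idn ob by simp
      then show ?thesis using D.ext_class_eq_iff[OF ext[OF e] ext[OF e'(1)]] by simp
    qed
    moreover have "ext_image D \<Phi> A B (ext_class S A B e) =
        (\<Union>e'\<in>ext_class S A B e. ext_class D (FObj \<Phi> A) (FObj \<Phi> B) (m e'))"
      unfolding ext_image_def m_def by (simp add: case_prod_unfold map_prod_def)
    ultimately show ?thesis using S.ext_class_self[OF e] by blast
  qed
  have hom: "ext_image D \<Phi> A B \<in> hom (Ext1 S A B) (Ext1 D (FObj \<Phi> A) (FObj \<Phi> B))"
    if ob: "A \<in> Obj S" "B \<in> Obj S" for A B
  proof (rule homI)
    fix \<xi> assume "\<xi> \<in> carrier (Ext1 S A B)"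
    then obtain e where e: "e \<in> extensions S A B" "\<xi> = ext_class S A B e" by (rule S.Ext1_carrierE)
    show "ext_image D \<Phi> A B \<xi> \<in> carrier (Ext1 D (FObj \<Phi> A) (FObj \<Phi> B))"
      unfolding e(2) img[OF e(1)] by (rule D.Ext1_carrierI[OF ext[OF e(1)]])
    fix \<zeta> assume "\<zeta> \<in> carrier (Ext1 S A B)"
    then obtain e' where e': "e' \<in> extensions S A B" "\<zeta> = ext_class S A B e'" by (rule S.Ext1_carrierE)
    obtain BB b b' qb qb' where bp: "is_biproduct S B B BB b b' qb qb'" using S.biproduct_ex[OF ob(2,2)] by blast
    note bt = S.is_biproductD(1-15)[OF bp]
    have q: "qb \<in> Hom S BB B" "qb' \<in> Hom S BB B" "Add S qb qb' \<in> Hom S BB B" using bt by (simp_all add: Hom_def)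
    obtain x where x: "x \<in> extensions S A BB" "ext_mor S x e qb (Idn S A)" "ext_mor S x e' qb' (Idn S A)"
      using S.ext_pair_exists[OF e(1) e'(1) bp] .
    obtain z where z: "z \<in> extensions S A B" "ext_mor S x z (Add S qb qb') (Idn S A)"
      using S.ext_push_exists[OF x(1) q(3)] .
    have s: "\<xi> \<otimes>\<^bsub>Ext1 S A B\<^esub> \<zeta> = ext_class S A B z"
      using S.baer_sum_push[OF x(1) q(1,2) e(1) e'(1) z(1) x(2,3) z(2)] e e' by (simp add: Ext1_def)
    \<comment> \<open>The common source \<open>x\<close> is sent to a common source of the images.
      With additivity on \<open>qb + qb'\<close> this is all that \<open>baer_sum_push\<close> asks
      for in \<open>D\<close>; its source may lie over any object, so the image of the biproduct is
      not examined.\<close>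
    have Fq: "FArr \<Phi> qb \<in> Hom D (FObj \<Phi> BB) (FObj \<Phi> B)" "FArr \<Phi> qb' \<in> Hom D (FObj \<Phi> BB) (FObj \<Phi> B)"
      using q FD(2) by blast+
    have Fadd: "FArr \<Phi> (Add S qb qb') = Add D (FArr \<Phi> qb) (FArr \<Phi> qb')" by (rule add) (use bt in simp_all)
    have I: "Idn D (FObj \<Phi> A) = FArr \<Phi> (Idn S A)" using idn[OF ob(1)] by simp
    note iA = S.idn_hom[OF ob(1)]
    have M: "ext_mor D (m x) (m e) (FArr \<Phi> qb) (Idn D (FObj \<Phi> A))"
      "ext_mor D (m x) (m e') (FArr \<Phi> qb') (Idn D (FObj \<Phi> A))"
      "ext_mor D (m x) (m z) (Add D (FArr \<Phi> qb) (FArr \<Phi> qb')) (Idn D (FObj \<Phi> A))"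
      unfolding I Fadd[symmetric]
      by (rule mor[OF x(1) e(1) q(1) iA x(2)] mor[OF x(1) e'(1) q(2) iA x(3)] mor[OF x(1) z(1) q(3) iA z(2)])+
    show "ext_image D \<Phi> A B (\<xi> \<otimes>\<^bsub>Ext1 S A B\<^esub> \<zeta>) =
        ext_image D \<Phi> A B \<xi> \<otimes>\<^bsub>Ext1 D (FObj \<Phi> A) (FObj \<Phi> B)\<^esub> ext_image D \<Phi> A B \<zeta>"
      unfolding s unfolding e e' img[OF e(1)] img[OF e'(1)] img[OF z(1)]
      using D.baer_sum_push[OF ext[OF x(1)] Fq ext[OF e(1)] ext[OF e'(1)] ext[OF z(1)] M] by (simp add: Ext1_def)
  qed
  let ?R = "restrict_exact_structure S D \<Phi> \<E>"
  have RE: "ext_class S A B e \<in> ?R A B \<longleftrightarrow> ext_class D (FObj \<Phi> A) (FObj \<Phi> B) (m e) \<in> \<E> (FObj \<Phi> A) (FObj \<Phi> B)"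
    if "e \<in> extensions S A B" for A B e
    using S.Ext1_carrierI[OF that] img[OF that] by (simp add: restrict_exact_structure_def)
  have REe: "\<exists>e\<in>extensions S A B. \<xi> = ext_class S A B e" if "\<xi> \<in> ?R A B" for \<xi> A B
    using that S.Ext1_carrierE unfolding restrict_exact_structure_def by blast
  show "exact_structure S ?R"
    unfolding exact_structure_def
  proof (intro conjI ballI)
    fix A B assume ob: "A \<in> Obj S" "B \<in> Obj S"
    have Fo: "FObj \<Phi> A \<in> Obj D" "FObj \<Phi> B \<in> Obj D" using ob FD(1) by simp_all
    \<comment> \<open>The restricted structure at \<open>A\<close> and \<open>B\<close> is by
      definition the preimage of a subgroup under this homomorphism.\<close>
    interpret group_hom "Ext1 S A B" "Ext1 D (FObj \<Phi> A) (FObj \<Phi> B)" "ext_image D \<Phi> A B"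
      using S.Ext1_group[OF ob] D.Ext1_group[OF Fo] hom[OF ob]
      by (intro group_hom.intro group_hom_axioms.intro)
    have "subgroup (\<E> (FObj \<Phi> A) (FObj \<Phi> B)) (Ext1 D (FObj \<Phi> A) (FObj \<Phi> B))"
      using E Fo by (simp add: exact_structure_def)
    from subgroup_preimage[OF this] show "subgroup (?R A B) (Ext1 S A B)"
      by (simp add: restrict_exact_structure_def)
  next
    fix A A' B f \<xi> assume ob: "A \<in> Obj S" "A' \<in> Obj S" "B \<in> Obj S" and f: "f \<in> Hom S A' A" and x: "\<xi> \<in> ?R A B"
    obtain e where e: "e \<in> extensions S A B" "\<xi> = ext_class S A B e" using REe[OF x] by blast
    obtain e' where e': "e' \<in> extensions S A' B" "ext_mor S e' e (Idn S B) f" using S.ext_pull_exists[OF e(1) f] .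
    have M: "ext_mor D (m e') (m e) (Idn D (FObj \<Phi> B)) (FArr \<Phi> f)"
      using mor[OF e'(1) e(1) S.idn_hom[OF ob(3)] f e'(2)] idn[OF ob(3)] by simp
    have "ext_pull D (FArr \<Phi> f) (ext_class D (FObj \<Phi> A) (FObj \<Phi> B) (m e)) \<in> \<E> (FObj \<Phi> A') (FObj \<Phi> B)"
      using E FD(1)[OF ob(1)] FD(1)[OF ob(2)] FD(1)[OF ob(3)] FD(2)[OF f] x unfolding e(2) RE[OF e(1)]
      by (simp add: exact_structure_def)
    then show "ext_pull S f \<xi> \<in> ?R A' B"
      unfolding e(2) S.ext_pull_class[OF e(1) e'(1) f e'(2)] RE[OF e'(1)]
        D.ext_pull_class[OF ext[OF e(1)] ext[OF e'(1)] FD(2)[OF f] M] .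
  next
    fix A B B' f \<xi> assume ob: "A \<in> Obj S" "B \<in> Obj S" "B' \<in> Obj S" and f: "f \<in> Hom S B B'" and x: "\<xi> \<in> ?R A B"
    obtain e where e: "e \<in> extensions S A B" "\<xi> = ext_class S A B e" using REe[OF x] by blast
    obtain e' where e': "e' \<in> extensions S A B'" "ext_mor S e e' f (Idn S A)" using S.ext_push_exists[OF e(1) f] .
    have M: "ext_mor D (m e) (m e') (FArr \<Phi> f) (Idn D (FObj \<Phi> A))"
      using mor[OF e(1) e'(1) f S.idn_hom[OF ob(1)] e'(2)] idn[OF ob(1)] by simp
    have "ext_push D (FArr \<Phi> f) (ext_class D (FObj \<Phi> A) (FObj \<Phi> B) (m e)) \<in> \<E> (FObj \<Phi> A) (FObj \<Phi> B')"
      using E FD(1)[OF ob(1)] FD(1)[OF ob(2)] FD(1)[OF ob(3)] FD(2)[OF f] x unfolding e(2) RE[OF e(1)]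
      by (simp add: exact_structure_def)
    then show "ext_push S f \<xi> \<in> ?R A B'"
      unfolding e(2) S.ext_push_class[OF e(1) e'(1) f e'(2)] RE[OF e'(1)]
        D.ext_push_class[OF ext[OF e(1)] ext[OF e'(1)] FD(2)[OF f] M] .
  qed (rule S)
qed

section \<open>Functor categories\<close>

lemma is_functor_op [simp]: "is_functor (op_cat C) (op_lin K) F \<longleftrightarrow> is_functor C K F"
proof -
  have "(\<forall>f\<in>Arr C. \<forall>g\<in>Arr C. Dom C f = Cod C g \<longrightarrow> FArr F (f \<cdot>\<^bsub>C\<^esub> g) = FArr F f \<cdot>\<^bsub>K\<^esub> FArr F g) \<longleftrightarrow>
    (\<forall>f\<in>Arr C. \<forall>g\<in>Arr C. Cod C f = Dom C g \<longrightarrow> FArr F (g \<cdot>\<^bsub>C\<^esub> f) = FArr F g \<cdot>\<^bsub>K\<^esub> FArr F f)" by metis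
  then show ?thesis by (simp add: is_functor_def)
qed

lemma nat_trans_op [simp]: "nat_trans (op_cat C) (op_lin K) G F \<eta> \<longleftrightarrow> nat_trans C K F G \<eta>"
  by (auto simp: nat_trans_def)

locale functors_to_abelian = C: category C + K: abelian_category K
  for C :: "('o, 'm, 'z) precat_scheme" and K :: "('p, 'n, 'k) prelincat"
begin

lemma op: "functors_to_abelian (op_cat C) (op_lin K)"
  by (intro functors_to_abelian.intro category_op_cat abelian_op_lin C.category_axioms K.abelian_category_axioms)

lemma functor_simps:
  assumes "is_functor C K F"
  shows "a \<in> Obj C \<Longrightarrow> FObj F a \<in> Obj K"
    "f \<in> Arr C \<Longrightarrow> FArr F f \<in> Arr K"
    "f \<in> Arr C \<Longrightarrow> Dom K (FArr F f) = FObj F (Dom C f)"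
    "f \<in> Arr C \<Longrightarrow> Cod K (FArr F f) = FObj F (Cod C f)"
    "a \<in> Obj C \<Longrightarrow> FArr F (Idn C a) = Idn K (FObj F a)"
    "f \<in> Arr C \<Longrightarrow> g \<in> Arr C \<Longrightarrow> Cod C f = Dom C g \<Longrightarrow> FArr F (g \<cdot>\<^bsub>C\<^esub> f) = FArr F g \<cdot>\<^bsub>K\<^esub> FArr F f"
  using assms by (auto simp: is_functor_def Hom_def)

lemma functorI:
  assumes "\<And>a. a \<in> Obj C \<Longrightarrow> o' a \<in> Obj K"
    "\<And>f. f \<in> Arr C \<Longrightarrow> m' f \<in> Hom K (o' (Dom C f)) (o' (Cod C f))"
    "\<And>a. a \<in> Obj C \<Longrightarrow> m' (Idn C a) = Idn K (o' a)"
    "\<And>f g. f \<in> Arr C \<Longrightarrow> g \<in> Arr C \<Longrightarrow> Cod C f = Dom C g \<Longrightarrow> m' (g \<cdot>\<^bsub>C\<^esub> f) = m' g \<cdot>\<^bsub>K\<^esub> m' f"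
  shows "is_functor C K \<lparr>FObj = \<lambda>a\<in>Obj C. o' a, FArr = \<lambda>f\<in>Arr C. m' f\<rparr>"
  using assms C.dom_obj C.cod_obj by (auto simp: is_functor_def Hom_def)

lemma nat_simps:
  assumes "nat_trans C K F G \<eta>"
  shows "a \<in> Obj C \<Longrightarrow> \<eta> a \<in> Arr K" "a \<in> Obj C \<Longrightarrow> Dom K (\<eta> a) = FObj F a" "a \<in> Obj C \<Longrightarrow> Cod K (\<eta> a) = FObj G a"
    "f \<in> Arr C \<Longrightarrow> \<eta> (Cod C f) \<cdot>\<^bsub>K\<^esub> FArr F f = FArr G f \<cdot>\<^bsub>K\<^esub> \<eta> (Dom C f)"
  using assms by (auto simp: nat_trans_def Hom_def)

lemma nat_transI:
  assumes "\<And>a. a \<in> Obj C \<Longrightarrow> t a \<in> Hom K (FObj F a) (FObj G a)"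
    "\<And>f. f \<in> Arr C \<Longrightarrow> t (Cod C f) \<cdot>\<^bsub>K\<^esub> FArr F f = FArr G f \<cdot>\<^bsub>K\<^esub> t (Dom C f)"
  shows "nat_trans C K F G (\<lambda>a\<in>Obj C. t a)"
  using assms C.dom_obj C.cod_obj by (auto simp: nat_trans_def)

lemma nat_eqI:
  assumes "nat_trans C K F G \<eta>" "nat_trans C K F' G' \<theta>" "\<And>a. a \<in> Obj C \<Longrightarrow> \<eta> a = \<theta> a"
  shows "\<eta> = \<theta>"
  using assms by (intro extensionalityI[of _ "Obj C"]) (auto simp: nat_trans_def)

lemma nat_eq_restrict:
  assumes "nat_trans C K F G \<eta>" "\<And>a. a \<in> Obj C \<Longrightarrow> t a = \<eta> a"
  shows "(\<lambda>a\<in>Obj C. t a) = \<eta>"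
  using assms by (intro extensionalityI[of _ "Obj C"]) (auto simp: nat_trans_def)

lemma nat_comp:
  assumes F: "is_functor C K F" and G: "is_functor C K G" and H: "is_functor C K H"
    and \<eta>: "nat_trans C K F G \<eta>" and \<theta>: "nat_trans C K G H \<theta>"
  shows "nat_trans C K F H (\<lambda>a\<in>Obj C. \<theta> a \<cdot>\<^bsub>K\<^esub> \<eta> a)"
proof (rule nat_transI)
  note s = nat_simps(1-3)[OF \<eta>] nat_simps(1-3)[OF \<theta>] functor_simps(1-4)[OF F] functor_simps(1-4)[OF G]
    functor_simps(1-4)[OF H]
  show "\<theta> a \<cdot>\<^bsub>K\<^esub> \<eta> a \<in> Hom K (FObj F a) (FObj H a)" if "a \<in> Obj C" for a
    using that s by (simp add: Hom_def)
  fix f assume f: "f \<in> Arr C"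
  note ob = C.dom_obj[OF f] C.cod_obj[OF f]
  show "\<theta> (Cod C f) \<cdot>\<^bsub>K\<^esub> \<eta> (Cod C f) \<cdot>\<^bsub>K\<^esub> FArr F f = FArr H f \<cdot>\<^bsub>K\<^esub> (\<theta> (Dom C f) \<cdot>\<^bsub>K\<^esub> \<eta> (Dom C f))"
    using f ob s nat_simps(4)[OF \<eta> f] K.comp_reassoc[OF nat_simps(4)[OF \<theta> f], of "\<eta> (Dom C f)"] by simp
qed

lemma nat_zero:
  assumes F: "is_functor C K F" and G: "is_functor C K G"
  shows "nat_trans C K F G (\<lambda>a\<in>Obj C. Zro K (FObj F a) (FObj G a))"
  by (rule nat_transI)
     (use functor_simps(1-4)[OF F] functor_simps(1-4)[OF G] C.dom_obj C.cod_obj in \<open>simp_all add: Hom_def\<close>)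

lemma nat_idn:
  assumes F: "is_functor C K F"
  shows "nat_trans C K F F (\<lambda>a\<in>Obj C. Idn K (FObj F a))"
  by (rule nat_transI)
     (use functor_simps(1-4)[OF F] C.dom_obj C.cod_obj in \<open>simp_all add: Hom_def\<close>)

lemma nat_add:
  assumes F: "is_functor C K F" and G: "is_functor C K G"
    and \<eta>: "nat_trans C K F G \<eta>" and \<theta>: "nat_trans C K F G \<theta>"
  shows "nat_trans C K F G (\<lambda>a\<in>Obj C. Add K (\<eta> a) (\<theta> a))"
proof (rule nat_transI)
  note s = nat_simps(1-3)[OF \<eta>] nat_simps(1-3)[OF \<theta>] functor_simps(1-4)[OF F] functor_simps(1-4)[OF G]
  show "Add K (\<eta> a) (\<theta> a) \<in> Hom K (FObj F a) (FObj G a)" if "a \<in> Obj C" for a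
    using that s by (simp add: Hom_def)
  fix f assume f: "f \<in> Arr C"
  note ob = C.dom_obj[OF f] C.cod_obj[OF f]
  show "Add K (\<eta> (Cod C f)) (\<theta> (Cod C f)) \<cdot>\<^bsub>K\<^esub> FArr F f = FArr G f \<cdot>\<^bsub>K\<^esub> Add K (\<eta> (Dom C f)) (\<theta> (Dom C f))"
    using f ob s nat_simps(4)[OF \<eta> f] nat_simps(4)[OF \<theta> f] by simp
qed

lemma nat_neg:
  assumes F: "is_functor C K F" and G: "is_functor C K G" and \<eta>: "nat_trans C K F G \<eta>"
  shows "nat_trans C K F G (\<lambda>a\<in>Obj C. K.neg (\<eta> a))"
proof (rule nat_transI)
  note s = nat_simps(1-3)[OF \<eta>] functor_simps(1-4)[OF F] functor_simps(1-4)[OF G]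
  show "K.neg (\<eta> a) \<in> Hom K (FObj F a) (FObj G a)" if "a \<in> Obj C" for a
    using that s by (simp add: Hom_def)
  fix f assume f: "f \<in> Arr C"
  note ob = C.dom_obj[OF f] C.cod_obj[OF f]
  show "K.neg (\<eta> (Cod C f)) \<cdot>\<^bsub>K\<^esub> FArr F f = FArr G f \<cdot>\<^bsub>K\<^esub> K.neg (\<eta> (Dom C f))"
    using f ob s nat_simps(4)[OF \<eta> f] by simp
qed

section \<open>Pointwise kernels, biproducts and zero\<close>

lemma pointwise_kernel:
  assumes F: "is_functor C K F" and G: "is_functor C K G" and \<eta>: "nat_trans C K F G \<eta>"
  obtains M k where "is_functor C K M" "nat_trans C K M F k" "\<And>a. a \<in> Obj C \<Longrightarrow> is_kernel K (k a) (\<eta> a)"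
proof -
  note s = nat_simps(1-3)[OF \<eta>] functor_simps(1-4)[OF F] functor_simps(1-4)[OF G]
  have "\<forall>a\<in>Obj C. \<exists>k. is_kernel K k (\<eta> a)" using K.kernel_ex s by blast
  then obtain k where k: "\<And>a. a \<in> Obj C \<Longrightarrow> is_kernel K (k a) (\<eta> a)" by metis
  have kD: "k a \<in> Arr K" "Cod K (k a) = FObj F a" "\<eta> a \<cdot>\<^bsub>K\<^esub> k a = Zro K (Dom K (k a)) (FObj G a)" "Dom K (k a) \<in> Obj K"
    if "a \<in> Obj C" for a
    using K.is_kernelD[OF k[OF that]] s that K.dom_obj by simp_all
  \<comment> \<open>By naturality \<open>\<eta>\<close> kills \<open>FArr F f \<cdot> k\<close>, so
    this composite lifts to the kernel at the target. Since every \<open>k a\<close> is monic, the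
    lifts respect identities and composition.\<close>
  have "\<exists>m. m \<in> Hom K (Dom K (k (Dom C f))) (Dom K (k (Cod C f))) \<and> k (Cod C f) \<cdot>\<^bsub>K\<^esub> m = FArr F f \<cdot>\<^bsub>K\<^esub> k (Dom C f)"
    if f: "f \<in> Arr C" for f
  proof -
    note ob = C.dom_obj[OF f] C.cod_obj[OF f]
    let ?g = "FArr F f \<cdot>\<^bsub>K\<^esub> k (Dom C f)"
    have g: "?g \<in> Arr K" "Dom K ?g = Dom K (k (Dom C f))" "Cod K ?g = Dom K (\<eta> (Cod C f))" using f ob s kD by simp_all
    have "\<eta> (Cod C f) \<cdot>\<^bsub>K\<^esub> ?g = FArr G f \<cdot>\<^bsub>K\<^esub> (\<eta> (Dom C f) \<cdot>\<^bsub>K\<^esub> k (Dom C f))"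
      using f ob s kD(1,2) K.comp_reassoc[OF nat_simps(4)[OF \<eta> f], of "k (Dom C f)"] by simp
    also have "\<dots> = Zro K (Dom K ?g) (Cod K (\<eta> (Cod C f)))" using f ob s kD by simp
    finally obtain m where "m \<in> Arr K" "Dom K m = Dom K ?g" "Cod K m = Dom K (k (Cod C f))" "k (Cod C f) \<cdot>\<^bsub>K\<^esub> m = ?g"
      using K.is_kernel_lift[OF k[OF ob(2)] g(1,3)] by blast
    then show ?thesis using g(2) by (auto simp: Hom_def)
  qed
  then obtain m where m: "\<And>f. f \<in> Arr C \<Longrightarrow> m f \<in> Hom K (Dom K (k (Dom C f))) (Dom K (k (Cod C f)))"
    "\<And>f. f \<in> Arr C \<Longrightarrow> k (Cod C f) \<cdot>\<^bsub>K\<^esub> m f = FArr F f \<cdot>\<^bsub>K\<^esub> k (Dom C f)" by metis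
  have mD: "m f \<in> Arr K" "Dom K (m f) = Dom K (k (Dom C f))" "Cod K (m f) = Dom K (k (Cod C f))" if "f \<in> Arr C" for f
    using m(1)[OF that] by (simp_all add: Hom_def)
  define M where "M = \<lparr>FObj = \<lambda>a\<in>Obj C. Dom K (k a), FArr = \<lambda>f\<in>Arr C. m f\<rparr>"
  have "is_functor C K M" unfolding M_def
  proof (rule functorI)
    fix a assume a: "a \<in> Obj C"
    show "Dom K (k a) \<in> Obj K" using kD[OF a] by simp
    show "m (Idn C a) = Idn K (Dom K (k a))"
      by (rule K.monic_cancel[OF K.is_kernel_monic[OF k[OF a]]])
         (use a kD[OF a] m(2)[of "Idn C a"] mD[of "Idn C a"] s functor_simps(5)[OF F a] in simp_all)
  next
    fix f g assume fg: "f \<in> Arr C" "g \<in> Arr C" "Cod C f = Dom C g"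
    note ob = C.dom_obj[OF fg(1)] C.dom_obj[OF fg(2)] C.cod_obj[OF fg(2)]
    have m2: "k (Dom C g) \<cdot>\<^bsub>K\<^esub> m f = FArr F f \<cdot>\<^bsub>K\<^esub> k (Dom C f)" using m(2)[OF fg(1)] fg(3) by simp
    show "m (g \<cdot>\<^bsub>C\<^esub> f) = m g \<cdot>\<^bsub>K\<^esub> m f"
      by (rule K.monic_cancel[OF K.is_kernel_monic[OF k[OF ob(3)]]])
         (use fg ob s kD(1,2) mD m(2)[of "g \<cdot>\<^bsub>C\<^esub> f"] m2 K.comp_reassoc[OF m(2)[OF fg(2)], of "m f"] functor_simps(6)[OF F fg]
           in simp_all)
  qed (fact m(1))
  moreover have "nat_trans C K M F (\<lambda>a\<in>Obj C. k a)"
    by (rule nat_transI) (use kD m(2) C.dom_obj in \<open>simp_all add: M_def Hom_def\<close>)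
  ultimately show thesis using that[of M "\<lambda>a\<in>Obj C. k a"] k by simp
qed

text \<open>Lifts chosen object by object are automatically natural, because the two sides of the
  square can be compared after composition with the monic \<open>k\<close>.\<close>

lemma pointwise_kernel_lift:
  assumes M: "is_functor C K M" and F: "is_functor C K F" and N: "is_functor C K N"
    and k: "nat_trans C K M F k" "\<And>a. a \<in> Obj C \<Longrightarrow> is_kernel K (k a) (\<eta> a)"
    and g: "nat_trans C K N F g" "\<And>a. a \<in> Obj C \<Longrightarrow> \<eta> a \<cdot>\<^bsub>K\<^esub> g a = Zro K (FObj N a) (Cod K (\<eta> a))"
  obtains h where "nat_trans C K N M h" "\<And>a. a \<in> Obj C \<Longrightarrow> k a \<cdot>\<^bsub>K\<^esub> h a = g a"
proof -
  note s = nat_simps(1-3)[OF k(1)] nat_simps(1-3)[OF g(1)] functor_simps(1-4)[OF F] functor_simps(1-4)[OF M] functor_simps(1-4)[OF N]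
  have "\<exists>h. h \<in> Hom K (FObj N a) (FObj M a) \<and> k a \<cdot>\<^bsub>K\<^esub> h = g a" if a: "a \<in> Obj C" for a
  proof -
    have "Cod K (g a) = Dom K (\<eta> a)" using s a K.is_kernelD(3)[OF k(2)[OF a]] by simp
    then obtain h where "h \<in> Arr K" "Dom K h = Dom K (g a)" "Cod K h = Dom K (k a)" "k a \<cdot>\<^bsub>K\<^esub> h = g a"
      using K.is_kernel_lift[OF k(2)[OF a], of "g a"] s a g(2)[OF a] by auto
    then show ?thesis using s a by (auto simp: Hom_def)
  qed
  then obtain h where h: "\<And>a. a \<in> Obj C \<Longrightarrow> h a \<in> Hom K (FObj N a) (FObj M a)" "\<And>a. a \<in> Obj C \<Longrightarrow> k a \<cdot>\<^bsub>K\<^esub> h a = g a"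
    by metis
  have hD: "h a \<in> Arr K" "Dom K (h a) = FObj N a" "Cod K (h a) = FObj M a" if "a \<in> Obj C" for a
    using h(1)[OF that] by (simp_all add: Hom_def)
  have "nat_trans C K N M (\<lambda>a\<in>Obj C. h a)"
  proof (rule nat_transI[OF h(1)])
    fix f assume f: "f \<in> Arr C"
    note ob = C.dom_obj[OF f] C.cod_obj[OF f]
    show "h (Cod C f) \<cdot>\<^bsub>K\<^esub> FArr N f = FArr M f \<cdot>\<^bsub>K\<^esub> h (Dom C f)"
      by (rule K.monic_cancel[OF K.is_kernel_monic[OF k(2)[OF ob(2)]]])
         (use f ob s hD h(2) nat_simps(4)[OF g(1) f] K.comp_reassoc[OF h(2)[OF ob(2)], of "FArr N f"]
            K.comp_reassoc[OF nat_simps(4)[OF k(1) f], of "h (Dom C f)"] in simp_all)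
  qed
  then show thesis using that[of "\<lambda>a\<in>Obj C. h a"] h(2) by simp
qed

lemma pointwise_biproduct:
  assumes F: "is_functor C K F" and G: "is_functor C K G"
  obtains M i j p q where "is_functor C K M" "nat_trans C K F M i" "nat_trans C K G M j" "nat_trans C K M F p" "nat_trans C K M G q"
    "\<And>a. a \<in> Obj C \<Longrightarrow> is_biproduct K (FObj F a) (FObj G a) (FObj M a) (i a) (j a) (p a) (q a)"
proof -
  note s = functor_simps(1-4)[OF F] functor_simps(1-4)[OF G]
  \<comment> \<open>The object and its four arrows are packed into one tuple, so that a single
    choice picks matching data at every object.\<close>
  have "\<exists>t. case t of (s, i, j, p, q) \<Rightarrow> is_biproduct K (FObj F a) (FObj G a) s i j p q" if "a \<in> Obj C" for a
    using K.biproduct_ex s that by fastforce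
  then obtain t where t: "\<And>a. a \<in> Obj C \<Longrightarrow> case t a of (s, i, j, p, q) \<Rightarrow> is_biproduct K (FObj F a) (FObj G a) s i j p q"
    by metis
  define S where "S a = fst (t a)" for a
  define i where "i a = fst (snd (t a))" for a
  define j where "j a = fst (snd (snd (t a)))" for a
  define p where "p a = fst (snd (snd (snd (t a))))" for a
  define q where "q a = snd (snd (snd (snd (t a))))" for a
  have b: "is_biproduct K (FObj F a) (FObj G a) (S a) (i a) (j a) (p a) (q a)" if "a \<in> Obj C" for a
    using t[OF that] by (simp add: S_def i_def j_def p_def q_def split_beta)
  note bt = K.is_biproductD(1-15)[OF b] and be = K.is_biproductD(16-)[OF b]
  \<comment> \<open>The diagonal matrix with entries \<open>FArr F f\<close> and
    \<open>FArr G f\<close>, expressed in the chosen injections and projections.\<close>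
  define m where "m f = Add K (i (Cod C f) \<cdot>\<^bsub>K\<^esub> (FArr F f \<cdot>\<^bsub>K\<^esub> p (Dom C f))) (j (Cod C f) \<cdot>\<^bsub>K\<^esub> (FArr G f \<cdot>\<^bsub>K\<^esub> q (Dom C f)))" for f
  have mD: "m f \<in> Arr K" "Dom K (m f) = S (Dom C f)" "Cod K (m f) = S (Cod C f)" if f: "f \<in> Arr C" for f
    unfolding m_def using f C.dom_obj[OF f] C.cod_obj[OF f] s bt by simp_all
  have pm: "p (Cod C f) \<cdot>\<^bsub>K\<^esub> m f = FArr F f \<cdot>\<^bsub>K\<^esub> p (Dom C f)" "q (Cod C f) \<cdot>\<^bsub>K\<^esub> m f = FArr G f \<cdot>\<^bsub>K\<^esub> q (Dom C f)"
    "m f \<cdot>\<^bsub>K\<^esub> i (Dom C f) = i (Cod C f) \<cdot>\<^bsub>K\<^esub> FArr F f" "m f \<cdot>\<^bsub>K\<^esub> j (Dom C f) = j (Cod C f) \<cdot>\<^bsub>K\<^esub> FArr G f"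
    if f: "f \<in> Arr C" for f
    unfolding m_def using f C.dom_obj[OF f] C.cod_obj[OF f] s bt be by simp_all
  define M where "M = \<lparr>FObj = \<lambda>a\<in>Obj C. S a, FArr = \<lambda>f\<in>Arr C. m f\<rparr>"
  have "is_functor C K M" unfolding M_def
  proof (rule functorI)
    fix a assume a: "a \<in> Obj C"
    show "S a \<in> Obj K" using bt a by simp
    have ia: "Idn C a \<in> Arr C" using a by simp
    show "m (Idn C a) = Idn K (S a)"
      by (rule K.biproduct_eqI[OF b[OF a]])
         (use a pm(1,2)[OF ia] mD[OF ia] bt s functor_simps(5)[OF F] functor_simps(5)[OF G] in simp_all)
  next
    fix f assume f: "f \<in> Arr C" show "m f \<in> Hom K (S (Dom C f)) (S (Cod C f))" using mD[OF f] by (simp add: Hom_def)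
    fix g assume fg: "g \<in> Arr C" "Cod C f = Dom C g"
    have gf: "g \<cdot>\<^bsub>C\<^esub> f \<in> Arr C" using f fg by simp
    note ob = C.dom_obj[OF f] C.dom_obj[OF fg(1)] C.cod_obj[OF fg(1)]
    note pmf = pm(1,2)[OF f, unfolded fg(2)]
    show "m (g \<cdot>\<^bsub>C\<^esub> f) = m g \<cdot>\<^bsub>K\<^esub> m f"
      by (rule K.biproduct_eqI[OF b[OF ob(3)]])
         (use f fg ob pm(1,2)[OF gf] mD[OF gf] mD[OF f] mD[OF fg(1)] bt s functor_simps(6)[OF F f fg] functor_simps(6)[OF G f fg]
            K.comp_reassoc[OF pm(1)[OF fg(1)], of "m f"] K.comp_reassoc[OF pm(2)[OF fg(1)], of "m f"] pmf in simp_all)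
  qed
  moreover have "nat_trans C K F M (\<lambda>a\<in>Obj C. i a)" "nat_trans C K G M (\<lambda>a\<in>Obj C. j a)"
    "nat_trans C K M F (\<lambda>a\<in>Obj C. p a)" "nat_trans C K M G (\<lambda>a\<in>Obj C. q a)"
    by (rule nat_transI; use bt pm C.dom_obj in \<open>simp add: M_def Hom_def\<close>)+
  moreover have "is_biproduct K (FObj F a) (FObj G a) (FObj M a) ((\<lambda>a\<in>Obj C. i a) a) ((\<lambda>a\<in>Obj C. j a) a)
      ((\<lambda>a\<in>Obj C. p a) a) ((\<lambda>a\<in>Obj C. q a) a)" if "a \<in> Obj C" for a
    using b[OF that] that by (simp add: M_def)
  ultimately show thesis by (rule that)
qed

lemma pointwise_zero:
  obtains M where "is_functor C K M" "\<And>a. a \<in> Obj C \<Longrightarrow> zero_object K (FObj M a)"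
proof -
  obtain z where z: "zero_object K z" using K.zero_ex by blast
  then have zo: "z \<in> Obj K" by (simp add: zero_object_def)
  define M where "M = \<lparr>FObj = \<lambda>a\<in>Obj C. z, FArr = \<lambda>f\<in>Arr C. Idn K z\<rparr>"
  have "is_functor C K M"
    unfolding M_def by (rule functorI) (use zo K.idn_hom in simp_all)
  moreover have "zero_object K (FObj M a)" if "a \<in> Obj C" for a
    using z that by (simp add: M_def)
  ultimately show thesis by (rule that)
qed

end

section \<open>Full subcategories of functor categories\<close>

lemma functor_cat_simps [simp]:
  "Obj (functor_cat C K \<F>) = \<F>"
  "(F, G, \<eta>) \<in> Arr (functor_cat C K \<F>) \<longleftrightarrow> F \<in> \<F> \<and> G \<in> \<F> \<and> nat_trans C K F G \<eta>"
  "Dom (functor_cat C K \<F>) (F, G, \<eta>) = F" "Cod (functor_cat C K \<F>) (F, G, \<eta>) = G"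
  "Idn (functor_cat C K \<F>) F = (F, F, \<lambda>a\<in>Obj C. Idn K (FObj F a))"
  "Comp (functor_cat C K \<F>) (G', H, \<theta>) (F, G, \<eta>) = (F, H, \<lambda>a\<in>Obj C. \<theta> a \<cdot>\<^bsub>K\<^esub> \<eta> a)"
  "Zro (functor_cat C K \<F>) F G = (F, G, \<lambda>a\<in>Obj C. Zro K (FObj F a) (FObj G a))"
  "Add (functor_cat C K \<F>) (F, G, \<eta>) (F', H', \<theta>) = (F, G, \<lambda>a\<in>Obj C. Add K (\<eta> a) (\<theta> a))"
  by (simp_all add: functor_cat_def)

lemma functor_cat_arrE:
  assumes "f \<in> Arr (functor_cat C K \<F>)"
  obtains F G \<eta> where "f = (F, G, \<eta>)" "F \<in> \<F>" "G \<in> \<F>" "nat_trans C K F G \<eta>"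
  using assms by (cases f) auto

lemma functor_cat_homE:
  assumes "f \<in> Hom (functor_cat C K \<F>) F G"
  obtains \<eta> where "f = (F, G, \<eta>)" "F \<in> \<F>" "G \<in> \<F>" "nat_trans C K F G \<eta>"
  using assms by (cases f) (auto simp: Hom_def)

lemma functor_cat_hom_iff [simp]:
  "(F', G', \<eta>) \<in> Hom (functor_cat C K \<F>) F G \<longleftrightarrow> F' = F \<and> G' = G \<and> F \<in> \<F> \<and> G \<in> \<F> \<and> nat_trans C K F G \<eta>"
  by (auto simp: Hom_def)

locale functor_subcategory = functors_to_abelian C K
  for C :: "('o, 'm, 'z) precat_scheme" and K :: "('p, 'n, 'k) prelincat" +
  fixes \<F> :: "('o, 'm, 'p, 'n) funct set"
  assumes functors: "F \<in> \<F> \<Longrightarrow> is_functor C K F"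
begin

abbreviation "\<R> \<equiv> functor_cat C K \<F>"

lemma functor_cat_category: "category \<R>"
proof
  show "f \<in> Arr \<R> \<Longrightarrow> Dom \<R> f \<in> Obj \<R>" "f \<in> Arr \<R> \<Longrightarrow> Cod \<R> f \<in> Obj \<R>" for f by (cases f; simp)+
  show "F \<in> Obj \<R> \<Longrightarrow> Idn \<R> F \<in> Hom \<R> F F" for F using nat_idn functors by simp
  show "f \<in> Hom \<R> F G \<Longrightarrow> g \<in> Hom \<R> G H \<Longrightarrow> g \<cdot>\<^bsub>\<R>\<^esub> f \<in> Hom \<R> F H" for f g F G H
    by (auto elim!: functor_cat_homE intro!: nat_comp dest: functors)
  show "Idn \<R> G \<cdot>\<^bsub>\<R>\<^esub> f = f" "f \<cdot>\<^bsub>\<R>\<^esub> Idn \<R> F = f" if f: "f \<in> Hom \<R> F G" for f F G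
  proof -
    obtain \<eta> where \<eta>: "f = (F, G, \<eta>)" "F \<in> \<F>" "G \<in> \<F>" "nat_trans C K F G \<eta>" using f by (rule functor_cat_homE)
    show "Idn \<R> G \<cdot>\<^bsub>\<R>\<^esub> f = f" "f \<cdot>\<^bsub>\<R>\<^esub> Idn \<R> F = f"
      using nat_simps(1-3)[OF \<eta>(4)] by (simp_all add: \<eta>(1) nat_eq_restrict[OF \<eta>(4)])
  qed
  show "h \<cdot>\<^bsub>\<R>\<^esub> (g \<cdot>\<^bsub>\<R>\<^esub> f) = h \<cdot>\<^bsub>\<R>\<^esub> g \<cdot>\<^bsub>\<R>\<^esub> f" if fgh: "f \<in> Hom \<R> F G" "g \<in> Hom \<R> G H" "h \<in> Hom \<R> H L" for f g h F G H L
  proof -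
    obtain \<eta> where \<eta>: "f = (F, G, \<eta>)" "F \<in> \<F>" "G \<in> \<F>" "nat_trans C K F G \<eta>" using fgh(1) by (rule functor_cat_homE)
    obtain \<theta> where \<theta>: "g = (G, H, \<theta>)" "G \<in> \<F>" "H \<in> \<F>" "nat_trans C K G H \<theta>" using fgh(2) by (rule functor_cat_homE)
    obtain \<kappa> where \<kappa>: "h = (H, L, \<kappa>)" "H \<in> \<F>" "L \<in> \<F>" "nat_trans C K H L \<kappa>" using fgh(3) by (rule functor_cat_homE)
    show ?thesis using nat_simps(1-3)[OF \<eta>(4)] nat_simps(1-3)[OF \<theta>(4)] nat_simps(1-3)[OF \<kappa>(4)]
      by (simp add: \<eta> \<theta> \<kappa> cong: restrict_cong)
  qed
qed

lemma functor_cat_preadditive: "preadditive_category \<R>"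
proof (intro preadditive_category.intro preadditive_category_axioms.intro functor_cat_category)
  fix F G assume FG: "F \<in> Obj \<R>" "G \<in> Obj \<R>"
  then have fn: "is_functor C K F" "is_functor C K G" using functors by simp_all
  let ?H = "Hom_module \<R> F G"
  have z: "Zro \<R> F G \<in> Hom \<R> F G" using FG nat_zero[OF fn] by simp
  show "abelian_group ?H"
  proof (rule abelian_groupI)
    fix f g assume f: "f \<in> carrier ?H" and g: "g \<in> carrier ?H"
    obtain \<eta> where \<eta>: "f = (F, G, \<eta>)" "nat_trans C K F G \<eta>" using f by (auto elim: functor_cat_homE)
    obtain \<theta> where \<theta>: "g = (F, G, \<theta>)" "nat_trans C K F G \<theta>" using g by (auto elim: functor_cat_homE)
    note s = nat_simps(1-3)[OF \<eta>(2)] nat_simps(1-3)[OF \<theta>(2)]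
    show "f \<oplus>\<^bsub>?H\<^esub> g \<in> carrier ?H" using FG nat_add[OF fn \<eta>(2) \<theta>(2)] by (simp add: \<eta> \<theta>)
    show "f \<oplus>\<^bsub>?H\<^esub> g = g \<oplus>\<^bsub>?H\<^esub> f" using s by (simp add: \<eta> \<theta> K.add_comm cong: restrict_cong)
    fix h assume h: "h \<in> carrier ?H"
    obtain \<kappa> where \<kappa>: "h = (F, G, \<kappa>)" "nat_trans C K F G \<kappa>" using h by (auto elim: functor_cat_homE)
    show "f \<oplus>\<^bsub>?H\<^esub> g \<oplus>\<^bsub>?H\<^esub> h = f \<oplus>\<^bsub>?H\<^esub> (g \<oplus>\<^bsub>?H\<^esub> h)"
      using s nat_simps(1-3)[OF \<kappa>(2)] by (simp add: \<eta> \<theta> \<kappa> K.add_assoc cong: restrict_cong)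
  next
    show "\<zero>\<^bsub>?H\<^esub> \<in> carrier ?H" using z by simp
  next
    fix f assume f: "f \<in> carrier ?H"
    obtain \<eta> where \<eta>: "f = (F, G, \<eta>)" "nat_trans C K F G \<eta>" using f by (auto elim: functor_cat_homE)
    note s = nat_simps(1-3)[OF \<eta>(2)]
    show "\<zero>\<^bsub>?H\<^esub> \<oplus>\<^bsub>?H\<^esub> f = f" using s by (simp add: \<eta>(1) nat_eq_restrict[OF \<eta>(2)])
    show "\<exists>g\<in>carrier ?H. g \<oplus>\<^bsub>?H\<^esub> f = \<zero>\<^bsub>?H\<^esub>"
      by (rule bexI[of _ "(F, G, \<lambda>a\<in>Obj C. K.neg (\<eta> a))"])
         (use s FG nat_neg[OF fn \<eta>(2)] in \<open>simp_all add: \<eta>(1) cong: restrict_cong\<close>)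
  qed
next
  fix f g h F G H
  assume f: "f \<in> Hom \<R> F G" and g: "g \<in> Hom \<R> G H" and h: "h \<in> Hom \<R> G H"
  obtain \<eta> where \<eta>: "f = (F, G, \<eta>)" "nat_trans C K F G \<eta>" using f by (rule functor_cat_homE)
  obtain \<theta> where \<theta>: "g = (G, H, \<theta>)" "nat_trans C K G H \<theta>" using g by (rule functor_cat_homE)
  obtain \<kappa> where \<kappa>: "h = (G, H, \<kappa>)" "nat_trans C K G H \<kappa>" using h by (rule functor_cat_homE)
  show "Add \<R> g h \<cdot>\<^bsub>\<R>\<^esub> f = Add \<R> (g \<cdot>\<^bsub>\<R>\<^esub> f) (h \<cdot>\<^bsub>\<R>\<^esub> f)"
    using nat_simps(1-3)[OF \<eta>(2)] nat_simps(1-3)[OF \<theta>(2)] nat_simps(1-3)[OF \<kappa>(2)]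
    by (simp add: \<eta> \<theta> \<kappa> cong: restrict_cong)
next
  fix f g h F G H
  assume f: "f \<in> Hom \<R> F G" and g: "g \<in> Hom \<R> F G" and h: "h \<in> Hom \<R> G H"
  obtain \<eta> where \<eta>: "f = (F, G, \<eta>)" "nat_trans C K F G \<eta>" using f by (rule functor_cat_homE)
  obtain \<theta> where \<theta>: "g = (F, G, \<theta>)" "nat_trans C K F G \<theta>" using g by (rule functor_cat_homE)
  obtain \<kappa> where \<kappa>: "h = (G, H, \<kappa>)" "nat_trans C K G H \<kappa>" using h by (rule functor_cat_homE)
  show "h \<cdot>\<^bsub>\<R>\<^esub> Add \<R> f g = Add \<R> (h \<cdot>\<^bsub>\<R>\<^esub> f) (h \<cdot>\<^bsub>\<R>\<^esub> g)"
    using nat_simps(1-3)[OF \<eta>(2)] nat_simps(1-3)[OF \<theta>(2)] nat_simps(1-3)[OF \<kappa>(2)]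
    by (simp add: \<eta> \<theta> \<kappa> cong: restrict_cong)
qed

sublocale R: preadditive_category \<R>
  by (rule functor_cat_preadditive)

lemma pointwise_monic:
  assumes \<eta>: "(F, G, \<eta>) \<in> Arr \<R>" and m: "\<And>a. a \<in> Obj C \<Longrightarrow> monic K (\<eta> a)"
  shows "monic \<R> (F, G, \<eta>)"
proof (rule R.monicI[OF \<eta>])
  fix g assume g: "g \<in> Arr \<R>" "Cod \<R> g = Dom \<R> (F, G, \<eta>)" "(F, G, \<eta>) \<cdot>\<^bsub>\<R>\<^esub> g = Zro \<R> (Dom \<R> g) (Cod \<R> (F, G, \<eta>))"
  obtain N \<theta> where \<theta>: "g = (N, F, \<theta>)" "N \<in> \<F>" "nat_trans C K N F \<theta>" using g(1,2) by (cases g) auto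
  have h: "nat_trans C K F G \<eta>" "F \<in> \<F>" using \<eta> by simp_all
  note s = nat_simps(1-3)[OF h(1)] nat_simps(1-3)[OF \<theta>(3)]
  have e: "(\<lambda>a\<in>Obj C. \<eta> a \<cdot>\<^bsub>K\<^esub> \<theta> a) = (\<lambda>a\<in>Obj C. Zro K (FObj N a) (FObj G a))" using g(3) by (simp add: \<theta>)
  have c: "\<eta> a \<cdot>\<^bsub>K\<^esub> \<theta> a = Zro K (FObj N a) (FObj G a)" if "a \<in> Obj C" for a
    using fun_cong[OF e, of a] that by simp
  have "\<theta> a = Zro K (FObj N a) (FObj F a)" if a: "a \<in> Obj C" for a
    by (rule K.monic_zeroI[OF m[OF a]]) (use a s c in simp_all)
  then have "(\<lambda>a\<in>Obj C. Zro K (FObj N a) (FObj F a)) = \<theta>"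
    by (intro nat_eq_restrict[OF \<theta>(3)]) simp
  then show "g = Zro \<R> (Dom \<R> g) (Dom \<R> (F, G, \<eta>))" by (simp add: \<theta>(1))
qed

text \<open>The lift runs between two members of a full subcategory and is therefore one of its
  arrows. So pointwise kernels are kernels in every full subcategory containing the functors
  concerned, without closure conditions.\<close>

lemma pointwise_is_kernel:
  assumes k: "(M, F, k) \<in> Arr \<R>" and \<eta>: "(F, G, \<eta>) \<in> Arr \<R>" and ker: "\<And>a. a \<in> Obj C \<Longrightarrow> is_kernel K (k a) (\<eta> a)"
  shows "is_kernel \<R> (M, F, k) (F, G, \<eta>)"
proof (rule R.is_kernelI)
  have h: "nat_trans C K M F k" "nat_trans C K F G \<eta>" "M \<in> \<F>" "F \<in> \<F>" "G \<in> \<F>" using k \<eta> by simp_all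
  note s = nat_simps(1-3)[OF h(1)] nat_simps(1-3)[OF h(2)]
  show "monic \<R> (M, F, k)" by (rule pointwise_monic[OF k]) (rule K.is_kernel_monic[OF ker])
  show "(F, G, \<eta>) \<cdot>\<^bsub>\<R>\<^esub> (M, F, k) = Zro \<R> (Dom \<R> (M, F, k)) (Cod \<R> (F, G, \<eta>))"
    using K.is_kernelD(4)[OF ker] s by (simp cong: restrict_cong)
  fix g assume g: "g \<in> Arr \<R>" "Cod \<R> g = Dom \<R> (F, G, \<eta>)" "(F, G, \<eta>) \<cdot>\<^bsub>\<R>\<^esub> g = Zro \<R> (Dom \<R> g) (Cod \<R> (F, G, \<eta>))"
  obtain N \<theta> where \<theta>: "g = (N, F, \<theta>)" "N \<in> \<F>" "nat_trans C K N F \<theta>" using g(1,2) by (cases g) auto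
  have e: "(\<lambda>a\<in>Obj C. \<eta> a \<cdot>\<^bsub>K\<^esub> \<theta> a) = (\<lambda>a\<in>Obj C. Zro K (FObj N a) (FObj G a))" using g(3) by (simp add: \<theta>)
  have c: "\<eta> a \<cdot>\<^bsub>K\<^esub> \<theta> a = Zro K (FObj N a) (Cod K (\<eta> a))" if "a \<in> Obj C" for a
    using fun_cong[OF e, of a] that s by simp
  obtain t where t: "nat_trans C K N M t" "\<And>a. a \<in> Obj C \<Longrightarrow> k a \<cdot>\<^bsub>K\<^esub> t a = \<theta> a"
    by (rule pointwise_kernel_lift[OF functors[OF h(3)] functors[OF h(4)] functors[OF \<theta>(2)] h(1) ker \<theta>(3) c]) (blast intro: that)+
  have "(M, F, k) \<cdot>\<^bsub>\<R>\<^esub> (N, M, t) = g" using t(2) by (simp add: \<theta>(1) nat_eq_restrict[OF \<theta>(3)])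
  then show "\<exists>h\<in>Hom \<R> (Dom \<R> g) (Dom \<R> (M, F, k)). (M, F, k) \<cdot>\<^bsub>\<R>\<^esub> h = g"
    using t(1) h(3) \<theta>(2) by (intro bexI[of _ "(N, M, t)"]) (simp_all add: \<theta>(1))
qed (use k \<eta> in simp_all)

lemma iso_pointwise:
  assumes "iso_arr \<R> (F, G, \<eta>)" "a \<in> Obj C"
  shows "iso_arr K (\<eta> a)"
proof -
  obtain g where g: "(F, G, \<eta>) \<in> Arr \<R>" "g \<in> Arr \<R>" "Dom \<R> g = G" "Cod \<R> g = F"
    "g \<cdot>\<^bsub>\<R>\<^esub> (F, G, \<eta>) = Idn \<R> F" "(F, G, \<eta>) \<cdot>\<^bsub>\<R>\<^esub> g = Idn \<R> G"
    using R.iso_arrE[OF assms(1)] by auto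
  obtain \<theta> where \<theta>: "g = (G, F, \<theta>)" "nat_trans C K G F \<theta>" using g(2-4) by (cases g) auto
  have h: "nat_trans C K F G \<eta>" using g by simp
  note s = nat_simps(1-3)[OF h assms(2)] nat_simps(1-3)[OF \<theta>(2) assms(2)]
  have e: "(\<lambda>a\<in>Obj C. \<theta> a \<cdot>\<^bsub>K\<^esub> \<eta> a) = (\<lambda>a\<in>Obj C. Idn K (FObj F a))"
    "(\<lambda>a\<in>Obj C. \<eta> a \<cdot>\<^bsub>K\<^esub> \<theta> a) = (\<lambda>a\<in>Obj C. Idn K (FObj G a))" using g by (simp_all add: \<theta>)
  have "\<theta> a \<cdot>\<^bsub>K\<^esub> \<eta> a = Idn K (FObj F a)" "\<eta> a \<cdot>\<^bsub>K\<^esub> \<theta> a = Idn K (FObj G a)"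
    using fun_cong[OF e(1), of a] fun_cong[OF e(2), of a] assms(2) by simp_all
  then show ?thesis using s by (intro K.iso_arrI[of _ "\<theta> a"]) simp_all
qed

text \<open>Arrows of a functor category are stored with their source and target, so \<open>\<R>'\<close> is isomorphic but
  not equal to the opposite of \<open>\<R>\<close>.\<close>

lemma op_sub: "functor_subcategory (op_cat C) (op_lin K) \<F>"
  by (intro functor_subcategory.intro functor_subcategory_axioms.intro op) (simp add: functors)

abbreviation "\<R>' \<equiv> functor_cat (op_cat C) (op_lin K) \<F>"

lemma op_arr: "(G, F, \<eta>) \<in> Arr \<R>' \<longleftrightarrow> (F, G, \<eta>) \<in> Arr \<R>"
  by auto

text \<open>Quantifiers over arrows are spelled out over their three components. After this the
  category and its dual version differ only in the order of the first two components, and dual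
  notions can be compared literally.\<close>

lemma ball_arr: "(\<forall>f\<in>Arr \<R>. Q f) \<longleftrightarrow> (\<forall>F G \<eta>. (F, G, \<eta>) \<in> Arr \<R> \<longrightarrow> Q (F, G, \<eta>))"
  by (metis surj_pair)

lemma ball_arr': "(\<forall>f\<in>Arr \<R>'. Q f) \<longleftrightarrow> (\<forall>F G \<eta>. (F, G, \<eta>) \<in> Arr \<R> \<longrightarrow> Q (G, F, \<eta>))"
  by (metis surj_pair op_arr)

lemma ex1_hom: "(\<exists>!h. h \<in> Hom \<R> F G \<and> Q h) \<longleftrightarrow> (\<exists>!\<eta>. (F, G, \<eta>) \<in> Arr \<R> \<and> Q (F, G, \<eta>))"
  by (auto simp: Hom_def) metis+

lemma ex1_hom': "(\<exists>!h. h \<in> Hom \<R>' G F \<and> Q h) \<longleftrightarrow> (\<exists>!\<eta>. (F, G, \<eta>) \<in> Arr \<R> \<and> Q (G, F, \<eta>))"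
  by (auto simp: Hom_def) metis+

lemma op_is_kernel: "is_kernel \<R>' (G, F, k) (F, H, \<eta>) \<longleftrightarrow> is_cokernel \<R> (F, G, k) (H, F, \<eta>)"
  unfolding is_kernel_def is_cokernel_def ball_arr ball_arr'
  by (simp add: ex1_hom ex1_hom' del: functor_cat_hom_iff) (rule iffI; elim conjE; intro conjI; assumption)

lemma op_monic: "monic \<R>' (G, F, \<eta>) \<longleftrightarrow> epic \<R> (F, G, \<eta>)"
  unfolding monic_def epic_def ball_arr ball_arr'
  by simp (rule iffI; elim conjE; intro conjI; assumption)

lemma pointwise_is_cokernel:
  assumes c: "(F, M, c) \<in> Arr \<R>" and \<eta>: "(G, F, \<eta>) \<in> Arr \<R>" and coker: "\<And>a. a \<in> Obj C \<Longrightarrow> is_cokernel K (c a) (\<eta> a)"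
  shows "is_cokernel \<R> (F, M, c) (G, F, \<eta>)"
  using functor_subcategory.pointwise_is_kernel[OF op_sub, of M F c G \<eta>] assms op_is_kernel[of M F c G \<eta>] by simp

lemma pointwise_short_exact:
  assumes "(M, F, k) \<in> Arr \<R>" "(F, G, c) \<in> Arr \<R>" "\<And>a. a \<in> Obj C \<Longrightarrow> short_exact K (k a) (c a)"
  shows "short_exact \<R> (M, F, k) (F, G, c)"
  using assms pointwise_is_kernel[of M F k G c] pointwise_is_cokernel[of F G c M k]
  by (simp add: short_exact_def del: functor_cat_simps)

end

text \<open>The conditions are pointwise in \<open>K\<close> and exchanged in pairs by duality, so
  the locale applies to the opposite situation as well. The biproduct condition supplies the
  structure maps because linearity of a biproduct is read off through its projections.\<close>

locale exact_functor_subcategory = functor_subcategory C K \<F>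
  for C :: "('o, 'm, 'z) precat_scheme" and K :: "('p, 'n, 'k) prelincat" and \<F> :: "('o, 'm, 'p, 'n) funct set" +
  assumes zero_closed: "\<lbrakk>is_functor C K M; \<And>a. a \<in> Obj C \<Longrightarrow> zero_object K (FObj M a)\<rbrakk> \<Longrightarrow> M \<in> \<F>"
    and sub_closed: "\<lbrakk>is_functor C K M; F \<in> \<F>; nat_trans C K M F k; \<And>a. a \<in> Obj C \<Longrightarrow> monic K (k a)\<rbrakk> \<Longrightarrow> M \<in> \<F>"
    and quotient_closed: "\<lbrakk>is_functor C K M; F \<in> \<F>; nat_trans C K F M c; \<And>a. a \<in> Obj C \<Longrightarrow> epic K (c a)\<rbrakk> \<Longrightarrow> M \<in> \<F>"
    and biproduct_closed: "\<lbrakk>is_functor C K M; F \<in> \<F>; G \<in> \<F>; nat_trans C K F M i; nat_trans C K G M j;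
       nat_trans C K M F p; nat_trans C K M G q;
       \<And>a. a \<in> Obj C \<Longrightarrow> is_biproduct K (FObj F a) (FObj G a) (FObj M a) (i a) (j a) (p a) (q a)\<rbrakk> \<Longrightarrow> M \<in> \<F>"
begin

lemma op_exact: "exact_functor_subcategory (op_cat C) (op_lin K) \<F>"
proof (intro exact_functor_subcategory.intro exact_functor_subcategory_axioms.intro op_sub)
  fix M F G i j p q
  assume a: "is_functor (op_cat C) (op_lin K) M" "F \<in> \<F>" "G \<in> \<F>"
    "nat_trans (op_cat C) (op_lin K) F M i" "nat_trans (op_cat C) (op_lin K) G M j"
    "nat_trans (op_cat C) (op_lin K) M F p" "nat_trans (op_cat C) (op_lin K) M G q"
    "\<And>a. a \<in> Obj (op_cat C) \<Longrightarrow> is_biproduct (op_lin K) (FObj F a) (FObj G a) (FObj M a) (i a) (j a) (p a) (q a)"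
  show "M \<in> \<F>" by (rule biproduct_closed[of M F G p q i j]) (use a in simp_all)
next
  fix M F k
  assume a: "is_functor (op_cat C) (op_lin K) M" "F \<in> \<F>"  "nat_trans (op_cat C) (op_lin K) M F k"
    "\<And>a. a \<in> Obj (op_cat C) \<Longrightarrow> monic (op_lin K) (k a)"
  show "M \<in> \<F>" by (rule quotient_closed[of M F k]) (use a in simp_all)
next
  fix M F k
  assume a: "is_functor (op_cat C) (op_lin K) M" "F \<in> \<F>"  "nat_trans (op_cat C) (op_lin K) F M k"
    "\<And>a. a \<in> Obj (op_cat C) \<Longrightarrow> epic (op_lin K) (k a)"
  show "M \<in> \<F>" by (rule sub_closed[of M F k]) (use a in simp_all)
qed (simp add: zero_closed)

lemma kernel_exists:
  assumes \<eta>: "(F, G, \<eta>) \<in> Arr \<R>"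
  obtains M k where "(M, F, k) \<in> Arr \<R>" "\<And>a. a \<in> Obj C \<Longrightarrow> is_kernel K (k a) (\<eta> a)" "is_kernel \<R> (M, F, k) (F, G, \<eta>)"
proof -
  have h: "F \<in> \<F>" "G \<in> \<F>" "nat_trans C K F G \<eta>" using \<eta> by simp_all
  obtain M k where M: "is_functor C K M" "nat_trans C K M F k" and k: "\<And>a. a \<in> Obj C \<Longrightarrow> is_kernel K (k a) (\<eta> a)"
    using pointwise_kernel[OF functors[OF h(1)] functors[OF h(2)] h(3)] by blast
  have "M \<in> \<F>" by (rule sub_closed[OF M(1) h(1) M(2)]) (rule K.is_kernel_monic[OF k])
  then have "(M, F, k) \<in> Arr \<R>" using M h by simp
  then show thesis using that k pointwise_is_kernel[OF _ \<eta> k] by blast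
qed

lemma cokernel_exists:
  assumes \<eta>: "(F, G, \<eta>) \<in> Arr \<R>"
  obtains M c where "(G, M, c) \<in> Arr \<R>" "\<And>a. a \<in> Obj C \<Longrightarrow> is_cokernel K (c a) (\<eta> a)" "is_cokernel \<R> (G, M, c) (F, G, \<eta>)"
proof -
  have "(G, F, \<eta>) \<in> Arr \<R>'" using \<eta> by simp
  then obtain M c where a: "(M, G, c) \<in> Arr \<R>'" "is_kernel \<R>' (M, G, c) (G, F, \<eta>)"
     and k: "\<And>a. a \<in> Obj (op_cat C) \<Longrightarrow> is_kernel (op_lin K) (c a) (\<eta> a)"
    using exact_functor_subcategory.kernel_exists[OF op_exact, of G F \<eta>] by blast
  have "\<And>a. a \<in> Obj C \<Longrightarrow> is_cokernel K (c a) (\<eta> a)" using k by simp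
  then show thesis using that[of M c] a op_is_kernel op_arr by blast
qed

text \<open>One kernel is pointwise by construction. Any other differs from it by an isomorphism of
  functors, which is an isomorphism at each object.\<close>

lemma kernel_pointwise:
  assumes k: "is_kernel \<R> (M, F, k) (F, G, \<eta>)" and a: "a \<in> Obj C"
  shows "is_kernel K (k a) (\<eta> a)"
proof -
  note kD = R.is_kernelD[OF k]
  obtain M' k' where k': "(M', F, k') \<in> Arr \<R>" "\<And>a. a \<in> Obj C \<Longrightarrow> is_kernel K (k' a) (\<eta> a)" "is_kernel \<R> (M', F, k') (F, G, \<eta>)"
    using kernel_exists[OF kD(2)] by blast
  obtain h where h: "iso_arr \<R> h" "Dom \<R> h = M" "Cod \<R> h = M'" "(M', F, k') \<cdot>\<^bsub>\<R>\<^esub> h = (M, F, k)"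
    using R.kernel_unique[OF k'(3) k] by auto
  have "h \<in> Arr \<R>" using h(1) by (simp add: iso_arr_def)
  then obtain \<theta> where \<theta>: "h = (M, M', \<theta>)" "nat_trans C K M M' \<theta>" using h(2,3) by (cases h) auto
  have "(\<lambda>a\<in>Obj C. k' a \<cdot>\<^bsub>K\<^esub> \<theta> a) = k" using h(4) by (simp add: \<theta>)
  then have e: "k' a \<cdot>\<^bsub>K\<^esub> \<theta> a = k a" using a by (metis restrict_apply')
  have "nat_trans C K M' F k'" using k'(1) by simp
  then have "Cod K (\<theta> a) = Dom K (k' a)" using nat_simps(2,3) \<theta>(2) a by simp
  from K.kernel_iso_comp[OF k'(2)[OF a] iso_pointwise[OF h(1)[unfolded \<theta>(1)] a] this] show ?thesis by (simp add: e)
qed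

lemma cokernel_pointwise:
  assumes "is_cokernel \<R> (F, M, c) (G, F, \<eta>)" and "a \<in> Obj C"
  shows "is_cokernel K (c a) (\<eta> a)"
  using exact_functor_subcategory.kernel_pointwise[OF op_exact, of M F c G \<eta> a] assms op_is_kernel[of M F c G \<eta>] by simp

lemma short_exact_pointwise:
  assumes "short_exact \<R> (M, F, k) (F, G, c)" "a \<in> Obj C"
  shows "short_exact K (k a) (c a)"
  using assms kernel_pointwise[of M F k G c a] cokernel_pointwise[of F G c M k a] by (simp add: short_exact_def)

text \<open>The pointwise kernel \<open>k\<close> of a monic is zero, since composing it with the
  monic gives zero. An arrow killed by \<open>\<eta> a\<close> factors through \<open>k a\<close>
  and hence vanishes.\<close>

lemma monic_pointwise:
  assumes m: "monic \<R> (F, G, \<eta>)" and a: "a \<in> Obj C"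
  shows "monic K (\<eta> a)"
proof -
  have \<eta>: "(F, G, \<eta>) \<in> Arr \<R>" using m by (simp add: monic_def del: functor_cat_simps)
  obtain M k where k: "(M, F, k) \<in> Arr \<R>" "\<And>a. a \<in> Obj C \<Longrightarrow> is_kernel K (k a) (\<eta> a)" "is_kernel \<R> (M, F, k) (F, G, \<eta>)"
    using kernel_exists[OF \<eta>] by blast
  have "(M, F, k) = Zro \<R> M F" using R.monic_zro[OF m k(1)] R.is_kernelD(4)[OF k(3)] by simp
  then have k0: "k = (\<lambda>a\<in>Obj C. Zro K (FObj M a) (FObj F a))" by simp
  have h: "nat_trans C K F G \<eta>" "is_functor C K F" "is_functor C K M" "nat_trans C K M F k" using \<eta> k(1) functors by simp_all
  note s = nat_simps(1-3)[OF h(1) a] functor_simps(1)[OF h(2) a] functor_simps(1)[OF h(3) a] nat_simps(1-3)[OF h(4) a]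
  show ?thesis
  proof (rule K.monicI[OF s(1)])
    fix g assume g: "g \<in> Arr K" "Cod K g = Dom K (\<eta> a)" "\<eta> a \<cdot>\<^bsub>K\<^esub> g = Zro K (Dom K g) (Cod K (\<eta> a))"
    obtain u where u: "u \<in> Arr K" "Dom K u = Dom K g" "Cod K u = Dom K (k a)" "k a \<cdot>\<^bsub>K\<^esub> u = g"
      using K.is_kernel_lift[OF k(2)[OF a] g] by blast
    have "k a \<cdot>\<^bsub>K\<^esub> u = Zro K (Dom K g) (FObj F a)" using u(1-3) s a by (simp add: k0)
    then show "g = Zro K (Dom K g) (Dom K (\<eta> a))" using u(4) s by simp
  qed
qed

theorem functor_cat_abelian: "abelian_category \<R>"
proof
  obtain Z where Z: "is_functor C K Z" "\<And>a. a \<in> Obj C \<Longrightarrow> zero_object K (FObj Z a)" using pointwise_zero by metis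
  have ZF: "Z \<in> \<F>" using zero_closed Z by blast
  have Zu: "f = g" if "f \<in> Hom K x y" "g \<in> Hom K x y" "zero_object K x \<or> zero_object K y" for f g x y
  proof -
    have "x \<in> Obj K" "y \<in> Obj K" using that(1) K.dom_obj K.cod_obj by (auto simp: Hom_def)
    then show ?thesis using that unfolding zero_object_def by blast
  qed
  have "\<exists>!f. f \<in> Hom \<R> M Z" "\<exists>!f. f \<in> Hom \<R> Z M" if M: "M \<in> \<F>" for M
  proof -
    have n: "nat_trans C K M Z (\<lambda>a\<in>Obj C. Zro K (FObj M a) (FObj Z a))" "nat_trans C K Z M (\<lambda>a\<in>Obj C. Zro K (FObj Z a) (FObj M a))"
      using nat_zero functors M ZF by blast+
    show "\<exists>!f. f \<in> Hom \<R> M Z"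
    proof (rule ex1I)
      show "(M, Z, \<lambda>a\<in>Obj C. Zro K (FObj M a) (FObj Z a)) \<in> Hom \<R> M Z" using n M ZF by simp
      fix f assume "f \<in> Hom \<R> M Z"
      then obtain \<theta> where \<theta>: "f = (M, Z, \<theta>)" "nat_trans C K M Z \<theta>" by (rule functor_cat_homE)
      have "\<theta> = (\<lambda>a\<in>Obj C. Zro K (FObj M a) (FObj Z a))"
      proof (rule nat_eqI[OF \<theta>(2) n(1)])
        fix a assume a: "a \<in> Obj C"
        show "\<theta> a = (\<lambda>a\<in>Obj C. Zro K (FObj M a) (FObj Z a)) a"
          by (rule Zu[of _ "FObj M a" "FObj Z a"])
             (use nat_simps(1-3)[OF \<theta>(2) a] nat_simps(1-3)[OF n(1) a] Z(2)[OF a] in \<open>simp_all only: Hom_def mem_Collect_eq simp_thms\<close>)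
      qed
      then show "f = (M, Z, \<lambda>a\<in>Obj C. Zro K (FObj M a) (FObj Z a))" using \<theta> by simp
    qed
    show "\<exists>!f. f \<in> Hom \<R> Z M"
    proof (rule ex1I)
      show "(Z, M, \<lambda>a\<in>Obj C. Zro K (FObj Z a) (FObj M a)) \<in> Hom \<R> Z M" using n M ZF by simp
      fix f assume "f \<in> Hom \<R> Z M"
      then obtain \<theta> where \<theta>: "f = (Z, M, \<theta>)" "nat_trans C K Z M \<theta>" by (rule functor_cat_homE)
      have "\<theta> = (\<lambda>a\<in>Obj C. Zro K (FObj Z a) (FObj M a))"
      proof (rule nat_eqI[OF \<theta>(2) n(2)])
        fix a assume a: "a \<in> Obj C"
        show "\<theta> a = (\<lambda>a\<in>Obj C. Zro K (FObj Z a) (FObj M a)) a"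
          by (rule Zu[of _ "FObj Z a" "FObj M a"])
             (use nat_simps(1-3)[OF \<theta>(2) a] nat_simps(1-3)[OF n(2) a] Z(2)[OF a] in \<open>simp_all only: Hom_def mem_Collect_eq simp_thms\<close>)
      qed
      then show "f = (Z, M, \<lambda>a\<in>Obj C. Zro K (FObj Z a) (FObj M a))" using \<theta> by simp
    qed
  qed
  then have "zero_object \<R> Z" using ZF by (simp add: zero_object_def)
  then show "\<exists>z. zero_object \<R> z" by blast
next
  fix F G assume "F \<in> Obj \<R>" "G \<in> Obj \<R>"
  then have FG: "F \<in> \<F>" "G \<in> \<F>" by simp_all
  obtain M i j p q where M: "is_functor C K M" "nat_trans C K F M i" "nat_trans C K G M j" "nat_trans C K M F p" "nat_trans C K M G q"
    and b: "\<And>a. a \<in> Obj C \<Longrightarrow> is_biproduct K (FObj F a) (FObj G a) (FObj M a) (i a) (j a) (p a) (q a)"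
    using pointwise_biproduct[OF functors[OF FG(1)] functors[OF FG(2)]] by metis
  have MF: "M \<in> \<F>" by (rule biproduct_closed[OF M(1) FG M(2-5) b])
  note be = K.is_biproductD(16-20)[OF b]
  have "is_biproduct \<R> F G M (F, M, i) (G, M, j) (M, F, p) (M, G, q)"
    unfolding is_biproduct_def using FG MF M be by (simp cong: restrict_cong)
  then show "\<exists>s i j p q. is_biproduct \<R> F G s i j p q" by blast
next
  show "\<exists>k. is_kernel \<R> k f" if "f \<in> Arr \<R>" for f
    using that kernel_exists by (cases f) metis
  show "\<exists>c. is_cokernel \<R> c f" if "f \<in> Arr \<R>" for f
    using that cokernel_exists by (cases f) metis
  show "\<exists>g. is_kernel \<R> f g" if m: "monic \<R> f" for f
  proof -
    obtain F G \<eta> where f: "f = (F, G, \<eta>)" by (cases f)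
    have \<eta>: "(F, G, \<eta>) \<in> Arr \<R>" using m f by (simp add: monic_def del: functor_cat_simps)
    \<comment> \<open>A monic is monic at every object, and there it is the kernel of its cokernel
      in \<open>K\<close>. The pointwise cokernel therefore exhibits it as a kernel.\<close>
    obtain M c where c: "(G, M, c) \<in> Arr \<R>" "\<And>a. a \<in> Obj C \<Longrightarrow> is_cokernel K (c a) (\<eta> a)"
      using cokernel_exists[OF \<eta>] by blast
    have "is_kernel \<R> (F, G, \<eta>) (G, M, c)"
      by (rule pointwise_is_kernel[OF \<eta> c(1)])
         (rule K.monic_is_kernel_of_cokernel[OF monic_pointwise[OF m[unfolded f]] c(2)])
    then show ?thesis using f by blast
  qed
  show "\<exists>g. is_cokernel \<R> f g" if e: "epic \<R> f" for f
  proof -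
    obtain F G \<eta> where f: "f = (F, G, \<eta>)" by (cases f)
    \<comment> \<open>Epicness at each object is obtained from \<open>monic_pointwise\<close> in the
      opposite functor category.\<close>
    have m: "monic \<R>' (G, F, \<eta>)" using e f op_monic by simp
    have \<eta>: "(F, G, \<eta>) \<in> Arr \<R>" using e f by (simp add: epic_def del: functor_cat_simps)
    obtain M k where k: "(M, F, k) \<in> Arr \<R>" "\<And>a. a \<in> Obj C \<Longrightarrow> is_kernel K (k a) (\<eta> a)"
      using kernel_exists[OF \<eta>] by blast
    have ep: "epic K (\<eta> a)" if "a \<in> Obj C" for a
      using exact_functor_subcategory.monic_pointwise[OF op_exact m] that by simp
    have "is_cokernel \<R> (F, G, \<eta>) (M, F, k)"
      by (rule pointwise_is_cokernel[OF \<eta> k(1)])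
         (rule K.epic_is_cokernel_of_kernel[OF ep k(2)])
    then show ?thesis using f by blast
  qed
qed

end

section \<open>Objects of finite length\<close>

context abelian_category
begin

text \<open>If the identity of \<open>a\<close> is zero, every arrow into or out of \<open>a\<close>
  factors through zero. This equational form replaces two families of unique existence
  statements.\<close>

lemma zero_object_iff: "zero_object D a \<longleftrightarrow> a \<in> Obj D \<and> Idn D a = Zro D a a"
proof
  assume z: "zero_object D a"
  then have a: "a \<in> Obj D" by (simp add: zero_object_def)
  have "Idn D a \<in> Hom D a a" "Zro D a a \<in> Hom D a a" using a by (simp_all add: Hom_def)
  then show "a \<in> Obj D \<and> Idn D a = Zro D a a" using z a unfolding zero_object_def by blast
next
  assume z: "a \<in> Obj D \<and> Idn D a = Zro D a a"
  have "f = Zro D b a" if "f \<in> Hom D b a" for f b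
    using z that idn_comp(1)[of f a] comp_zro_left[of f a a] by (simp add: Hom_def)
  moreover have "f = Zro D a b" if "f \<in> Hom D a b" for f b
    using z that idn_comp(2)[of f a] comp_zro_right[of f a a] by (simp add: Hom_def)
  moreover have "Zro D b a \<in> Hom D b a" "Zro D a b \<in> Hom D a b" if "b \<in> Obj D" for b
    using that z by (simp_all add: Hom_def)
  ultimately show "zero_object D a" using z unfolding zero_object_def by blast
qed

lemma arr_to_zero: "zero_object D b \<Longrightarrow> f \<in> Arr D \<Longrightarrow> Cod D f = b \<Longrightarrow> f = Zro D (Dom D f) b"
  using idn_comp(1)[of f b] comp_zro_left[of f b b] by (auto simp: zero_object_iff)

lemma arr_from_zero: "zero_object D b \<Longrightarrow> f \<in> Arr D \<Longrightarrow> Dom D f = b \<Longrightarrow> f = Zro D b (Cod D f)"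
  using idn_comp(2)[of f b] comp_zro_right[of f b b] by (auto simp: zero_object_iff)

lemma monic_to_zero:
  assumes "monic D m" "zero_object D (Cod D m)"
  shows "zero_object D (Dom D m)"
proof -
  have m: "m \<in> Arr D" using assms(1) by (simp add: monic_def)
  have "m \<cdot> Idn D (Dom D m) = m" using m by simp
  also have "m = Zro D (Dom D m) (Cod D m)" by (rule arr_to_zero[OF assms(2) m HOL.refl])
  finally have mz: "m \<cdot> Idn D (Dom D m) = Zro D (Dom D m) (Cod D m)" .
  have "Idn D (Dom D m) = Zro D (Dom D m) (Dom D m)"
    by (rule monic_zeroI[OF assms(1)]) (use m dom_obj mz in simp_all)
  then show ?thesis using m dom_obj by (simp add: zero_object_iff)
qed

lemma epic_from_zero:
  assumes "epic D e" "zero_object D (Dom D e)"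
  shows "zero_object D (Cod D e)"
  using abelian_category.monic_to_zero[OF abelian_op_lin[OF abelian_category_axioms], of e] assms by simp

lemma iso_arr_monic_epic:
  assumes "iso_arr D f"
  shows "monic D f" "epic D f"
proof -
  obtain g where g: "f \<in> Arr D" "g \<in> Arr D" "Dom D g = Cod D f" "Cod D g = Dom D f"
    "g \<cdot> f = Idn D (Dom D f)" "f \<cdot> g = Idn D (Cod D f)" using assms by (rule iso_arrE)
  show "monic D f"
  proof (rule monicI[OF g(1)])
    fix x assume x: "x \<in> Arr D" "Cod D x = Dom D f" "f \<cdot> x = Zro D (Dom D x) (Cod D f)"
    have "x = g \<cdot> (f \<cdot> x)" using comp_reassoc[OF g(5), of x] g x(1,2) by simp
    also have "\<dots> = Zro D (Dom D x) (Dom D f)" unfolding x(3) using g x(1) dom_obj by simp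
    finally show "x = Zro D (Dom D x) (Dom D f)" .
  qed
  show "epic D f"
  proof (rule epicI[OF g(1)])
    fix x assume x: "x \<in> Arr D" "Dom D x = Cod D f" "x \<cdot> f = Zro D (Dom D f) (Cod D x)"
    have "x = (x \<cdot> f) \<cdot> g" using g x(1,2) by simp
    also have "\<dots> = Zro D (Cod D f) (Cod D x)" unfolding x(3) using g x(1) cod_obj by simp
    finally show "x = Zro D (Cod D f) (Cod D x)" .
  qed
qed

lemma iso_arr_inverse:
  assumes "iso_arr D f"
  obtains g where "iso_arr D g" "Dom D g = Cod D f" "Cod D g = Dom D f"
    "g \<cdot> f = Idn D (Dom D f)" "f \<cdot> g = Idn D (Cod D f)"
proof -
  obtain g where g: "f \<in> Arr D" "g \<in> Arr D" "Dom D g = Cod D f" "Cod D g = Dom D f"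
    "g \<cdot> f = Idn D (Dom D f)" "f \<cdot> g = Idn D (Cod D f)" using assms by (rule iso_arrE)
  then show thesis using that[of g] iso_arrI[of g f] by simp
qed

lemma monic_comp:
  assumes "monic D f" "monic D g" "Cod D f = Dom D g"
  shows "monic D (g \<cdot> f)"
proof -
  have h: "f \<in> Arr D" "g \<in> Arr D" using assms by (simp_all add: monic_def)
  show ?thesis
  proof (rule monicI)
    fix x assume x: "x \<in> Arr D" "Cod D x = Dom D (g \<cdot> f)" "g \<cdot> f \<cdot> x = Zro D (Dom D x) (Cod D (g \<cdot> f))"
    have "f \<cdot> x = Zro D (Dom D x) (Cod D f)" by (rule monic_zeroI[OF assms(2)]) (use x h assms(3) in simp_all)
    note fx = this
    have "x = Zro D (Dom D x) (Dom D f)" by (rule monic_zeroI[OF assms(1)]) (use fx x(1,2) h assms(3) in simp_all)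
    then show "x = Zro D (Dom D x) (Dom D (g \<cdot> f))" using h assms(3) by simp
  qed (use h assms in simp)
qed

lemma epic_comp:
  assumes "epic D f" "epic D g" "Cod D f = Dom D g"
  shows "epic D (g \<cdot> f)"
  using abelian_category.monic_comp[OF abelian_op_lin[OF abelian_category_axioms], of g f] assms by simp

lemma monic_right_factor:
  assumes "monic D (g \<cdot> f)" "f \<in> Arr D" "g \<in> Arr D" "Cod D f = Dom D g"
  shows "monic D f"
proof (rule monicI[OF assms(2)])
  fix x assume x: "x \<in> Arr D" "Cod D x = Dom D f" "f \<cdot> x = Zro D (Dom D x) (Cod D f)"
  have "g \<cdot> (f \<cdot> x) = Zro D (Dom D x) (Cod D g)" unfolding x(3) using x(1) assms dom_obj by simp
  note gfx = this
  show "x = Zro D (Dom D x) (Dom D f)"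
    by (rule monic_zeroI[OF assms(1)]) (use gfx x(1,2) assms in simp_all)
qed

lemma epic_left_factor:
  assumes "epic D (g \<cdot> f)" "f \<in> Arr D" "g \<in> Arr D" "Cod D f = Dom D g"
  shows "epic D g"
  using abelian_category.monic_right_factor[OF abelian_op_lin[OF abelian_category_axioms], of f g] assms by simp

text \<open>That \<open>n\<close> is monic is checked after pulling back along \<open>e\<close>.\<close>

lemma coimage_factorization:
  assumes c: "c \<in> Arr D" and k: "is_kernel D k c"
  obtains e n where "short_exact D k e" "Dom D e = Dom D c" "monic D n" "Dom D n = Cod D e" "Cod D n = Cod D c" "n \<cdot> e = c"
proof -
  note kD = is_kernelD[OF k]
  obtain e where e: "is_cokernel D e k" using cokernel_ex kD(1) by blast
  note eD = is_cokernelD[OF e]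
  have s: "short_exact D k e" by (rule short_exactI'[OF e is_kernel_monic[OF k]])
  have E: "(k, e) \<in> extensions D (Cod D e) (Dom D k)" using s by (simp add: extensions_def)
  obtain n where n: "n \<in> Arr D" "Dom D n = Cod D e" "Cod D n = Cod D c" "n \<cdot> e = c"
    using is_cokernel_lift[OF e c] kD by auto
  have "monic D n"
  proof (rule monicI[OF n(1)])
    fix x assume x: "x \<in> Arr D" "Cod D x = Dom D n" "n \<cdot> x = Zro D (Dom D x) (Cod D n)"
    note ox = dom_obj[OF x(1)]
    show "x = Zro D (Dom D x) (Dom D n)"
    proof (rule pullback_extension[OF E x(1) HOL.refl])
      show "Cod D x = Cod D e" using x n by simp
      fix k' e' y assume a: "(k', e') \<in> extensions D (Dom D x) (Dom D k)"
        "y \<in> Arr D" "Dom D y = Cod D k'" "Cod D y = Cod D k" "y \<cdot> k' = k" "e \<cdot> y = x \<cdot> e'"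
      note aD = extensionsD[OF a(1)]
      note t = kD eD n(1-3) a(2-4) aD x(1,2) ox
      \<comment> \<open>Over the pullback, \<open>x\<close> is represented by \<open>y\<close>. As
        \<open>c\<close> kills \<open>y\<close>, it factors through \<open>k\<close>, which
        \<open>e\<close> kills; so \<open>x \<cdot> e'\<close> vanishes, and \<open>e'\<close> is
        epic.\<close>
      have "c \<cdot> y = n \<cdot> (e \<cdot> y)" using n(4) comp_assoc_right[of y e n] t by simp
      also have "\<dots> = (n \<cdot> x) \<cdot> e'" unfolding a(6) using comp_assoc_right[of e' x n] t by simp
      also have "\<dots> = Zro D (Dom D y) (Cod D c)" unfolding x(3) using t cod_obj[OF c] by simp
      finally obtain u where u: "u \<in> Arr D" "Dom D u = Dom D y" "Cod D u = Dom D k" "k \<cdot> u = y"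
        using is_kernel_lift[OF k, of y] t by auto
      have "x \<cdot> e' = (e \<cdot> k) \<cdot> u" unfolding a(6)[symmetric] using u comp_assoc_right[of u k e] t by simp
      also have "\<dots> = Zro D (Dom D e') (Cod D x)" unfolding eD(4) using u(1-3) t cod_obj[OF x(1)] by simp
      finally have xe: "x \<cdot> e' = Zro D (Dom D e') (Cod D x)" .
      show ?thesis by (rule epic_zeroI[OF short_exactD(6)[OF aD(1)]]) (use xe t in simp_all)
    qed
  qed
  then show thesis using that[OF s _ _ n(2,3,4)] eD kD by simp
qed

lemma image_factorization:
  assumes c: "c \<in> Arr D" and r: "is_cokernel D r c"
  obtains l t where "short_exact D l r" "Cod D l = Cod D c" "epic D t" "Cod D t = Dom D l" "Dom D t = Dom D c" "l \<cdot> t = c"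
  using abelian_category.coimage_factorization[OF abelian_op_lin[OF abelian_category_axioms], of c r] c r by auto

section \<open>Simple objects under isomorphisms, monics and epics\<close>

lemma simple_object_iso:
  assumes s: "simple_object D (Dom D h)" and h: "iso_arr D h"
  shows "simple_object D (Cod D h)"
proof -
  obtain g where g: "iso_arr D g" "Dom D g = Cod D h" "Cod D g = Dom D h"
    "g \<cdot> h = Idn D (Dom D h)" "h \<cdot> g = Idn D (Cod D h)" using h by (rule iso_arr_inverse)
  have t: "h \<in> Arr D" "g \<in> Arr D" using h g by (simp_all add: iso_arr_def)
  have "\<not> zero_object D (Cod D h)"
    using s monic_to_zero[OF iso_arr_monic_epic(1)[OF h]] by (auto simp: simple_object_def)
  moreover have "zero_object D (Dom D m) \<or> iso_arr D m" if m: "monic D m" "Cod D m = Cod D h" for m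
  proof -
    have mA: "m \<in> Arr D" using m by (simp add: monic_def)
    have "monic D (g \<cdot> m)" by (rule monic_comp[OF m(1) iso_arr_monic_epic(1)[OF g(1)]]) (use m g in simp)
    moreover have "Cod D (g \<cdot> m) = Dom D h" using t mA m g(2,3) by simp
    ultimately have "zero_object D (Dom D (g \<cdot> m)) \<or> iso_arr D (g \<cdot> m)"
      using s unfolding simple_object_def by blast
    moreover have "iso_arr D m" if i: "iso_arr D (g \<cdot> m)"
    proof -
      have "iso_arr D (h \<cdot> (g \<cdot> m))" by (rule iso_arr_comp[OF i h]) (use t mA m g(2,3) in simp)
      then show ?thesis using comp_reassoc[OF g(5), of m] t mA m g(2,3) by simp
    qed
    ultimately show ?thesis using t mA m g(2,3) by auto
  qed
  ultimately show ?thesis using cod_obj[OF t(1)] by (simp add: simple_object_def)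
qed

lemma simple_sub:
  assumes "simple_object D (Cod D m)" "monic D m"
  shows "zero_object D (Dom D m) \<or> simple_object D (Dom D m)"
proof -
  have "zero_object D (Dom D m) \<or> iso_arr D m" using assms unfolding simple_object_def by blast
  moreover have "simple_object D (Dom D m)" if i: "iso_arr D m"
  proof -
    obtain g where "iso_arr D g" "Dom D g = Cod D m" "Cod D g = Dom D m" using i by (rule iso_arr_inverse)
    then show ?thesis using simple_object_iso[of g] assms(1) by simp
  qed
  ultimately show ?thesis by blast
qed

text \<open>The kernel \<open>k\<close> of \<open>e\<close> is zero or an isomorphism. In the first
  case \<open>e\<close> is monic as well and thus an isomorphism; in the second \<open>e\<close> is
  zero, and an epic zero arrow has a zero target.\<close>

lemma simple_quotient:
  assumes s: "simple_object D (Dom D e)" and e: "epic D e"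
  shows "zero_object D (Cod D e) \<or> simple_object D (Cod D e)"
proof -
  have eA: "e \<in> Arr D" using e by (simp add: epic_def)
  obtain k where k: "is_kernel D k e" using kernel_ex eA by blast
  note kD = is_kernelD[OF k] and km = is_kernel_monic[OF k]
  have "zero_object D (Dom D k) \<or> iso_arr D k" using s km kD(3) unfolding simple_object_def by blast
  then show ?thesis
  proof
    assume z: "zero_object D (Dom D k)"
    have "monic D e"
    proof (rule monicI[OF eA])
      fix x assume x: "x \<in> Arr D" "Cod D x = Dom D e" "e \<cdot> x = Zro D (Dom D x) (Cod D e)"
      obtain u where u: "u \<in> Arr D" "Dom D u = Dom D x" "Cod D u = Dom D k" "k \<cdot> u = x"
        using is_kernel_lift[OF k x] .
      have "u = Zro D (Dom D x) (Dom D k)" using arr_to_zero[OF z u(1,3)] unfolding u(2) .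
      with u(4) have "k \<cdot> Zro D (Dom D x) (Dom D k) = x" by simp
      then show "x = Zro D (Dom D x) (Dom D e)" using kD(1,3) dom_obj[OF x(1)] by simp
    qed
    then have "iso_arr D e" using e by (rule monic_epic_iso)
    then show ?thesis using simple_object_iso[OF s] by blast
  next
    assume i: "iso_arr D k"
    have "e = Zro D (Cod D k) (Cod D e)"
      by (rule epic_zeroI[OF iso_arr_monic_epic(2)[OF i]]) (use eA kD in simp_all)
    then have ez: "Idn D (Cod D e) \<cdot> e = Zro D (Dom D e) (Cod D e)" using eA kD by simp
    have "Idn D (Cod D e) = Zro D (Cod D e) (Cod D e)"
      by (rule epic_zeroI[OF e]) (use ez eA cod_obj[OF eA] in simp_all)
    then show ?thesis using cod_obj[OF eA] by (simp add: zero_object_iff)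
  qed
qed

section \<open>Closure properties of finite length\<close>

lemma short_exact_iso_right:
  assumes s: "short_exact D i p" and h: "iso_arr D h" "Dom D h = Cod D i"
  shows "short_exact D (h \<cdot> i) (p \<cdot> inv_arr D h)"
proof -
  note S = short_exactD[OF s]
  define g where "g = inv_arr D h"
  have g: "h \<in> Arr D" "g \<in> Arr D" "Dom D g = Cod D h" "Cod D g = Dom D h"
    "g \<cdot> h = Idn D (Dom D h)" "h \<cdot> g = Idn D (Cod D h)"
    using inv_arr[OF h(1)] h(1) by (simp_all add: g_def Hom_def iso_arr_def)
  note t = S(1-3) g(1-4) h(2)
  have gi: "iso_arr D g" using iso_arrI[of g h] g by simp
  have "is_kernel D (h \<cdot> i) (p \<cdot> g)"
  proof (rule is_kernelI)
    show "monic D (h \<cdot> i)" by (rule monic_comp[OF S(5) iso_arr_monic_epic(1)[OF h(1)]]) (use h in simp)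
    show "p \<cdot> g \<cdot> (h \<cdot> i) = Zro D (Dom D (h \<cdot> i)) (Cod D (p \<cdot> g))"
      using t comp_reassoc[OF g(5), of i] S(4) by simp
    fix x assume x: "x \<in> Arr D" "Cod D x = Dom D (p \<cdot> g)" "p \<cdot> g \<cdot> x = Zro D (Dom D x) (Cod D (p \<cdot> g))"
    obtain u where u: "u \<in> Arr D" "Dom D u = Dom D x" "Cod D u = Dom D i" "i \<cdot> u = g \<cdot> x"
      using is_kernel_lift[OF S(7), of "g \<cdot> x"] x t by auto
    have "h \<cdot> i \<cdot> u = x" using u x(1,2) t comp_reassoc[OF g(6), of x] by simp
    then show "\<exists>u\<in>Hom D (Dom D x) (Dom D (h \<cdot> i)). h \<cdot> i \<cdot> u = x" using u t by (intro bexI[of _ u]) (simp_all add: Hom_def)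
  qed (use t in simp_all)
  moreover have "epic D (p \<cdot> g)" by (rule epic_comp[OF iso_arr_monic_epic(2)[OF gi] S(6)]) (use t in simp)
  ultimately show ?thesis unfolding g_def by (rule short_exactI)
qed

lemma finite_length_iso:
  assumes "finite_length D (Dom D h)" and h: "iso_arr D h"
  shows "finite_length D (Cod D h)"
  using assms(1)
proof cases
  case zero
  obtain g where g: "iso_arr D g" "Dom D g = Cod D h" "Cod D g = Dom D h" using h by (rule iso_arr_inverse)
  then have "zero_object D (Cod D h)" using monic_to_zero[OF iso_arr_monic_epic(1)[OF g(1)]] zero by simp
  then show ?thesis by (rule finite_length.zero)
next
  case (step i p)
  note S = short_exactD[OF step(2)]
  have hA: "h \<in> Arr D" using h by (simp add: iso_arr_def)
  have g: "inv_arr D h \<in> Arr D" "Cod D (inv_arr D h) = Dom D h" using inv_arr(1)[OF h] by (simp_all add: Hom_def)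
  have "short_exact D (h \<cdot> i) (p \<cdot> inv_arr D h)" by (rule short_exact_iso_right[OF step(2) h step(1)])
  from finite_length.step[OF this] show ?thesis using step S(1-3) hA g by simp
qed

text \<open>Intersecting a composition series with a subobject, or projecting it to a quotient, may
  turn a simple factor into zero. Such a step is harmless: then \<open>k\<close> is epic and hence
  an isomorphism.\<close>

lemma finite_length_step:
  assumes s: "short_exact D k e" and f: "finite_length D (Dom D k)" and z: "zero_object D (Cod D e) \<or> simple_object D (Cod D e)"
  shows "finite_length D (Cod D k)"
proof (cases "simple_object D (Cod D e)")
  case True then show ?thesis using finite_length.step[OF s f] by simp
next
  case False
  then have z: "zero_object D (Cod D e)" using z by simp
  note S = short_exactD[OF s]
  have "epic D k"
  proof (rule epicI[OF S(1)])
    fix g assume g: "g \<in> Arr D" "Dom D g = Cod D k" "g \<cdot> k = Zro D (Dom D k) (Cod D g)"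
    obtain u where u: "u \<in> Arr D" "Dom D u = Cod D e" "Cod D u = Cod D g" "u \<cdot> e = g"
      using is_cokernel_lift[OF S(8) g] .
    have "u = Zro D (Cod D e) (Cod D g)" using arr_from_zero[OF z u(1,2)] unfolding u(3) .
    with u(4) have "Zro D (Cod D e) (Cod D g) \<cdot> e = g" by simp
    then show "g = Zro D (Cod D k) (Cod D g)" using S(1-3) cod_obj[OF g(1)] by simp
  qed
  then have "iso_arr D k" using S(5) by (intro monic_epic_iso)
  then show ?thesis using finite_length_iso[OF f] by simp
qed

text \<open>Induction along the composition series. The kernel of \<open>p \<cdot> m\<close> is the
  intersection of the subobject with \<open>Dom D i\<close>, and the quotient by it embeds into the
  simple object \<open>Cod D p\<close>, so it is zero or simple.\<close>

lemma finite_length_sub: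
  assumes "finite_length D X" "monic D m" "Cod D m = X"
  shows "finite_length D (Dom D m)"
  using assms
proof (induction arbitrary: m rule: finite_length.induct)
  case (zero a) then show ?case using monic_to_zero[of m] finite_length.zero[of D "Dom D m"] by simp
next
  case (step i p)
  note S = short_exactD[OF step(1)]
  have m: "m \<in> Arr D" using step.prems by (simp add: monic_def)
  let ?c = "p \<cdot> m"
  have c: "?c \<in> Arr D" "Dom D ?c = Dom D m" "Cod D ?c = Cod D p" using m S(1-3) step.prems by simp_all
  obtain k where k: "is_kernel D k ?c" using kernel_ex c by blast
  obtain e n where e: "short_exact D k e" "Dom D e = Dom D ?c" "monic D n" "Dom D n = Cod D e" "Cod D n = Cod D ?c"
    using coimage_factorization[OF c(1) k] .
  note kD = is_kernelD[OF k]
  have k1: "Cod D k = Dom D m" using kD(3) c by simp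
  have "p \<cdot> (m \<cdot> k) = Zro D (Dom D (m \<cdot> k)) (Cod D p)" using kD(4) kD(1) k1 m S(1-3) step.prems by simp
  then obtain w where w: "w \<in> Arr D" "Dom D w = Dom D k" "Cod D w = Dom D i" "i \<cdot> w = m \<cdot> k"
    using is_kernel_lift[OF S(7), of "m \<cdot> k"] kD(1) k1 m S(1-3) step.prems by auto
  \<comment> \<open>The intersection embeds into \<open>Dom D i\<close> through \<open>w\<close>,
    which is where the induction hypothesis applies.\<close>
  have "monic D (i \<cdot> w)" unfolding w(4) by (rule monic_comp[OF is_kernel_monic[OF k] step.prems(1) k1])
  then have "monic D w" by (rule monic_right_factor) (use w(1-3) S(1-3) in simp_all)
  then have "finite_length D (Dom D k)" using step.IH[of w] w by simp
  moreover have "zero_object D (Cod D e) \<or> simple_object D (Cod D e)"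
    using simple_sub[OF _ e(3)] e(4,5) c step(3) by simp
  ultimately show ?case using finite_length_step[OF e(1)] k1 by simp
qed

text \<open>The image of \<open>Dom D i\<close> under \<open>e\<close> has finite length by
  induction, and what is left of the quotient is itself a quotient of the simple
  \<open>Cod D p\<close>. The argument is separate from the one for subobjects because the inductive
  definition adds simple factors on top only and is not formally self-dual.\<close>

lemma finite_length_quotient:
  assumes "finite_length D X" "epic D e" "Dom D e = X"
  shows "finite_length D (Cod D e)"
  using assms
proof (induction arbitrary: e rule: finite_length.induct)
  case (zero a) then show ?case using epic_from_zero[of e] finite_length.zero[of D "Cod D e"] by simp
next
  case (step i p)
  note S = short_exactD[OF step(1)]
  have e: "e \<in> Arr D" using step.prems by (simp add: epic_def)
  let ?c = "e \<cdot> i"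
  have c: "?c \<in> Arr D" "Dom D ?c = Dom D i" "Cod D ?c = Cod D e" using e S(1-3) step.prems by simp_all
  obtain r where r: "is_cokernel D r ?c" using cokernel_ex c by blast
  obtain l t where l: "short_exact D l r" "Cod D l = Cod D ?c" "epic D t" "Cod D t = Dom D l" "Dom D t = Dom D ?c"
    using image_factorization[OF c(1) r] .
  note rD = is_cokernelD[OF r]
  have r1: "Dom D r = Cod D e" using rD(3) c by simp
  have "finite_length D (Dom D l)" using step.IH[OF l(3)] l(4,5) c by simp
  moreover have "(r \<cdot> e) \<cdot> i = Zro D (Dom D i) (Cod D (r \<cdot> e))" using rD(4) rD(1) r1 e S(1-3) step.prems by simp
  then obtain v where v: "v \<in> Arr D" "Dom D v = Cod D p" "Cod D v = Cod D (r \<cdot> e)" "v \<cdot> p = r \<cdot> e"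
    using is_cokernel_lift[OF S(8), of "r \<cdot> e"] rD(1) r1 e S(1-3) step.prems by auto
  have "epic D (v \<cdot> p)" unfolding v(4) by (rule epic_comp[OF step.prems(1) is_cokernel_epic[OF r]]) (use r1 in simp)
  then have "epic D v" by (rule epic_left_factor) (use v(1-3) S(1-3) in simp_all)
  then have "zero_object D (Cod D r) \<or> simple_object D (Cod D r)"
    using simple_quotient[of v] v step(3) rD(1) r1 e by simp
  ultimately show ?case using finite_length_step[OF l(1)] l(2) c by simp
qed

text \<open>Induction on the right-hand end. Pulling the extension back along the inclusion
  \<open>j\<close> of the smaller end gives an extension of finite length, and this pullback is the
  kernel of \<open>q \<cdot> p\<close>, whose target is simple.\<close>

lemma finite_length_extension:
  assumes "finite_length D A" and B: "finite_length D B" and "(i, p) \<in> extensions D A B"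
  shows "finite_length D (Cod D i)"
  using assms(1,3)
proof (induction arbitrary: i p rule: finite_length.induct)
  case (zero a)
  then show ?case using finite_length_step[of i p] B by (auto simp: extensions_def)
next
  case (step j q)
  note S = short_exactD[OF step(1)] and eD = extensionsD[OF step.prems]
  note S' = short_exactD[OF eD(1)]
  let ?q = "q \<cdot> p"
  show ?case
  proof (rule pullback_extension[OF step.prems S(1) HOL.refl HOL.refl])
    fix i' p' h assume a: "(i', p') \<in> extensions D (Dom D j) B" "h \<in> Arr D" "Dom D h = Cod D i'" "Cod D h = Cod D i"
        "h \<cdot> i' = i" "p \<cdot> h = j \<cdot> p'"
      and univ: "\<And>u v. u \<in> Arr D \<Longrightarrow> v \<in> Arr D \<Longrightarrow> Dom D u = Dom D v \<Longrightarrow> Cod D u = Cod D i \<Longrightarrow> Cod D v = Dom D j \<Longrightarrow>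
       p \<cdot> u = j \<cdot> v \<Longrightarrow> \<exists>!w. w \<in> Hom D (Dom D u) (Cod D i') \<and> h \<cdot> w = u \<and> p' \<cdot> w = v"
    note aD = extensionsD[OF a(1)]
    note t = S(1-3) eD(2-9) aD(2-9) a(2-4)
    have qA: "?q \<in> Arr D" "Dom D ?q = Cod D i" "Cod D ?q = Cod D q" using t by simp_all
    \<comment> \<open>If \<open>h \<cdot> x\<close> vanishes, so does
      \<open>j \<cdot> (p' \<cdot> x)\<close> and hence \<open>p' \<cdot> x\<close>; uniqueness for
      arrows into the pullback leaves only zero.\<close>
    have mono: "monic D h"
    proof (rule monicI[OF a(2)])
      fix x assume x: "x \<in> Arr D" "Cod D x = Dom D h" "h \<cdot> x = Zro D (Dom D x) (Cod D h)"
      note ox = dom_obj[OF x(1)]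
      have "j \<cdot> (p' \<cdot> x) = p \<cdot> (h \<cdot> x)" using comp_reassoc[OF a(6), of x] x(1,2) t by simp
      also have "\<dots> = Zro D (Dom D x) (Cod D j)" unfolding x(3) using t ox by simp
      finally have jx: "j \<cdot> (p' \<cdot> x) = Zro D (Dom D x) (Cod D j)" .
      have px: "p' \<cdot> x = Zro D (Dom D x) (Dom D j)"
        by (rule monic_zeroI[OF S(5)]) (use jx x(1,2) t in simp_all)
      let ?u = "Zro D (Dom D x) (Cod D i)" and ?v = "Zro D (Dom D x) (Dom D j)"
      have oj: "Dom D j \<in> Obj D" using dom_obj S(1) by blast
      have "\<exists>!w. w \<in> Hom D (Dom D ?u) (Cod D i') \<and> h \<cdot> w = ?u \<and> p' \<cdot> w = ?v"
        by (rule univ) (use t ox oj in simp_all)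
      moreover have "x \<in> Hom D (Dom D ?u) (Cod D i') \<and> h \<cdot> x = ?u \<and> p' \<cdot> x = ?v"
        using x px t ox by (simp add: Hom_def)
      moreover have "Zro D (Dom D x) (Cod D i') \<in> Hom D (Dom D ?u) (Cod D i') \<and>
          h \<cdot> Zro D (Dom D x) (Cod D i') = ?u \<and> p' \<cdot> Zro D (Dom D x) (Cod D i') = ?v"
        using t ox by (simp add: Hom_def)
      ultimately have "x = Zro D (Dom D x) (Cod D i')" by blast
      then show "x = Zro D (Dom D x) (Dom D h)" using a(3) by simp
    qed
    have "is_kernel D h ?q"
    proof (rule is_kernelI[OF mono qA(1)])
      show "Cod D h = Dom D ?q" using qA a by simp
      have "q \<cdot> (p \<cdot> h) = Zro D (Cod D i') (Cod D q)" unfolding a(6) using comp_reassoc[OF S(4), of p'] t cod_obj[OF S(2)] by simp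
      then show "?q \<cdot> h = Zro D (Dom D h) (Cod D ?q)" using t by simp
      fix g assume g: "g \<in> Arr D" "Cod D g = Dom D ?q" "?q \<cdot> g = Zro D (Dom D g) (Cod D ?q)"
      have "q \<cdot> (p \<cdot> g) = Zro D (Dom D (p \<cdot> g)) (Cod D q)" using g qA t by simp
      then obtain v where v: "v \<in> Arr D" "Dom D v = Dom D (p \<cdot> g)" "Cod D v = Dom D j" "j \<cdot> v = p \<cdot> g"
        using is_kernel_lift[OF S(7), of "p \<cdot> g"] g(1,2) qA t by auto
      have "\<exists>!w. w \<in> Hom D (Dom D g) (Cod D i') \<and> h \<cdot> w = g \<and> p' \<cdot> w = v"
        by (rule univ) (use v g(1,2) qA t in simp_all)
      then show "\<exists>w\<in>Hom D (Dom D g) (Dom D h). h \<cdot> w = g" using a(3) by auto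
    qed
    moreover have "epic D ?q" by (rule epic_comp[OF S'(6) S(6)]) (use t in simp)
    ultimately have "short_exact D h ?q" by (rule short_exactI)
    from finite_length.step[OF this] show ?thesis using step.IH[OF a(1)] step(3) a(3,4) qA by simp
  qed
qed

lemma finite_length_biproduct:
  assumes "is_biproduct D a b s i j p q" "finite_length D a" "finite_length D b"
  shows "finite_length D s"
  using finite_length_extension[OF assms(3,2) split_extension[OF assms(1)]] is_biproductD(6)[OF assms(1)] by simp

end

section \<open>Scalars and generated ideals\<close>

context linear_category
begin

lemma scl_simps [simp]:
  assumes "r \<in> carrier R" "f \<in> Arr D"
  shows "Scl D r f \<in> Arr D" "Dom D (Scl D r f) = Dom D f" "Cod D (Scl D r f) = Cod D f"
  using scl_hom[OF assms(1) homI[OF assms(2)]] by (simp_all add: Hom_def)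

lemma comp_scl [simp]:
  assumes "r \<in> carrier R" "f \<in> Arr D" "g \<in> Arr D" "Cod D f = Dom D g"
  shows "Scl D r g \<cdot> f = Scl D r (g \<cdot> f)" "g \<cdot> Scl D r f = Scl D r (g \<cdot> f)"
  using comp_scl_left[of r f "Dom D f" "Dom D g" g "Cod D g"] comp_scl_right[of r f "Dom D f" "Dom D g" g "Cod D g"] assms
  by (simp_all add: Hom_def)

lemma scl_add:
  assumes "r \<in> carrier R" "f \<in> Arr D" "g \<in> Arr D" "Dom D f = Dom D g" "Cod D f = Cod D g"
  shows "Scl D r (Add D f g) = Add D (Scl D r f) (Scl D r g)"
proof -
  interpret M: module R "Hom_module D (Dom D g) (Cod D g)" using hom_module dom_obj cod_obj assms by blast
  show ?thesis using M.smult_r_distr[of r f g] assms by (simp add: Hom_def)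
qed

lemma scl_simps2:
  assumes "f \<in> Arr D" "r \<in> carrier R" "s \<in> carrier R"
  shows "Scl D (r \<oplus>\<^bsub>R\<^esub> s) f = Add D (Scl D r f) (Scl D s f)" "Scl D (r \<otimes>\<^bsub>R\<^esub> s) f = Scl D r (Scl D s f)"
    "Scl D \<one>\<^bsub>R\<^esub> f = f"
proof -
  interpret M: module R "Hom_module D (Dom D f) (Cod D f)" using hom_module dom_obj cod_obj assms by blast
  show "Scl D (r \<oplus>\<^bsub>R\<^esub> s) f = Add D (Scl D r f) (Scl D s f)" "Scl D (r \<otimes>\<^bsub>R\<^esub> s) f = Scl D r (Scl D s f)"
    "Scl D \<one>\<^bsub>R\<^esub> f = f"
    using M.smult_l_distr[of r s f] M.smult_assoc1[of r s f] M.smult_one[of f] assms homI by simp_all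
qed

text \<open>\<open>cat_ideal\<close> asks for closure under scalars and does not list negatives;
  this identity supplies them.\<close>

lemma neg_eq_scl:
  assumes f: "f \<in> Arr D"
  shows "neg f = Scl D (\<ominus>\<^bsub>R\<^esub> \<one>\<^bsub>R\<^esub>) f"
proof -
  interpret cring R by (rule scalars)
  interpret M: module R "Hom_module D (Dom D f) (Cod D f)" using hom_module dom_obj cod_obj f by blast
  have "Add D f (Scl D (\<ominus>\<^bsub>R\<^esub> \<one>\<^bsub>R\<^esub>) f) = Scl D (\<one>\<^bsub>R\<^esub> \<oplus>\<^bsub>R\<^esub> \<ominus>\<^bsub>R\<^esub> \<one>\<^bsub>R\<^esub>) f"
    using scl_simps2[OF f, of "\<one>\<^bsub>R\<^esub>" "\<ominus>\<^bsub>R\<^esub> \<one>\<^bsub>R\<^esub>"] scl_simps2(3)[OF f, of "\<one>\<^bsub>R\<^esub>"] by simp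
  also have "\<dots> = Zro D (Dom D f) (Cod D f)" using M.smult_l_null[of f] homI[OF f] by (simp add: r_neg)
  finally show ?thesis using f by (intro neg_unique[symmetric]) simp_all
qed

text \<open>The family intersected in \<open>ideal_gen\<close> has a member inside
  \<open>Arr D\<close>, which keeps the generated ideal inside \<open>Arr D\<close>; an empty
  intersection would be the whole type.\<close>

lemma cat_ideal_Arr: "cat_ideal R D (Arr D)"
  unfolding cat_ideal_def by simp

lemma ideal_gen_ideal:
  assumes "S \<subseteq> Arr D"
  shows "cat_ideal R D (ideal_gen R D S)"
proof -
  have "ideal_gen R D S \<subseteq> Arr D" using cat_ideal_Arr assms unfolding ideal_gen_def by blast
  then show ?thesis unfolding cat_ideal_def ideal_gen_def by blast
qed

lemma ideal_gen_incl: "S \<subseteq> ideal_gen R D S"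
  unfolding ideal_gen_def by blast

end

section \<open>Exact categories of representations\<close>

context functors_to_abelian
begin

lemma exact_functors: "exact_functor_subcategory C K {M. is_functor C K M}"
  by unfold_locales simp_all

lemma exact_functors_pwf:
  "exact_functor_subcategory C K {M. is_functor C K M \<and> (\<forall>x\<in>Obj C. finite_length K (FObj M x))}"
proof unfold_locales
  show "M \<in> {M. is_functor C K M \<and> (\<forall>x\<in>Obj C. finite_length K (FObj M x))}"
    if "is_functor C K M" "\<And>a. a \<in> Obj C \<Longrightarrow> zero_object K (FObj M a)" for M :: "('o, 'm, 'p, 'n) funct"
    using that(1) finite_length.zero[OF that(2)] by simp
  show "M \<in> {M. is_functor C K M \<and> (\<forall>x\<in>Obj C. finite_length K (FObj M x))}"
    if a: "is_functor C K M" "F \<in> {M. is_functor C K M \<and> (\<forall>x\<in>Obj C. finite_length K (FObj M x))}"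
      "nat_trans C K M F k" "\<And>a. a \<in> Obj C \<Longrightarrow> monic K (k a)" for M F :: "('o, 'm, 'p, 'n) funct" and k
  proof -
    have "finite_length K (FObj M x)" if x: "x \<in> Obj C" for x
      using K.finite_length_sub[of "FObj F x" "k x"] a(2) a(4)[OF x] nat_simps(2,3)[OF a(3) x] x by simp
    then show ?thesis using a(1) by simp
  qed
  show "M \<in> {M. is_functor C K M \<and> (\<forall>x\<in>Obj C. finite_length K (FObj M x))}"
    if a: "is_functor C K M" "F \<in> {M. is_functor C K M \<and> (\<forall>x\<in>Obj C. finite_length K (FObj M x))}"
      "nat_trans C K F M c" "\<And>a. a \<in> Obj C \<Longrightarrow> epic K (c a)" for M F :: "('o, 'm, 'p, 'n) funct" and c
  proof -
    have "finite_length K (FObj M x)" if x: "x \<in> Obj C" for x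
      using K.finite_length_quotient[of "FObj F x" "c x"] a(2) a(4)[OF x] nat_simps(2,3)[OF a(3) x] x by simp
    then show ?thesis using a(1) by simp
  qed
  show "M \<in> {M. is_functor C K M \<and> (\<forall>x\<in>Obj C. finite_length K (FObj M x))}"
    if a: "is_functor C K M" "F \<in> {M. is_functor C K M \<and> (\<forall>x\<in>Obj C. finite_length K (FObj M x))}"
      "G \<in> {M. is_functor C K M \<and> (\<forall>x\<in>Obj C. finite_length K (FObj M x))}"
      "\<And>a. a \<in> Obj C \<Longrightarrow> is_biproduct K (FObj F a) (FObj G a) (FObj M a) (i a) (j a) (p a) (q a)"
    for M F G :: "('o, 'm, 'p, 'n) funct" and i j p q
  proof -
    have "finite_length K (FObj M x)" if x: "x \<in> Obj C" for x
      using K.finite_length_biproduct[OF a(4)[OF x]] a(2,3) x by simp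
    then show ?thesis using a(1) by simp
  qed
qed simp

end

lemma exact_functor_subcategory_Int:
  assumes "exact_functor_subcategory C K \<F>" "exact_functor_subcategory C K \<G>"
  shows "exact_functor_subcategory C K (\<F> \<inter> \<G>)"
proof -
  interpret F: exact_functor_subcategory C K \<F> by fact
  interpret G: exact_functor_subcategory C K \<G> by fact
  show ?thesis
  proof unfold_locales
    show "is_functor C K F" if "F \<in> \<F> \<inter> \<G>" for F using that F.functors by blast
    show "M \<in> \<F> \<inter> \<G>" if "is_functor C K M" "\<And>a. a \<in> Obj C \<Longrightarrow> zero_object K (FObj M a)" for M
      using F.zero_closed[OF that] G.zero_closed[OF that] by blast
    show "M \<in> \<F> \<inter> \<G>" if "is_functor C K M" "F \<in> \<F> \<inter> \<G>" "nat_trans C K M F k" "\<And>a. a \<in> Obj C \<Longrightarrow> monic K (k a)" for M F k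
      using F.sub_closed[OF that(1) _ that(3,4)] G.sub_closed[OF that(1) _ that(3,4)] that(2) by blast
    show "M \<in> \<F> \<inter> \<G>" if "is_functor C K M" "F \<in> \<F> \<inter> \<G>" "nat_trans C K F M c" "\<And>a. a \<in> Obj C \<Longrightarrow> epic K (c a)" for M F c
      using F.quotient_closed[OF that(1) _ that(3,4)] G.quotient_closed[OF that(1) _ that(3,4)] that(2) by blast
    show "M \<in> \<F> \<inter> \<G>"
      if "is_functor C K M" "F \<in> \<F> \<inter> \<G>" "G \<in> \<F> \<inter> \<G>" "nat_trans C K F M i" "nat_trans C K G M j"
       "nat_trans C K M F p" "nat_trans C K M G q"
       "\<And>a. a \<in> Obj C \<Longrightarrow> is_biproduct K (FObj F a) (FObj G a) (FObj M a) (i a) (j a) (p a) (q a)"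
      for M F G i j p q
      using F.biproduct_closed[OF that(1) _ _ that(4-8)] G.biproduct_closed[OF that(1) _ _ that(4-8)] that(2,3) by blast
  qed
qed

section \<open>Linear functors into an abelian category\<close>

locale linear_functors_to_abelian = D: linear_category R D + KL: linear_category R K + functors_to_abelian D K
  for R :: "('k, 'r) ring_scheme" and D :: "('o, 'm, 'k) prelincat" and K :: "('p, 'n, 'k) prelincat"
begin

lemma linear_functorI:
  assumes M: "is_functor D K M"
    and add: "\<And>f g. f \<in> Arr D \<Longrightarrow> g \<in> Arr D \<Longrightarrow> Dom D f = Dom D g \<Longrightarrow> Cod D f = Cod D g \<Longrightarrow>
      FArr M (Add D f g) = Add K (FArr M f) (FArr M g)"
    and scl: "\<And>r f. r \<in> carrier R \<Longrightarrow> f \<in> Arr D \<Longrightarrow> FArr M (Scl D r f) = Scl K r (FArr M f)"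
  shows "is_linear_functor R D K M"
  using assms by (auto simp: is_linear_functor_def)

lemma linear_functorD:
  assumes "is_linear_functor R D K M"
  shows "is_functor D K M"
    "f \<in> Arr D \<Longrightarrow> g \<in> Arr D \<Longrightarrow> Dom D f = Dom D g \<Longrightarrow> Cod D f = Cod D g \<Longrightarrow>
      FArr M (Add D f g) = Add K (FArr M f) (FArr M g)"
    "r \<in> carrier R \<Longrightarrow> f \<in> Arr D \<Longrightarrow> FArr M (Scl D r f) = Scl K r (FArr M f)"
  using assms by (auto simp: is_linear_functor_def)

text \<open>By naturality both sides can be moved to \<open>F\<close>, which is linear. Cancelling
  \<open>k\<close> then makes subfunctors linear, and cancelling the two projections together makes
  biproducts linear.\<close>

lemma linear_transfer:
  assumes M: "is_functor D K M" and F: "is_linear_functor R D K F" and k: "nat_trans D K M F k"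
  shows "f \<in> Arr D \<Longrightarrow> g \<in> Arr D \<Longrightarrow> Dom D f = Dom D g \<Longrightarrow> Cod D f = Cod D g \<Longrightarrow>
      k (Cod D g) \<cdot>\<^bsub>K\<^esub> FArr M (Add D f g) = k (Cod D g) \<cdot>\<^bsub>K\<^esub> Add K (FArr M f) (FArr M g)"
    "r \<in> carrier R \<Longrightarrow> f \<in> Arr D \<Longrightarrow> k (Cod D f) \<cdot>\<^bsub>K\<^esub> FArr M (Scl D r f) = k (Cod D f) \<cdot>\<^bsub>K\<^esub> Scl K r (FArr M f)"
proof -
  note s = nat_simps(1-3)[OF k] functor_simps(1-4)[OF M] functor_simps(1-4)[OF linear_functorD(1)[OF F]]
  show "k (Cod D g) \<cdot>\<^bsub>K\<^esub> FArr M (Add D f g) = k (Cod D g) \<cdot>\<^bsub>K\<^esub> Add K (FArr M f) (FArr M g)"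
    if f: "f \<in> Arr D" "g \<in> Arr D" "Dom D f = Dom D g" "Cod D f = Cod D g"
    using nat_simps(4)[OF k, of "Add D f g"] nat_simps(4)[OF k f(1)] nat_simps(4)[OF k f(2)]
      linear_functorD(2)[OF F f] f s D.dom_obj[OF f(2)] D.cod_obj[OF f(2)] by simp
  show "k (Cod D f) \<cdot>\<^bsub>K\<^esub> FArr M (Scl D r f) = k (Cod D f) \<cdot>\<^bsub>K\<^esub> Scl K r (FArr M f)"
    if f: "r \<in> carrier R" "f \<in> Arr D"
    using nat_simps(4)[OF k, of "Scl D r f"] nat_simps(4)[OF k f(2)]
      linear_functorD(3)[OF F f] f s D.dom_obj[OF f(2)] D.cod_obj[OF f(2)] by simp
qed

lemma linear_transfer':
  assumes M: "is_functor D K M" and F: "is_linear_functor R D K F" and k: "nat_trans D K F M k"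
  shows "f \<in> Arr D \<Longrightarrow> g \<in> Arr D \<Longrightarrow> Dom D f = Dom D g \<Longrightarrow> Cod D f = Cod D g \<Longrightarrow>
      FArr M (Add D f g) \<cdot>\<^bsub>K\<^esub> k (Dom D g) = Add K (FArr M f) (FArr M g) \<cdot>\<^bsub>K\<^esub> k (Dom D g)"
    "r \<in> carrier R \<Longrightarrow> f \<in> Arr D \<Longrightarrow> FArr M (Scl D r f) \<cdot>\<^bsub>K\<^esub> k (Dom D f) = Scl K r (FArr M f) \<cdot>\<^bsub>K\<^esub> k (Dom D f)"
proof -
  note s = nat_simps(1-3)[OF k] functor_simps(1-4)[OF M] functor_simps(1-4)[OF linear_functorD(1)[OF F]]
  show "FArr M (Add D f g) \<cdot>\<^bsub>K\<^esub> k (Dom D g) = Add K (FArr M f) (FArr M g) \<cdot>\<^bsub>K\<^esub> k (Dom D g)"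
    if f: "f \<in> Arr D" "g \<in> Arr D" "Dom D f = Dom D g" "Cod D f = Cod D g"
    using nat_simps(4)[OF k, of "Add D f g", symmetric] nat_simps(4)[OF k f(1), symmetric] nat_simps(4)[OF k f(2), symmetric]
      linear_functorD(2)[OF F f] f s D.dom_obj[OF f(2)] D.cod_obj[OF f(2)] by simp
  show "FArr M (Scl D r f) \<cdot>\<^bsub>K\<^esub> k (Dom D f) = Scl K r (FArr M f) \<cdot>\<^bsub>K\<^esub> k (Dom D f)"
    if f: "r \<in> carrier R" "f \<in> Arr D"
    using nat_simps(4)[OF k, of "Scl D r f", symmetric] nat_simps(4)[OF k f(2), symmetric]
      linear_functorD(3)[OF F f] f s D.dom_obj[OF f(2)] D.cod_obj[OF f(2)] by simp
qed

lemma exact_linear_functors: "exact_functor_subcategory D K {M. is_linear_functor R D K M}"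
proof unfold_locales
  show "is_functor D K F" if "F \<in> {M. is_linear_functor R D K M}" for F using that linear_functorD by blast
  show "M \<in> {M. is_linear_functor R D K M}"
    if M: "is_functor D K M" and z: "\<And>a. a \<in> Obj D \<Longrightarrow> zero_object K (FObj M a)" for M
  proof -
    note s = functor_simps(1-4)[OF M]
    \<comment> \<open>Parallel arrows out of a zero object agree, so linearity of a functor with
      zero values is automatic.\<close>
    have eq: "u = v" if "u \<in> Arr K" "v \<in> Arr K" "Dom K u = FObj M a" "Dom K v = FObj M a" "Cod K u = Cod K v" "a \<in> Obj D" for u v a
      using K.arr_from_zero[OF z[OF that(6)] that(1,3)] K.arr_from_zero[OF z[OF that(6)] that(2,4)] that(5) by simp
    have "is_linear_functor R D K M"
    proof (rule linear_functorI[OF M])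
      fix f g assume f: "f \<in> Arr D" "g \<in> Arr D" "Dom D f = Dom D g" "Cod D f = Cod D g"
      show "FArr M (Add D f g) = Add K (FArr M f) (FArr M g)"
        by (rule eq[of _ _ "Dom D g"]) (use f s D.dom_obj D.cod_obj in simp_all)
    next
      fix r f assume f: "r \<in> carrier R" "f \<in> Arr D"
      show "FArr M (Scl D r f) = Scl K r (FArr M f)"
        by (rule eq[of _ _ "Dom D f"]) (use f s D.dom_obj D.cod_obj in simp_all)
    qed
    then show ?thesis by simp
  qed
  show "M \<in> {M. is_linear_functor R D K M}"
    if M: "is_functor D K M" and "F \<in> {M. is_linear_functor R D K M}" and k: "nat_trans D K M F k"
      and mono: "\<And>a. a \<in> Obj D \<Longrightarrow> monic K (k a)" for M F k
  proof -
    have F: "is_linear_functor R D K F" using that(2) by simp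
    note s = nat_simps(1-3)[OF k] functor_simps(1-4)[OF M]
    have "is_linear_functor R D K M"
    proof (rule linear_functorI[OF M])
      fix f g assume f: "f \<in> Arr D" "g \<in> Arr D" "Dom D f = Dom D g" "Cod D f = Cod D g"
      show "FArr M (Add D f g) = Add K (FArr M f) (FArr M g)"
        by (rule KL.monic_cancel[OF mono[OF D.cod_obj[OF f(2)]]])
           (use linear_transfer(1)[OF M F k f] f s D.dom_obj[OF f(2)] D.cod_obj[OF f(2)] in \<open>simp_all del: KL.comp_add\<close>)
    next
      fix r f assume f: "r \<in> carrier R" "f \<in> Arr D"
      show "FArr M (Scl D r f) = Scl K r (FArr M f)"
        by (rule KL.monic_cancel[OF mono[OF D.cod_obj[OF f(2)]]])
           (use linear_transfer(2)[OF M F k f] f s D.dom_obj[OF f(2)] D.cod_obj[OF f(2)] in \<open>simp_all del: KL.comp_scl\<close>)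
    qed
    then show ?thesis by simp
  qed
  show "M \<in> {M. is_linear_functor R D K M}"
    if M: "is_functor D K M" and "F \<in> {M. is_linear_functor R D K M}" and k: "nat_trans D K F M k"
      and epi: "\<And>a. a \<in> Obj D \<Longrightarrow> epic K (k a)" for M F k
  proof -
    have F: "is_linear_functor R D K F" using that(2) by simp
    note s = nat_simps(1-3)[OF k] functor_simps(1-4)[OF M]
    have "is_linear_functor R D K M"
    proof (rule linear_functorI[OF M])
      fix f g assume f: "f \<in> Arr D" "g \<in> Arr D" "Dom D f = Dom D g" "Cod D f = Cod D g"
      show "FArr M (Add D f g) = Add K (FArr M f) (FArr M g)"
        by (rule KL.epic_cancel[OF epi[OF D.dom_obj[OF f(2)]]])
           (use linear_transfer'(1)[OF M F k f] f s D.dom_obj[OF f(2)] D.cod_obj[OF f(2)] in \<open>simp_all del: KL.comp_add\<close>)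
    next
      fix r f assume f: "r \<in> carrier R" "f \<in> Arr D"
      show "FArr M (Scl D r f) = Scl K r (FArr M f)"
        by (rule KL.epic_cancel[OF epi[OF D.dom_obj[OF f(2)]]])
           (use linear_transfer'(2)[OF M F k f] f s D.dom_obj[OF f(2)] D.cod_obj[OF f(2)] in \<open>simp_all del: KL.comp_scl\<close>)
    qed
    then show ?thesis by simp
  qed
  show "M \<in> {M. is_linear_functor R D K M}"
    if M: "is_functor D K M" and "F \<in> {M. is_linear_functor R D K M}" "G \<in> {M. is_linear_functor R D K M}"
      and p: "nat_trans D K M F p" and q: "nat_trans D K M G q"
      and b: "\<And>a. a \<in> Obj D \<Longrightarrow> is_biproduct K (FObj F a) (FObj G a) (FObj M a) (i a) (j a) (p a) (q a)" for M F G i j p q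
  proof -
    have F: "is_linear_functor R D K F" and G: "is_linear_functor R D K G" using that(2,3) by simp_all
    note s = nat_simps(1-3)[OF p] nat_simps(1-3)[OF q] functor_simps(1-4)[OF M]
    have "is_linear_functor R D K M"
    proof (rule linear_functorI[OF M])
      fix f g assume f: "f \<in> Arr D" "g \<in> Arr D" "Dom D f = Dom D g" "Cod D f = Cod D g"
      \<comment> \<open>The two projections of the biproduct are jointly monic, so linearity is
        checked after each of them.\<close>
      show "FArr M (Add D f g) = Add K (FArr M f) (FArr M g)"
        by (rule KL.biproduct_eqI[OF b[OF D.cod_obj[OF f(2)]] _ _ _ _ linear_transfer(1)[OF M F p f] linear_transfer(1)[OF M G q f]])
           (use f s D.dom_obj[OF f(2)] D.cod_obj[OF f(2)] in simp_all)
    next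
      fix r f assume f: "r \<in> carrier R" "f \<in> Arr D"
      show "FArr M (Scl D r f) = Scl K r (FArr M f)"
        by (rule KL.biproduct_eqI[OF b[OF D.cod_obj[OF f(2)]] _ _ _ _ linear_transfer(2)[OF M F p f] linear_transfer(2)[OF M G q f]])
           (use f s D.dom_obj[OF f(2)] D.cod_obj[OF f(2)] in simp_all)
    qed
    then show ?thesis by simp
  qed
qed

lemma exact_linear_functors_pwf:
  "exact_functor_subcategory D K {M. is_linear_functor R D K M \<and> (\<forall>x\<in>Obj D. finite_length K (FObj M x))}"
proof -
  have "{M. is_linear_functor R D K M \<and> (\<forall>x\<in>Obj D. finite_length K (FObj M x))} =
      {M. is_linear_functor R D K M} \<inter> {M. is_functor D K M \<and> (\<forall>x\<in>Obj D. finite_length K (FObj M x))}"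
    using linear_functorD(1) by blast
  then show ?thesis using exact_functor_subcategory_Int[OF exact_linear_functors exact_functors_pwf] by simp
qed

end

section \<open>Precomposition\<close>

text \<open>Exactness holds because kernels and cokernels are pointwise on both sides, whatever the full
  subcategory \<open>\<G>\<close> is.\<close>

lemma precomposition_restricts:
  assumes E: "exact_functor_subcategory E K \<F>" and G: "functor_subcategory C K \<G>" and Q: "is_functor C E Q"
    and maps: "\<And>F. F \<in> \<F> \<Longrightarrow> funct_comp C F Q \<in> \<G>"
  shows "exact_structures_restrict (functor_cat E K \<F>) (functor_cat C K \<G>) (precomposition (functor_cat E K \<F>) C Q)"
proof -
  interpret E: exact_functor_subcategory E K \<F> by fact
  interpret G: functor_subcategory C K \<G> by fact
  let ?P = "precomposition (functor_cat E K \<F>) C Q"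
  let ?q = "\<lambda>\<eta>. \<lambda>a\<in>Obj C. \<eta> (FObj Q a)"
  have Qo: "FObj Q a \<in> Obj E" if "a \<in> Obj C" for a using Q that by (auto simp: is_functor_def)
  have Qa: "FArr Q f \<in> Arr E" "Dom E (FArr Q f) = FObj Q (Dom C f)" "Cod E (FArr Q f) = FObj Q (Cod C f)" if "f \<in> Arr C" for f
    using Q that by (auto simp: is_functor_def Hom_def)
  have P: "FArr ?P (F, G, \<eta>) = (funct_comp C F Q, funct_comp C G Q, ?q \<eta>)" if "(F, G, \<eta>) \<in> Arr (functor_cat E K \<F>)" for F G \<eta>
    using that by (simp add: precomposition_def)
  have PO: "FObj ?P F = funct_comp C F Q" if "F \<in> \<F>" for F using that by (simp add: precomposition_def)
  have nat: "nat_trans C K (funct_comp C F Q) (funct_comp C G Q) (?q \<eta>)" if "nat_trans E K F G \<eta>" for F G \<eta>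
  proof (rule G.nat_transI)
    fix a assume a: "a \<in> Obj C"
    show "\<eta> (FObj Q a) \<in> Hom K (FObj (funct_comp C F Q) a) (FObj (funct_comp C G Q) a)"
      using E.nat_simps(1-3)[OF that Qo[OF a]] a by (simp add: funct_comp_def Hom_def)
  next
    fix f assume f: "f \<in> Arr C"
    show "\<eta> (FObj Q (Cod C f)) \<cdot>\<^bsub>K\<^esub> FArr (funct_comp C F Q) f = FArr (funct_comp C G Q) f \<cdot>\<^bsub>K\<^esub> \<eta> (FObj Q (Dom C f))"
      using E.nat_simps(4)[OF that Qa(1)[OF f]] f Qa(2,3)[OF f] by (simp add: funct_comp_def)
  qed
  have arr: "FArr ?P f \<in> Arr (functor_cat C K \<G>)" if "f \<in> Arr (functor_cat E K \<F>)" for f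
    using that nat maps P by (cases f) simp
  have fn: "is_functor (functor_cat E K \<F>) (functor_cat C K \<G>) ?P"
    unfolding is_functor_def
  proof (intro conjI ballI impI)
    show "FObj ?P \<in> Obj (functor_cat E K \<F>) \<rightarrow>\<^sub>E Obj (functor_cat C K \<G>)"
      using maps by (auto simp: precomposition_def)
    have "FArr ?P \<in> extensional (Arr (functor_cat E K \<F>))" by (simp add: precomposition_def)
    then show "FArr ?P \<in> Arr (functor_cat E K \<F>) \<rightarrow>\<^sub>E Arr (functor_cat C K \<G>)"
      unfolding PiE_iff using arr by (intro conjI ballI)
    fix f assume f: "f \<in> Arr (functor_cat E K \<F>)"
    then obtain F G \<eta> where \<eta>: "f = (F, G, \<eta>)" "F \<in> \<F>" "G \<in> \<F>" "nat_trans E K F G \<eta>" by (rule functor_cat_arrE)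
    show "FArr ?P f \<in> Hom (functor_cat C K \<G>) (FObj ?P (Dom (functor_cat E K \<F>) f)) (FObj ?P (Cod (functor_cat E K \<F>) f))"
      using \<eta> maps nat P PO by simp
    fix g assume g: "g \<in> Arr (functor_cat E K \<F>)" "Cod (functor_cat E K \<F>) f = Dom (functor_cat E K \<F>) g"
    then obtain H \<theta> where \<theta>: "g = (G, H, \<theta>)" "H \<in> \<F>" "nat_trans E K G H \<theta>" using \<eta> by (cases g) auto
    have c: "(F, H, \<lambda>a\<in>Obj E. \<theta> a \<cdot>\<^bsub>K\<^esub> \<eta> a) \<in> Arr (functor_cat E K \<F>)"
      using E.nat_comp[OF E.functors E.functors E.functors \<eta>(4) \<theta>(3)] \<eta> \<theta> by simp
    show "FArr ?P (g \<cdot>\<^bsub>functor_cat E K \<F>\<^esub> f) = FArr ?P g \<cdot>\<^bsub>functor_cat C K \<G>\<^esub> FArr ?P f"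
      using P[OF c] P[of F G \<eta>] P[of G H \<theta>] \<eta> \<theta> Qo by (simp cong: restrict_cong)
  next
    fix F assume F: "F \<in> Obj (functor_cat E K \<F>)"
    have "(F, F, \<lambda>a\<in>Obj E. Idn K (FObj F a)) \<in> Arr (functor_cat E K \<F>)"
      using F E.nat_idn[OF E.functors] by simp
    from P[OF this] show "FArr ?P (Idn (functor_cat E K \<F>) F) = Idn (functor_cat C K \<G>) (FObj ?P F)"
      using F PO Qo by (simp add: funct_comp_def cong: restrict_cong)
  qed
  show ?thesis
  proof (rule exact_functor_restricts[OF E.functor_cat_abelian fn])
    fix f g assume fg: "f \<in> Arr (functor_cat E K \<F>)" "g \<in> Arr (functor_cat E K \<F>)"
      "Dom (functor_cat E K \<F>) f = Dom (functor_cat E K \<F>) g" "Cod (functor_cat E K \<F>) f = Cod (functor_cat E K \<F>) g"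
    obtain F G \<eta> where \<eta>: "f = (F, G, \<eta>)" "F \<in> \<F>" "G \<in> \<F>" "nat_trans E K F G \<eta>" using fg(1) by (rule functor_cat_arrE)
    obtain \<theta> where \<theta>: "g = (F, G, \<theta>)" "nat_trans E K F G \<theta>" using fg(2-4) \<eta>(1) by (cases g) auto
    have c: "(F, G, \<lambda>a\<in>Obj E. Add K (\<eta> a) (\<theta> a)) \<in> Arr (functor_cat E K \<F>)"
      using E.nat_add[OF E.functors E.functors \<eta>(4) \<theta>(2)] \<eta> by simp
    show "FArr ?P (Add (functor_cat E K \<F>) f g) = Add (functor_cat C K \<G>) (FArr ?P f) (FArr ?P g)"
      using P[OF c] P[of F G \<eta>] P[of F G \<theta>] \<eta> \<theta> Qo by (simp cong: restrict_cong)
  next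
    fix i p assume s: "short_exact (functor_cat E K \<F>) i p"
    then have ip: "i \<in> Arr (functor_cat E K \<F>)" "p \<in> Arr (functor_cat E K \<F>)" "Cod (functor_cat E K \<F>) i = Dom (functor_cat E K \<F>) p"
      unfolding short_exact_def is_kernel_def by blast+
    obtain M F k where k: "i = (M, F, k)" using ip(1) by (rule functor_cat_arrE)
    obtain G c where c: "p = (F, G, c)" using ip(2,3) k by (cases p) auto
    \<comment> \<open>At \<open>a\<close> the precomposed sequence is the original one at
      \<open>FObj Q a\<close>.\<close>
    have "short_exact K (?q k a) (?q c a)" if "a \<in> Obj C" for a
      using E.short_exact_pointwise[OF s[unfolded k c] Qo[OF that]] that by simp
    then show "short_exact (functor_cat C K \<G>) (FArr ?P i) (FArr ?P p)"
      unfolding k c P[OF ip(1)[unfolded k]] P[OF ip(2)[unfolded c]]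
      by (intro G.pointwise_short_exact)
         (use arr[OF ip(1)] arr[OF ip(2)] P[OF ip(1)[unfolded k]] P[OF ip(2)[unfolded c]] k c in simp_all)
  qed
qed

section \<open>Functors, ideals and quotients\<close>

lemma funct_comp_functor:
  assumes F: "is_functor C D F" and G: "is_functor D E G" and C: "category C"
  shows "is_functor C E (funct_comp C G F)"
proof -
  interpret C: category C by fact
  have o: "FObj F a \<in> Obj D" if "a \<in> Obj C" for a using F that by (auto simp: is_functor_def)
  have a: "FArr F f \<in> Arr D" "Dom D (FArr F f) = FObj F (Dom C f)" "Cod D (FArr F f) = FObj F (Cod C f)" if "f \<in> Arr C" for f
    using F that by (auto simp: is_functor_def Hom_def)
  show ?thesis unfolding is_functor_def
  proof (intro conjI ballI impI)
    show "FObj (funct_comp C G F) \<in> Obj C \<rightarrow>\<^sub>E Obj E" using G o by (auto simp: is_functor_def funct_comp_def)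
    show "FArr (funct_comp C G F) \<in> Arr C \<rightarrow>\<^sub>E Arr E" using G a by (auto simp: is_functor_def funct_comp_def)
    show "FArr (funct_comp C G F) f \<in> Hom E (FObj (funct_comp C G F) (Dom C f)) (FObj (funct_comp C G F) (Cod C f))"
      if "f \<in> Arr C" for f
      using G a[OF that] that C.dom_obj C.cod_obj by (auto simp: is_functor_def funct_comp_def Hom_def)
    show "FArr (funct_comp C G F) (Idn C x) = Idn E (FObj (funct_comp C G F) x)" if "x \<in> Obj C" for x
      using F G o[OF that] that by (simp add: is_functor_def funct_comp_def)
    show "FArr (funct_comp C G F) (g \<cdot>\<^bsub>C\<^esub> f) = FArr (funct_comp C G F) g \<cdot>\<^bsub>E\<^esub> FArr (funct_comp C G F) f"
      if fg: "f \<in> Arr C" "g \<in> Arr C" "Cod C f = Dom C g" for f g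
    proof -
      have "FArr F (g \<cdot>\<^bsub>C\<^esub> f) = FArr F g \<cdot>\<^bsub>D\<^esub> FArr F f" using F fg by (simp add: is_functor_def)
      moreover have "FArr G (FArr F g \<cdot>\<^bsub>D\<^esub> FArr F f) = FArr G (FArr F g) \<cdot>\<^bsub>E\<^esub> FArr G (FArr F f)"
        using G a[OF fg(1)] a[OF fg(2)] fg(3) by (simp add: is_functor_def)
      ultimately show ?thesis using fg by (simp add: funct_comp_def)
    qed
  qed
qed

lemma funct_comp_linear:
  assumes F: "is_linear_functor R C D F" and G: "is_linear_functor R D E G" and C: "linear_category R C"
  shows "is_linear_functor R C E (funct_comp C G F)"
proof -
  interpret C: linear_category R C by fact
  have fF: "is_functor C D F" and fG: "is_functor D E G" using F G by (simp_all add: is_linear_functor_def)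
  have a: "FArr F f \<in> Arr D" "Dom D (FArr F f) = FObj F (Dom C f)" "Cod D (FArr F f) = FObj F (Cod C f)" if "f \<in> Arr C" for f
    using fF that by (auto simp: is_functor_def Hom_def)
  have s: "Scl C r f \<in> Arr C" if "r \<in> carrier R" "f \<in> Arr C" for r f
    using C.scl_hom[OF that(1) C.homI[OF that(2)]] by (simp add: Hom_def)
  show ?thesis unfolding is_linear_functor_def
  proof (intro conjI ballI impI)
    show "is_functor C E (funct_comp C G F)" by (rule funct_comp_functor[OF fF fG C.category_axioms])
    show "FArr (funct_comp C G F) (Add C f g) = Add E (FArr (funct_comp C G F) f) (FArr (funct_comp C G F) g)"
      if "f \<in> Arr C" "g \<in> Arr C" "Dom C f = Dom C g \<and> Cod C f = Cod C g" for f g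
      using that a F G by (simp add: is_linear_functor_def funct_comp_def)
    show "FArr (funct_comp C G F) (Scl C r f) = Scl E r (FArr (funct_comp C G F) f)"
      if "r \<in> carrier R" "f \<in> Arr C" for r f
      using that a s F G by (simp add: is_linear_functor_def funct_comp_def)
  qed
qed

lemma functor_iso:
  assumes "category C" "is_functor C D F" "iso_arr C f"
  shows "iso_arr D (FArr F f)"
proof -
  interpret C: category C by fact
  obtain g where g: "f \<in> Arr C" "g \<in> Arr C" "Dom C g = Cod C f" "Cod C g = Dom C f"
    "g \<cdot>\<^bsub>C\<^esub> f = Idn C (Dom C f)" "f \<cdot>\<^bsub>C\<^esub> g = Idn C (Cod C f)" using assms(3) by (rule C.iso_arrE)
  have a: "FArr F h \<in> Arr D" "Dom D (FArr F h) = FObj F (Dom C h)" "Cod D (FArr F h) = FObj F (Cod C h)" if "h \<in> Arr C" for h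
    using assms(2) that by (auto simp: is_functor_def Hom_def)
  have m: "FArr F (h \<cdot>\<^bsub>C\<^esub> k) = FArr F h \<cdot>\<^bsub>D\<^esub> FArr F k" if "k \<in> Arr C" "h \<in> Arr C" "Cod C k = Dom C h" for h k
    using assms(2) that by (simp add: is_functor_def)
  have i: "FArr F (Idn C x) = Idn D (FObj F x)" if "x \<in> Obj C" for x using assms(2) that by (simp add: is_functor_def)
  show ?thesis
    unfolding iso_arr_def
  proof (intro conjI bexI)
    show "FArr F g \<in> Hom D (Cod D (FArr F f)) (Dom D (FArr F f))" using a g by (simp add: Hom_def)
    show "FArr F g \<cdot>\<^bsub>D\<^esub> FArr F f = Idn D (Dom D (FArr F f))"
      using m[of f g] i g(1-5) a C.dom_obj by simp
    show "FArr F f \<cdot>\<^bsub>D\<^esub> FArr F g = Idn D (Cod D (FArr F f))"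
      using m[of g f] i g(1-4,6) a C.cod_obj by simp
  qed (use a g in simp)
qed

section \<open>Quotients of a linear category by an ideal\<close>

locale quotient_by_ideal = linear_category R D
  for R :: "('k, 'r) ring_scheme" and D :: "('o, 'm, 'k) prelincat" +
  fixes J :: "'m set"
  assumes ideal: "cat_ideal R D J"
begin

lemma J_arr: "h \<in> J \<Longrightarrow> h \<in> Arr D"
  and J_zro: "a \<in> Obj D \<Longrightarrow> b \<in> Obj D \<Longrightarrow> Zro D a b \<in> J"
  and J_add: "f \<in> J \<Longrightarrow> g \<in> J \<Longrightarrow> Dom D f = Dom D g \<Longrightarrow> Cod D f = Cod D g \<Longrightarrow> Add D f g \<in> J"
  and J_scl: "r \<in> carrier R \<Longrightarrow> f \<in> J \<Longrightarrow> Scl D r f \<in> J"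
  and J_left: "f \<in> J \<Longrightarrow> g \<in> Arr D \<Longrightarrow> Dom D g = Cod D f \<Longrightarrow> g \<cdot>\<^bsub>D\<^esub> f \<in> J"
  and J_right: "f \<in> J \<Longrightarrow> g \<in> Arr D \<Longrightarrow> Cod D g = Dom D f \<Longrightarrow> f \<cdot>\<^bsub>D\<^esub> g \<in> J"
  using ideal unfolding cat_ideal_def by blast+

lemma J_neg: "f \<in> J \<Longrightarrow> neg f \<in> J"
proof -
  interpret cring R by (rule scalars)
  show "f \<in> J \<Longrightarrow> neg f \<in> J" using J_arr J_scl neg_eq_scl by simp
qed

abbreviation "q \<equiv> coset D J"

lemma coset_mem:
  "g \<in> q f \<longleftrightarrow> (\<exists>h\<in>J. Dom D h = Dom D f \<and> Cod D h = Cod D f \<and> g = Add D f h)"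
  using J_arr by (auto simp: coset_def Hom_def)

lemma coset_arr: "f \<in> Arr D \<Longrightarrow> g \<in> q f \<Longrightarrow> g \<in> Arr D \<and> Dom D g = Dom D f \<and> Cod D g = Cod D f"
  using J_arr by (auto simp: coset_mem)

lemma coset_self: "f \<in> Arr D \<Longrightarrow> f \<in> q f"
  using J_zro dom_obj cod_obj by (auto simp: coset_mem intro!: bexI[of _ "Zro D (Dom D f) (Cod D f)"])

lemma coset_subset:
  assumes f: "f \<in> Arr D" and g: "g \<in> q f"
  shows "q g \<subseteq> q f"
proof
  fix x assume "x \<in> q g"
  obtain h where h: "h \<in> J" "Dom D h = Dom D f" "Cod D h = Cod D f" "g = Add D f h" using g coset_mem by blast
  obtain h' where h': "h' \<in> J" "Dom D h' = Dom D g" "Cod D h' = Cod D g" "x = Add D g h'" using \<open>x \<in> q g\<close> coset_mem by blast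
  note gD = coset_arr[OF f g] and t = J_arr[OF h(1)] J_arr[OF h'(1)]
  have "x = Add D f (Add D h h')" unfolding h'(4) h(4) using f t h(2,3) h'(2,3) gD by (intro add_assoc) simp_all
  then show "x \<in> q f" unfolding coset_mem
    using J_add[OF h(1) h'(1)] h(2,3) h'(2,3) gD t by (intro bexI[of _ "Add D h h'"]) simp_all
qed

text \<open>The ideal contains negatives, so \<open>f\<close> also lies in the coset of
  \<open>g\<close> and the inclusion of cosets applies in both directions.\<close>

lemma coset_eq:
  assumes f: "f \<in> Arr D" and g: "g \<in> q f"
  shows "q g = q f"
proof
  show "q g \<subseteq> q f" by (rule coset_subset[OF f g])
  obtain h where h: "h \<in> J" "Dom D h = Dom D f" "Cod D h = Cod D f" "g = Add D f h" using g coset_mem by blast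
  note gD = coset_arr[OF f g] and t = J_arr[OF h(1)]
  have "Add D g (neg h) = f" unfolding h(4) using f t h(2,3) by (simp add: add_assoc)
  then have "f \<in> q g" unfolding coset_mem using J_neg[OF h(1)] h gD t by (intro bexI[of _ "neg h"]) simp_all
  then show "q f \<subseteq> q g" using coset_subset gD by blast
qed

lemma coset_union:
  assumes f: "f \<in> Arr D" and t: "\<And>x. x \<in> q f \<Longrightarrow> t x = t f"
  shows "(\<Union>x\<in>q f. t x) = t f"
  using coset_self[OF f] t by blast

text \<open>\<open>quot_cat\<close> reads the ends off an arbitrarily chosen member of the coset,
  and all members share the ends of \<open>f\<close>.\<close>

lemma q_simps:
  assumes f: "f \<in> Arr D"
  shows "Dom (quot_cat D J) (q f) = Dom D f" "Cod (quot_cat D J) (q f) = Cod D f" "q f \<in> Arr (quot_cat D J)"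
proof -
  have "(SOME g. g \<in> q f) \<in> q f" using coset_self[OF f] by (rule someI)
  from coset_arr[OF f this] show "Dom (quot_cat D J) (q f) = Dom D f" "Cod (quot_cat D J) (q f) = Cod D f"
    by (simp_all add: quot_cat_def)
  show "q f \<in> Arr (quot_cat D J)" using f by (simp add: quot_cat_def)
qed

text \<open>Operations of \<open>quot_cat\<close> are unions over all representatives. The resulting
  coset is the same for every choice, so the nonempty union collapses to it.\<close>

lemma q_add:
  assumes f: "f \<in> Arr D" "g \<in> Arr D" "Dom D f = Dom D g" "Cod D f = Cod D g"
  shows "Add (quot_cat D J) (q f) (q g) = q (Add D f g)"
proof -
  have "q (Add D x y) = q (Add D f g)" if x: "x \<in> q f" and y: "y \<in> q g" for x y
  proof (rule coset_eq)
    obtain h where h: "h \<in> J" "Dom D h = Dom D f" "Cod D h = Cod D f" "x = Add D f h" using x coset_mem by blast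
    obtain h' where h': "h' \<in> J" "Dom D h' = Dom D g" "Cod D h' = Cod D g" "y = Add D g h'" using y coset_mem by blast
    note t = J_arr[OF h(1)] J_arr[OF h'(1)]
    have "Add D x y = Add D (Add D f g) (Add D h h')" unfolding h(4) h'(4)
      by (rule add_interchange) (use f t h(2,3) h'(2,3) in simp_all)
    then show "Add D x y \<in> q (Add D f g)" unfolding coset_mem
      using J_add[OF h(1) h'(1)] h(2,3) h'(2,3) f t by (intro bexI[of _ "Add D h h'"]) simp_all
  qed (use f in simp)
  then have "(\<Union>x\<in>q f. \<Union>y\<in>q g. q (Add D x y)) = q (Add D f g)"
    using coset_self[OF f(1)] coset_self[OF f(2)] by blast
  then show ?thesis by (simp add: quot_cat_def)
qed

lemma q_comp:
  assumes f: "f \<in> Arr D" "g \<in> Arr D" "Cod D f = Dom D g"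
  shows "q g \<cdot>\<^bsub>quot_cat D J\<^esub> q f = q (g \<cdot>\<^bsub>D\<^esub> f)"
proof -
  have "q (y \<cdot>\<^bsub>D\<^esub> x) = q (g \<cdot>\<^bsub>D\<^esub> f)" if x: "x \<in> q f" and y: "y \<in> q g" for x y
  proof (rule coset_eq)
    obtain h where h: "h \<in> J" "Dom D h = Dom D f" "Cod D h = Cod D f" "x = Add D f h" using x coset_mem by blast
    obtain h' where h': "h' \<in> J" "Dom D h' = Dom D g" "Cod D h' = Cod D g" "y = Add D g h'" using y coset_mem by blast
    note t = J_arr[OF h(1)] J_arr[OF h'(1)] coset_arr[OF f(1) x] coset_arr[OF f(2) y]
    \<comment> \<open>The error term: with \<open>x = f + h\<close> and \<open>y = g + h'\<close>,
      the product \<open>y x\<close> is \<open>g f\<close> plus \<open>g h + h' x\<close>, and both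
      of these summands lie in the ideal.\<close>
    let ?k = "Add D (g \<cdot>\<^bsub>D\<^esub> h) (h' \<cdot>\<^bsub>D\<^esub> x)"
    have "y \<cdot>\<^bsub>D\<^esub> x = Add D (g \<cdot>\<^bsub>D\<^esub> x) (h' \<cdot>\<^bsub>D\<^esub> x)" unfolding h'(4) using f t h'(2,3) by (intro comp_add(1)) simp_all
    moreover have "g \<cdot>\<^bsub>D\<^esub> x = Add D (g \<cdot>\<^bsub>D\<^esub> f) (g \<cdot>\<^bsub>D\<^esub> h)" unfolding h(4) using f t h(2,3) by (intro comp_add(2)) simp_all
    ultimately have "y \<cdot>\<^bsub>D\<^esub> x = Add D (g \<cdot>\<^bsub>D\<^esub> f) ?k" using f t h(2,3) h'(2,3) by (simp add: add_assoc)
    moreover have "?k \<in> J"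
      by (rule J_add[OF J_left[OF h(1) f(2)] J_right[OF h'(1)]]) (use f t h(2,3) h'(2,3) in simp_all)
    ultimately show "y \<cdot>\<^bsub>D\<^esub> x \<in> q (g \<cdot>\<^bsub>D\<^esub> f)" unfolding coset_mem
      using h(2,3) h'(2,3) f t by (intro bexI[of _ ?k]) simp_all
  qed (use f in simp)
  then have "(\<Union>y\<in>q g. \<Union>x\<in>q f. q (y \<cdot>\<^bsub>D\<^esub> x)) = q (g \<cdot>\<^bsub>D\<^esub> f)"
    using coset_self[OF f(1)] coset_self[OF f(2)] by blast
  then show ?thesis by (simp add: quot_cat_def)
qed

lemma q_scl:
  assumes f: "r \<in> carrier R" "f \<in> Arr D"
  shows "Scl (quot_cat D J) r (q f) = q (Scl D r f)"
proof -
  have "q (Scl D r x) = q (Scl D r f)" if x: "x \<in> q f" for x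
  proof (rule coset_eq)
    obtain h where h: "h \<in> J" "Dom D h = Dom D f" "Cod D h = Cod D f" "x = Add D f h" using x coset_mem by blast
    note t = J_arr[OF h(1)]
    have "Scl D r x = Add D (Scl D r f) (Scl D r h)" unfolding h(4) using f t h(2,3) by (intro scl_add) simp_all
    then show "Scl D r x \<in> q (Scl D r f)" unfolding coset_mem
      using J_scl[OF f(1) h(1)] h(2,3) f t by (intro bexI[of _ "Scl D r h"]) simp_all
  qed (use f in simp)
  then have "(\<Union>x\<in>q f. q (Scl D r x)) = q (Scl D r f)" using coset_self[OF f(2)] by blast
  then show ?thesis by (simp add: quot_cat_def)
qed

lemma q_other: "Obj (quot_cat D J) = Obj D" "Idn (quot_cat D J) a = q (Idn D a)" "Zro (quot_cat D J) a b = q (Zro D a b)"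
  by (simp_all add: quot_cat_def)

lemma quot_arrE:
  assumes "F \<in> Arr (quot_cat D J)"
  obtains f where "f \<in> Arr D" "F = q f"
  using assms by (auto simp: quot_cat_def)

lemma quot_homE:
  assumes "F \<in> Hom (quot_cat D J) a b"
  obtains f where "f \<in> Arr D" "Dom D f = a" "Cod D f = b" "F = q f"
proof -
  have "F \<in> Arr (quot_cat D J)" using assms by (simp add: Hom_def)
  then obtain f where "f \<in> Arr D" "F = q f" by (rule quot_arrE)
  then show thesis using that assms q_simps by (simp add: Hom_def)
qed

lemma q_hom: "f \<in> Arr D \<Longrightarrow> Dom D f = a \<Longrightarrow> Cod D f = b \<Longrightarrow> q f \<in> Hom (quot_cat D J) a b"
  by (simp add: Hom_def q_simps)

lemma quotient_category: "category (quot_cat D J)"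
proof
  show "F \<in> Arr (quot_cat D J) \<Longrightarrow> Dom (quot_cat D J) F \<in> Obj (quot_cat D J)"
    "F \<in> Arr (quot_cat D J) \<Longrightarrow> Cod (quot_cat D J) F \<in> Obj (quot_cat D J)" for F
    by (auto elim!: quot_arrE simp: q_simps q_other dom_obj cod_obj)
  show "a \<in> Obj (quot_cat D J) \<Longrightarrow> Idn (quot_cat D J) a \<in> Hom (quot_cat D J) a a" for a
    by (simp add: q_other q_hom)
  show "F \<in> Hom (quot_cat D J) a b \<Longrightarrow> G \<in> Hom (quot_cat D J) b c \<Longrightarrow> G \<cdot>\<^bsub>quot_cat D J\<^esub> F \<in> Hom (quot_cat D J) a c" for F G a b c
    by (elim quot_homE) (simp add: q_comp q_hom)
  show "F \<in> Hom (quot_cat D J) a b \<Longrightarrow> Idn (quot_cat D J) b \<cdot>\<^bsub>quot_cat D J\<^esub> F = F"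
    "F \<in> Hom (quot_cat D J) a b \<Longrightarrow> F \<cdot>\<^bsub>quot_cat D J\<^esub> Idn (quot_cat D J) a = F" for F a b
    by (elim quot_homE; use dom_obj cod_obj in \<open>fastforce simp: q_other q_comp\<close>)+
  show "F \<in> Hom (quot_cat D J) a b \<Longrightarrow> G \<in> Hom (quot_cat D J) b c \<Longrightarrow> H \<in> Hom (quot_cat D J) c d \<Longrightarrow>
    H \<cdot>\<^bsub>quot_cat D J\<^esub> (G \<cdot>\<^bsub>quot_cat D J\<^esub> F) = H \<cdot>\<^bsub>quot_cat D J\<^esub> G \<cdot>\<^bsub>quot_cat D J\<^esub> F" for F G H a b c d
    by (elim quot_homE) (simp add: q_comp)
qed

lemma quotient_linear: "linear_category R (quot_cat D J)"
proof -
  have grp: "abelian_group (Hom_module (quot_cat D J) a b)" if ob: "a \<in> Obj D" "b \<in> Obj D" for a b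
  proof (rule abelian_groupI; (unfold Hom_module_simps)?)
    fix F assume "F \<in> Hom (quot_cat D J) a b"
    then obtain f where f: "f \<in> Arr D" "Dom D f = a" "Cod D f = b" "F = q f" by (rule quot_homE)
    show "Add (quot_cat D J) (Zro (quot_cat D J) a b) F = F" using f ob by (simp add: q_other q_add)
    show "\<exists>G\<in>Hom (quot_cat D J) a b. Add (quot_cat D J) G F = Zro (quot_cat D J) a b"
      by (rule bexI[of _ "q (neg f)"]) (use f ob in \<open>simp_all add: q_other q_add q_hom\<close>)
    fix G assume "G \<in> Hom (quot_cat D J) a b"
    then obtain g where g: "g \<in> Arr D" "Dom D g = a" "Cod D g = b" "G = q g" by (rule quot_homE)
    show "Add (quot_cat D J) F G \<in> Hom (quot_cat D J) a b" using f g by (simp add: q_add q_hom)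
    show "Add (quot_cat D J) F G = Add (quot_cat D J) G F" using f g by (simp add: q_add add_comm)
    fix H assume "H \<in> Hom (quot_cat D J) a b"
    then obtain h where h: "h \<in> Arr D" "Dom D h = a" "Cod D h = b" "H = q h" by (rule quot_homE)
    show "Add (quot_cat D J) (Add (quot_cat D J) F G) H = Add (quot_cat D J) F (Add (quot_cat D J) G H)"
      using f g h by (simp add: q_add add_assoc)
  qed (use ob in \<open>simp add: q_other q_hom\<close>)
  have mod: "module R (Hom_module (quot_cat D J) a b)" if ob: "a \<in> Obj D" "b \<in> Obj D" for a b
  proof (rule moduleI[OF scalars grp[OF ob]]; (unfold Hom_module_simps)?)
    fix F r assume r: "r \<in> carrier R" and "F \<in> Hom (quot_cat D J) a b"
    then obtain f where f: "f \<in> Arr D" "Dom D f = a" "Cod D f = b" "F = q f" by (auto elim: quot_homE)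
    show "Scl (quot_cat D J) r F \<in> Hom (quot_cat D J) a b" using f r by (simp add: q_scl q_hom)
    { fix s assume s: "s \<in> carrier R"
      have rs: "r \<oplus>\<^bsub>R\<^esub> s \<in> carrier R" "r \<otimes>\<^bsub>R\<^esub> s \<in> carrier R"
        using r s scalars by (simp_all add: cring.cring_simprules)
      show "Scl (quot_cat D J) (r \<oplus>\<^bsub>R\<^esub> s) F = Add (quot_cat D J) (Scl (quot_cat D J) r F) (Scl (quot_cat D J) s F)"
        "Scl (quot_cat D J) (r \<otimes>\<^bsub>R\<^esub> s) F = Scl (quot_cat D J) r (Scl (quot_cat D J) s F)"
        using f r s rs scl_simps2[OF f(1) r s] by (simp_all add: q_scl q_add) }
    fix G assume "G \<in> Hom (quot_cat D J) a b"
    then obtain g where g: "g \<in> Arr D" "Dom D g = a" "Cod D g = b" "G = q g" by (rule quot_homE)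
    show "Scl (quot_cat D J) r (Add (quot_cat D J) F G) = Add (quot_cat D J) (Scl (quot_cat D J) r F) (Scl (quot_cat D J) r G)"
      using f g r by (simp add: q_scl q_add scl_add)
  next
    fix F assume "F \<in> Hom (quot_cat D J) a b"
    then obtain f where f: "f \<in> Arr D" "Dom D f = a" "Cod D f = b" "F = q f" by (rule quot_homE)
    have o: "\<one>\<^bsub>R\<^esub> \<in> carrier R" using scalars by (simp add: cring.cring_simprules)
    show "Scl (quot_cat D J) \<one>\<^bsub>R\<^esub> F = F" using f o scl_simps2(3)[OF f(1) o o] by (simp add: q_scl)
  qed
  show ?thesis
  proof (intro linear_category.intro preadditive_category.intro preadditive_category_axioms.intro
      linear_category_axioms.intro quotient_category scalars)
    show "abelian_group (Hom_module (quot_cat D J) a b)" "module R (Hom_module (quot_cat D J) a b)"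
      if "a \<in> Obj (quot_cat D J)" "b \<in> Obj (quot_cat D J)" for a b using grp mod that by (simp_all add: q_other)
  qed (elim quot_homE; simp add: q_add q_comp q_scl)+
qed

text \<open>For \<open>I \<subseteq> J\<close> a coset of \<open>I\<close> lies inside one coset of
  \<open>J\<close>, so the union in \<open>quot_map\<close> is the coset of any
  representative.\<close>

lemma quot_map_linear:
  assumes "quotient_by_ideal R D I" and IJ: "I \<subseteq> J"
  shows "is_linear_functor R (quot_cat D I) (quot_cat D J) (quot_map D I J)"
    "f \<in> Arr D \<Longrightarrow> FArr (quot_map D I J) (coset D I f) = q f"
proof -
  interpret I: quotient_by_ideal R D I by fact
  have "q g = q f" if f: "f \<in> Arr D" and g: "g \<in> coset D I f" for f g
  proof (rule coset_eq[OF f])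
    show "g \<in> q f" using g IJ unfolding I.coset_mem coset_mem by blast
  qed
  then have m: "FArr (quot_map D I J) (coset D I f) = q f" if "f \<in> Arr D" for f
    using I.coset_union[OF that, of q] that I.q_simps(3)[OF that] by (simp add: quot_map_def)
  then show "f \<in> Arr D \<Longrightarrow> FArr (quot_map D I J) (coset D I f) = q f" .
  have o: "FObj (quot_map D I J) a = a" if "a \<in> Obj D" for a using that by (simp add: quot_map_def)
  have "FArr (quot_map D I J) F \<in> Arr (quot_cat D J)" if "F \<in> Arr (quot_cat D I)" for F
    using that by (elim I.quot_arrE) (simp add: m q_simps)
  moreover have "FArr (quot_map D I J) \<in> extensional (Arr (quot_cat D I))" by (simp add: quot_map_def)
  ultimately have ext: "FArr (quot_map D I J) \<in> Arr (quot_cat D I) \<rightarrow>\<^sub>E Arr (quot_cat D J)"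
    unfolding PiE_iff by simp
  show "is_linear_functor R (quot_cat D I) (quot_cat D J) (quot_map D I J)"
    unfolding is_linear_functor_def is_functor_def
  proof (intro conjI ballI impI ext)
    show "FObj (quot_map D I J) \<in> Obj (quot_cat D I) \<rightarrow>\<^sub>E Obj (quot_cat D J)"
      by (auto simp: quot_map_def q_other I.q_other)
    show "FArr (quot_map D I J) F \<in> Hom (quot_cat D J) (FObj (quot_map D I J) (Dom (quot_cat D I) F)) (FObj (quot_map D I J) (Cod (quot_cat D I) F))"
      if "F \<in> Arr (quot_cat D I)" for F
      using that by (elim I.quot_arrE) (simp add: m o I.q_simps q_hom dom_obj cod_obj)
    show "FArr (quot_map D I J) (Idn (quot_cat D I) a) = Idn (quot_cat D J) (FObj (quot_map D I J) a)"
      if "a \<in> Obj (quot_cat D I)" for a using that by (simp add: I.q_other q_other m o)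
    show "FArr (quot_map D I J) (G \<cdot>\<^bsub>quot_cat D I\<^esub> F) = FArr (quot_map D I J) G \<cdot>\<^bsub>quot_cat D J\<^esub> FArr (quot_map D I J) F"
      if "F \<in> Arr (quot_cat D I)" "G \<in> Arr (quot_cat D I)" "Cod (quot_cat D I) F = Dom (quot_cat D I) G" for F G
      using that by (elim I.quot_arrE) (simp add: m I.q_simps I.q_comp q_comp)
    show "FArr (quot_map D I J) (Add (quot_cat D I) F G) = Add (quot_cat D J) (FArr (quot_map D I J) F) (FArr (quot_map D I J) G)"
      if "F \<in> Arr (quot_cat D I)" "G \<in> Arr (quot_cat D I)"
        "Dom (quot_cat D I) F = Dom (quot_cat D I) G \<and> Cod (quot_cat D I) F = Cod (quot_cat D I) G" for F G
      using that by (elim I.quot_arrE) (simp add: m I.q_simps I.q_add q_add)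
    show "FArr (quot_map D I J) (Scl (quot_cat D I) r F) = Scl (quot_cat D J) r (FArr (quot_map D I J) F)"
      if "r \<in> carrier R" "F \<in> Arr (quot_cat D I)" for r F
      using that by (elim I.quot_arrE) (simp add: m I.q_scl q_scl)
  qed
qed

end

section \<open>The path category\<close>

text \<open>Continuity suffices for sending intervals to intervals, since connected subsets of the
  line are intervals. The reparametrizations used below are continuous and piecewise linear.\<close>

lemma reparamI:
  assumes "continuous_on {0..1} \<phi>" "\<And>t. 0 \<le> t \<Longrightarrow> t \<le> 1 \<Longrightarrow> 0 \<le> \<phi> t \<and> \<phi> t \<le> 1"
    "\<And>s t. 0 \<le> s \<Longrightarrow> s \<le> t \<Longrightarrow> t \<le> 1 \<Longrightarrow> \<phi> s \<le> \<phi> t"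
  shows "reparam \<phi>"
  unfolding reparam_def
proof (intro conjI allI impI)
  show "\<phi> ` {0..1} \<subseteq> {0..1}" using assms(2) by auto
  show "mono_on {0..1} \<phi>" using assms(3) by (auto intro!: mono_onI)
  fix J :: "real set" assume J: "J \<subseteq> {0..1}" "is_interval J"
  have "connected (\<phi> ` J)"
    by (rule connected_continuous_image[OF continuous_on_subset[OF assms(1) J(1)]]) (use J(2) in \<open>simp add: is_interval_connected\<close>)
  then show "is_interval (\<phi> ` J)" by (simp add: is_interval_connected_1)
qed

locale path_triple =
  fixes T :: "'x path_triple"
  assumes triple: "is_triple T"
begin

lemma path_pt: "\<gamma> \<in> Paths T \<Longrightarrow> 0 \<le> t \<Longrightarrow> t \<le> 1 \<Longrightarrow> \<gamma> t \<in> Pts T"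
  and peq_equiv: "equiv (Paths T) (Peq T)"
  and peq_ends: "(\<gamma>, \<gamma>') \<in> Peq T \<Longrightarrow> \<gamma> 0 = \<gamma>' 0 \<and> \<gamma> 1 = \<gamma>' 1"
  and conc_path: "\<gamma> \<in> Paths T \<Longrightarrow> \<gamma>' \<in> Paths T \<Longrightarrow> \<gamma> 1 = \<gamma>' 0 \<Longrightarrow> \<gamma> \<frown> \<gamma>' \<in> Paths T"
  and const_path: "x \<in> Pts T \<Longrightarrow> const_path x \<in> Paths T"
  and reparam_peq: "\<gamma> \<in> Paths T \<Longrightarrow> reparam \<phi> \<Longrightarrow> \<phi> 0 = 0 \<Longrightarrow> \<phi> 1 = 1 \<Longrightarrow> (\<gamma>, restrict (\<gamma> \<circ> \<phi>) {0..1}) \<in> Peq T"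
  using triple by (auto simp: is_triple_def PiE_iff)

lemma conc_peq:
  assumes "\<gamma> \<in> Paths T" "\<gamma>' \<in> Paths T" "\<rho> \<in> Paths T" "\<rho>' \<in> Paths T"
    "\<rho> 1 = \<gamma> 0" "\<gamma> 1 = \<rho>' 0" "\<rho> 1 = \<gamma>' 0" "\<gamma>' 1 = \<rho>' 0"
    "\<rho> \<frown> \<gamma> \<frown> \<rho>' \<in> Paths T" "\<rho> \<frown> \<gamma>' \<frown> \<rho>' \<in> Paths T" "(\<gamma>, \<gamma>') \<in> Peq T"
  shows "(\<rho> \<frown> \<gamma> \<frown> \<rho>', \<rho> \<frown> \<gamma>' \<frown> \<rho>') \<in> Peq T"
proof -
  have "\<forall>\<gamma>\<in>Paths T. \<forall>\<gamma>'\<in>Paths T. \<forall>\<rho>\<in>Paths T. \<forall>\<rho>'\<in>Paths T.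
        \<rho> 1 = \<gamma> 0 \<and> \<gamma> 1 = \<rho>' 0 \<and> \<rho> 1 = \<gamma>' 0 \<and> \<gamma>' 1 = \<rho>' 0 \<and>
        \<rho> \<frown> \<gamma> \<frown> \<rho>' \<in> Paths T \<and> \<rho> \<frown> \<gamma>' \<frown> \<rho>' \<in> Paths T \<longrightarrow>
        ((\<gamma>, \<gamma>') \<in> Peq T \<longleftrightarrow> (\<rho> \<frown> \<gamma> \<frown> \<rho>', \<rho> \<frown> \<gamma>' \<frown> \<rho>') \<in> Peq T)"
    using triple unfolding is_triple_def by (elim conjE)
  from this[rule_format, OF assms(1-4)] show ?thesis using assms(5-) by blast
qed

lemma conc_ends [simp]: "(\<gamma> \<frown> \<gamma>') 0 = \<gamma> 0" "(\<gamma> \<frown> \<gamma>') 1 = \<gamma>' 1"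
  by (simp_all add: conc_def)

lemma const_path_ends [simp]: "const_path x 0 = x" "const_path x 1 = x"
  by (simp_all add: const_path_def)

lemma peq_refl: "\<gamma> \<in> Paths T \<Longrightarrow> (\<gamma>, \<gamma>) \<in> Peq T"
  and peq_sym: "(\<gamma>, \<gamma>') \<in> Peq T \<Longrightarrow> (\<gamma>', \<gamma>) \<in> Peq T"
  and peq_trans: "(\<gamma>, \<gamma>') \<in> Peq T \<Longrightarrow> (\<gamma>', \<gamma>'') \<in> Peq T \<Longrightarrow> (\<gamma>, \<gamma>'') \<in> Peq T"
  using peq_equiv by (meson equivE refl_onD symD transD)+

lemma peq_paths: "(\<gamma>, \<gamma>') \<in> Peq T \<Longrightarrow> \<gamma> \<in> Paths T \<and> \<gamma>' \<in> Paths T"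
  using peq_equiv by (auto simp: equiv_def)

lemma conc_assoc_peq:
  assumes "\<gamma> \<in> Paths T" "\<delta> \<in> Paths T" "\<epsilon> \<in> Paths T" "\<gamma> 1 = \<delta> 0" "\<delta> 1 = \<epsilon> 0"
  shows "(\<gamma> \<frown> (\<delta> \<frown> \<epsilon>), \<gamma> \<frown> \<delta> \<frown> \<epsilon>) \<in> Peq T"
proof -
  \<comment> \<open>The breakpoints 1/4 and 1/2 of the left-bracketed path must go to the
    breakpoints 1/2 and 3/4 of the right-bracketed one. The slopes 2, 1 and 1/2 decrease, so the
    piecewise linear map is the minimum of its three pieces.\<close>
  define \<phi> :: "real \<Rightarrow> real" where "\<phi> t = min (2 * t) (min (t + 1 / 4) (t / 2 + 1 / 2))" for t
  have r: "reparam \<phi>" by (rule reparamI) (auto simp: \<phi>_def intro!: continuous_intros)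
  have p: "\<gamma> \<frown> (\<delta> \<frown> \<epsilon>) \<in> Paths T" by (intro conc_path) (use assms in simp_all)
  have "restrict (\<gamma> \<frown> (\<delta> \<frown> \<epsilon>) \<circ> \<phi>) {0..1} = \<gamma> \<frown> \<delta> \<frown> \<epsilon>"
  proof (rule extensionalityI[of _ "{0..1}"])
    fix t :: real assume t: "t \<in> {0..1}"
    consider "t \<le> 1 / 4" | "1 / 4 < t" "t \<le> 1 / 2" | "1 / 2 < t" by linarith
    then show "restrict (\<gamma> \<frown> (\<delta> \<frown> \<epsilon>) \<circ> \<phi>) {0..1} t = (\<gamma> \<frown> \<delta> \<frown> \<epsilon>) t"
    proof cases
      case 1 then have "\<phi> t = 2 * t" using t by (simp add: \<phi>_def)
      then show ?thesis using 1 t by (simp add: conc_def)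
    next
      case 2 then have "\<phi> t = t + 1 / 4" using t by (simp add: \<phi>_def)
      then show ?thesis using 2 t by (simp add: conc_def field_simps)
    next
      case 3 then have "\<phi> t = t / 2 + 1 / 2" using t by (simp add: \<phi>_def)
      then show ?thesis using 3 t by (simp add: conc_def field_simps)
    qed
  qed (simp_all add: conc_def)
  then show ?thesis using reparam_peq[OF p r] by (simp add: \<phi>_def)
qed

lemma conc_const_peq:
  assumes "\<gamma> \<in> Paths T"
  shows "(\<gamma>, const_path (\<gamma> 0) \<frown> \<gamma>) \<in> Peq T" "(\<gamma>, \<gamma> \<frown> const_path (\<gamma> 1)) \<in> Peq T"
proof -
  \<comment> \<open>This map waits at 0 on the first half and then runs at double speed; its
    counterpart \<open>min (2 * t) 1\<close> runs first and then waits at 1.\<close>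
  have "reparam (\<lambda>t. max 0 (2 * t - 1))" by (rule reparamI) (auto intro!: continuous_intros)
  moreover have "restrict (\<gamma> \<circ> (\<lambda>t. max 0 (2 * t - 1))) {0..1} = const_path (\<gamma> 0) \<frown> \<gamma>"
  proof (rule extensionalityI[of _ "{0..1}"])
    fix t :: real assume t: "t \<in> {0..1}"
    show "restrict (\<gamma> \<circ> (\<lambda>t. max 0 (2 * t - 1))) {0..1} t = (const_path (\<gamma> 0) \<frown> \<gamma>) t"
    proof (cases "t \<le> 1 / 2")
      case True then have "max 0 (2 * t - 1) = 0" by simp
      then show ?thesis using True t by (simp add: conc_def const_path_def)
    next
      case False then have "max 0 (2 * t - 1) = 2 * t - 1" by simp
      then show ?thesis using False t by (simp add: conc_def)
    qed
  qed (simp_all add: conc_def)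
  ultimately show "(\<gamma>, const_path (\<gamma> 0) \<frown> \<gamma>) \<in> Peq T"
    using reparam_peq[OF assms, of "\<lambda>t. max 0 (2 * t - 1)"] by simp
  have "reparam (\<lambda>t. min (2 * t) 1)" by (rule reparamI) (auto intro!: continuous_intros)
  moreover have "restrict (\<gamma> \<circ> (\<lambda>t. min (2 * t) 1)) {0..1} = \<gamma> \<frown> const_path (\<gamma> 1)"
  proof (rule extensionalityI[of _ "{0..1}"])
    fix t :: real assume t: "t \<in> {0..1}"
    show "restrict (\<gamma> \<circ> (\<lambda>t. min (2 * t) 1)) {0..1} t = (\<gamma> \<frown> const_path (\<gamma> 1)) t"
    proof (cases "t \<le> 1 / 2")
      case True then have "min (2 * t) 1 = 2 * t" by simp
      then show ?thesis using True t by (simp add: conc_def)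
    next
      case False then have "min (2 * t) 1 = 1" by simp
      then show ?thesis using False t by (simp add: conc_def const_path_def)
    qed
  qed (simp_all add: conc_def)
  ultimately show "(\<gamma>, \<gamma> \<frown> const_path (\<gamma> 1)) \<in> Peq T"
    using reparam_peq[OF assms, of "\<lambda>t. min (2 * t) 1"] by simp
qed

lemma const_conc_peq:
  assumes "\<gamma> \<in> Paths T" "\<rho> \<in> Paths T" "\<gamma> 1 = \<rho> 0"
  shows "(\<gamma> \<frown> \<rho>, const_path (\<gamma> 0) \<frown> \<gamma> \<frown> \<rho>) \<in> Peq T"
proof -
  \<comment> \<open>The left-bracketed path waits until 1/4, traverses \<open>\<gamma>\<close> until
    1/2 and then follows \<open>\<rho>\<close> as before; the three pieces are 0,
    \<open>2 * t - 1 / 2\<close> and \<open>t\<close>.\<close>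
  define \<phi> :: "real \<Rightarrow> real" where "\<phi> t = max 0 (min (2 * t - 1 / 2) t)" for t
  have r: "reparam \<phi>" by (rule reparamI) (auto simp: \<phi>_def intro!: continuous_intros)
  have "restrict (\<gamma> \<frown> \<rho> \<circ> \<phi>) {0..1} = const_path (\<gamma> 0) \<frown> \<gamma> \<frown> \<rho>"
  proof (rule extensionalityI[of _ "{0..1}"])
    fix t :: real assume t: "t \<in> {0..1}"
    consider "t \<le> 1 / 4" | "1 / 4 < t" "t \<le> 1 / 2" | "1 / 2 < t" by linarith
    then show "restrict (\<gamma> \<frown> \<rho> \<circ> \<phi>) {0..1} t = (const_path (\<gamma> 0) \<frown> \<gamma> \<frown> \<rho>) t"
    proof cases
      case 1 then have "\<phi> t = 0" using t by (simp add: \<phi>_def)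
      then show ?thesis using 1 t by (simp add: conc_def const_path_def)
    next
      case 2 then have "\<phi> t = 2 * t - 1 / 2" using t by (simp add: \<phi>_def)
      then have "\<phi> t \<le> 1 / 2" "0 \<le> \<phi> t" "2 * \<phi> t = 2 * (2 * t) - 1" using 2 by simp_all
      then show ?thesis using 2 t by (simp add: conc_def)
    next
      case 3 then have "\<phi> t = t" using t by (simp add: \<phi>_def)
      then show ?thesis using 3 t by (simp add: conc_def)
    qed
  qed (simp_all add: conc_def)
  then show ?thesis using reparam_peq[OF conc_path[OF assms] r] by (simp add: \<phi>_def)
qed

text \<open>The compatibility axiom speaks of a middle factor between two others. The left factor is
  therefore replaced with a constant path put in front, the right factor with a constant path put
  behind, and the constants are absorbed by reparametrization.\<close>

lemma conc_cong:
  assumes g: "(\<gamma>, \<gamma>') \<in> Peq T" and d: "(\<delta>, \<delta>') \<in> Peq T" and e: "\<gamma> 1 = \<delta> 0"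
  shows "(\<gamma> \<frown> \<delta>, \<gamma>' \<frown> \<delta>') \<in> Peq T"
proof -
  note p = peq_paths[OF g, THEN conjunct1] peq_paths[OF g, THEN conjunct2] peq_paths[OF d, THEN conjunct1] peq_paths[OF d, THEN conjunct2]
  note ends = peq_ends[OF g] peq_ends[OF d]
  let ?c = "const_path (\<gamma> 0)" and ?c' = "const_path (\<delta> 1)"
  have c: "?c \<in> Paths T" "?c' \<in> Paths T" using p path_pt const_path by simp_all
  have "(?c \<frown> \<gamma> \<frown> \<delta>, ?c \<frown> \<gamma>' \<frown> \<delta>) \<in> Peq T"
    by (rule conc_peq[OF p(1,2) c(1) p(3)]) (use ends e p c g in \<open>simp_all add: conc_path\<close>)
  moreover have "(\<gamma> \<frown> \<delta>, ?c \<frown> \<gamma> \<frown> \<delta>) \<in> Peq T" by (rule const_conc_peq[OF p(1,3) e])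
  moreover have "(\<gamma>' \<frown> \<delta>, ?c \<frown> \<gamma>' \<frown> \<delta>) \<in> Peq T" using const_conc_peq[OF p(2,3)] ends e by simp
  ultimately have 1: "(\<gamma> \<frown> \<delta>, \<gamma>' \<frown> \<delta>) \<in> Peq T" using peq_sym peq_trans by blast
  have e': "\<gamma>' 1 = \<delta> 0" using ends e by simp
  have "(\<gamma>' \<frown> \<delta> \<frown> ?c', \<gamma>' \<frown> \<delta>' \<frown> ?c') \<in> Peq T"
    by (rule conc_peq[OF p(3,4) p(2) c(2)]) (use ends e p c d in \<open>simp_all add: conc_path\<close>)
  moreover have "(\<gamma>' \<frown> \<delta>, \<gamma>' \<frown> \<delta> \<frown> ?c') \<in> Peq T" using conc_const_peq(2)[OF conc_path[OF p(2,3) e']] by simp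
  moreover have "(\<gamma>' \<frown> \<delta>', \<gamma>' \<frown> \<delta>' \<frown> ?c') \<in> Peq T" using conc_const_peq(2)[OF conc_path[OF p(2,4)]] e' ends by simp
  ultimately have "(\<gamma>' \<frown> \<delta>, \<gamma>' \<frown> \<delta>') \<in> Peq T" using peq_sym peq_trans by blast
  with 1 show ?thesis by (rule peq_trans)
qed

lemma class_eq_iff: "\<gamma> \<in> Paths T \<Longrightarrow> \<gamma>' \<in> Paths T \<Longrightarrow> path_class T \<gamma> = path_class T \<gamma>' \<longleftrightarrow> (\<gamma>, \<gamma>') \<in> Peq T"
  using eq_equiv_class_iff[OF peq_equiv] .

lemma class_self: "\<gamma> \<in> Paths T \<Longrightarrow> \<gamma> \<in> path_class T \<gamma>"
  using peq_refl by simp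

lemma path_cat_simps:
  "Obj (path_cat T) = Pts T"
  "\<gamma> \<in> Paths T \<Longrightarrow> path_class T \<gamma> \<in> Arr (path_cat T)"
  "\<gamma> \<in> Paths T \<Longrightarrow> Dom (path_cat T) (path_class T \<gamma>) = \<gamma> 0"
  "\<gamma> \<in> Paths T \<Longrightarrow> Cod (path_cat T) (path_class T \<gamma>) = \<gamma> 1"
  "Idn (path_cat T) x = path_class T (const_path x)"
proof -
  assume g: "\<gamma> \<in> Paths T"
  have "(SOME \<delta>. \<delta> \<in> path_class T \<gamma>) \<in> path_class T \<gamma>"
    unfolding some_in_eq using class_self[OF g] by blast
  then have "(\<gamma>, SOME \<delta>. \<delta> \<in> path_class T \<gamma>) \<in> Peq T" by simp
  from peq_ends[OF this] show "Dom (path_cat T) (path_class T \<gamma>) = \<gamma> 0" "Cod (path_cat T) (path_class T \<gamma>) = \<gamma> 1"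
    by (simp_all add: path_cat_def)
qed (simp_all add: path_cat_def)

lemma path_cat_comp:
  assumes "\<gamma> \<in> Paths T" "\<delta> \<in> Paths T" "\<gamma> 1 = \<delta> 0"
  shows "path_class T \<delta> \<cdot>\<^bsub>path_cat T\<^esub> path_class T \<gamma> = path_class T (\<gamma> \<frown> \<delta>)"
proof -
  have "path_class T (\<gamma>' \<frown> \<delta>') = path_class T (\<gamma> \<frown> \<delta>)" if "\<gamma>' \<in> path_class T \<gamma>" "\<delta>' \<in> path_class T \<delta>" for \<gamma>' \<delta>'
  proof -
    have "(\<gamma> \<frown> \<delta>, \<gamma>' \<frown> \<delta>') \<in> Peq T" using conc_cong[of \<gamma> \<gamma>' \<delta> \<delta>'] that assms(3) by simp
    from peq_paths[OF this] this class_eq_iff peq_sym show ?thesis by blast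
  qed
  then have "(\<Union>\<gamma>'\<in>path_class T \<gamma>. \<Union>\<delta>'\<in>path_class T \<delta>. path_class T (\<gamma>' \<frown> \<delta>')) = path_class T (\<gamma> \<frown> \<delta>)"
    using class_self[OF assms(1)] class_self[OF assms(2)] by blast
  then show ?thesis by (simp add: path_cat_def)
qed

lemma path_cat_homE:
  assumes "c \<in> Hom (path_cat T) x y"
  obtains \<gamma> where "\<gamma> \<in> Paths T" "\<gamma> 0 = x" "\<gamma> 1 = y" "c = path_class T \<gamma>"
proof -
  obtain \<gamma> where g: "\<gamma> \<in> Paths T" "c = path_class T \<gamma>" using assms by (auto simp: Hom_def path_cat_def)
  then show thesis using that assms path_cat_simps(3,4)[OF g(1)] by (simp add: Hom_def)
qed

lemma path_cat_homI: "\<gamma> \<in> Paths T \<Longrightarrow> \<gamma> 0 = x \<Longrightarrow> \<gamma> 1 = y \<Longrightarrow> path_class T \<gamma> \<in> Hom (path_cat T) x y"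
  by (simp add: Hom_def path_cat_simps)

lemma path_cat_category: "category (path_cat T)"
proof
  show "f \<in> Arr (path_cat T) \<Longrightarrow> Dom (path_cat T) f \<in> Obj (path_cat T)"
    "f \<in> Arr (path_cat T) \<Longrightarrow> Cod (path_cat T) f \<in> Obj (path_cat T)" for f
  proof -
    assume "f \<in> Arr (path_cat T)"
    then obtain \<gamma> where "\<gamma> \<in> Paths T" "f = path_class T \<gamma>" by (auto simp: path_cat_def)
    then show "Dom (path_cat T) f \<in> Obj (path_cat T)" "Cod (path_cat T) f \<in> Obj (path_cat T)"
      using path_pt by (simp_all add: path_cat_simps)
  qed
  show "a \<in> Obj (path_cat T) \<Longrightarrow> Idn (path_cat T) a \<in> Hom (path_cat T) a a" for a
    by (simp add: path_cat_simps(1,5) path_cat_homI const_path)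
  show "f \<in> Hom (path_cat T) a b \<Longrightarrow> g \<in> Hom (path_cat T) b c \<Longrightarrow> g \<cdot>\<^bsub>path_cat T\<^esub> f \<in> Hom (path_cat T) a c" for f g a b c
    by (elim path_cat_homE) (simp add: path_cat_comp path_cat_homI conc_path)
  show "Idn (path_cat T) b \<cdot>\<^bsub>path_cat T\<^esub> f = f" "f \<cdot>\<^bsub>path_cat T\<^esub> Idn (path_cat T) a = f"
    if f: "f \<in> Hom (path_cat T) a b" for f a b
  proof -
    obtain \<gamma> where g: "\<gamma> \<in> Paths T" "\<gamma> 0 = a" "\<gamma> 1 = b" "f = path_class T \<gamma>" using f by (rule path_cat_homE)
    have c: "const_path a \<in> Paths T" "const_path b \<in> Paths T" using g path_pt[OF g(1), of 0] path_pt[OF g(1), of 1] const_path by simp_all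
    have "path_class T (\<gamma> \<frown> const_path b) = path_class T \<gamma>" "path_class T (const_path a \<frown> \<gamma>) = path_class T \<gamma>"
      using conc_const_peq[OF g(1)] g(2,3) class_eq_iff peq_paths peq_sym by metis+
    then show "Idn (path_cat T) b \<cdot>\<^bsub>path_cat T\<^esub> f = f" "f \<cdot>\<^bsub>path_cat T\<^esub> Idn (path_cat T) a = f"
      using path_cat_comp[OF g(1) c(2)] path_cat_comp[OF c(1) g(1)] g by (simp_all add: path_cat_simps(5))
  qed
  show "h \<cdot>\<^bsub>path_cat T\<^esub> (g \<cdot>\<^bsub>path_cat T\<^esub> f) = h \<cdot>\<^bsub>path_cat T\<^esub> g \<cdot>\<^bsub>path_cat T\<^esub> f"
    if f: "f \<in> Hom (path_cat T) a b" and g: "g \<in> Hom (path_cat T) b c" and h: "h \<in> Hom (path_cat T) c d" for f g h a b c d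
  proof -
    obtain \<gamma> where g1: "\<gamma> \<in> Paths T" "\<gamma> 0 = a" "\<gamma> 1 = b" "f = path_class T \<gamma>" using f by (rule path_cat_homE)
    obtain \<delta> where d: "\<delta> \<in> Paths T" "\<delta> 0 = b" "\<delta> 1 = c" "g = path_class T \<delta>" using g by (rule path_cat_homE)
    obtain \<epsilon> where e: "\<epsilon> \<in> Paths T" "\<epsilon> 0 = c" "\<epsilon> 1 = d" "h = path_class T \<epsilon>" using h by (rule path_cat_homE)
    have "(\<gamma> \<frown> (\<delta> \<frown> \<epsilon>), \<gamma> \<frown> \<delta> \<frown> \<epsilon>) \<in> Peq T" by (rule conc_assoc_peq) (use g1 d e in simp_all)
    then have "path_class T (\<gamma> \<frown> \<delta> \<frown> \<epsilon>) = path_class T (\<gamma> \<frown> (\<delta> \<frown> \<epsilon>))"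
      using class_eq_iff peq_paths by metis
    then show ?thesis using g1 d e by (simp add: path_cat_comp conc_path)
  qed
qed

end

section \<open>The linear path category\<close>

text \<open>Empty as soon as one end is the adjoined zero object \<open>None\<close>.\<close>

definition hom_classes :: "'x path_triple \<Rightarrow> 'x option \<Rightarrow> 'x option \<Rightarrow> 'x path set set" where
  "hom_classes T a b = {c. \<exists>x y. a = Some x \<and> b = Some y \<and> c \<in> Hom (path_cat T) x y}"

text \<open>The free module on \<open>X\<close>, realized by functions on the whole type so that
  elements over different bases share one type.\<close>

definition coefficients :: "('k, 'r) ring_scheme \<Rightarrow> 'm set \<Rightarrow> ('m \<Rightarrow> 'k) set" where
  "coefficients R X = {f. range f \<subseteq> carrier R \<and> finite {c. f c \<noteq> \<zero>\<^bsub>R\<^esub>} \<and> {c. f c \<noteq> \<zero>\<^bsub>R\<^esub>} \<subseteq> X}"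

text \<open>The product of the category algebra, extended to arbitrary coefficient
  functions.\<close>

definition convolution :: "('k, 'r) ring_scheme \<Rightarrow> ('o, 'm, 'z) precat_scheme \<Rightarrow> ('m \<Rightarrow> 'k) \<Rightarrow> ('m \<Rightarrow> 'k) \<Rightarrow> 'm \<Rightarrow> 'k" where
  "convolution R C g f = (\<lambda>c. finsum R (\<lambda>(v, u). g v \<otimes>\<^bsub>R\<^esub> f u)
       {(v, u). g v \<noteq> \<zero>\<^bsub>R\<^esub> \<and> f u \<noteq> \<zero>\<^bsub>R\<^esub> \<and> v \<cdot>\<^bsub>C\<^esub> u = c})"

definition point_mass :: "('k, 'r) ring_scheme \<Rightarrow> 'k \<Rightarrow> 'm \<Rightarrow> 'm \<Rightarrow> 'k" where
  "point_mass R r u = (\<lambda>c. if c = u then r else \<zero>\<^bsub>R\<^esub>)"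

section \<open>Bilinearity and associativity of convolution\<close>

context cring
begin

lemma coefficientsD:
  "f \<in> coefficients R X \<Longrightarrow> f c \<in> carrier R" "f \<in> coefficients R X \<Longrightarrow> finite {c. f c \<noteq> \<zero>}"
  "f \<in> coefficients R X \<Longrightarrow> f c \<noteq> \<zero> \<Longrightarrow> c \<in> X"
  by (auto simp: coefficients_def)

lemma coefficients_zero: "(\<lambda>c. \<zero>) \<in> coefficients R X"
  by (auto simp: coefficients_def)

lemma coefficients_add:
  assumes "f \<in> coefficients R X" "g \<in> coefficients R X"
  shows "(\<lambda>c. f c \<oplus> g c) \<in> coefficients R X"
proof -
  have "{c. f c \<oplus> g c \<noteq> \<zero>} \<subseteq> {c. f c \<noteq> \<zero>} \<union> {c. g c \<noteq> \<zero>}" by auto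
  then have "finite {c. f c \<oplus> g c \<noteq> \<zero>}" using assms by (auto simp: coefficients_def intro: finite_subset)
  moreover have "f c \<oplus> g c \<in> carrier R" for c using assms by (simp add: coefficientsD(1))
  moreover have "c \<in> X" if "f c \<oplus> g c \<noteq> \<zero>" for c
    using coefficientsD(3)[OF assms(1), of c] coefficientsD(3)[OF assms(2), of c] coefficientsD(1)[OF assms(2), of c] that
    by (cases "f c = \<zero>") auto
  ultimately show ?thesis unfolding coefficients_def by blast
qed

lemma coefficients_scl:
  assumes "f \<in> coefficients R X" "r \<in> carrier R"
  shows "(\<lambda>c. r \<otimes> f c) \<in> coefficients R X"
proof -
  have "{c. r \<otimes> f c \<noteq> \<zero>} \<subseteq> {c. f c \<noteq> \<zero>}" using assms(2) by auto
  then show ?thesis using assms by (auto simp: coefficients_def intro: finite_subset)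
qed

lemma point_mass_coefficients: "r \<in> carrier R \<Longrightarrow> u \<in> X \<Longrightarrow> point_mass R r u \<in> coefficients R X"
proof -
  assume a: "r \<in> carrier R" "u \<in> X"
  have "{c. point_mass R r u c \<noteq> \<zero>} \<subseteq> {u}" by (auto simp: point_mass_def)
  then show ?thesis using a by (auto simp: coefficients_def point_mass_def dest: finite_subset)
qed

text \<open>Induction on the support, splitting off one point at a time. It reduces an identity that
  is additive in a coefficient function to basis elements.\<close>

lemma coefficients_induct [consumes 1, case_names zero add]:
  assumes f: "f \<in> coefficients R X" and z: "Q (\<lambda>c. \<zero>)"
    and add: "\<And>r u f. r \<in> carrier R \<Longrightarrow> u \<in> X \<Longrightarrow> f \<in> coefficients R X \<Longrightarrow> Q f \<Longrightarrow> Q (\<lambda>c. point_mass R r u c \<oplus> f c)"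
  shows "Q f"
proof -
  have "finite S \<Longrightarrow> {c. f c \<noteq> \<zero>} \<subseteq> S \<Longrightarrow> f \<in> coefficients R X \<Longrightarrow> Q f" for S f
  proof (induction S arbitrary: f rule: finite_induct)
    case empty
    then have "f = (\<lambda>c. \<zero>)" by auto
    then show ?case using z by simp
  next
    case (insert u S)
    show ?case
    proof (cases "f u = \<zero>")
      case True
      then have "{c. f c \<noteq> \<zero>} \<subseteq> S" using insert.prems by auto
      then show ?thesis using insert.IH[OF _ insert.prems(2)] by blast
    next
      case False
      then have u: "u \<in> X" "f u \<in> carrier R" using coefficientsD(3)[OF insert.prems(2) False] coefficientsD(1)[OF insert.prems(2)] by simp_all
      let ?g = "f(u := \<zero>)"
      have sub: "{c. ?g c \<noteq> \<zero>} \<subseteq> {c. f c \<noteq> \<zero>}" by auto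
      have g: "?g \<in> coefficients R X"
        using insert.prems(2) finite_subset[OF sub] by (auto simp: coefficients_def)
      have "{c. ?g c \<noteq> \<zero>} \<subseteq> S" using insert.prems(1) by auto
      then have "Q ?g" by (rule insert.IH[OF _ g])
      from add[OF u(2,1) g this] have "Q (\<lambda>c. point_mass R (f u) u c \<oplus> ?g c)" .
      moreover have "(\<lambda>c. point_mass R (f u) u c \<oplus> ?g c) = f"
        using coefficientsD(1)[OF insert.prems(2)] u by (auto simp: point_mass_def)
      ultimately show ?thesis by simp
    qed
  qed
  from this[OF _ subset_refl f] show ?thesis using coefficientsD(2)[OF f] by simp
qed

text \<open>The index set in \<open>convolution\<close> depends on the exact supports, which change
  under addition and scaling. Over a fixed rectangle containing them, with zero as default term,
  different convolutions can be compared term by term.\<close>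

lemma convolution_sum:
  assumes g: "g \<in> coefficients R Y" and f: "f \<in> coefficients R X"
    and fin: "finite V" "finite U" "{c. g c \<noteq> \<zero>} \<subseteq> V" "{c. f c \<noteq> \<zero>} \<subseteq> U"
  shows "convolution R C g f c = (\<Oplus>p\<in>V \<times> U. if fst p \<cdot>\<^bsub>C\<^esub> snd p = c then g (fst p) \<otimes> f (snd p) else \<zero>)"
  unfolding convolution_def
proof (rule add.finprod_mono_neutral_cong_left)
  show "{(v, u). g v \<noteq> \<zero> \<and> f u \<noteq> \<zero> \<and> v \<cdot>\<^bsub>C\<^esub> u = c} \<subseteq> V \<times> U" using fin by auto
  show "(if fst p \<cdot>\<^bsub>C\<^esub> snd p = c then g (fst p) \<otimes> f (snd p) else \<zero>) = \<zero>"
    if "p \<in> V \<times> U - {(v, u). g v \<noteq> \<zero> \<and> f u \<noteq> \<zero> \<and> v \<cdot>\<^bsub>C\<^esub> u = c}" for p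
    using that coefficientsD(1)[OF g] coefficientsD(1)[OF f] by auto
  show "(case p of (v, u) \<Rightarrow> g v \<otimes> f u) = (if fst p \<cdot>\<^bsub>C\<^esub> snd p = c then g (fst p) \<otimes> f (snd p) else \<zero>)"
    if "p \<in> {(v, u). g v \<noteq> \<zero> \<and> f u \<noteq> \<zero> \<and> v \<cdot>\<^bsub>C\<^esub> u = c}" for p
    using that by auto
  show "(\<lambda>p. if fst p \<cdot>\<^bsub>C\<^esub> snd p = c then g (fst p) \<otimes> f (snd p) else \<zero>) \<in> V \<times> U \<rightarrow> carrier R"
    using coefficientsD(1)[OF g] coefficientsD(1)[OF f] by auto
qed (use fin in simp)

lemma convolution_add_right:
  assumes g: "g \<in> coefficients R Y" and f: "f \<in> coefficients R X" "f' \<in> coefficients R X"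
  shows "convolution R C g (\<lambda>c. f c \<oplus> f' c) = (\<lambda>c. convolution R C g f c \<oplus> convolution R C g f' c)"
proof (rule ext)
  fix c
  let ?V = "{c. g c \<noteq> \<zero>}" and ?U = "{c. f c \<noteq> \<zero>} \<union> {c. f' c \<noteq> \<zero>}"
  have fin: "finite ?V" "finite ?U" using coefficientsD(2) g f by auto
  note S = convolution_sum[OF g _ fin subset_refl, where C = C and c = c]
  note cl = coefficientsD(1)[OF g] coefficientsD(1)[OF f(1)] coefficientsD(1)[OF f(2)]
  have "convolution R C g (\<lambda>c. f c \<oplus> f' c) c =
      (\<Oplus>p\<in>?V \<times> ?U. if fst p \<cdot>\<^bsub>C\<^esub> snd p = c then g (fst p) \<otimes> (f (snd p) \<oplus> f' (snd p)) else \<zero>)"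
    by (rule S[OF coefficients_add[OF f]]) auto
  also have "\<dots> = (\<Oplus>p\<in>?V \<times> ?U. (if fst p \<cdot>\<^bsub>C\<^esub> snd p = c then g (fst p) \<otimes> f (snd p) else \<zero>) \<oplus>
      (if fst p \<cdot>\<^bsub>C\<^esub> snd p = c then g (fst p) \<otimes> f' (snd p) else \<zero>))"
    by (rule finsum_cong') (use cl in \<open>auto simp: r_distr\<close>)
  also have "\<dots> = convolution R C g f c \<oplus> convolution R C g f' c"
    unfolding S[OF f(1) Un_upper1] S[OF f(2) Un_upper2] by (rule finsum_addf) (use cl in auto)
  finally show "convolution R C g (\<lambda>c. f c \<oplus> f' c) c = convolution R C g f c \<oplus> convolution R C g f' c" .
qed

lemma convolution_add_left:
  assumes g: "g \<in> coefficients R Y" "g' \<in> coefficients R Y" and f: "f \<in> coefficients R X"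
  shows "convolution R C (\<lambda>c. g c \<oplus> g' c) f = (\<lambda>c. convolution R C g f c \<oplus> convolution R C g' f c)"
proof (rule ext)
  fix c
  let ?V = "{c. g c \<noteq> \<zero>} \<union> {c. g' c \<noteq> \<zero>}" and ?U = "{c. f c \<noteq> \<zero>}"
  have fin: "finite ?V" "finite ?U" using coefficientsD(2) g f by auto
  note S = convolution_sum[OF _ f fin, where C = C and c = c]
  note cl = coefficientsD(1)[OF g(1)] coefficientsD(1)[OF g(2)] coefficientsD(1)[OF f]
  have "convolution R C (\<lambda>c. g c \<oplus> g' c) f c =
      (\<Oplus>p\<in>?V \<times> ?U. if fst p \<cdot>\<^bsub>C\<^esub> snd p = c then (g (fst p) \<oplus> g' (fst p)) \<otimes> f (snd p) else \<zero>)"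
    by (rule S[OF coefficients_add[OF g]]) auto
  also have "\<dots> = (\<Oplus>p\<in>?V \<times> ?U. (if fst p \<cdot>\<^bsub>C\<^esub> snd p = c then g (fst p) \<otimes> f (snd p) else \<zero>) \<oplus>
      (if fst p \<cdot>\<^bsub>C\<^esub> snd p = c then g' (fst p) \<otimes> f (snd p) else \<zero>))"
    by (rule finsum_cong') (use cl in \<open>auto simp: l_distr\<close>)
  also have "\<dots> = convolution R C g f c \<oplus> convolution R C g' f c"
    unfolding S[OF g(1) Un_upper1 subset_refl] S[OF g(2) Un_upper2 subset_refl] by (rule finsum_addf) (use cl in auto)
  finally show "convolution R C (\<lambda>c. g c \<oplus> g' c) f c = convolution R C g f c \<oplus> convolution R C g' f c" .
qed

lemma convolution_scl:
  assumes g: "g \<in> coefficients R Y" and f: "f \<in> coefficients R X" and r: "r \<in> carrier R"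
  shows "convolution R C (\<lambda>c. r \<otimes> g c) f = (\<lambda>c. r \<otimes> convolution R C g f c)"
    "convolution R C g (\<lambda>c. r \<otimes> f c) = (\<lambda>c. r \<otimes> convolution R C g f c)"
proof -
  let ?V = "{c. g c \<noteq> \<zero>}" and ?U = "{c. f c \<noteq> \<zero>}"
  have fin: "finite ?V" "finite ?U" using coefficientsD(2) g f by auto
  note cl = coefficientsD(1)[OF g] coefficientsD(1)[OF f]
  have sg: "{c. r \<otimes> g c \<noteq> \<zero>} \<subseteq> ?V" and sf: "{c. r \<otimes> f c \<noteq> \<zero>} \<subseteq> ?U" using r by auto
  have R: "r \<otimes> convolution R C g f c = (\<Oplus>p\<in>?V \<times> ?U. r \<otimes> (if fst p \<cdot>\<^bsub>C\<^esub> snd p = c then g (fst p) \<otimes> f (snd p) else \<zero>))" for c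
    unfolding convolution_sum[OF g f fin subset_refl subset_refl]
    by (rule finsum_rdistr) (use fin r cl in auto)
  show "convolution R C (\<lambda>c. r \<otimes> g c) f = (\<lambda>c. r \<otimes> convolution R C g f c)"
    unfolding R convolution_sum[OF coefficients_scl[OF g r] f fin sg subset_refl]
    by (rule ext, rule finsum_cong') (use cl r in \<open>auto simp: m_assoc\<close>)
  show "convolution R C g (\<lambda>c. r \<otimes> f c) = (\<lambda>c. r \<otimes> convolution R C g f c)"
    unfolding R convolution_sum[OF g coefficients_scl[OF f r] fin subset_refl sf]
    by (rule ext, rule finsum_cong') (use cl r in \<open>auto simp: m_lcomm\<close>)
qed

lemma convolution_zero: "convolution R C g (\<lambda>c. \<zero>) = (\<lambda>c. \<zero>)" "convolution R C (\<lambda>c. \<zero>) f = (\<lambda>c. \<zero>)"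
  by (simp_all add: convolution_def)

lemma convolution_point_mass:
  assumes "r \<in> carrier R" "s \<in> carrier R"
  shows "convolution R C (point_mass R r v) (point_mass R s u) = point_mass R (r \<otimes> s) (v \<cdot>\<^bsub>C\<^esub> u)"
proof (rule ext)
  fix c
  have "convolution R C (point_mass R r v) (point_mass R s u) c =
    (\<Oplus>p\<in>{v} \<times> {u}. if fst p \<cdot>\<^bsub>C\<^esub> snd p = c then point_mass R r v (fst p) \<otimes> point_mass R s u (snd p) else \<zero>)"
    by (rule convolution_sum[OF point_mass_coefficients[of r v UNIV] point_mass_coefficients[of s u UNIV]])
       (use assms in \<open>auto simp: point_mass_def\<close>)
  also have "{v} \<times> {u} = {(v, u)}" by simp
  also have "(\<Oplus>p\<in>{(v, u)}. if fst p \<cdot>\<^bsub>C\<^esub> snd p = c then point_mass R r v (fst p) \<otimes> point_mass R s u (snd p) else \<zero>) =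
     point_mass R (r \<otimes> s) (v \<cdot>\<^bsub>C\<^esub> u) c"
    by (subst finsum_insert) (use assms in \<open>auto simp: point_mass_def\<close>)
  finally show "convolution R C (point_mass R r v) (point_mass R s u) c = point_mass R (r \<otimes> s) (v \<cdot>\<^bsub>C\<^esub> u) c" .
qed

lemma convolution_coefficients:
  assumes g: "g \<in> coefficients R Y" and f: "f \<in> coefficients R X"
    and c: "\<And>v u. v \<in> Y \<Longrightarrow> u \<in> X \<Longrightarrow> v \<cdot>\<^bsub>C\<^esub> u \<in> Z"
  shows "convolution R C g f \<in> coefficients R Z"
  using f
proof (induction rule: coefficients_induct)
  case zero show ?case unfolding convolution_zero by (rule coefficients_zero)
next
  case (add s u f)
  have "convolution R C g (point_mass R s u) \<in> coefficients R Z"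
    using g
  proof (induction rule: coefficients_induct)
    case zero show ?case unfolding convolution_zero by (rule coefficients_zero)
  next
    case (add r v g)
    show ?case
      unfolding convolution_add_left[OF point_mass_coefficients[OF add(1,2)] add(3) point_mass_coefficients[OF \<open>s \<in> carrier R\<close> \<open>u \<in> X\<close>]]
        convolution_point_mass[OF add(1) \<open>s \<in> carrier R\<close>]
      by (intro coefficients_add point_mass_coefficients c add m_closed \<open>s \<in> carrier R\<close> \<open>u \<in> X\<close>)
  qed
  then show ?case
    unfolding convolution_add_right[OF g point_mass_coefficients[OF add(1,2)] add(3)]
    by (rule coefficients_add) (rule add.IH)
qed

text \<open>Both sides are additive in each argument, so the arguments are reduced to point masses
  one after another: \<open>h\<close> in fact 1, \<open>g\<close> in fact 2 and \<open>f\<close> at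
  the end. On point masses it is associativity in the category and in the ring.\<close>

lemma convolution_assoc:
  assumes h: "h \<in> coefficients R Z" and g: "g \<in> coefficients R Y" and f: "f \<in> coefficients R X"
    and a: "\<And>w v u. w \<in> Z \<Longrightarrow> v \<in> Y \<Longrightarrow> u \<in> X \<Longrightarrow> w \<cdot>\<^bsub>C\<^esub> (v \<cdot>\<^bsub>C\<^esub> u) = (w \<cdot>\<^bsub>C\<^esub> v) \<cdot>\<^bsub>C\<^esub> u"
  shows "convolution R C h (convolution R C g f) = convolution R C (convolution R C h g) f"
proof -
  \<comment> \<open>The additivity rules only need some common bound for the supports, so partial
    products are placed over \<open>UNIV\<close>.\<close>
  note cv = convolution_coefficients[where Z = UNIV and C = C, OF _ _ UNIV_I]
  note pm = point_mass_coefficients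
  have 1: "convolution R C h (convolution R C (point_mass R r v) (point_mass R s u)) =
     convolution R C (convolution R C h (point_mass R r v)) (point_mass R s u)"
    if r: "r \<in> carrier R" "v \<in> Y" and s: "s \<in> carrier R" "u \<in> X" for r s v u
    using h
  proof (induction rule: coefficients_induct)
    case zero show ?case unfolding convolution_zero ..
  next
    case (add t w h)
    note p = pm[OF add(1,2)] pm[OF r] pm[OF s]
    have m: "r \<otimes> s \<in> carrier R" "t \<otimes> r \<in> carrier R" using add r s by simp_all
    have "convolution R C (point_mass R t w) (convolution R C (point_mass R r v) (point_mass R s u)) =
      convolution R C (convolution R C (point_mass R t w) (point_mass R r v)) (point_mass R s u)"
      by (simp only: convolution_point_mass[OF r(1) s(1)] convolution_point_mass[OF add(1) r(1)]
          convolution_point_mass[OF add(1) m(1)] convolution_point_mass[OF m(2) s(1)] a[OF add(2) r(2) s(2)] m_assoc[OF add(1) r(1) s(1)])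
    then show ?case
      unfolding convolution_add_left[OF p(1) add(3) cv[OF p(2,3)]] convolution_add_left[OF p(1) add(3) p(2)]
        convolution_add_left[OF cv[OF p(1,2)] cv[OF add(3) p(2)] p(3)]
      using add.IH by simp
  qed
  have 2: "convolution R C h (convolution R C g (point_mass R s u)) =
     convolution R C (convolution R C h g) (point_mass R s u)" if s: "s \<in> carrier R" "u \<in> X" for s u
    using g
  proof (induction rule: coefficients_induct)
    case zero show ?case unfolding convolution_zero ..
  next
    case (add r v g)
    note p = pm[OF add(1,2)] pm[OF s]
    show ?case
      unfolding convolution_add_left[OF p(1) add(3) p(2)] convolution_add_right[OF h cv[OF p(1,2)] cv[OF add(3) p(2)]]
        convolution_add_right[OF h p(1) add(3)] convolution_add_left[OF cv[OF h p(1)] cv[OF h add(3)] p(2)]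
        add.IH 1[OF add(1,2) s] ..
  qed
  show ?thesis using f
  proof (induction rule: coefficients_induct)
    case zero show ?case unfolding convolution_zero ..
  next
    case (add s u f)
    note p = pm[OF add(1,2)]
    show ?case
      unfolding convolution_add_right[OF g p add(3)] convolution_add_right[OF h cv[OF g p] cv[OF g add(3)]]
        convolution_add_right[OF cv[OF h g] p add(3)] add.IH 2[OF add(1,2)] ..
  qed
qed

lemma convolution_unit:
  assumes f: "f \<in> coefficients R X"
  shows "(\<And>u. u \<in> X \<Longrightarrow> e \<cdot>\<^bsub>C\<^esub> u = u) \<Longrightarrow> convolution R C (point_mass R \<one> e) f = f"
    "(\<And>u. u \<in> X \<Longrightarrow> u \<cdot>\<^bsub>C\<^esub> e = u) \<Longrightarrow> convolution R C f (point_mass R \<one> e) = f"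
proof -
  have e: "point_mass R \<one> e \<in> coefficients R UNIV" by (simp add: point_mass_coefficients)
  show "convolution R C (point_mass R \<one> e) f = f" if u: "\<And>u. u \<in> X \<Longrightarrow> e \<cdot>\<^bsub>C\<^esub> u = u"
    using f
  proof (induction rule: coefficients_induct)
    case (add r v f)
    show ?case unfolding convolution_add_right[OF e point_mass_coefficients[OF add(1,2)] add(3)] add.IH
      convolution_point_mass[OF one_closed add(1)] using u add by simp
  qed (simp add: convolution_zero)
  show "convolution R C f (point_mass R \<one> e) = f" if u: "\<And>u. u \<in> X \<Longrightarrow> u \<cdot>\<^bsub>C\<^esub> e = u"
    using f
  proof (induction rule: coefficients_induct)
    case (add r v f)
    show ?case unfolding convolution_add_left[OF point_mass_coefficients[OF add(1,2)] add(3) e] add.IH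
      convolution_point_mass[OF add(1) one_closed] using u add by simp
  qed (simp add: convolution_zero)
qed

end

section \<open>Linearity of the linear path category\<close>

locale lin_path = path_triple T + R: cring R
  for T :: "'x path_triple" and R :: "('k, 'r) ring_scheme"
begin

abbreviation "\<C> \<equiv> lin_path_cat R T"

lemma lin_arr:
  "(a, b, f) \<in> Arr \<C> \<longleftrightarrow> a \<in> Obj \<C> \<and> b \<in> Obj \<C> \<and> f \<in> coefficients R (hom_classes T a b)"
  by (auto simp: lin_path_cat_def coefficients_def hom_classes_def)

lemma lin_simps [simp]:
  "Obj \<C> = insert None (Some ` Pts T)" "Dom \<C> (a, b, f) = a" "Cod \<C> (a, b, f) = b"
  "Comp \<C> (b', d, g) (a, b, f) = (a, d, convolution R (path_cat T) g f)"
  "Zro \<C> a b = (a, b, \<lambda>c. \<zero>\<^bsub>R\<^esub>)" "Add \<C> (a, b, f) (a', d, g) = (a, b, \<lambda>c. f c \<oplus>\<^bsub>R\<^esub> g c)"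
  "Scl \<C> r (a, b, f) = (a, b, \<lambda>c. r \<otimes>\<^bsub>R\<^esub> f c)"
  by (simp_all add: lin_path_cat_def convolution_def)

lemma lin_idn: "Idn \<C> (Some x) = (Some x, Some x, point_mass R \<one>\<^bsub>R\<^esub> (Idn (path_cat T) x))"
  "Idn \<C> None = (None, None, \<lambda>c. \<zero>\<^bsub>R\<^esub>)"
  by (auto simp: lin_path_cat_def point_mass_def)

lemma lin_homE:
  assumes "F \<in> Hom \<C> a b"
  obtains f where "F = (a, b, f)" "a \<in> Obj \<C>" "b \<in> Obj \<C>" "f \<in> coefficients R (hom_classes T a b)"
  using assms lin_arr by (cases F) (auto simp: Hom_def)

lemma lin_homI: "a \<in> Obj \<C> \<Longrightarrow> b \<in> Obj \<C> \<Longrightarrow> f \<in> coefficients R (hom_classes T a b) \<Longrightarrow> (a, b, f) \<in> Hom \<C> a b"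
  using lin_arr by (simp add: Hom_def)

lemma classes_comp: "v \<in> hom_classes T b d \<Longrightarrow> u \<in> hom_classes T a b \<Longrightarrow> v \<cdot>\<^bsub>path_cat T\<^esub> u \<in> hom_classes T a d"
  using category.comp_hom[OF path_cat_category] by (auto simp: hom_classes_def)

lemma coefficients_none: "f \<in> coefficients R (hom_classes T a b) \<Longrightarrow> a = None \<or> b = None \<Longrightarrow> f = (\<lambda>c. \<zero>\<^bsub>R\<^esub>)"
  by (auto simp: coefficients_def hom_classes_def)

lemma lin_category: "category \<C>"
proof
  interpret P: category "path_cat T" by (rule path_cat_category)
  show "F \<in> Arr \<C> \<Longrightarrow> Dom \<C> F \<in> Obj \<C>" "F \<in> Arr \<C> \<Longrightarrow> Cod \<C> F \<in> Obj \<C>" for F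
    by (cases F; simp add: lin_arr del: lin_simps(1))+
  show "Idn \<C> a \<in> Hom \<C> a a" if "a \<in> Obj \<C>" for a
  proof (cases a)
    case None then show ?thesis unfolding None lin_idn by (intro lin_homI R.coefficients_zero) simp_all
  next
    case (Some x)
    then have x: "x \<in> Pts T" using that by auto
    have "Idn (path_cat T) x \<in> hom_classes T a a" using P.idn_hom[of x] x path_cat_simps(1) Some by (auto simp: hom_classes_def)
    then show ?thesis using that unfolding Some lin_idn by (intro lin_homI R.point_mass_coefficients) (use x in simp_all)
  qed
  show "G \<cdot>\<^bsub>\<C>\<^esub> F \<in> Hom \<C> a d" if F: "F \<in> Hom \<C> a b" and G: "G \<in> Hom \<C> b d" for F G a b d
  proof -
    obtain f where f: "F = (a, b, f)" "a \<in> Obj \<C>" "b \<in> Obj \<C>" "f \<in> coefficients R (hom_classes T a b)" using F by (rule lin_homE)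
    obtain g where g: "G = (b, d, g)" "b \<in> Obj \<C>" "d \<in> Obj \<C>" "g \<in> coefficients R (hom_classes T b d)" using G by (rule lin_homE)
    show ?thesis unfolding f(1) g(1) lin_simps
      by (intro lin_homI f g R.convolution_coefficients[OF g(4) f(4) classes_comp])
  qed
  show "Idn \<C> b \<cdot>\<^bsub>\<C>\<^esub> F = F" if F: "F \<in> Hom \<C> a b" for F a b
  proof -
    obtain f where f: "F = (a, b, f)" "a \<in> Obj \<C>" "b \<in> Obj \<C>" "f \<in> coefficients R (hom_classes T a b)" using F by (rule lin_homE)
    show ?thesis
    \<comment> \<open>At the zero object the identity is the zero function. It still acts as a unit,
      because every arrow with such an end is zero.\<close>
    proof (cases b)
      case None then show ?thesis using f coefficients_none[OF f(4)] by (simp add: lin_idn R.convolution_zero)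
    next
      case (Some y)
      have "convolution R (path_cat T) (point_mass R \<one>\<^bsub>R\<^esub> (Idn (path_cat T) y)) f = f"
        by (rule R.convolution_unit(1)[OF f(4)]) (use Some P.comp_idn_left in \<open>auto simp: hom_classes_def\<close>)
      then show ?thesis using f(1) Some by (simp add: lin_idn)
    qed
  qed
  show "F \<cdot>\<^bsub>\<C>\<^esub> Idn \<C> a = F" if F: "F \<in> Hom \<C> a b" for F a b
  proof -
    obtain f where f: "F = (a, b, f)" "a \<in> Obj \<C>" "b \<in> Obj \<C>" "f \<in> coefficients R (hom_classes T a b)" using F by (rule lin_homE)
    show ?thesis
    proof (cases a)
      case None then show ?thesis using f coefficients_none[OF f(4)] by (simp add: lin_idn R.convolution_zero)
    next
      case (Some y)
      have "convolution R (path_cat T) f (point_mass R \<one>\<^bsub>R\<^esub> (Idn (path_cat T) y)) = f"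
        by (rule R.convolution_unit(2)[OF f(4)]) (use Some P.comp_idn_right in \<open>auto simp: hom_classes_def\<close>)
      then show ?thesis using f(1) Some by (simp add: lin_idn)
    qed
  qed
  show "H \<cdot>\<^bsub>\<C>\<^esub> (G \<cdot>\<^bsub>\<C>\<^esub> F) = H \<cdot>\<^bsub>\<C>\<^esub> G \<cdot>\<^bsub>\<C>\<^esub> F"
    if F: "F \<in> Hom \<C> a b" and G: "G \<in> Hom \<C> b d" and H: "H \<in> Hom \<C> d e" for F G H a b d e
  proof -
    obtain f where f: "F = (a, b, f)" "f \<in> coefficients R (hom_classes T a b)" using F by (rule lin_homE)
    obtain g where g: "G = (b, d, g)" "g \<in> coefficients R (hom_classes T b d)" using G by (rule lin_homE)
    obtain h where h: "H = (d, e, h)" "h \<in> coefficients R (hom_classes T d e)" using H by (rule lin_homE)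
    have "convolution R (path_cat T) h (convolution R (path_cat T) g f) = convolution R (path_cat T) (convolution R (path_cat T) h g) f"
      by (rule R.convolution_assoc[OF h(2) g(2) f(2)]) (auto simp: hom_classes_def P.comp_assoc)
    then show ?thesis using f g h by simp
  qed
qed

lemma lin_module:
  assumes ob: "a \<in> Obj \<C>" "b \<in> Obj \<C>"
  shows "abelian_group (Hom_module \<C> a b)" "module R (Hom_module \<C> a b)"
proof -
  note I = lin_homI[OF ob]
  show g: "abelian_group (Hom_module \<C> a b)"
  proof (rule abelian_groupI; (unfold Hom_module_simps)?)
    fix F assume "F \<in> Hom \<C> a b"
    then obtain f where f: "F = (a, b, f)" "f \<in> coefficients R (hom_classes T a b)" by (rule lin_homE)
    note fc = R.coefficientsD(1)[OF f(2)]
    show "Add \<C> (Zro \<C> a b) F = F" using f(1) fc by simp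
    \<comment> \<open>The additive inverse is taken as the multiple by minus one, so that its finite
      support comes from \<open>coefficients_scl\<close>.\<close>
    have m: "\<ominus>\<^bsub>R\<^esub> \<one>\<^bsub>R\<^esub> \<otimes>\<^bsub>R\<^esub> f c \<oplus>\<^bsub>R\<^esub> f c = \<zero>\<^bsub>R\<^esub>" for c using fc by (simp add: R.l_minus R.l_neg)
    show "\<exists>G\<in>Hom \<C> a b. Add \<C> G F = Zro \<C> a b"
      by (rule bexI[of _ "(a, b, \<lambda>c. \<ominus>\<^bsub>R\<^esub> \<one>\<^bsub>R\<^esub> \<otimes>\<^bsub>R\<^esub> f c)"]) (use f m in \<open>simp_all add: I R.coefficients_scl\<close>)
    fix G assume "G \<in> Hom \<C> a b"
    then obtain g where g: "G = (a, b, g)" "g \<in> coefficients R (hom_classes T a b)" by (rule lin_homE)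
    note gc = R.coefficientsD(1)[OF g(2)]
    show "Add \<C> F G \<in> Hom \<C> a b" using f g by (simp add: I R.coefficients_add)
    show "Add \<C> F G = Add \<C> G F" using f(1) g(1) fc gc by (simp add: R.a_comm)
    fix H assume "H \<in> Hom \<C> a b"
    then obtain h where h: "H = (a, b, h)" "h \<in> coefficients R (hom_classes T a b)" by (rule lin_homE)
    note hc = R.coefficientsD(1)[OF h(2)]
    show "Add \<C> (Add \<C> F G) H = Add \<C> F (Add \<C> G H)" using f(1) g(1) h(1) fc gc hc by (simp add: R.a_assoc)
  qed (simp add: I R.coefficients_zero)
  show "module R (Hom_module \<C> a b)"
  proof (rule moduleI[OF R.is_cring g]; (unfold Hom_module_simps)?)
    fix F r assume r: "r \<in> carrier R" and "F \<in> Hom \<C> a b"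
    then obtain f where f: "F = (a, b, f)" "f \<in> coefficients R (hom_classes T a b)" by (auto elim: lin_homE)
    note fc = R.coefficientsD(1)[OF f(2)]
    show "Scl \<C> r F \<in> Hom \<C> a b" using f r by (simp add: I R.coefficients_scl)
    show "Scl \<C> (r \<oplus>\<^bsub>R\<^esub> s) F = Add \<C> (Scl \<C> r F) (Scl \<C> s F)" "Scl \<C> (r \<otimes>\<^bsub>R\<^esub> s) F = Scl \<C> r (Scl \<C> s F)"
      if "s \<in> carrier R" for s
      using that r f(1) fc by (simp_all add: R.l_distr R.m_assoc)
    fix G assume "G \<in> Hom \<C> a b"
    then obtain g where g: "G = (a, b, g)" "g \<in> coefficients R (hom_classes T a b)" by (rule lin_homE)
    show "Scl \<C> r (Add \<C> F G) = Add \<C> (Scl \<C> r F) (Scl \<C> r G)"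
      using r f(1) g(1) fc R.coefficientsD(1)[OF g(2)] by (simp add: R.r_distr)
  next
    fix F assume "F \<in> Hom \<C> a b"
    then obtain f where f: "F = (a, b, f)" "f \<in> coefficients R (hom_classes T a b)" by (auto elim: lin_homE)
    show "Scl \<C> \<one>\<^bsub>R\<^esub> F = F" using f(1) R.coefficientsD(1)[OF f(2)] by simp
  qed
qed

theorem lin_path_linear: "linear_category R \<C>"
proof (intro linear_category.intro preadditive_category.intro preadditive_category_axioms.intro
    linear_category_axioms.intro lin_category R.is_cring lin_module)
  fix F G H a b d assume F: "F \<in> Hom \<C> a b" and G: "G \<in> Hom \<C> b d" and H: "H \<in> Hom \<C> b d"
  obtain f where f: "F = (a, b, f)" "f \<in> coefficients R (hom_classes T a b)" using F by (rule lin_homE)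
  obtain g where g: "G = (b, d, g)" "g \<in> coefficients R (hom_classes T b d)" using G by (rule lin_homE)
  obtain h where h: "H = (b, d, h)" "h \<in> coefficients R (hom_classes T b d)" using H by (rule lin_homE)
  show "Add \<C> G H \<cdot>\<^bsub>\<C>\<^esub> F = Add \<C> (G \<cdot>\<^bsub>\<C>\<^esub> F) (H \<cdot>\<^bsub>\<C>\<^esub> F)"
    using R.convolution_add_left[OF g(2) h(2) f(2)] by (simp add: f g h)
next
  fix F G H a b d assume F: "F \<in> Hom \<C> a b" and G: "G \<in> Hom \<C> a b" and H: "H \<in> Hom \<C> b d"
  obtain f where f: "F = (a, b, f)" "f \<in> coefficients R (hom_classes T a b)" using F by (rule lin_homE)
  obtain g where g: "G = (a, b, g)" "g \<in> coefficients R (hom_classes T a b)" using G by (rule lin_homE)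
  obtain h where h: "H = (b, d, h)" "h \<in> coefficients R (hom_classes T b d)" using H by (rule lin_homE)
  show "H \<cdot>\<^bsub>\<C>\<^esub> Add \<C> F G = Add \<C> (H \<cdot>\<^bsub>\<C>\<^esub> F) (H \<cdot>\<^bsub>\<C>\<^esub> G)"
    using R.convolution_add_right[OF h(2) f(2) g(2)] by (simp add: f g h)
next
  fix r F G a b d assume r: "r \<in> carrier R" and F: "F \<in> Hom \<C> a b" and G: "G \<in> Hom \<C> b d"
  obtain f where f: "F = (a, b, f)" "f \<in> coefficients R (hom_classes T a b)" using F by (rule lin_homE)
  obtain g where g: "G = (b, d, g)" "g \<in> coefficients R (hom_classes T b d)" using G by (rule lin_homE)
  show "Scl \<C> r G \<cdot>\<^bsub>\<C>\<^esub> F = Scl \<C> r (G \<cdot>\<^bsub>\<C>\<^esub> F)" "G \<cdot>\<^bsub>\<C>\<^esub> Scl \<C> r F = Scl \<C> r (G \<cdot>\<^bsub>\<C>\<^esub> F)"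
    using R.convolution_scl[OF g(2) f(2) r] by (simp_all add: f g)
qed

end

section \<open>Pixelations\<close>

context lin_path
begin

lemma path_sum_hom:
  assumes v: "valid_terms R T x y ts"
  shows "path_sum R T x y ts \<in> Hom \<C> (Some x) (Some y)"
  unfolding path_sum_def
proof (rule lin_homI)
  have t: "fst (ts ! i) \<in> carrier R" "snd (ts ! i) \<in> Paths T" "snd (ts ! i) 0 = x" "snd (ts ! i) 1 = y" if "i < length ts" for i
    using v nth_mem[OF that] by (auto simp: valid_terms_def)
  show "Some x \<in> Obj \<C>" "Some y \<in> Obj \<C>" using v by (simp_all add: valid_terms_def)
  let ?f = "\<lambda>c. \<Oplus>\<^bsub>R\<^esub>i\<in>{i. i < length ts \<and> path_class T (snd (ts ! i)) = c}. fst (ts ! i)"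
  have cl: "?f c \<in> carrier R" for c by (rule R.finsum_closed) (use t in auto)
  have supp: "\<exists>i<length ts. path_class T (snd (ts ! i)) = c" if "?f c \<noteq> \<zero>\<^bsub>R\<^esub>" for c
  proof (rule ccontr)
    assume "\<not> ?thesis"
    then have e: "{i. i < length ts \<and> path_class T (snd (ts ! i)) = c} = {}" by blast
    show False using that unfolding e by simp
  qed
  have "{c. ?f c \<noteq> \<zero>\<^bsub>R\<^esub>} \<subseteq> (\<lambda>i. path_class T (snd (ts ! i))) ` {..<length ts}" using supp by blast
  then have "finite {c. ?f c \<noteq> \<zero>\<^bsub>R\<^esub>}" by (rule finite_subset) simp
  moreover have "c \<in> hom_classes T (Some x) (Some y)" if "?f c \<noteq> \<zero>\<^bsub>R\<^esub>" for c
    using supp[OF that] t path_cat_homI by (auto simp: hom_classes_def)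
  ultimately show "?f \<in> coefficients R (hom_classes T (Some x) (Some y))"
    using cl unfolding coefficients_def by blast
qed

text \<open>One term is taken for each class in the support, with a chosen representative path. The
  classes are listed without repetition, so each coefficient is a sum of at most one term. The list
  form is needed because \<open>pix_equiv_lin\<close> compares lists of terms.\<close>

lemma path_sum_exists:
  assumes xy: "x \<in> Pts T" "y \<in> Pts T" and f: "f \<in> coefficients R (hom_classes T (Some x) (Some y))"
  obtains ts where "valid_terms R T x y ts" "path_sum R T x y ts = (Some x, Some y, f)"
proof -
  obtain cs where cs: "set cs = {c. f c \<noteq> \<zero>\<^bsub>R\<^esub>}" "distinct cs"
    using finite_distinct_list[OF R.coefficientsD(2)[OF f]] by blast
  have "\<exists>\<gamma>. \<gamma> \<in> Paths T \<and> \<gamma> 0 = x \<and> \<gamma> 1 = y \<and> c = path_class T \<gamma>" if "c \<in> set cs" for c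
  proof -
    have "c \<in> Hom (path_cat T) x y" using R.coefficientsD(3)[OF f] that cs(1) by (auto simp: hom_classes_def)
    then show ?thesis by (auto elim: path_cat_homE)
  qed
  then obtain g where g: "\<And>c. c \<in> set cs \<Longrightarrow> g c \<in> Paths T \<and> g c 0 = x \<and> g c 1 = y \<and> c = path_class T (g c)" by metis
  define ts where "ts = map (\<lambda>c. (f c, g c)) cs"
  have "valid_terms R T x y ts"
    using xy g R.coefficientsD(1)[OF f] by (auto simp: valid_terms_def ts_def)
  moreover have "path_sum R T x y ts = (Some x, Some y, f)"
  proof -
    have n: "length ts = length cs" by (simp add: ts_def)
    have s: "snd (ts ! i) = g (cs ! i)" "fst (ts ! i) = f (cs ! i)" if "i < length cs" for i using that by (simp_all add: ts_def)
    have cls: "path_class T (snd (ts ! i)) = cs ! i" if "i < length cs" for i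
      using g[OF nth_mem[OF that]] s[OF that] by simp
    have "(\<Oplus>\<^bsub>R\<^esub>i\<in>{i. i < length ts \<and> path_class T (snd (ts ! i)) = c}. fst (ts ! i)) = f c" for c
    proof (cases "c \<in> set cs")
      case True
      then obtain k where k: "k < length cs" "cs ! k = c" by (auto simp: in_set_conv_nth)
      have e: "{i. i < length ts \<and> path_class T (snd (ts ! i)) = c} = {k}"
        using k cls n nth_eq_iff_index_eq[OF cs(2)] by auto
      show ?thesis unfolding e using k s[OF k(1)] R.coefficientsD(1)[OF f] by simp
    next
      case False
      then have e: "{i. i < length ts \<and> path_class T (snd (ts ! i)) = c} = {}"
        using cls n nth_mem by fastforce
      show ?thesis unfolding e using False cs(1) by simp
    qed
    then show ?thesis by (simp add: path_sum_def)
  qed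
  ultimately show thesis by (rule that)
qed

lemma path_based_ideal:
  assumes "path_based R T I"
  shows "cat_ideal R \<C> I"
proof -
  obtain S where S: "I = ideal_gen R \<C> S"
    "S \<subseteq> {path_sum R T x y ts | x y ts. valid_terms R T x y ts \<and> (\<forall>(l, \<gamma>)\<in>set ts. non_zero_divisor R l)}"
    using assms unfolding path_based_def by blast
  have "S \<subseteq> Arr \<C>" using S(2) path_sum_hom by (auto simp: Hom_def simp del: lin_simps)
  then show ?thesis using linear_category.ideal_gen_ideal[OF lin_path_linear] S(1) by simp
qed

lemma ideal_closure_ideal: "cat_ideal R \<C> (ideal_closure R T I P)"
proof -
  have "{f. \<exists>g\<in>I. pix_equiv_lin R T P f g} \<subseteq> Arr \<C>"
    using path_sum_hom by (auto simp: pix_equiv_lin_def Hom_def simp del: lin_simps)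
  then show ?thesis using linear_category.ideal_gen_ideal[OF lin_path_linear] unfolding ideal_closure_def by simp
qed

text \<open>Constant paths serve on both sides; each lies in a pixel because the pixels cover all
  points.\<close>

lemma pix_equiv_refl:
  assumes P: "partition_on (Pts T) P" and g: "\<gamma> \<in> Paths T"
  shows "pix_equiv T P \<gamma> \<gamma>"
proof -
  have pt: "\<gamma> 0 \<in> Pts T" "\<gamma> 1 \<in> Pts T" using path_pt[OF g] by simp_all
  have im: "in_pixel P (im (const_path x) \<union> im (const_path x))" if "x \<in> Pts T" for x
  proof -
    obtain X where "X \<in> P" "x \<in> X" using P \<open>x \<in> Pts T\<close> unfolding partition_on_def by blast
    then show ?thesis by (auto simp: in_pixel_def im_def const_path_def)
  qed
  have p: "const_path (\<gamma> 0) \<frown> \<gamma> \<frown> const_path (\<gamma> 1) \<in> Paths T"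
    using const_path[OF pt(1)] const_path[OF pt(2)] g by (intro conc_path) simp_all
  show ?thesis unfolding pix_equiv_def
    using g im[OF pt(1)] im[OF pt(2)] const_path[OF pt(1)] const_path[OF pt(2)] peq_refl[OF p]
    by (intro conjI bexI[of _ "const_path (\<gamma> 0)"] bexI[of _ "const_path (\<gamma> 1)"]) simp_all
qed

text \<open>An element of the ideal between two points is a path sum and equivalent to itself, hence
  a generator of the closure. An arrow with the zero object at one end is not a path sum, but it is
  zero and so lies in every ideal.\<close>

lemma ideal_subset_closure:
  assumes I: "cat_ideal R \<C> I" and P: "partition_on (Pts T) P"
  shows "I \<subseteq> ideal_closure R T I P"
proof
  interpret J: quotient_by_ideal R \<C> "ideal_closure R T I P"
    by (intro quotient_by_ideal.intro quotient_by_ideal_axioms.intro lin_path_linear ideal_closure_ideal)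
  fix F assume F: "F \<in> I"
  obtain a b f where f: "F = (a, b, f)" by (cases F)
  have "F \<in> Arr \<C>" using F I by (auto simp: cat_ideal_def)
  then have ab: "a \<in> Obj \<C>" "b \<in> Obj \<C>" "f \<in> coefficients R (hom_classes T a b)" unfolding f lin_arr by simp_all
  show "F \<in> ideal_closure R T I P"
  proof (cases "a = None \<or> b = None")
    case True
    then have "F = Zro \<C> a b" using coefficients_none[OF ab(3)] f by simp
    then show ?thesis using J.J_zro[OF ab(1,2)] by simp
  next
    case False
    then obtain x y where xy: "a = Some x" "b = Some y" "x \<in> Pts T" "y \<in> Pts T" using ab by auto
    obtain ts where ts: "valid_terms R T x y ts" "path_sum R T x y ts = F"
      using path_sum_exists[OF xy(3,4) ab(3)[unfolded xy(1,2)]] f xy by blast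
    have la: "list_all2 (\<lambda>(l, \<gamma>) (l', \<gamma>'). l = l' \<and> pix_equiv T P \<gamma> \<gamma>') ts ts"
      using ts(1) pix_equiv_refl[OF P] by (auto simp: valid_terms_def list_all2_same)
    have "pix_equiv_lin R T P F F" unfolding pix_equiv_lin_def
      by (rule exI[of _ x], rule exI[of _ y], rule exI[of _ ts], rule exI[of _ x], rule exI[of _ y], rule exI[of _ ts])
         (simp only: ts la simp_thms)
    then have "F \<in> {f. \<exists>g\<in>I. pix_equiv_lin R T P f g}" using F by blast
    from subsetD[OF linear_category.ideal_gen_incl[OF lin_path_linear] this] show ?thesis
      unfolding ideal_closure_def .
  qed
qed

lemma lin_class_arr: "\<gamma> \<in> Paths T \<Longrightarrow> lin_class R T \<gamma> \<in> Arr \<C>"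
proof -
  assume g: "\<gamma> \<in> Paths T"
  have "valid_terms R T (\<gamma> 0) (\<gamma> 1) [(\<one>\<^bsub>R\<^esub>, \<gamma>)]" using g path_pt[OF g] by (simp add: valid_terms_def)
  from path_sum_hom[OF this] show ?thesis unfolding lin_class_def Hom_def by blast
qed

lemma pixelation_lin_functor_linear:
  assumes I: "cat_ideal R \<C> I" and P: "partition_on (Pts T) P"
  shows "is_linear_functor R (A_cat R T I) (pixelation_lin R T I P) (pixelation_lin_functor R T I P)"
proof -
  interpret I: quotient_by_ideal R \<C> I
    by (intro quotient_by_ideal.intro quotient_by_ideal_axioms.intro lin_path_linear I)
  interpret J: quotient_by_ideal R \<C> "ideal_closure R T I P"
    by (intro quotient_by_ideal.intro quotient_by_ideal_axioms.intro lin_path_linear ideal_closure_ideal)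
  show ?thesis unfolding pixelation_lin_functor_def
    by (rule funct_comp_linear[OF J.quot_map_linear(1)[OF I.quotient_by_ideal_axioms ideal_subset_closure[OF I P]]
          lloc_functor_linear[OF J.quotient_linear] I.quotient_linear])
qed

text \<open>The arrows that a pixelated representation must invert are sent by the quotient map into
  \<open>sigma_lin\<close>. The localization inverts these, and \<open>F\<close> preserves
  isomorphisms.\<close>

lemma pixelates_lin_precomposition:
  assumes I: "cat_ideal R \<C> I" and P: "partition_on (Pts T) P"
    and F: "is_linear_functor R (pixelation_lin R T I P) K F"
  shows "pixelates_lin R T I K P (funct_comp (A_cat R T I) F (pixelation_lin_functor R T I P))"
proof -
  let ?J = "ideal_closure R T I P" and ?L = "pixelation_lin R T I P"
  interpret I: quotient_by_ideal R \<C> I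
    by (intro quotient_by_ideal.intro quotient_by_ideal_axioms.intro lin_path_linear I)
  interpret J: quotient_by_ideal R \<C> ?J
    by (intro quotient_by_ideal.intro quotient_by_ideal_axioms.intro lin_path_linear ideal_closure_ideal)
  note B = J.quotient_linear
  note m = J.quot_map_linear[OF I.quotient_by_ideal_axioms ideal_subset_closure[OF I P]]
  let ?lf = "lloc_functor R (A_bar R T I P) (sigma_lin R T I P)"
  have LC: "category ?L" using lloc_cat_linear[OF B] by (simp add: linear_category_def preadditive_category_def)
  have Ff: "is_functor ?L K F" using F by (simp add: is_linear_functor_def)
  \<comment> \<open>Both quotients are evaluated on a common representative \<open>f\<close> in the
    linear path category.\<close>
  have eval: "FArr (funct_comp (A_cat R T I) F (pixelation_lin_functor R T I P)) (coset \<C> I f) = FArr F (FArr ?lf (coset \<C> ?J f))"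
    if "f \<in> Arr \<C>" for f
    using I.q_simps(3)[OF that] m(2)[OF that] by (simp add: funct_comp_def pixelation_lin_functor_def)
  have iso: "iso_arr K (FArr (funct_comp (A_cat R T I) F (pixelation_lin_functor R T I P)) (coset \<C> I f))"
    if f: "f \<in> Arr \<C>" and s: "coset \<C> ?J f \<in> sigma_lin R T I P" for f
    unfolding eval[OF f] by (rule functor_iso[OF LC Ff lloc_inverts[OF B s J.q_simps(3)[OF f]]])
  show "pixelates_lin R T I K P (funct_comp (A_cat R T I) F (pixelation_lin_functor R T I P))"
    unfolding pixelates_lin_def
  proof (intro conjI ballI impI)
    fix \<rho> assume r: "\<rho> \<in> Paths T" "in_pixel P (im \<rho>) \<and> \<not> vanishes R T ?J \<rho>"
    have "coset \<C> ?J (lin_class R T \<rho>) \<in> sigma_lin R T I P"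
      using r unfolding sigma_lin_def quot_class_def[symmetric] by blast
    from iso[OF lin_class_arr[OF r(1)] this]
    show "iso_arr K (FArr (funct_comp (A_cat R T I) F (pixelation_lin_functor R T I P)) (quot_class R T I \<rho>))"
      unfolding quot_class_def .
  next
    fix X x y assume X: "X \<in> P" "pre_dead R T I X" "x \<in> X" "y \<in> X"
    have "x \<in> Pts T" "y \<in> Pts T" using P X unfolding partition_on_def by blast+
    then have z: "Zro \<C> (Some x) (Some y) \<in> Arr \<C>" by (intro I.zro_simps) simp_all
    have "coset \<C> ?J (Zro \<C> (Some x) (Some y)) \<in> sigma_lin R T I P"
      unfolding sigma_lin_def J.q_other(3)[symmetric] using X by blast
    from iso[OF z this]
    show "iso_arr K (FArr (funct_comp (A_cat R T I) F (pixelation_lin_functor R T I P)) (Zro (A_cat R T I) (Some x) (Some y)))"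
      unfolding I.q_other(3) .
  qed
qed

end

lemma (in path_triple) pixelates_precomposition:
  assumes F: "is_functor (pixelation T P) K F"
  shows "pixelates T K P (funct_comp (path_cat T) F (pixelation_functor T P))"
  unfolding pixelates_def
proof
  fix \<sigma> assume s: "\<sigma> \<in> sigma T P"
  then have a: "\<sigma> \<in> Arr (path_cat T)" by (auto simp: sigma_def path_cat_simps(2))
  have "iso_arr K (FArr F (FArr (pixelation_functor T P) \<sigma>))"
    by (rule functor_iso[OF loc_cat_category[OF path_cat_category] F loc_inverts[OF path_cat_category s a]])
  then show "iso_arr K (FArr (funct_comp (path_cat T) F (pixelation_functor T P)) \<sigma>)"
    using a by (simp add: funct_comp_def)
qed

theorem corollary3p14:
  fixes R :: "('k, 'r) ring_scheme"
    and K :: "('o, 'm, 'k) prelincat"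
    and T :: "'x path_triple"
    and I :: "('x, 'k) lin_path set"
    and L :: "'x set set set"
    and P :: "'x set set"
  assumes "cring R"
    and "linear_category R K" and "abelian_category K"
    and "is_triple T" and "screens T \<noteq> {}"
    and "path_based R T I"
    and "L \<subseteq> screens T"
    and "\<And>F. finite F \<Longrightarrow> F \<subseteq> L \<Longrightarrow> \<exists>Q\<in>L. \<forall>P'\<in>F. refines (Pts T) Q P'"
    and "P \<in> L"
  shows
    "exact_structures_restrict (Rep_lin R (pixelation_lin R T I P) K) (Rep_lin_scr R T I K L)
       (precomposition (Rep_lin R (pixelation_lin R T I P) K) (A_cat R T I) (pixelation_lin_functor R T I P)) \<and>
     exact_structures_restrict (rep_lin_pwf R (pixelation_lin R T I P) K) (rep_lin_scr R T I K L)
       (precomposition (rep_lin_pwf R (pixelation_lin R T I P) K) (A_cat R T I) (pixelation_lin_functor R T I P)) \<and>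
     exact_structures_restrict (Rep (pixelation T P) K) (Rep_scr T K L)
       (precomposition (Rep (pixelation T P) K) (path_cat T) (pixelation_functor T P)) \<and>
     exact_structures_restrict (rep_pwf (pixelation T P) K) (rep_scr T K L)
       (precomposition (rep_pwf (pixelation T P) K) (path_cat T) (pixelation_functor T P))"
proof -
  interpret lin_path T R using assms(1,4) by (intro lin_path.intro path_triple.intro)
  have part: "partition_on (Pts T) P" using assms(7,9) by (auto simp: screens_def is_screen_def)
  have I: "cat_ideal R \<C> I" by (rule path_based_ideal[OF assms(6)])
  interpret I: quotient_by_ideal R \<C> I
    by (intro quotient_by_ideal.intro quotient_by_ideal_axioms.intro lin_path_linear I)
  interpret J: quotient_by_ideal R \<C> "ideal_closure R T I P"
    by (intro quotient_by_ideal.intro quotient_by_ideal_axioms.intro lin_path_linear ideal_closure_ideal)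
  let ?Q = "pixelation_lin_functor R T I P"
  note A = I.quotient_linear
  note LL = lloc_cat_linear[OF J.quotient_linear, of "sigma_lin R T I P"]
  have cats: "category (A_cat R T I)" "category (pixelation_lin R T I P)"
    using A LL by (simp_all add: linear_category_def preadditive_category_def)
  interpret LF: linear_functors_to_abelian R "pixelation_lin R T I P" K
    using LL assms(2,3) cats by (intro linear_functors_to_abelian.intro functors_to_abelian.intro)
  interpret PF: functors_to_abelian "pixelation T P" K
    using assms(3) loc_cat_category[OF path_cat_category] by (intro functors_to_abelian.intro)
  have Q: "is_linear_functor R (A_cat R T I) (pixelation_lin R T I P) ?Q"
    by (rule pixelation_lin_functor_linear[OF I part])
  have linf: "is_functor (A_cat R T I) K M" if "is_linear_functor R (A_cat R T I) K M" for M
    using that by (simp add: is_linear_functor_def)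
  have Qf: "is_functor (A_cat R T I) (pixelation_lin R T I P) ?Q" using Q by (simp add: is_linear_functor_def)
  have p: "is_functor (path_cat T) (pixelation T P) (pixelation_functor T P)"
    by (rule loc_functor_is_functor[OF path_cat_category])
  \<comment> \<open>The screen witnessing membership in the target category is \<open>P\<close>
    itself, a member of \<open>L\<close>.\<close>
  have lin: "is_linear_functor R (A_cat R T I) K (funct_comp (A_cat R T I) F ?Q)"
    "\<exists>P\<in>L. pixelates_lin R T I K P (funct_comp (A_cat R T I) F ?Q)"
    if "is_linear_functor R (pixelation_lin R T I P) K F" for F
    using funct_comp_linear[OF Q that A] pixelates_lin_precomposition[OF I part that] assms(9) by blast+
  have fn: "is_functor (path_cat T) K (funct_comp (path_cat T) F (pixelation_functor T P))"
    "\<exists>P'\<in>L. pixelates T K P' (funct_comp (path_cat T) F (pixelation_functor T P))"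
    if "is_functor (pixelation T P) K F" for F
    using funct_comp_functor[OF p that path_cat_category] pixelates_precomposition[OF that] assms(9) by blast+
  have lin_pwf: "\<forall>x\<in>Obj (A_cat R T I). finite_length K (FObj (funct_comp (A_cat R T I) F ?Q) x)"
    if "\<forall>x\<in>Obj (pixelation_lin R T I P). finite_length K (FObj F x)" for F
    using that Qf by (auto simp: funct_comp_def is_functor_def)
  have fn_pwf: "\<forall>x\<in>Obj (path_cat T). finite_length K (FObj (funct_comp (path_cat T) F (pixelation_functor T P)) x)"
    if "\<forall>x\<in>Obj (pixelation T P). finite_length K (FObj F x)" for F
    using that p by (auto simp: funct_comp_def is_functor_def)
  \<comment> \<open>Stated for an arbitrary set of functors, so that it serves the unrestricted and
    the finite-length case alike.\<close>
  have subA: "functor_subcategory (A_cat R T I) K \<G>" if "\<And>M. M \<in> \<G> \<Longrightarrow> is_functor (A_cat R T I) K M" for \<G>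
    using that cats assms(3) by (intro functor_subcategory.intro functors_to_abelian.intro functor_subcategory_axioms.intro)
  have subC: "functor_subcategory (path_cat T) K \<G>" if "\<And>M. M \<in> \<G> \<Longrightarrow> is_functor (path_cat T) K M" for \<G>
    using that path_cat_category assms(3)
    by (intro functor_subcategory.intro functors_to_abelian.intro functor_subcategory_axioms.intro)
  show ?thesis
    unfolding Rep_lin_def rep_lin_pwf_def Rep_def rep_pwf_def Rep_lin_scr_def rep_lin_scr_def Rep_scr_def rep_scr_def functor_cat_simps(1)
  proof (intro conjI)
    show "exact_structures_restrict (functor_cat (pixelation_lin R T I P) K {M. is_linear_functor R (pixelation_lin R T I P) K M})
      (functor_cat (A_cat R T I) K {M. M \<in> {M. is_linear_functor R (A_cat R T I) K M} \<and> (\<exists>P\<in>L. pixelates_lin R T I K P M)})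
      (precomposition (functor_cat (pixelation_lin R T I P) K {M. is_linear_functor R (pixelation_lin R T I P) K M}) (A_cat R T I) ?Q)"
      by (rule precomposition_restricts[OF LF.exact_linear_functors subA Qf])
         (simp_all add: lin linf)
    show "exact_structures_restrict (functor_cat (pixelation_lin R T I P) K
        {M. is_linear_functor R (pixelation_lin R T I P) K M \<and> (\<forall>x\<in>Obj (pixelation_lin R T I P). finite_length K (FObj M x))})
      (functor_cat (A_cat R T I) K {M. M \<in> {M. is_linear_functor R (A_cat R T I) K M \<and> (\<forall>x\<in>Obj (A_cat R T I). finite_length K (FObj M x))}
        \<and> (\<exists>P\<in>L. pixelates_lin R T I K P M)})
      (precomposition (functor_cat (pixelation_lin R T I P) K
        {M. is_linear_functor R (pixelation_lin R T I P) K M \<and> (\<forall>x\<in>Obj (pixelation_lin R T I P). finite_length K (FObj M x))}) (A_cat R T I) ?Q)"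
      by (rule precomposition_restricts[OF LF.exact_linear_functors_pwf subA Qf])
         (simp_all add: lin linf lin_pwf)
    show "exact_structures_restrict (functor_cat (pixelation T P) K {M. is_functor (pixelation T P) K M})
      (functor_cat (path_cat T) K {M. M \<in> {M. is_functor (path_cat T) K M} \<and> (\<exists>P\<in>L. pixelates T K P M)})
      (precomposition (functor_cat (pixelation T P) K {M. is_functor (pixelation T P) K M}) (path_cat T) (pixelation_functor T P))"
      by (rule precomposition_restricts[OF PF.exact_functors subC p]) (simp_all add: fn)
    show "exact_structures_restrict (functor_cat (pixelation T P) K
        {M. is_functor (pixelation T P) K M \<and> (\<forall>x\<in>Obj (pixelation T P). finite_length K (FObj M x))})
      (functor_cat (path_cat T) K {M. M \<in> {M. is_functor (path_cat T) K M \<and> (\<forall>x\<in>Obj (path_cat T). finite_length K (FObj M x))}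
        \<and> (\<exists>P\<in>L. pixelates T K P M)})
      (precomposition (functor_cat (pixelation T P) K
        {M. is_functor (pixelation T P) K M \<and> (\<forall>x\<in>Obj (pixelation T P). finite_length K (FObj M x))}) (path_cat T) (pixelation_functor T P))"
      by (rule precomposition_restricts[OF PF.exact_functors_pwf subC p]) (simp_all add: fn fn_pwf)
  qed
qed

end
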